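(* Let $I$ and $\Theta$ be two inner functions in the upper half-plane. Assume that there exists an outer function $h$ (in the upper half-plane) so that on $\mathbb{R}$ we have $\overline{I}\,\Theta=\overline{h}/h$ and $\int_{\mathbb{R}}\frac{|h(x)|^2}{1+x^2}dx<\infty$. Denote $w=|h|^2$. Then the following are equivalent: (i) The restricted projection $P_I|K_\Theta:K_\Theta\to K_I$ is an isomorphism. (ii) The Riesz projection $R$ is a bounded operator on $L^2_w(\mathbb{R})$. Moreover, in this case $\|(P_I|K_\Theta)^{-1}\|=\|R\|_w$.
   Context: $\mathbf{H}^2$ is the Hardy space of the upper half-plane, regarded as a closed subspace of $L^2(\mathbb{R})$ through boundary values; functions analytic in the upper (lower) half-plane are identified with their boundary values on $\mathbb{R}$. For an inner function $\Theta$, $K_\Theta=\mathbf{H}^2\ominus\Theta\mathbf{H}^2$ and $P_\Theta$ is the orthogonal projection from $\mathbf{H}^2$ onto $K_\Theta$; $P_I|K_\Theta$ is the restriction of $P_I$ to $K_\Theta$, as an operator into $K_I$. For a weight $w>0$ a.e. with $\int_{\mathbb{R}}\frac{w(x)}{1+x^2}dx<\infty$, $L^2_w(\mathbb{R})$ is the space of $g$ with $\|g\|_{L^2_w}^2=\int_{\mathbb{R}}|g|^2w\,dx<\infty$. For $n\in\mathbb{N}$ ($n\ge1$) let $r_n(z)=\frac{(i-z)^{n-1}}{\sqrt\pi(i+z)^n}$ and $r_{-n}(z)=\overline{r_n(\bar z)}$; put $M=\mathrm{span}\{r_n:n\geq1\}$, $N=\mathrm{span}\{r_{-n}:n\geq1\}$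 and $E=M+N$, which is a dense subset of $L^2_w(\mathbb{R})$. The Riesz projection $R$ is defined on $E$ as the projection on $M$ along $N$: $R\big(\sum_{n=-K,n\neq0}^{K}a_nr_n\big)=\sum_{n=1}^Ka_nr_n$. It is bounded on $L^2_w(\mathbb{R})$ if $\|Rf\|_{L^2_w}\leq C\|f\|_{L^2_w}$ for all $f\in E$ with some finite constant $C$; the smallest such $C$ is denoted $\|R\|_w$ (the operator norm).
   Formalization: The norm identity in the "Moreover" is stated only when K_Θ ≠ {0}; for constant I and Θ (e.g. I = Θ = 1, h = 1) the inverse on the zero space has norm 0 while ‖R‖_w = 1, so the identity fails there. *)

theory Defs
  imports "HOL-Complex_Analysis.Complex_Analysis"
begin

section \<open>The space $L^2(\mathbb R)$\<close>

text \<open>Elements of the space are represented by functions; two representatives of the same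
  element are identified by \<open>ae_eq\<close>.\<close>

definition ae_eq :: "(real \<Rightarrow> complex) \<Rightarrow> (real \<Rightarrow> complex) \<Rightarrow> bool" where
  "ae_eq f g \<longleftrightarrow> (AE x in lebesgue. f x = g x)"

definition L2 :: "(real \<Rightarrow> complex) set" where
  "L2 = {f \<in> borel_measurable lebesgue. integrable lebesgue (\<lambda>x. (norm (f x))\<^sup>2)}"

definition l2_inner :: "(real \<Rightarrow> complex) \<Rightarrow> (real \<Rightarrow> complex) \<Rightarrow> complex" where
  "l2_inner f g = (LINT x|lebesgue. f x * cnj (g x))"

definition weighted_norm :: "(real \<Rightarrow> real) \<Rightarrow> (real \<Rightarrow> complex) \<Rightarrow> real" where
  "weighted_norm w f = sqrt (LINT x|lebesgue. (norm (f x))\<^sup>2 * w x)"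

definition l2_norm :: "(real \<Rightarrow> complex) \<Rightarrow> real" where
  "l2_norm f = weighted_norm (\<lambda>_. 1) f"


section \<open>Bounded operators between spaces of functions\<close>

definition op_bounded ::
  "((real \<Rightarrow> complex) \<Rightarrow> real) \<Rightarrow> ((real \<Rightarrow> complex) \<Rightarrow> (real \<Rightarrow> complex)) \<Rightarrow> (real \<Rightarrow> complex) set \<Rightarrow> bool" where
  "op_bounded nrm T X \<longleftrightarrow> (\<exists>C. \<forall>f\<in>X. nrm (T f) \<le> C * nrm f)"

text \<open>The smallest admissible constant; meaningful only for bounded operators. On the zero space
  the value is 0.\<close>

definition op_norm ::
  "((real \<Rightarrow> complex) \<Rightarrow> real) \<Rightarrow> ((real \<Rightarrow> complex) \<Rightarrow> (real \<Rightarrow> complex)) \<Rightarrow> (real \<Rightarrow> complex) set \<Rightarrow> real" where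
  "op_norm nrm T X = Inf {C. 0 \<le> C \<and> (\<forall>f\<in>X. nrm (T f) \<le> C * nrm f)}"

definition l2_bounded_linear ::
  "((real \<Rightarrow> complex) \<Rightarrow> (real \<Rightarrow> complex)) \<Rightarrow> (real \<Rightarrow> complex) set \<Rightarrow> (real \<Rightarrow> complex) set \<Rightarrow> bool" where
  "l2_bounded_linear T X Y \<longleftrightarrow>
     (\<forall>f\<in>X. T f \<in> Y) \<and>
     (\<forall>f\<in>X. \<forall>g\<in>X. ae_eq (T (\<lambda>x. f x + g x)) (\<lambda>x. T f x + T g x)) \<and>
     (\<forall>f\<in>X. \<forall>c. ae_eq (T (\<lambda>x. c * f x)) (\<lambda>x. c * T f x)) \<and>
     op_bounded l2_norm T X"

text \<open>The inverse of \<open>T\<close> restricted to \<open>X\<close>; the choice is unique up to \<open>ae_eq\<close> when the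
  restriction is injective.\<close>

definition l2_inverse ::
  "((real \<Rightarrow> complex) \<Rightarrow> (real \<Rightarrow> complex)) \<Rightarrow> (real \<Rightarrow> complex) set \<Rightarrow> (real \<Rightarrow> complex) \<Rightarrow> (real \<Rightarrow> complex)" where
  "l2_inverse T X g = (SOME f. f \<in> X \<and> ae_eq (T f) g)"

definition l2_isomorphism ::
  "((real \<Rightarrow> complex) \<Rightarrow> (real \<Rightarrow> complex)) \<Rightarrow> (real \<Rightarrow> complex) set \<Rightarrow> (real \<Rightarrow> complex) set \<Rightarrow> bool" where
  "l2_isomorphism T X Y \<longleftrightarrow>
     l2_bounded_linear T X Y \<and>
     (\<forall>f\<in>X. \<forall>g\<in>X. ae_eq (T f) (T g) \<longrightarrow> ae_eq f g) \<and>
     (\<forall>g\<in>Y. \<exists>f\<in>X. ae_eq (T f) g) \<and>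
     l2_bounded_linear (l2_inverse T X) Y X"

text \<open>The orthogonal projection onto a closed subspace, unique up to \<open>ae_eq\<close>.\<close>

definition orth_proj :: "(real \<Rightarrow> complex) set \<Rightarrow> (real \<Rightarrow> complex) \<Rightarrow> (real \<Rightarrow> complex)" where
  "orth_proj S f = (SOME g. g \<in> S \<and> (\<forall>k\<in>S. l2_inner (\<lambda>x. f x - g x) k = 0))"


section \<open>Boundary values, inner and outer functions in the upper half-plane\<close>

definition upper_half_plane :: "complex set" where
  "upper_half_plane = {z. Im z > 0}"

text \<open>Boundary values are limits along vertical lines, almost everywhere. For the functions
  considered here (Hardy space functions, inner and outer functions) these exist by Fatou's theorem
  and coincide almost everywhere with the non-tangential limits.\<close>

definition has_boundary_values :: "(complex \<Rightarrow> complex) \<Rightarrow> (real \<Rightarrow> complex) \<Rightarrow> bool" where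
  "has_boundary_values F f \<longleftrightarrow>
     (AE x in lebesgue. ((\<lambda>y. F (Complex x y)) \<longlongrightarrow> f x) (at_right 0))"

definition bdry :: "(complex \<Rightarrow> complex) \<Rightarrow> real \<Rightarrow> complex" where
  "bdry F x = Lim (at_right 0) (\<lambda>y. F (Complex x y))"

definition inner_function :: "(complex \<Rightarrow> complex) \<Rightarrow> bool" where
  "inner_function \<Theta> \<longleftrightarrow>
     \<Theta> holomorphic_on upper_half_plane \<and> bounded (\<Theta> ` upper_half_plane) \<and>
     has_boundary_values \<Theta> (bdry \<Theta>) \<and> (AE x in lebesgue. norm (bdry \<Theta> x) = 1)"

text \<open>Outer functions are the functions
  $h(z) = c\,\exp\bigl(\frac{1}{\pi i}\int_{\mathbb R}\bigl(\frac1{t-z}-\frac{t}{1+t^2}\bigr)\log|h(t)|\,dt\bigr)$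
  with $|c|=1$ and $\int_{\mathbb R}\frac{|\log|h(t)||}{1+t^2}\,dt<\infty$. The condition that the boundary
  function does not vanish is part of the integrability of $\log|h|$, but has to be stated
  because \<open>ln 0 = 0\<close>.\<close>

definition outer_function :: "(complex \<Rightarrow> complex) \<Rightarrow> bool" where
  "outer_function h \<longleftrightarrow>
     has_boundary_values h (bdry h) \<and> (AE t in lebesgue. bdry h t \<noteq> 0) \<and>
     integrable lebesgue (\<lambda>t. ln (norm (bdry h t)) / (1 + t\<^sup>2)) \<and>
     (\<exists>c. norm c = 1 \<and>
       (\<forall>z\<in>upper_half_plane.
          h z = c * exp (1 / (of_real pi * \<i>) *
            (LINT t|lebesgue. (1 / (of_real t - z) - of_real (t / (1 + t\<^sup>2)))
                                * of_real (ln (norm (bdry h t)))))))"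


section \<open>The Hardy space and model spaces\<close>

definition H2 :: "(real \<Rightarrow> complex) set" where
  "H2 = {f \<in> L2. \<exists>F. F holomorphic_on upper_half_plane \<and>
           (\<exists>C. \<forall>y>0. integrable lebesgue (\<lambda>x. (norm (F (Complex x y)))\<^sup>2) \<and>
                      (LINT x|lebesgue. (norm (F (Complex x y)))\<^sup>2) \<le> C) \<and>
           has_boundary_values F f}"

text \<open>$K_\Theta = \mathbf H^2 \ominus \Theta\mathbf H^2$\<close>

definition model_space :: "(complex \<Rightarrow> complex) \<Rightarrow> (real \<Rightarrow> complex) set" where
  "model_space \<Theta> = {f \<in> H2. \<forall>g\<in>H2. l2_inner f (\<lambda>x. bdry \<Theta> x * g x) = 0}"

definition model_proj :: "(complex \<Rightarrow> complex) \<Rightarrow> (real \<Rightarrow> complex) \<Rightarrow> (real \<Rightarrow> complex)" where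
  "model_proj \<Theta> = orth_proj (model_space \<Theta>)"


section \<open>The Riesz projection\<close>

definition r_pos :: "nat \<Rightarrow> complex \<Rightarrow> complex" where
  "r_pos n z = (\<i> - z) ^ (n - 1) / (of_real (sqrt pi) * (\<i> + z) ^ n)"

definition r_neg :: "nat \<Rightarrow> complex \<Rightarrow> complex" where
  "r_neg n z = cnj (r_pos n (cnj z))"

definition M_space :: "(real \<Rightarrow> complex) set" where
  "M_space = {f. \<exists>K a. f = (\<lambda>x. \<Sum>n=1..K. a n * r_pos n (of_real x))}"

definition N_space :: "(real \<Rightarrow> complex) set" where
  "N_space = {f. \<exists>K a. f = (\<lambda>x. \<Sum>n=1..K. a n * r_neg n (of_real x))}"

definition E_space :: "(real \<Rightarrow> complex) set" where
  "E_space = {f. \<exists>m\<in>M_space. \<exists>n\<in>N_space. f = (\<lambda>x. m x + n x)}"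

text \<open>The projection onto $M$ along $N$. The component is unique: elements of $M$ are rational functions
  vanishing at infinity with poles only at $-i$, those of $N$ with poles only at $i$.\<close>

definition riesz_proj :: "(real \<Rightarrow> complex) \<Rightarrow> (real \<Rightarrow> complex)" where
  "riesz_proj f = (THE m. m \<in> M_space \<and> (\<exists>n\<in>N_space. f = (\<lambda>x. m x + n x)))"

definition riesz_bounded :: "(real \<Rightarrow> real) \<Rightarrow> bool" where
  "riesz_bounded w \<longleftrightarrow> op_bounded (weighted_norm w) riesz_proj E_space"

definition riesz_norm :: "(real \<Rightarrow> real) \<Rightarrow> real" where
  "riesz_norm w = op_norm (weighted_norm w) riesz_proj E_space"

end

theory Submission
  imports Defs
begin

text \<open>Write \<open>s = h / cnj h\<close> for the boundary function, so that \<open>cnj \<Theta> I = s\<close> almost everywhere.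
  The model spaces of \<open>\<Theta>\<close> and \<open>I\<close> are the orthogonal complements in \<open>H2\<close> of \<open>\<Theta> H2\<close> and
  \<open>I H2\<close>, and passing to complements does not change the question: if the projection onto
  \<open>I H2\<close> restricted to \<open>\<Theta> H2\<close> is onto and satisfies \<open>\<parallel>a\<parallel> \<le> C \<parallel>P a\<parallel>\<close> with \<open>C \<ge> 1\<close>, then the
  projection between the model spaces has both properties with the same \<open>C\<close>, and conversely
  (\<open>complementary_restricted_proj\<close>).

  The projection of \<open>\<Theta> f\<close> to \<open>I H2\<close> is the element of least norm in \<open>\<Theta> f + (I H2)\<^sup>\<bottom>\<close>, and
  since the orthogonal complement of \<open>H2\<close> in \<open>L2\<close> is the space of conjugates of \<open>H2\<close>, that
  of \<open>I H2\<close> consists of the functions \<open>I cnj g\<close> with \<open>g\<close> in \<open>H2\<close>. After multiplication by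
  \<open>cnj \<Theta>\<close> the lower bound on \<open>\<Theta> H2\<close> becomes \<open>\<parallel>f\<parallel> \<le> C \<parallel>f + s cnj g\<parallel>\<close> for all \<open>f\<close> and \<open>g\<close> in
  \<open>H2\<close>. If \<open>f = h m\<close> and \<open>g = h m'\<close>, where \<open>m\<close> and \<open>m'\<close> are in the span \<open>M\<close> of the functions
  \<open>r\<^sub>n\<close>, then \<open>f + s cnj g = h (m + cnj m')\<close>, and this is the estimate \<open>\<parallel>R e\<parallel> \<le> C \<parallel>e\<parallel>\<close> in
  the weighted space for \<open>e = m + cnj m'\<close>.

  Two properties of the outer function \<open>h\<close> complete the argument. The space \<open>h M\<close> is dense
  in \<open>H2\<close> (\<open>outer_span_dense\<close>), so the Riesz estimate extends to all \<open>f\<close> and \<open>g\<close>. And no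
  nonzero \<open>I f\<close> in \<open>I H2\<close> is orthogonal to \<open>\<Theta> H2\<close>, since then \<open>s f = cnj g\<close> with \<open>g\<close> in
  \<open>H2\<close>, so \<open>h f\<close> would be both analytic and the conjugate of an analytic function
  (\<open>outer_toeplitz_injective\<close>); this gives surjectivity. Every step keeps the constant, and
  all admissible constants are at least 1 when the model space of \<open>\<Theta>\<close> is not zero; therefore
  the two operator norms agree.

  The facts on \<open>H2\<close> rest on the description \<open>H2_eq\<close> of \<open>H2\<close> by vanishing moments
  \<open>\<integral> f(t) (\<i> - t)\<^sup>n / (\<i> + t)\<^sup>n\<^sup>+\<^sup>1 dt\<close>. The moments of a function in the Hardy class vanish
  on each horizontal line by Cauchy's theorem, and the functions on the lines converge in
  \<open>L2\<close> as the line approaches the boundary. Conversely, if the moments vanish, then the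
  Cauchy integral of \<open>f\<close> is zero in the lower half-plane, so in the upper half-plane it
  agrees, up to the factor \<open>2 \<pi> \<i>\<close>, with the Poisson integral, whose vertical limits are \<open>f\<close>
  almost everywhere (\<open>poisson_vertical_limit\<close>). A function is zero if its moments and those
  of its conjugate vanish (\<open>Cauchy_class_AE_zero_of_moments\<close>); density and duality in \<open>H2\<close>
  follow from this.\<close>

section \<open>Orthogonal projections in real Hilbert spaces\<close>

text \<open>The parallelogram law turns a minimizing sequence into a Cauchy sequence, because the
  midpoint of two elements of \<open>S\<close> is again at distance at least \<open>sqrt d\<close> from \<open>x\<close>.\<close>

lemma closest_point_exists:
  fixes S :: "'a::{real_inner,complete_space} set"
  assumes "subspace S" "closed S"
  shows "\<exists>y\<in>S. \<forall>s\<in>S. norm (x - y) \<le> norm (x - s)"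
proof -
  define d where "d = (INF s\<in>S. (norm (x - s))\<^sup>2)"
  have S0: "0 \<in> S" using assms(1) by (rule subspace_0)
  have bdd: "bdd_below ((\<lambda>s. (norm (x - s))\<^sup>2) ` S)"
    by (rule bdd_belowI[of _ 0]) auto
  have dle: "d \<le> (norm (x - s))\<^sup>2" if "s \<in> S" for s
    unfolding d_def by (rule cINF_lower[OF bdd that])
  have "\<exists>s\<in>S. (norm (x - s))\<^sup>2 < d + e" if "e > 0" for e
    using cINF_less_iff[of S "\<lambda>s. (norm (x - s))\<^sup>2" "d + e", OF _ bdd] S0 that
    unfolding d_def[symmetric] by auto
  then have "\<forall>n::nat. \<exists>s\<in>S. (norm (x - s))\<^sup>2 < d + 1 / Suc n"
    by simp
  then obtain s where s: "\<And>n. s n \<in> S" "\<And>n. (norm (x - s n))\<^sup>2 < d + 1 / Suc n"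
    by metis
  have key: "(norm (s m - s n))\<^sup>2 \<le> 2 / Suc m + 2 / Suc n" for m n
  proof -
    have "(1/2) *\<^sub>R (s m + s n) \<in> S"
      using assms(1) s(1) by (intro subspace_scale subspace_add)
    from dle[OF this] have "d \<le> (norm (x - (1/2) *\<^sub>R (s m + s n)))\<^sup>2" .
    moreover have "(norm (s m - s n))\<^sup>2 = 2 * (norm (x - s m))\<^sup>2 + 2 * (norm (x - s n))\<^sup>2
        - 4 * (norm (x - (1/2) *\<^sub>R (s m + s n)))\<^sup>2"
      by (simp add: power2_norm_eq_inner algebra_simps inner_commute)
    ultimately show ?thesis using s(2)[of m] s(2)[of n] by simp
  qed
  have "Cauchy s"
  proof (rule metric_CauchyI)
    fix e :: real assume "e > 0"
    obtain N where N: "1 / real (Suc N) < e\<^sup>2 / 4"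
      using nat_approx_posE[of "e\<^sup>2 / 4"] \<open>e > 0\<close> by auto
    have "dist (s m) (s n) < e" if "m \<ge> N" "n \<ge> N" for m n
    proof -
      have "1 / real (Suc m) \<le> 1 / real (Suc N)" "1 / real (Suc n) \<le> 1 / real (Suc N)"
        using that by (auto intro!: divide_left_mono)
      then have "(norm (s m - s n))\<^sup>2 < e\<^sup>2" using key[of m n] N by simp
      then show ?thesis using \<open>e > 0\<close> by (simp add: dist_norm power2_less_imp_less)
    qed
    then show "\<exists>M. \<forall>m\<ge>M. \<forall>n\<ge>M. dist (s m) (s n) < e" by blast
  qed
  then obtain y where y: "s \<longlonglongrightarrow> y" using Cauchy_convergent_iff[of s] by (auto simp: convergent_def)
  have yS: "y \<in> S" using closed_sequentially[OF assms(2) _ y] s(1) by simp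
  have "(\<lambda>n. (norm (x - s n))\<^sup>2) \<longlonglongrightarrow> (norm (x - y))\<^sup>2"
    by (intro tendsto_intros y)
  moreover have "(\<lambda>n. d + 1 / real (Suc n)) \<longlonglongrightarrow> d + 0"
    using LIMSEQ_inverse_real_of_nat by (intro tendsto_intros) (simp add: inverse_eq_divide)
  ultimately have "(norm (x - y))\<^sup>2 \<le> d + 0"
    by (rule LIMSEQ_le) (use s(2) less_imp_le in blast)
  then have "norm (x - y) \<le> norm (x - t)" if "t \<in> S" for t
    using dle[OF that] by (simp add: power2_le_imp_le)
  then show ?thesis using yS by blast
qed

text \<open>The difference between \<open>x\<close> and its closest point \<open>y\<close> is orthogonal to \<open>k\<close>: otherwise moving
  \<open>y\<close> along \<open>k\<close> to the minimum of a quadratic polynomial would decrease the distance.\<close>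

lemma projection_exists:
  fixes S :: "'a::{real_inner,complete_space} set"
  assumes "subspace S" "closed S"
  shows "\<exists>y\<in>S. \<forall>k\<in>S. inner (x - y) k = 0"
proof -
  obtain y where y: "y \<in> S" "\<And>s. s \<in> S \<Longrightarrow> norm (x - y) \<le> norm (x - s)"
    using closest_point_exists[OF assms] by blast
  have "inner (x - y) k = 0" if k: "k \<in> S" for k
  proof (cases "k = 0")
    case False
    \<comment> \<open>The point where \<open>\<parallel>x - y - t k\<parallel>\<close> is smallest.\<close>
    define t where "t = inner (x - y) k / inner k k"
    have kk: "inner k k > 0" using False by simp
    have "y + t *\<^sub>R k \<in> S" using assms(1) y(1) k by (intro subspace_add subspace_scale)
    from y(2)[OF this] have "(norm (x - y))\<^sup>2 \<le> (norm (x - (y + t *\<^sub>R k)))\<^sup>2"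
      by (simp add: power_mono)
    also have "\<dots> = (norm (x - y))\<^sup>2 - 2 * t * inner (x - y) k + t * t * inner k k"
      by (simp add: power2_norm_eq_inner algebra_simps inner_commute)
    also have "t * t * inner k k = t * inner (x - y) k"
      using kk by (simp add: t_def)
    finally have "t * inner (x - y) k \<le> 0" by simp
    then have "(inner (x - y) k)\<^sup>2 / inner k k \<le> 0" by (simp add: t_def power2_eq_square)
    then have "(inner (x - y) k)\<^sup>2 \<le> 0" using kk by (simp add: divide_le_0_iff)
    then show ?thesis by simp
  qed simp
  then show ?thesis using y(1) by blast
qed

definition proj :: "'a::real_inner set \<Rightarrow> 'a \<Rightarrow> 'a" where
  "proj S x = (SOME y. y \<in> S \<and> (\<forall>k\<in>S. inner (x - y) k = 0))"

context
  fixes S :: "'a::{real_inner,complete_space} set"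
  assumes S: "subspace S" "closed S"
begin

lemma proj_both: "proj S x \<in> S \<and> (\<forall>k\<in>S. inner (x - proj S x) k = 0)"
  unfolding proj_def by (rule someI_ex) (use projection_exists[OF S, of x] in blast)

lemma proj_in: "proj S x \<in> S" and proj_orth: "k \<in> S \<Longrightarrow> inner (x - proj S x) k = 0"
  using proj_both by auto

lemma inner_proj: "k \<in> S \<Longrightarrow> inner (proj S x) k = inner x k"
  using proj_orth[of k x] by (simp add: inner_diff_left)

lemma proj_unique:
  assumes "y \<in> S" "\<And>k. k \<in> S \<Longrightarrow> inner (x - y) k = 0"
  shows "proj S x = y"
proof -
  have d: "proj S x - y \<in> S" using S(1) proj_in assms(1) by (intro subspace_diff)
  have "inner (proj S x - y) (proj S x - y) = 0"
    using assms(2)[OF d] proj_orth[OF d, of x] by (simp add: inner_diff_left)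
  then show ?thesis by simp
qed

lemma proj_add: "proj S (x + y) = proj S x + proj S y"
  using S(1) proj_in
  by (intro proj_unique subspace_add) (auto simp: inner_add_left inner_diff_left inner_proj)

lemma proj_scale: "proj S (c *\<^sub>R x) = c *\<^sub>R proj S x"
  using S(1) proj_in
  by (intro proj_unique subspace_scale) (auto simp: inner_diff_left inner_proj)

lemma proj_diff: "proj S (x - y) = proj S x - proj S y"
  using proj_add[of x "-y"] proj_scale[of "-1" y] by simp

lemma proj_pythagoras: "(norm x)\<^sup>2 = (norm (proj S x))\<^sup>2 + (norm (x - proj S x))\<^sup>2"
  using proj_orth[OF proj_in, of x x]
  by (simp add: power2_norm_eq_inner algebra_simps inner_commute)

lemma norm_proj_le: "norm (proj S x) \<le> norm x"
  by (rule power2_le_imp_le) (use proj_pythagoras[of x] in auto)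

lemma proj_tendsto: "f \<longlonglongrightarrow> x \<Longrightarrow> (\<lambda>n. proj S (f n)) \<longlonglongrightarrow> proj S x"
proof -
  assume f: "f \<longlonglongrightarrow> x"
  have "(\<lambda>n. norm (f n - x)) \<longlonglongrightarrow> 0" by (intro tendsto_norm_zero LIM_zero f)
  then have "(\<lambda>n. norm (proj S (f n) - proj S x)) \<longlonglongrightarrow> 0"
    by (rule tendsto_sandwich[OF _ _ tendsto_const, rotated 2])
       (auto simp: proj_diff[symmetric] norm_proj_le)
  then show ?thesis by (simp add: tendsto_norm_zero_iff LIM_zero_cancel)
qed

end

text \<open>All density statements below are obtained by applying this criterion to the closure of a
  subspace.\<close>

lemma closed_subspace_eqI:
  fixes V A :: "'a::{real_inner,complete_space} set"
  assumes V: "subspace V" "closed V" and A: "subspace A" and "V \<subseteq> A"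
    and triv: "\<And>x. x \<in> A \<Longrightarrow> (\<And>v. v \<in> V \<Longrightarrow> inner x v = 0) \<Longrightarrow> x = 0"
  shows "V = A"
proof
  show "A \<subseteq> V"
  proof
    fix x assume "x \<in> A"
    have "x - proj V x \<in> A" using A \<open>x \<in> A\<close> proj_in[OF V] \<open>V \<subseteq> A\<close> by (intro subspace_diff) auto
    then have "x - proj V x = 0" using proj_orth[OF V] by (intro triv) auto
    then show "x \<in> V" using proj_in[OF V, of x] by simp
  qed
qed fact

section \<open>Restricted projections and complementary subspaces\<close>

definition rel_compl :: "'a::real_inner set \<Rightarrow> 'a set \<Rightarrow> 'a set" where
  "rel_compl H A = {x \<in> H. \<forall>a\<in>A. inner x a = 0}"

lemma subspace_rel_compl: "subspace H \<Longrightarrow> subspace (rel_compl H A)"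
  by (auto simp: subspace_def rel_compl_def inner_add_left)

lemma closed_rel_compl: "closed H \<Longrightarrow> closed (rel_compl H A)"
proof -
  assume "closed H"
  have "rel_compl H A = H \<inter> (\<Inter>a\<in>A. {x. inner x a = 0})" by (auto simp: rel_compl_def)
  moreover have "closed {x. inner x a = 0}" for a :: 'a
    by (intro closed_Collect_eq continuous_intros)
  ultimately show ?thesis using \<open>closed H\<close> by (simp add: closed_Int closed_INT)
qed

context
  fixes H A :: "'a::{real_inner,complete_space} set"
  assumes H: "subspace H" "closed H" and A: "subspace A" "closed A" and AH: "A \<subseteq> H"
begin

text \<open>Double complements allow the theorem on complementary restricted projections to be read in
  both directions.\<close>

lemma rel_compl_rel_compl: "rel_compl H (rel_compl H A) = A"
proof
  show "A \<subseteq> rel_compl H (rel_compl H A)" using AH by (auto simp: rel_compl_def inner_commute)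
  show "rel_compl H (rel_compl H A) \<subseteq> A"
  proof
    fix x assume x: "x \<in> rel_compl H (rel_compl H A)"
    define z where "z = x - proj A x"
    have zH: "z \<in> H" using x proj_in[OF A] AH H(1)
      unfolding z_def by (intro subspace_diff) (auto simp: rel_compl_def)
    then have z: "z \<in> rel_compl H A" using proj_orth[OF A] by (auto simp: rel_compl_def z_def)
    have "inner z z = inner x z - inner (proj A x) z" by (simp add: z_def inner_diff_left)
    also have "inner x z = 0" using x z by (auto simp: rel_compl_def)
    also have "inner (proj A x) z = 0" using z proj_in[OF A] by (auto simp: rel_compl_def inner_commute)
    finally show "x \<in> A" using proj_in[OF A, of x] by (simp add: z_def)
  qed
qed

lemma proj_rel_compl: "x \<in> H \<Longrightarrow> proj (rel_compl H A) x = x - proj A x"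
proof (rule proj_unique[OF subspace_rel_compl[OF H(1)] closed_rel_compl[OF H(2)]])
  assume "x \<in> H"
  then show "x - proj A x \<in> rel_compl H A"
    using proj_in[OF A] proj_orth[OF A] AH H(1) by (auto simp: rel_compl_def intro!: subspace_diff)
  show "inner (x - (x - proj A x)) k = 0" if "k \<in> rel_compl H A" for k
    using that proj_in[OF A, of x] by (auto simp: rel_compl_def inner_commute)
qed

end

text \<open>The lower bound makes the range closed. An element of \<open>B\<close> that is orthogonal to the range is
  orthogonal to \<open>A\<close>, because the projection onto \<open>B\<close> does not change its inner products with
  elements of \<open>B\<close>.\<close>

lemma restricted_proj_surjective:
  fixes A B :: "'a::{real_inner,complete_space} set"
  assumes A: "subspace A" "closed A" and B: "subspace B" "closed B"
    and C: "0 \<le> C"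
    and low: "\<And>a. a \<in> A \<Longrightarrow> norm a \<le> C * norm (proj B a)"
    and triv: "\<And>b. b \<in> B \<Longrightarrow> (\<And>a. a \<in> A \<Longrightarrow> inner b a = 0) \<Longrightarrow> b = 0"
  shows "proj B ` A = B"
proof (rule closed_subspace_eqI)
  have lin: "linear (proj B)" by (rule linearI) (auto simp: proj_add[OF B] proj_scale[OF B])
  show "subspace (proj B ` A)" using lin A(1) by (rule linear_subspace_image)
  show "closed (proj B ` A)"
  proof (unfold closed_sequential_limits, intro allI impI, elim conjE)
    fix f l assume fB: "\<forall>n. f n \<in> proj B ` A" and fl: "f \<longlonglongrightarrow> l"
    have "\<forall>n::nat. \<exists>x. x \<in> A \<and> f n = proj B x" using fB by blast
    from choice[OF this] obtain a where a: "\<And>n. a n \<in> A" "\<And>n. f n = proj B (a n)" by blast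
    have d: "norm (a m - a n) \<le> C * norm (f m - f n)" for m n
      using low[of "a m - a n"] A(1) a by (simp add: subspace_diff proj_diff[OF B])
    have "Cauchy a"
    proof (rule CauchyI)
      fix e :: real assume e: "e > 0"
      have "Cauchy f" using fl LIMSEQ_imp_Cauchy by blast
      then obtain M where M: "\<forall>m\<ge>M. \<forall>n\<ge>M. norm (f m - f n) < e / (C + 1)"
        using CauchyD[of f "e / (C + 1)"] e C by auto
      have "norm (a m - a n) < e" if "m \<ge> M" "n \<ge> M" for m n
      proof -
        have "norm (a m - a n) \<le> C * norm (f m - f n)" by (rule d)
        also have "\<dots> \<le> C * (e / (C + 1))" using M that C by (intro mult_left_mono) (auto intro: less_imp_le)
        also have "\<dots> < e" using C e by (simp add: field_simps)
        finally show ?thesis .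
      qed
      then show "\<exists>M. \<forall>m\<ge>M. \<forall>n\<ge>M. norm (a m - a n) < e" by blast
    qed
    then obtain x where x: "a \<longlonglongrightarrow> x" using Cauchy_convergent_iff[of a] by (auto simp: convergent_def)
    have "x \<in> A" using closed_sequentially[OF A(2) _ x] a(1) by simp
    moreover have "l = proj B x"
    proof (rule LIMSEQ_unique[OF fl])
      show "f \<longlonglongrightarrow> proj B x" using proj_tendsto[OF B x] by (simp add: a(2)[abs_def])
    qed
    ultimately show "l \<in> proj B ` A" by blast
  qed
  show "subspace B" by fact
  show "proj B ` A \<subseteq> B" using proj_in[OF B] by auto
  show "x = 0" if "x \<in> B" "\<And>v. v \<in> proj B ` A \<Longrightarrow> inner x v = 0" for x
  proof (rule triv[OF that(1)])
    fix a assume "a \<in> A"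
    then have "inner x (proj B a) = 0" using that(2) by blast
    then show "inner x a = 0"
      using inner_proj[OF B that(1), of a] by (simp add: inner_commute[of x])
  qed
qed

text \<open>The constant is the inverse of the cosine of the angle between \<open>A\<close> and \<open>B\<close>, and their
  complements form the same angle. In detail: \<open>proj B\<close> maps \<open>A\<close> onto \<open>B\<close>, so by duality
  \<open>proj A\<close> is bounded below on \<open>B\<close> with the same constant. Let \<open>a\<close> be orthogonal to \<open>A\<close> and
  \<open>p = proj B a\<close>. Then \<open>\<parallel>p\<parallel>\<^sup>2 = \<langle>p - proj A p, a\<rangle>\<close>, and the lower bound on \<open>B\<close> makes
  \<open>p - proj A p\<close> small compared with \<open>p\<close>; hence \<open>\<parallel>p\<parallel>\<^sup>2 \<le> (1 - 1 / C\<^sup>2) \<parallel>a\<parallel>\<^sup>2\<close>, and by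
  Pythagoras \<open>a - p\<close>, the projection of \<open>a\<close> to the complement of \<open>B\<close>, has norm at least
  \<open>\<parallel>a\<parallel> / C\<close>.\<close>

theorem complementary_restricted_proj:
  fixes H A B :: "'a::{real_inner,complete_space} set"
  assumes H: "subspace H" "closed H"
    and A: "subspace A" "closed A" "A \<subseteq> H" and B: "subspace B" "closed B" "B \<subseteq> H"
    and C: "1 \<le> C"
    and low: "\<And>a. a \<in> A \<Longrightarrow> norm a \<le> C * norm (proj B a)"
    and triv: "\<And>b. b \<in> B \<Longrightarrow> (\<And>a. a \<in> A \<Longrightarrow> inner b a = 0) \<Longrightarrow> b = 0"
  shows "a \<in> rel_compl H A \<Longrightarrow> norm a \<le> C * norm (proj (rel_compl H B) a)"
    and "proj (rel_compl H B) ` rel_compl H A = rel_compl H B"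
proof -
  have surj: "proj B ` A = B" using C by (intro restricted_proj_surjective[OF A(1,2) B(1,2) _ low triv]) auto
  \<comment> \<open>The adjoint of an invertible map has an inverse of the same norm.\<close>
  have adj: "norm b \<le> C * norm (proj A b)" if "b \<in> B" for b
  proof -
    obtain a where a: "a \<in> A" "b = proj B a" using surj \<open>b \<in> B\<close> by blast
    have "(norm b)\<^sup>2 = inner b a"
      using inner_proj[OF B(1,2) \<open>b \<in> B\<close>, of a] a(2) by (simp add: power2_norm_eq_inner inner_commute)
    also have "\<dots> = inner (proj A b) a" by (simp add: inner_proj[OF A(1,2) a(1)])
    also have "\<dots> \<le> norm (proj A b) * norm a" by (rule norm_cauchy_schwarz)
    also have "\<dots> \<le> norm (proj A b) * (C * norm b)" using low[OF a(1)] a(2) by (intro mult_left_mono) auto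
    finally have "norm b * norm b \<le> norm b * (C * norm (proj A b))" by (simp add: power2_eq_square mult_ac)
    then show ?thesis using C by (cases "b = 0") auto
  qed
  have low': "norm a \<le> C * norm (proj (rel_compl H B) a)" if a: "a \<in> rel_compl H A" for a
  proof -
    define p where "p = proj B a"
    have pB: "p \<in> B" by (simp add: p_def proj_in[OF B(1,2)])
    have ip: "(norm p)\<^sup>2 = inner (p - proj A p) a"
    proof -
      have "inner (proj A p) a = 0" using a proj_in[OF A(1,2)] by (auto simp: rel_compl_def inner_commute)
      moreover have "(norm p)\<^sup>2 = inner p a"
        using inner_proj[OF B(1,2) pB, of a] by (simp add: p_def power2_norm_eq_inner inner_commute)
      ultimately show ?thesis by (simp add: inner_diff_left)
    qed
    have "C\<^sup>2 * (norm (p - proj A p))\<^sup>2 \<le> (C\<^sup>2 - 1) * (norm p)\<^sup>2"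
    proof -
      have "(norm p)\<^sup>2 \<le> (C * norm (proj A p))\<^sup>2" using adj[OF pB] by (intro power_mono) auto
      then show ?thesis using proj_pythagoras[OF A(1,2), of p] by (simp add: algebra_simps power_mult_distrib)
    qed
    moreover have "(norm p)\<^sup>2 * (norm p)\<^sup>2 \<le> (norm (p - proj A p))\<^sup>2 * (norm a)\<^sup>2"
    proof -
      have "(norm p)\<^sup>2 \<le> norm (p - proj A p) * norm a" unfolding ip by (rule norm_cauchy_schwarz)
      then have "((norm p)\<^sup>2)\<^sup>2 \<le> (norm (p - proj A p) * norm a)\<^sup>2" by (intro power_mono) auto
      then show ?thesis by (simp add: power_mult_distrib power2_eq_square mult_ac)
    qed
    ultimately have "C\<^sup>2 * ((norm p)\<^sup>2 * (norm p)\<^sup>2) \<le> (C\<^sup>2 - 1) * (norm p)\<^sup>2 * (norm a)\<^sup>2"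
      (is "?c * (?p * ?p) \<le> _")
    proof -
      assume 1: "?c * (norm (p - proj A p))\<^sup>2 \<le> (?c - 1) * ?p"
        and 2: "?p * ?p \<le> (norm (p - proj A p))\<^sup>2 * (norm a)\<^sup>2"
      have "?c * (?p * ?p) \<le> ?c * (norm (p - proj A p))\<^sup>2 * (norm a)\<^sup>2"
        using mult_left_mono[OF 2, of ?c] by (simp add: mult.assoc)
      also have "\<dots> \<le> (?c - 1) * ?p * (norm a)\<^sup>2" by (rule mult_right_mono[OF 1]) simp
      finally show ?thesis .
    qed
    then have "(norm p)\<^sup>2 * (C\<^sup>2 * (norm p)\<^sup>2) \<le> (norm p)\<^sup>2 * ((C\<^sup>2 - 1) * (norm a)\<^sup>2)" by (simp add: mult_ac)
    then have pa: "C\<^sup>2 * (norm p)\<^sup>2 \<le> (C\<^sup>2 - 1) * (norm a)\<^sup>2"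
      using C by (cases "p = 0") auto
    have "(norm a)\<^sup>2 \<le> (C * norm (a - p))\<^sup>2"
      using pa proj_pythagoras[OF B(1,2), of a] by (simp add: p_def algebra_simps power_mult_distrib)
    then have "norm a \<le> C * norm (a - p)" by (rule power2_le_imp_le) (use C in auto)
    moreover have "proj (rel_compl H B) a = a - p"
      using proj_rel_compl[OF H B] a by (simp add: p_def rel_compl_def)
    ultimately show ?thesis by simp
  qed
  then show "a \<in> rel_compl H A \<Longrightarrow> norm a \<le> C * norm (proj (rel_compl H B) a)" .
  show "proj (rel_compl H B) ` rel_compl H A = rel_compl H B"
  proof (rule restricted_proj_surjective[where C = C])
    fix b assume b: "b \<in> rel_compl H B" and "\<And>a. a \<in> rel_compl H A \<Longrightarrow> inner b a = 0"
    then have "b \<in> rel_compl H (rel_compl H A)" by (auto simp: rel_compl_def)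
    then have "b \<in> A" by (simp add: rel_compl_rel_compl[OF H A])
    moreover have "proj B b = 0"
      using b B(1) by (intro proj_unique[OF B(1,2)]) (auto simp: rel_compl_def subspace_0)
    ultimately show "b = 0" using low[of b] by simp
  qed (use C low' H subspace_rel_compl closed_rel_compl in auto)
qed

section \<open>The Hilbert space of classes of square-integrable functions\<close>

text \<open>Lebesgue measure is complete, so measurability survives changes on null sets.\<close>

lemma borel_measurable_lebesgue_ae:
  fixes f g :: "real \<Rightarrow> 'b::topological_space"
  assumes f: "f \<in> borel_measurable lebesgue" and ae: "AE x in lebesgue. f x = g x"
  shows "g \<in> borel_measurable lebesgue"
proof (rule measurableI)
  fix A :: "'b set" assume A: "A \<in> sets borel"
  have "f -` A \<inter> space lebesgue \<in> sets lebesgue" by (rule measurable_sets[OF f A])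
  then show "g -` A \<inter> space lebesgue \<in> sets lebesgue"
    by (rule completion.in_sets_AE[rotated]) (use ae in \<open>auto elim: eventually_mono\<close>)
qed simp

lemma ae_eq_refl [simp]: "ae_eq f f" by (simp add: ae_eq_def)
lemma ae_eq_sym: "ae_eq f g \<Longrightarrow> ae_eq g f" by (auto simp: ae_eq_def elim: eventually_mono)
lemma ae_eq_trans: "ae_eq f g \<Longrightarrow> ae_eq g h \<Longrightarrow> ae_eq f h" unfolding ae_eq_def by (elim eventually_elim2) auto

lemma L2_measurable: "f \<in> L2 \<Longrightarrow> f \<in> borel_measurable lebesgue" by (simp add: L2_def)
lemma L2_integrable: "f \<in> L2 \<Longrightarrow> integrable lebesgue (\<lambda>x. (norm (f x))\<^sup>2)" by (simp add: L2_def)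

lemma L2_cong_ae: "f \<in> L2 \<Longrightarrow> ae_eq f g \<Longrightarrow> g \<in> L2"
proof -
  assume f: "f \<in> L2" and ae: "ae_eq f g"
  have g: "g \<in> borel_measurable lebesgue"
    using borel_measurable_lebesgue_ae[OF L2_measurable[OF f]] ae by (simp add: ae_eq_def)
  have "integrable lebesgue (\<lambda>x. (norm (g x))\<^sup>2)"
    by (rule integrable_cong_AE_imp[OF L2_integrable[OF f]])
       (use g ae in \<open>auto simp: ae_eq_def elim: eventually_mono\<close>)
  with g show "g \<in> L2" by (simp add: L2_def)
qed

lemma L2_bound:
  assumes g: "g \<in> borel_measurable lebesgue" and F: "integrable lebesgue F"
    and le: "AE x in lebesgue. (norm (g x))\<^sup>2 \<le> F x"
  shows "g \<in> L2"
proof -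
  have "integrable lebesgue (\<lambda>x. (norm (g x))\<^sup>2)"
    by (rule Bochner_Integration.integrable_bound[OF F]) (use g le in \<open>auto elim!: eventually_mono\<close>)
  with g show ?thesis by (simp add: L2_def)
qed

lemma L2_zero [simp]: "(\<lambda>x. 0) \<in> L2" by (simp add: L2_def)

lemma L2_bounded_mult:
  assumes f: "f \<in> L2" and b: "b \<in> borel_measurable lebesgue" and le: "AE x in lebesgue. norm (b x) \<le> B"
  shows "(\<lambda>x. b x * f x) \<in> L2"
proof (rule L2_bound)
  show "integrable lebesgue (\<lambda>x. B\<^sup>2 * (norm (f x))\<^sup>2)" using L2_integrable[OF f] by simp
  show "(\<lambda>x. b x * f x) \<in> borel_measurable lebesgue" using L2_measurable[OF f] b by simp
  show "AE x in lebesgue. (norm (b x * f x))\<^sup>2 \<le> B\<^sup>2 * (norm (f x))\<^sup>2"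
    using le by eventually_elim (auto simp: norm_mult power_mult_distrib intro!: mult_right_mono power_mono)
qed

lemma L2_cmult: "f \<in> L2 \<Longrightarrow> (\<lambda>x. c * f x) \<in> L2"
  by (rule L2_bounded_mult[of _ _ "norm c"]) auto

lemma L2_cnj: "f \<in> L2 \<Longrightarrow> (\<lambda>x. cnj (f x)) \<in> L2"
proof (rule L2_bound[OF _ L2_integrable])
  assume "f \<in> L2"
  then show "(\<lambda>x. cnj (f x)) \<in> borel_measurable lebesgue"
    by (intro measurable_compose[OF L2_measurable borel_measurable_continuous_onI] continuous_intros)
qed auto

lemma norm_add_sq_le: "(norm (a + b :: 'a::real_normed_vector))\<^sup>2 \<le> 2 * (norm a)\<^sup>2 + 2 * (norm b)\<^sup>2"
proof -
  have "(norm (a + b))\<^sup>2 \<le> (norm a + norm b)\<^sup>2" by (simp add: norm_triangle_ineq power_mono)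
  also have "\<dots> \<le> 2 * (norm a)\<^sup>2 + 2 * (norm b)\<^sup>2"
    using zero_le_power2[of "norm a - norm b"] unfolding power2_sum power2_diff by linarith
  finally show ?thesis .
qed

lemma L2_add: "f \<in> L2 \<Longrightarrow> g \<in> L2 \<Longrightarrow> (\<lambda>x. f x + g x) \<in> L2"
proof (rule L2_bound[of _ "\<lambda>x. 2 * (norm (f x))\<^sup>2 + 2 * (norm (g x))\<^sup>2"])
  assume L: "f \<in> L2" "g \<in> L2"
  show "(\<lambda>x. f x + g x) \<in> borel_measurable lebesgue"
    using L[THEN L2_measurable] by simp
qed (simp_all add: norm_add_sq_le L2_integrable)

lemma L2_uminus: "f \<in> L2 \<Longrightarrow> (\<lambda>x. - f x) \<in> L2" using L2_cmult[of f "-1"] by simp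
lemma L2_diff: "f \<in> L2 \<Longrightarrow> g \<in> L2 \<Longrightarrow> (\<lambda>x. f x - g x) \<in> L2"
  using L2_add[of f "\<lambda>x. - g x"] by (simp add: L2_uminus)
lemma L2_mult_integrable:
  assumes "f \<in> L2" "g \<in> L2" shows "integrable lebesgue (\<lambda>x. f x * g x)"
proof (rule Bochner_Integration.integrable_bound)
  show "integrable lebesgue (\<lambda>x. (norm (f x))\<^sup>2 + (norm (g x))\<^sup>2)"
    using assms by (simp add: L2_integrable)
  show "(\<lambda>x. f x * g x) \<in> borel_measurable lebesgue" using assms[THEN L2_measurable] by simp
  have "norm a * norm b \<le> (norm a)\<^sup>2 + (norm b)\<^sup>2" for a b :: complex
  proof -
    have "0 \<le> norm a * norm b" by simp
    then show ?thesis using zero_le_power2[of "norm a - norm b"] unfolding power2_diff by linarith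
  qed
  then show "AE x in lebesgue. norm (f x * g x) \<le> norm ((norm (f x))\<^sup>2 + (norm (g x))\<^sup>2)"
    by (auto simp: norm_mult)
qed

lemma L2_inner_integrable: "f \<in> L2 \<Longrightarrow> g \<in> L2 \<Longrightarrow> integrable lebesgue (\<lambda>x. f x * cnj (g x))"
  using L2_mult_integrable[of f "\<lambda>x. cnj (g x)"] L2_cnj by blast

lemma l2_inner_add_left: "f \<in> L2 \<Longrightarrow> g \<in> L2 \<Longrightarrow> k \<in> L2 \<Longrightarrow>
   l2_inner (\<lambda>x. f x + g x) k = l2_inner f k + l2_inner g k"
  by (simp add: l2_inner_def distrib_right L2_inner_integrable)
lemma l2_inner_diff_left: "f \<in> L2 \<Longrightarrow> g \<in> L2 \<Longrightarrow> k \<in> L2 \<Longrightarrow>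
   l2_inner (\<lambda>x. f x - g x) k = l2_inner f k - l2_inner g k"
  by (simp add: l2_inner_def left_diff_distrib L2_inner_integrable)
lemma l2_inner_cmult_left: "l2_inner (\<lambda>x. c * f x) k = c * l2_inner f k"
  by (simp add: l2_inner_def mult.assoc)
lemma l2_inner_cmult_right: "l2_inner f (\<lambda>x. c * k x) = cnj c * l2_inner f k"
proof -
  have "(\<lambda>x. f x * cnj (c * k x)) = (\<lambda>x. cnj c * (f x * cnj (k x)))" by (auto simp: mult_ac)
  then show ?thesis by (simp only: l2_inner_def integral_mult_right_zero)
qed
lemma l2_inner_commute: "l2_inner g f = cnj (l2_inner f g)"
  by (simp add: l2_inner_def Bochner_Integration.integral_cnj[symmetric] mult.commute)
lemma l2_inner_cong: "ae_eq f f' \<Longrightarrow> ae_eq g g' \<Longrightarrow> f \<in> L2 \<Longrightarrow> g \<in> L2 \<Longrightarrow> l2_inner f g = l2_inner f' g'"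
proof -
  assume e: "ae_eq f f'" "ae_eq g g'" and L: "f \<in> L2" "g \<in> L2"
  have L': "f' \<in> L2" "g' \<in> L2" using e L L2_cong_ae by blast+
  show ?thesis unfolding l2_inner_def
  proof (rule integral_cong_AE)
    show "AE x in lebesgue. f x * cnj (g x) = f' x * cnj (g' x)"
      using e unfolding ae_eq_def by eventually_elim simp
  qed (use L L' L2_inner_integrable[THEN borel_measurable_integrable] in blast)+
qed

lemma l2_inner_self: "f \<in> L2 \<Longrightarrow> l2_inner f f = of_real (LINT x|lebesgue. (norm (f x))\<^sup>2)"
  by (simp add: l2_inner_def complex_norm_square[symmetric] del: of_real_power)

quotient_type l2 = "real \<Rightarrow> complex" / partial: "\<lambda>f g. f \<in> L2 \<and> g \<in> L2 \<and> ae_eq f g"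
proof (rule part_equivpI)
  show "\<exists>x. x \<in> L2 \<and> x \<in> L2 \<and> ae_eq x x" using L2_zero ae_eq_refl by blast
qed (auto intro!: sympI transpI dest: ae_eq_sym intro: ae_eq_trans)

instantiation l2 :: "{zero,plus,minus,uminus,scaleR}"
begin
lift_definition zero_l2 :: l2 is "\<lambda>x. 0" by simp
lift_definition plus_l2 :: "l2 \<Rightarrow> l2 \<Rightarrow> l2" is "\<lambda>f g x. f x + g x"
  by (auto simp: L2_add ae_eq_def elim: eventually_elim2)
lift_definition minus_l2 :: "l2 \<Rightarrow> l2 \<Rightarrow> l2" is "\<lambda>f g x. f x - g x"
  by (auto simp: L2_diff ae_eq_def elim: eventually_elim2)
lift_definition uminus_l2 :: "l2 \<Rightarrow> l2" is "\<lambda>f x. - f x"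
  by (auto simp: L2_uminus ae_eq_def elim: eventually_mono)
lift_definition scaleR_l2 :: "real \<Rightarrow> l2 \<Rightarrow> l2" is "\<lambda>c f x. of_real c * f x"
  by (auto simp: L2_cmult ae_eq_def elim: eventually_mono)
instance ..
end

lift_definition ip_l2 :: "l2 \<Rightarrow> l2 \<Rightarrow> complex" is l2_inner
  by (auto intro: l2_inner_cong)

instance l2 :: real_vector
proof
  fix a b c :: l2 and r s :: real
  show "a + b + c = a + (b + c)" by transfer (auto simp: L2_add add.assoc)
  show "a + b = b + a" by transfer (auto simp: L2_add add.commute)
  show "0 + a = a" by transfer auto
  show "- a + a = 0" by transfer (auto simp: L2_uminus)
  show "a - b = a + - b" by transfer (auto simp: L2_diff)
  show "r *\<^sub>R (a + b) = r *\<^sub>R a + r *\<^sub>R b" by transfer (auto simp: L2_add L2_cmult distrib_left)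
  show "(r + s) *\<^sub>R a = r *\<^sub>R a + s *\<^sub>R a" by transfer (auto simp: L2_add L2_cmult distrib_right)
  show "r *\<^sub>R s *\<^sub>R a = (r * s) *\<^sub>R a" by transfer (auto simp: L2_cmult mult.assoc)
  show "1 *\<^sub>R a = a" by transfer auto
qed

text \<open>The real part of the complex inner product is enough for the projection theorem. It yields
  complex orthogonality on subspaces that are closed under multiplication by \<open>\<i>\<close>.\<close>

instantiation l2 :: real_inner
begin
definition inner_l2 :: "l2 \<Rightarrow> l2 \<Rightarrow> real" where "inner_l2 x y = Re (ip_l2 x y)"
definition norm_l2 :: "l2 \<Rightarrow> real" where "norm_l2 x = sqrt (inner x x)"
definition sgn_l2 :: "l2 \<Rightarrow> l2" where "sgn_l2 x = x /\<^sub>R norm x"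
definition dist_l2 :: "l2 \<Rightarrow> l2 \<Rightarrow> real" where "dist_l2 x y = norm (x - y)"
definition uniformity_l2 :: "(l2 \<times> l2) filter" where
  "uniformity_l2 = (INF e\<in>{0<..}. principal {(x, y). dist x y < e})"
definition open_l2 :: "l2 set \<Rightarrow> bool" where
  "open_l2 U = (\<forall>x\<in>U. \<forall>\<^sub>F (x', y) in uniformity. x' = x \<longrightarrow> y \<in> U)"
instance
proof
  fix x y z :: l2 and r :: real
  show "dist x y = norm (x - y)" by (rule dist_l2_def)
  show "sgn x = x /\<^sub>R norm x" by (rule sgn_l2_def)
  show "norm x = sqrt (inner x x)" by (rule norm_l2_def)
  show "(uniformity :: (l2 \<times> l2) filter) = (INF e\<in>{0<..}. principal {(x, y). dist x y < e})"
    by (rule uniformity_l2_def)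
  show "open U = (\<forall>x\<in>U. \<forall>\<^sub>F (x', y) in uniformity. x' = x \<longrightarrow> y \<in> U)" for U :: "l2 set"
    by (rule open_l2_def)
  show "inner x y = inner y x" unfolding inner_l2_def
    by transfer (metis l2_inner_commute cnj.simps(1))
  show "inner (x + y) z = inner x z + inner y z" unfolding inner_l2_def
    by transfer (simp add: l2_inner_add_left)
  show "inner (r *\<^sub>R x) y = r * inner x y" unfolding inner_l2_def
    by transfer (simp add: l2_inner_cmult_left)
  show "0 \<le> inner x x" unfolding inner_l2_def
    by transfer (simp add: l2_inner_self)
  show "inner x x = 0 \<longleftrightarrow> x = 0" unfolding inner_l2_def
    by transfer (auto simp: l2_inner_self integral_nonneg_eq_0_iff_AE[OF L2_integrable] ae_eq_def)
qed
end

abbreviation cls :: "(real \<Rightarrow> complex) \<Rightarrow> l2" where "cls \<equiv> abs_l2"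
definition rep :: "l2 \<Rightarrow> (real \<Rightarrow> complex)" where "rep x = rep_l2 x"

lemma rep_L2 [simp]: "rep x \<in> L2"
  using Quotient_rep_reflp[OF Quotient_l2, of x] by (simp add: rep_def)
lemma cls_rep [simp]: "cls (rep x) = x"
  using Quotient_abs_rep[OF Quotient_l2, of x] by (simp add: rep_def)
lemma cls_eq_iff: "f \<in> L2 \<Longrightarrow> g \<in> L2 \<Longrightarrow> cls f = cls g \<longleftrightarrow> ae_eq f g"
  using Quotient_rel[OF Quotient_l2, of f g] by auto
lemma rep_cls: "f \<in> L2 \<Longrightarrow> ae_eq (rep (cls f)) f"
  by (subst cls_eq_iff[symmetric]) auto
lemma ip_cls: "f \<in> L2 \<Longrightarrow> g \<in> L2 \<Longrightarrow> ip_l2 (cls f) (cls g) = l2_inner f g"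
  by (rule ip_l2.abs_eq) auto
lemma inner_cls: "f \<in> L2 \<Longrightarrow> g \<in> L2 \<Longrightarrow> inner (cls f) (cls g) = Re (l2_inner f g)"
  by (simp add: inner_l2_def ip_cls)
lemma cls_add: "f \<in> L2 \<Longrightarrow> g \<in> L2 \<Longrightarrow> cls (\<lambda>x. f x + g x) = cls f + cls g"
  by (rule plus_l2.abs_eq[symmetric]) auto
lemma cls_diff: "f \<in> L2 \<Longrightarrow> g \<in> L2 \<Longrightarrow> cls (\<lambda>x. f x - g x) = cls f - cls g"
  by (rule minus_l2.abs_eq[symmetric]) auto
lemma cls_scale: "f \<in> L2 \<Longrightarrow> cls (\<lambda>x. of_real r * f x) = r *\<^sub>R cls f"
  by (rule scaleR_l2.abs_eq[symmetric]) auto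
lemma cls_zero: "cls (\<lambda>x. 0) = 0" by (simp add: zero_l2_def)
lemma norm_cls: "f \<in> L2 \<Longrightarrow> norm (cls f) = l2_norm f"
  by (simp add: norm_l2_def inner_cls l2_inner_self l2_norm_def weighted_norm_def)
lemma norm_cls_sq: "f \<in> L2 \<Longrightarrow> (norm (cls f))\<^sup>2 = (LINT x|lebesgue. (norm (f x))\<^sup>2)"
  by (simp add: norm_cls l2_norm_def weighted_norm_def)

lemma norm_ip_le: "norm (ip_l2 x y) \<le> norm x * norm y"
proof -
  obtain c where c: "norm c = 1" "c * ip_l2 x y = of_real (norm (ip_l2 x y))"
  proof (cases "ip_l2 x y = 0")
    case False
    have "cnj (ip_l2 x y) * ip_l2 x y = of_real (norm (ip_l2 x y)) * of_real (norm (ip_l2 x y))"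
      by (simp add: mult.commute[of "cnj _"] complex_norm_square[symmetric] power2_eq_square)
    then show ?thesis
      by (intro that[of "cnj (ip_l2 x y) / of_real (norm (ip_l2 x y))"])
         (use False in \<open>simp_all add: norm_divide\<close>)
  qed (use that[of 1] in auto)
  have "norm (ip_l2 x y) = Re (c * ip_l2 x y)" by (simp add: c(2))
  also have "c * ip_l2 x y = ip_l2 (cls (\<lambda>t. c * rep x t)) y"
    using ip_cls[of "\<lambda>t. c * rep x t" "rep y"] ip_cls[of "rep x" "rep y"]
    by (simp add: L2_cmult l2_inner_cmult_left)
  also have "Re \<dots> = inner (cls (\<lambda>t. c * rep x t)) y" by (simp add: inner_l2_def)
  also have "\<dots> \<le> norm (cls (\<lambda>t. c * rep x t)) * norm y" by (rule norm_cauchy_schwarz)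
  also have "norm (cls (\<lambda>t. c * rep x t)) = norm (cls (rep x))"
    using c(1) by (simp only: norm_cls rep_L2 L2_cmult l2_norm_def weighted_norm_def norm_mult mult_1)
  finally show ?thesis by simp
qed

lemma norm_l2_inner_le: "f \<in> L2 \<Longrightarrow> g \<in> L2 \<Longrightarrow> norm (l2_inner f g) \<le> norm (cls f) * norm (cls g)"
  using norm_ip_le[of "cls f" "cls g"] by (simp add: ip_cls)

lemma ip_diff_left: "ip_l2 (x - y) z = ip_l2 x z - ip_l2 y z"
  by transfer (simp add: l2_inner_diff_left)
lemma ip_commute: "ip_l2 y x = cnj (ip_l2 x y)"
  by transfer (rule l2_inner_commute)

lemma ip_tendsto: "(f \<longlongrightarrow> x) F \<Longrightarrow> ((\<lambda>n. ip_l2 (f n) z) \<longlongrightarrow> ip_l2 x z) F"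
proof -
  assume f: "(f \<longlongrightarrow> x) F"
  have "((\<lambda>n. norm (f n - x) * norm z) \<longlongrightarrow> 0) F"
    by (intro tendsto_mult_left_zero tendsto_norm_zero LIM_zero f)
  then show "((\<lambda>n. ip_l2 (f n) z) \<longlongrightarrow> ip_l2 x z) F"
  proof (rule LIM_zero_cancel[OF Lim_null_comparison[rotated]], intro always_eventually allI)
    fix n show "norm (ip_l2 (f n) z - ip_l2 x z) \<le> norm (f n - x) * norm z"
    unfolding ip_diff_left[symmetric] by (rule norm_ip_le)
  qed
qed

section \<open>Completeness of the space of square-integrable functions\<close>

lemma has_bochner_integral_inverse_1_plus_square:
  "has_bochner_integral lborel (\<lambda>x::real. 1 / (1 + x\<^sup>2)) pi"
proof -
  have 1: "(\<integral>\<^sup>+ x. ennreal (1 / (1 + x\<^sup>2)) * indicator {0..} x \<partial>lborel) = ennreal (pi/2 - arctan 0)"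
  proof (rule nn_integral_FTC_atLeast)
    show "(arctan has_real_derivative 1 / (1 + x\<^sup>2)) (at x)" for x
      by (auto intro!: derivative_eq_intros simp: inverse_eq_divide)
    show "(arctan \<longlongrightarrow> pi/2) at_top" by (rule tendsto_arctan_at_top)
  qed auto
  have 2: "(\<integral>\<^sup>+ x. ennreal (1 / (1 + x\<^sup>2)) * indicator {..0} x \<partial>lborel) = (\<integral>\<^sup>+ x. ennreal (1 / (1 + x\<^sup>2)) * indicator {0..} x \<partial>lborel)"
    by (subst nn_integral_real_affine[where c="-1" and t=0])
       (auto intro!: nn_integral_cong split: split_indicator)
  have "(\<integral>\<^sup>+ x. ennreal (1 / (1 + x\<^sup>2)) \<partial>lborel)
      = (\<integral>\<^sup>+ x. ennreal (1 / (1 + x\<^sup>2)) * indicator {..0} x + ennreal (1 / (1 + x\<^sup>2)) * indicator {0..} x \<partial>lborel)"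
    using AE_lborel_singleton[of "0::real"] by (intro nn_integral_cong_AE) (auto split: split_indicator)
  also have "\<dots> = (\<integral>\<^sup>+ x. ennreal (1 / (1 + x\<^sup>2)) * indicator {..0} x \<partial>lborel) + (\<integral>\<^sup>+ x. ennreal (1 / (1 + x\<^sup>2)) * indicator {0..} x \<partial>lborel)"
    by (rule nn_integral_add) auto
  also have "\<dots> = ennreal pi" unfolding 1 2 by (simp flip: ennreal_plus)
  finally show ?thesis by (intro has_bochner_integral_nn_integral) auto
qed

lemma integrable_inverse_1_plus_square: "integrable lebesgue (\<lambda>x::real. 1 / (1 + x\<^sup>2))"
  using has_bochner_integral_inverse_1_plus_square
  by (subst integrable_completion) (auto simp: has_bochner_integral_iff)

lemma nn_integral_norm_sq_cls:
  assumes "f \<in> L2"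
  shows "(\<integral>\<^sup>+x. ennreal ((norm (f x))\<^sup>2) \<partial>lebesgue) = ennreal ((norm (cls f))\<^sup>2)"
  using nn_integral_eq_integral[OF L2_integrable[OF assms]] by (simp add: norm_cls_sq[OF assms])

text \<open>The square-integrable function \<open>1 / sqrt (1 + x\<^sup>2)\<close> is used as a weight: by the
  Cauchy-Schwarz inequality the weighted increments have summable integrals, so the sum of
  the increments converges almost everywhere.\<close>

lemma L2_fast_limit:
  fixes f :: "nat \<Rightarrow> real \<Rightarrow> complex"
  assumes f: "\<And>n. f n \<in> L2" and fast: "\<And>n. norm (cls (f (Suc n)) - cls (f n)) \<le> (1/2)^n"
  shows "AE x in lebesgue. convergent (\<lambda>n. f n x)"
proof -
  define \<phi> where "\<phi> = (\<lambda>x::real. complex_of_real (1 / sqrt (1 + x\<^sup>2)))"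
  have \<phi>: "\<phi> \<in> L2"
    by (rule L2_bound[OF _ integrable_inverse_1_plus_square])
       (auto simp: \<phi>_def norm_divide power_divide real_sqrt_pow2 add_nonneg_nonneg intro!: measurable_completion borel_measurable_continuous_onI continuous_intros simp: add_pos_nonneg[THEN less_imp_neq[symmetric]] add_nonneg_eq_0_iff)
  define d where "d = (\<lambda>n x. complex_of_real (norm (f (Suc n) x - f n x)))"
  have d: "d n \<in> L2" for n
    by (rule L2_bound[OF _ L2_integrable[OF L2_diff[OF f[of "Suc n"] f[of n]]]])
       (use f[THEN L2_measurable] in \<open>auto simp: d_def\<close>)
  have dn: "norm (cls (d n)) \<le> (1/2)^n" for n
  proof -
    have "norm (cls (d n)) = norm (cls (\<lambda>x. f (Suc n) x - f n x))"
      by (simp add: norm_cls d L2_diff f) (simp add: l2_norm_def weighted_norm_def d_def)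
    then show ?thesis using fast[of n] by (simp add: cls_diff f)
  qed
  define g where "g = (\<lambda>n x. norm (f (Suc n) x - f n x) * (1 / sqrt (1 + x\<^sup>2)))"
  have gd: "complex_of_real (g n x) = d n x * cnj (\<phi> x)" for n x by (simp add: g_def d_def \<phi>_def)
  have gi: "integrable lebesgue (g n)" for n
    using L2_inner_integrable[OF d \<phi>, of n] unfolding gd[symmetric] by (simp add: complex_of_real_integrable_eq)
  have g0: "g n x \<ge> 0" for n x by (simp add: g_def)
  have gb: "(LINT x|lebesgue. g n x) \<le> (1/2)^n * norm (cls \<phi>)" for n
  proof -
    have "complex_of_real (LINT x|lebesgue. g n x) = l2_inner (d n) \<phi>"
      by (simp add: l2_inner_def gd[symmetric])
    then have "(LINT x|lebesgue. g n x) \<le> norm (l2_inner (d n) \<phi>)"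
      by (metis abs_ge_self norm_of_real)
    also have "\<dots> \<le> norm (cls (d n)) * norm (cls \<phi>)" by (rule norm_l2_inner_le[OF d \<phi>])
    also have "\<dots> \<le> (1/2)^n * norm (cls \<phi>)" using dn by (intro mult_right_mono) auto
    finally show ?thesis .
  qed
  have gm: "(\<lambda>x. ennreal (g n x)) \<in> borel_measurable lebesgue" for n using gi[of n] by auto
  have "(\<integral>\<^sup>+x. (\<Sum>n. ennreal (g n x)) \<partial>lebesgue) = (\<Sum>n. \<integral>\<^sup>+x. ennreal (g n x) \<partial>lebesgue)"
    by (rule nn_integral_suminf[OF gm])
  also have "\<dots> = (\<Sum>n. ennreal (LINT x|lebesgue. g n x))"
    using g0 by (intro suminf_cong nn_integral_eq_integral gi) auto
  also have "\<dots> \<le> (\<Sum>n. ennreal ((1/2)^n * norm (cls \<phi>)))"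
    using gb by (intro suminf_le ennreal_leI) auto
  also have "\<dots> = ennreal (\<Sum>n. (1/2)^n * norm (cls \<phi>))"
    by (intro suminf_ennreal2 summable_mult2) (auto intro: summable_geometric)
  also have "\<dots> < \<infinity>" by simp
  finally have "AE x in lebesgue. (\<Sum>n. ennreal (g n x)) \<noteq> \<infinity>"
    by (intro nn_integral_noteq_infinite) (use gm in auto)
  then show ?thesis
  proof eventually_elim
    case (elim x)
    have "summable (\<lambda>n. g n x)" using elim g0 by (intro summable_suminf_not_top) (auto simp: top_ennreal_def)
    then have "summable (\<lambda>n. g n x * sqrt (1 + x\<^sup>2))" by (rule summable_mult2)
    moreover have "g n x * sqrt (1 + x\<^sup>2) = norm (f (Suc n) x - f n x)" for n
    proof -
      have "sqrt (1 + x\<^sup>2) > 0" by (simp add: add_pos_nonneg)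
      then show ?thesis unfolding g_def by (simp only: mult.assoc) (simp add: less_imp_neq[symmetric] del: real_sqrt_gt_0_iff real_sqrt_eq_0_iff real_sqrt_eq_zero_cancel_iff)
    qed
    ultimately have "summable (\<lambda>n. norm (f (Suc n) x - f n x))" by simp
    then have "summable (\<lambda>n. f (Suc n) x - f n x)" by (rule summable_norm_cancel)
    then have "convergent (\<lambda>n. \<Sum>k<n. f (Suc k) x - f k x)" by (simp add: summable_iff_convergent)
    then have "convergent (\<lambda>n. f n x - f 0 x)" using sum_lessThan_telescope[of "\<lambda>k. f k x"] by simp
    then have "convergent (\<lambda>n. (f n x - f 0 x) + f 0 x)" by (intro convergent_add convergent_const)
    then show ?case by simp
  qed
qed

text \<open>By Fatou's lemma the distance of \<open>f m\<close> to the pointwise limit is at most the limit inferior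
  of the distances of \<open>f m\<close> to \<open>f n\<close>.\<close>

lemma L2_ae_limit:
  fixes f :: "nat \<Rightarrow> real \<Rightarrow> complex"
  assumes f: "\<And>n. f n \<in> L2" and C: "Cauchy (\<lambda>n. cls (f n))" and g: "g \<in> borel_measurable lebesgue"
    and lim: "AE x in lebesgue. (\<lambda>n. f n x) \<longlonglongrightarrow> g x"
  shows "g \<in> L2" "(\<lambda>n. cls (f n)) \<longlonglongrightarrow> cls g"
proof -
  have key: "(\<integral>\<^sup>+x. ennreal ((norm (f m x - g x))\<^sup>2) \<partial>lebesgue) \<le> ennreal (e\<^sup>2)"
    if "e > 0" "\<And>n. n \<ge> N \<Longrightarrow> norm (cls (f m) - cls (f n)) \<le> e" for m N e
  proof -
    have "(\<integral>\<^sup>+x. ennreal ((norm (f m x - g x))\<^sup>2) \<partial>lebesgue)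
        = (\<integral>\<^sup>+x. liminf (\<lambda>n. ennreal ((norm (f m x - f n x))\<^sup>2)) \<partial>lebesgue)"
    proof (rule nn_integral_cong_AE, use lim in eventually_elim)
      fix x assume "(\<lambda>n. f n x) \<longlonglongrightarrow> g x"
      then have "(\<lambda>n. ennreal ((norm (f m x - f n x))\<^sup>2)) \<longlonglongrightarrow> ennreal ((norm (f m x - g x))\<^sup>2)"
        by (intro tendsto_intros)
      then show "ennreal ((norm (f m x - g x))\<^sup>2) = liminf (\<lambda>n. ennreal ((norm (f m x - f n x))\<^sup>2))"
        using lim_imp_Liminf[OF sequentially_bot] by (metis (no_types))
    qed
    also have "\<dots> \<le> liminf (\<lambda>n. \<integral>\<^sup>+x. ennreal ((norm (f m x - f n x))\<^sup>2) \<partial>lebesgue)"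
      using f[THEN L2_measurable] by (intro nn_integral_liminf) auto
    also have "\<dots> \<le> limsup (\<lambda>n. \<integral>\<^sup>+x. ennreal ((norm (f m x - f n x))\<^sup>2) \<partial>lebesgue)"
      by (rule Liminf_le_Limsup) simp
    also have "\<dots> \<le> ennreal (e\<^sup>2)"
    proof (rule Limsup_bounded, rule eventually_sequentiallyI)
      fix n assume "n \<ge> N"
      then have "(norm (cls (f m) - cls (f n)))\<^sup>2 \<le> e\<^sup>2" using that(2) by (intro power_mono) auto
      then show "(\<integral>\<^sup>+x. ennreal ((norm (f m x - f n x))\<^sup>2) \<partial>lebesgue) \<le> ennreal (e\<^sup>2)"
        using nn_integral_norm_sq_cls[OF L2_diff[OF f f], of m n] by (simp add: cls_diff f ennreal_leI)
    qed
    finally show ?thesis .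
  qed
  have diffL2: "(\<lambda>x. f m x - g x) \<in> L2" if "e > 0" "\<And>n. n \<ge> N \<Longrightarrow> norm (cls (f m) - cls (f n)) \<le> e" for m N e
  proof -
    have "integrable lebesgue (\<lambda>x. (norm (f m x - g x))\<^sup>2)"
    proof (rule integrableI_bounded)
      show "(\<lambda>x. (norm (f m x - g x))\<^sup>2) \<in> borel_measurable lebesgue" using f[THEN L2_measurable] g by auto
      show "(\<integral>\<^sup>+ x. ennreal (norm ((cmod (f m x - g x))\<^sup>2)) \<partial>lebesgue) < \<infinity>"
        using order_le_less_trans[OF key[OF that] ennreal_less_top] by simp
    qed
    then show ?thesis using f[THEN L2_measurable] g by (auto simp: L2_def)
  qed
  obtain N where N: "\<And>m n. m \<ge> N \<Longrightarrow> n \<ge> N \<Longrightarrow> norm (cls (f m) - cls (f n)) < 1"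
    using CauchyD[OF C, of 1] by auto
  have "(\<lambda>x. f N x - (f N x - g x)) \<in> L2"
    by (rule L2_diff[OF f diffL2[of 1 N N]]) (use N less_imp_le in auto)
  then show gL2: "g \<in> L2" by simp
  show "(\<lambda>n. cls (f n)) \<longlonglongrightarrow> cls g"
  proof (rule LIMSEQ_I)
    fix e :: real assume e: "e > 0"
    obtain N where N: "\<And>m n. m \<ge> N \<Longrightarrow> n \<ge> N \<Longrightarrow> norm (cls (f m) - cls (f n)) < e/2"
      using CauchyD[OF C, of "e/2"] e by auto
    have "norm (cls (f m) - cls g) < e" if "m \<ge> N" for m
    proof -
      have "ennreal ((norm (cls (\<lambda>x. f m x - g x)))\<^sup>2) \<le> ennreal ((e/2)\<^sup>2)"
        using key[of "e/2" N m] N[OF that] e less_imp_le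
        by (subst nn_integral_norm_sq_cls[OF L2_diff[OF f gL2], symmetric]) auto
      then have "(norm (cls (\<lambda>x. f m x - g x)))\<^sup>2 \<le> (e/2)\<^sup>2" using e by (simp add: ennreal_le_iff)
      then have "norm (cls (\<lambda>x. f m x - g x)) \<le> e/2" by (rule power2_le_imp_le) (use e in simp)
      then show ?thesis using e by (simp add: cls_diff f gL2)
    qed
    then show "\<exists>no. \<forall>n\<ge>no. norm (cls (f n) - cls g) < e" by blast
  qed
qed

instance l2 :: complete_space
proof
  fix X :: "nat \<Rightarrow> l2" assume C: "Cauchy X"
  have "\<exists>N. \<forall>m\<ge>N. \<forall>n\<ge>N. norm (X m - X n) < (1/2)^k" for k
    using CauchyD[OF C, of "(1/2)^k"] by simp
  then obtain N where N: "\<And>k m n. m \<ge> N k \<Longrightarrow> n \<ge> N k \<Longrightarrow> norm (X m - X n) < (1/2)^k" by metis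
  \<comment> \<open>A strictly increasing subsequence whose increments are bounded by \<open>1 / 2\<^sup>k\<close>.\<close>
  define r where "r = rec_nat (N 0) (\<lambda>k a. max (Suc a) (N (Suc k)))"
  have rS: "r (Suc k) = max (Suc (r k)) (N (Suc k))" for k by (simp add: r_def)
  have sm: "strict_mono r" by (rule strict_monoI_Suc) (simp add: rS)
  have rN: "r k \<ge> N k" for k by (cases k) (simp_all add: r_def)
  define f where "f = (\<lambda>k. rep (X (r k)))"
  have fL2: "f k \<in> L2" and fX: "cls (f k) = X (r k)" for k by (simp_all add: f_def)
  have "AE x in lebesgue. convergent (\<lambda>n. f n x)"
  proof (rule L2_fast_limit[OF fL2])
    fix n
    have "r (Suc n) \<ge> N n" using rN[of n] by (simp add: rS le_max_iff_disj)
    then show "norm (cls (f (Suc n)) - cls (f n)) \<le> (1/2)^n"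
      using N[of n "r (Suc n)" "r n"] rN[of n] by (simp add: fX less_imp_le)
  qed
  then have lim: "AE x in lebesgue. (\<lambda>n. f n x) \<longlonglongrightarrow> lim (\<lambda>n. f n x)"
    by eventually_elim (simp add: convergent_LIMSEQ_iff)
  have meas: "(\<lambda>x. lim (\<lambda>n. f n x)) \<in> borel_measurable lebesgue"
    using fL2[THEN L2_measurable] by (intro borel_measurable_lim_metric)
  have "(\<lambda>k. cls (f k)) \<longlonglongrightarrow> cls (\<lambda>x. lim (\<lambda>n. f n x))"
  proof (rule L2_ae_limit(2)[OF fL2 _ meas lim])
    show "Cauchy (\<lambda>n. cls (f n))" using Cauchy_subseq_Cauchy[OF C sm] by (simp add: fX o_def)
  qed
  then have "(X \<circ> r) \<longlonglongrightarrow> cls (\<lambda>x. lim (\<lambda>n. f n x))" by (simp add: fX o_def)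
  then have "X \<longlonglongrightarrow> cls (\<lambda>x. lim (\<lambda>n. f n x))" by (rule Cauchy_converges_subseq[OF C sm])
  then show "convergent X" by (rule convergentI)
qed

section \<open>Cauchy transforms\<close>

lemma of_real_measurable_lebesgue [measurable]: "(\<lambda>x::real. complex_of_real x) \<in> borel_measurable lebesgue"
  and ident_measurable_lebesgue: "(\<lambda>x::real. x) \<in> borel_measurable lebesgue"
  by (auto intro!: measurable_completion)

lemma i_plus_real_neq_0 [simp]: "\<i> + complex_of_real t \<noteq> 0"
  by (simp add: complex_eq_iff)

lemma real_minus_neq_0: "Im z \<noteq> 0 \<Longrightarrow> complex_of_real t - z \<noteq> 0"
  by (auto simp: complex_eq_iff)

lemma norm_i_plus_real_sq: "(norm (\<i> + complex_of_real t))\<^sup>2 = 1 + t\<^sup>2"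
  by (simp add: cmod_power2)

lemma integrable_bounded_mult:
  fixes f g :: "'a \<Rightarrow> 'b::{real_normed_field,second_countable_topology,banach}"
  assumes f: "integrable M f" and g: "g \<in> borel_measurable M" and b: "AE x in M. norm (g x) \<le> B"
  shows "integrable M (\<lambda>x. f x * g x)"
proof (rule Bochner_Integration.integrable_bound)
  show "integrable M (\<lambda>x. B * norm (f x))" using f by simp
  show "(\<lambda>x. f x * g x) \<in> borel_measurable M" using f g by simp
  show "AE x in M. norm (f x * g x) \<le> norm (B * norm (f x))"
    using b
  proof eventually_elim
    case (elim x)
    then have "norm (f x) * norm (g x) \<le> norm (f x) * B" by (intro mult_left_mono) auto
    also have "\<dots> \<le> norm (B * norm (f x))" by (simp add: mult.commute)
    finally show ?case by (simp add: norm_mult)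
  qed
qed

text \<open>The condition gives absolute convergence of all Cauchy integrals off the line. It is weaker
  than square integrability: products \<open>h f\<close> with \<open>h / (\<i> + t)\<close> and \<open>f\<close> in \<open>L2\<close> satisfy it as
  well.\<close>

definition Cauchy_class :: "(real \<Rightarrow> complex) set" where
  "Cauchy_class = {k. integrable lebesgue (\<lambda>t. k t / (\<i> + of_real t))}"

definition cauchy_tr :: "(real \<Rightarrow> complex) \<Rightarrow> complex \<Rightarrow> complex" where
  "cauchy_tr k z = (LINT t|lebesgue. k t / (of_real t - z))"

definition cayley :: "real \<Rightarrow> complex" where "cayley t = (\<i> - of_real t) / (\<i> + of_real t)"

definition moment :: "(real \<Rightarrow> complex) \<Rightarrow> nat \<Rightarrow> complex" where
  "moment k n = (LINT t|lebesgue. k t * (cayley t ^ n / (\<i> + of_real t)))"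

lemma cayley_measurable [measurable]: "cayley \<in> borel_measurable lebesgue"
  unfolding cayley_def[abs_def] by measurable

lemma norm_cayley [simp]: "norm (cayley t) = 1"
proof -
  have "\<i> - of_real t = - cnj (\<i> + of_real t)" by (simp add: complex_eq_iff)
  then have "norm (\<i> - of_real t) = norm (\<i> + of_real t)" by (metis complex_mod_cnj norm_minus_cancel)
  then show ?thesis by (simp add: cayley_def norm_divide)
qed

lemma Cauchy_class_integrable: "k \<in> Cauchy_class \<Longrightarrow> integrable lebesgue (\<lambda>t. k t / (\<i> + of_real t))"
  by (simp add: Cauchy_class_def)

lemma Cauchy_class_measurable:
  assumes "k \<in> Cauchy_class" shows "k \<in> borel_measurable lebesgue"
proof -
  have "(\<lambda>t. k t / (\<i> + of_real t) * (\<i> + of_real t)) \<in> borel_measurable lebesgue"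
    by (intro borel_measurable_times borel_measurable_integrable[OF Cauchy_class_integrable[OF assms]]) measurable
  then show ?thesis by simp
qed

text \<open>Every Cauchy kernel off the line is dominated by a multiple of the one at \<open>- \<i>\<close>.\<close>

lemma kernel_bound:
  assumes "Im z \<noteq> 0"
  shows "norm ((\<i> + of_real t) / (of_real t - z)) \<le> 1 + norm (z + \<i>) / \<bar>Im z\<bar>"
proof -
  have y: "\<bar>Im z\<bar> \<le> norm (of_real t - z)" using abs_Im_le_cmod[of "of_real t - z"] by simp
  have "norm (\<i> + of_real t) = norm ((of_real t - z) + (z + \<i>))" by (simp add: algebra_simps)
  also have "\<dots> \<le> norm (of_real t - z) + norm (z + \<i>)" by (rule norm_triangle_ineq)
  also have "norm (z + \<i>) \<le> norm (of_real t - z) * (norm (z + \<i>) / \<bar>Im z\<bar>)"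
    using mult_right_mono[OF y, of "norm (z + \<i>) / \<bar>Im z\<bar>"] assms by simp
  finally have "norm (\<i> + of_real t) \<le> (1 + norm (z + \<i>) / \<bar>Im z\<bar>) * norm (of_real t - z)"
    by (simp add: algebra_simps)
  moreover have "norm (of_real t - z) > 0" using y assms by linarith
  ultimately show ?thesis by (simp add: norm_divide divide_le_eq)
qed

lemma Cauchy_class_cauchy_integrable:
  assumes k: "k \<in> Cauchy_class" and z: "Im z \<noteq> 0"
  shows "integrable lebesgue (\<lambda>t. k t / (of_real t - z))"
proof -
  have "integrable lebesgue (\<lambda>t. k t / (\<i> + of_real t) * ((\<i> + of_real t) / (of_real t - z)))"
    by (rule integrable_bounded_mult[OF Cauchy_class_integrable[OF k]])
       (use kernel_bound[OF z] in \<open>auto\<close>)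
  then show ?thesis by (simp add: divide_divide_eq_left mult.commute)
qed

lemma Cauchy_class_cnj: "k \<in> Cauchy_class \<Longrightarrow> (\<lambda>t. cnj (k t)) \<in> Cauchy_class"
proof -
  assume "k \<in> Cauchy_class"
  then have "integrable lebesgue (\<lambda>t. k t / (of_real t - \<i>))"
    by (rule Cauchy_class_cauchy_integrable) simp
  then have "integrable lebesgue (\<lambda>t. cnj (k t / (of_real t - \<i>)))" by (rule integrable_cnj)
  then show ?thesis by (simp add: Cauchy_class_def add.commute[of \<i>])
qed

lemma cauchy_tr_cnj: "cauchy_tr (\<lambda>t. cnj (k t)) z = cnj (cauchy_tr k (cnj z))"
  unfolding cauchy_tr_def by (subst Bochner_Integration.integral_cnj[symmetric]) simp

lemma cayley_disc:
  assumes "Im z < 0"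
  shows "norm ((\<i> + z) / (\<i> - z)) < 1"
proof -
  have "(norm (\<i> + z))\<^sup>2 < (norm (\<i> - z))\<^sup>2"
    using assms by (simp add: cmod_power2 power2_sum power2_diff)
  then have "norm (\<i> + z) < norm (\<i> - z)" by (rule power2_less_imp_less) simp
  then show ?thesis by (simp add: norm_divide divide_less_eq)
qed

text \<open>With \<open>q = (\<i> + z) / (\<i> - z)\<close>, a point of the unit disc, the identity
  \<open>(1 - cayley t q) (\<i> - z) (\<i> + t) = 2 \<i> (t - z)\<close> makes the Cauchy kernel a geometric
  series in \<open>cayley t q\<close>.\<close>

lemma kernel_sums:
  assumes z: "Im z < 0"
  shows "(\<lambda>n. cayley t ^ n / (\<i> + of_real t) * (((\<i> + z) / (\<i> - z)) ^ n * (2 * \<i> / (\<i> - z)))) sums (1 / (of_real t - z))"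
proof -
  define q where "q = (\<i> + z) / (\<i> - z)"
  define c where "c = 2 * \<i> / ((\<i> - z) * (\<i> + of_real t))"
  have iz: "\<i> - z \<noteq> 0" using z by (auto simp: complex_eq_iff)
  have q: "norm (cayley t * q) < 1" using cayley_disc[OF z] unfolding norm_mult norm_cayley q_def by simp
  have "(\<lambda>n. (cayley t * q) ^ n * c) sums (1 / (1 - cayley t * q) * c)"
    by (intro sums_mult2 geometric_sums q)
  also have "1 / (1 - cayley t * q) * c = 1 / (of_real t - z)"
  proof -
    have 1: "cayley t * (\<i> + of_real t) = \<i> - of_real t" and 2: "q * (\<i> - z) = \<i> + z"
      using iz by (simp_all add: cayley_def q_def)
    have "(1 - cayley t * q) * ((\<i> - z) * (\<i> + of_real t))
        = (\<i> - z) * (\<i> + of_real t) - (cayley t * (\<i> + of_real t)) * (q * (\<i> - z))"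
      by (simp add: algebra_simps)
    also have "\<dots> = (of_real t - z) * (2 * \<i>)" unfolding 1 2 by (simp add: algebra_simps)
    finally have eq: "(1 - cayley t * q) * ((\<i> - z) * (\<i> + of_real t)) = (of_real t - z) * (2 * \<i>)" .
    have "1 / (1 - cayley t * q) * c = (2 * \<i>) / ((1 - cayley t * q) * ((\<i> - z) * (\<i> + of_real t)))"
      by (simp add: c_def)
    also have "\<dots> = (2 * \<i>) / ((of_real t - z) * (2 * \<i>))" by (simp only: eq)
    finally show ?thesis by simp
  qed
  finally show ?thesis unfolding power_mult_distrib by (simp add: c_def q_def mult_ac)
qed

lemma norm_moment_le:
  assumes k: "k \<in> Cauchy_class"
  shows "norm (moment k n) \<le> (LINT t|lebesgue. norm (k t / (\<i> + of_real t)))"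
proof -
  have "norm (moment k n) \<le> (LINT t|lebesgue. norm (k t * (cayley t ^ n / (\<i> + of_real t))))"
    unfolding moment_def by (rule integral_norm_bound)
  then show ?thesis by (simp add: norm_mult norm_divide norm_power)
qed

lemma Cauchy_class_moment_integrable:
  assumes k: "k \<in> Cauchy_class"
  shows "integrable lebesgue (\<lambda>t. k t * (cayley t ^ n / (\<i> + of_real t)))"
proof -
  have "integrable lebesgue (\<lambda>t. k t / (\<i> + of_real t) * cayley t ^ n)"
    by (rule integrable_bounded_mult[OF Cauchy_class_integrable[OF k], of _ 1]) (auto simp: norm_power)
  then show ?thesis by (simp add: mult_ac)
qed

text \<open>The moments are the Taylor coefficients of the Cauchy integral in the variable of the disc,
  up to the factor \<open>2 \<i> / (\<i> - z)\<close>.\<close>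

lemma cauchy_tr_sums:
  assumes k: "k \<in> Cauchy_class" and z: "Im z < 0"
  shows "(\<lambda>n. moment k n * (((\<i> + z) / (\<i> - z)) ^ n * (2 * \<i> / (\<i> - z)))) sums cauchy_tr k z"
proof -
  define q where "q = (\<i> + z) / (\<i> - z)"
  have q: "norm q < 1" using cayley_disc[OF z] by (simp add: q_def)
  let ?f = "\<lambda>n t. k t * (cayley t ^ n / (\<i> + of_real t)) * (q ^ n * (2 * \<i> / (\<i> - z)))"
  have nf: "norm (?f n t) = norm (k t / (\<i> + of_real t)) * norm (2 * \<i> / (\<i> - z)) * norm q ^ n" for n t
    by (simp add: norm_mult norm_divide norm_power)
  have geo: "summable (\<lambda>n. c * norm q ^ n)" for c :: real
    using q by (intro summable_mult summable_geometric) simp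
  have "(\<lambda>n. LINT t|lebesgue. ?f n t) sums (LINT t|lebesgue. (\<Sum>n. ?f n t))"
  proof (rule sums_integral)
    show "integrable lebesgue (?f n)" for n
      by (intro integrable_mult_left Cauchy_class_moment_integrable k)
    show "AE t in lebesgue. summable (\<lambda>n. norm (?f n t))" unfolding nf by (intro AE_I2 geo)
    show "summable (\<lambda>n. LINT t|lebesgue. norm (?f n t))"
      unfolding nf Bochner_Integration.integral_mult_left_zero by (rule geo)
  qed
  also have "(LINT t|lebesgue. (\<Sum>n. ?f n t)) = cauchy_tr k z"
    unfolding cauchy_tr_def
  proof (rule Bochner_Integration.integral_cong[OF refl])
    fix t
    have "(\<lambda>n. k t * (cayley t ^ n / (\<i> + of_real t) * (q ^ n * (2 * \<i> / (\<i> - z))))) sums (k t * (1 / (of_real t - z)))"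
      unfolding q_def by (rule sums_mult[OF kernel_sums[OF z]])
    then show "(\<Sum>n. ?f n t) = k t / (of_real t - z)" by (simp add: sums_iff mult.assoc)
  qed
  also have "(\<lambda>n. LINT t|lebesgue. ?f n t) = (\<lambda>n. moment k n * (q ^ n * (2 * \<i> / (\<i> - z))))"
    unfolding moment_def Bochner_Integration.integral_mult_left_zero ..
  finally show ?thesis by (simp only: q_def)
qed

lemma cauchy_tr_eq_0_of_moments:
  assumes "k \<in> Cauchy_class" "\<And>n. moment k n = 0" "Im z < 0"
  shows "cauchy_tr k z = 0"
  using cauchy_tr_sums[OF assms(1,3)] assms(2) sums_unique2[OF _ sums_zero] by simp

lemma cauchy_tr_holomorphic_lower:
  assumes k: "k \<in> Cauchy_class"
  shows "cauchy_tr k holomorphic_on {z. Im z < 0}"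
proof -
  define g where "g = (\<lambda>w. \<Sum>n. moment k n * w ^ n)"
  have g: "(\<lambda>n. moment k n * w ^ n) sums g w" if "norm w < 1" for w
  proof -
    let ?N = "LINT t|lebesgue. norm (k t / (\<i> + of_real t))"
    have "summable (\<lambda>n. moment k n * w ^ n)"
    proof (rule summable_comparison_test')
      show "summable (\<lambda>n. ?N * norm w ^ n)" using that by (intro summable_mult summable_geometric) simp
      show "norm (moment k n * w ^ n) \<le> ?N * norm w ^ n" for n
        unfolding norm_mult norm_power by (intro mult_right_mono norm_moment_le k) auto
    qed
    then show ?thesis by (simp add: g_def summable_sums)
  qed
  have "g holomorphic_on ball 0 1"
    by (rule power_series_holomorphic[where a = "moment k"]) (use g in \<open>auto simp: dist_norm\<close>)
  then have "(g \<circ> (\<lambda>z. (\<i> + z) / (\<i> - z))) holomorphic_on {z. Im z < 0}"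
    by (rule holomorphic_on_compose_gen[rotated])
       (use cayley_disc in \<open>auto intro!: holomorphic_intros simp: complex_eq_iff dist_norm\<close>)
  then have "(\<lambda>z. g ((\<i> + z) / (\<i> - z)) * (2 * \<i> / (\<i> - z))) holomorphic_on {z. Im z < 0}"
    unfolding o_def by (rule holomorphic_on_mult) (auto intro!: holomorphic_intros simp: complex_eq_iff)
  then show ?thesis
  proof (rule holomorphic_transform)
    fix z assume "z \<in> {z. Im z < 0}"
    then have z: "Im z < 0" by simp
    have "(\<lambda>n. moment k n * (((\<i> + z) / (\<i> - z)) ^ n * (2 * \<i> / (\<i> - z)))) sums (g ((\<i> + z) / (\<i> - z)) * (2 * \<i> / (\<i> - z)))"
      unfolding mult.assoc[symmetric] by (rule sums_mult2[OF g[OF cayley_disc[OF z]]])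
    then show "g ((\<i> + z) / (\<i> - z)) * (2 * \<i> / (\<i> - z)) = cauchy_tr k z"
      using sums_unique2 cauchy_tr_sums[OF k z] by blast
  qed
qed

lemma open_upper [simp]: "open upper_half_plane" by (simp add: upper_half_plane_def open_halfspace_Im_gt)

text \<open>Reflection in the real line exchanges the half-planes and conjugates \<open>k\<close>.\<close>

lemma cauchy_tr_holomorphic_upper:
  assumes k: "k \<in> Cauchy_class"
  shows "cauchy_tr k holomorphic_on upper_half_plane"
proof -
  have "(cnj \<circ> cauchy_tr (\<lambda>t. cnj (k t)) \<circ> cnj) holomorphic_on upper_half_plane"
  proof (rule holomorphic_on_compose_cnj_cnj)
    have "cnj ` upper_half_plane \<subseteq> {z. Im z < 0}" by (auto simp: upper_half_plane_def)
    then show "cauchy_tr (\<lambda>t. cnj (k t)) holomorphic_on cnj ` upper_half_plane"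
      using cauchy_tr_holomorphic_lower[OF Cauchy_class_cnj[OF k]] by (rule holomorphic_on_subset[rotated])
  qed simp
  then show ?thesis by (simp add: o_def cauchy_tr_cnj)
qed

lemma inverse_i_plus_L2: "(\<lambda>t. 1 / (\<i> + of_real t)) \<in> L2"
  by (rule L2_bound[OF _ integrable_inverse_1_plus_square])
     (auto simp: norm_divide power_divide norm_i_plus_real_sq)

lemma L2_Cauchy_class: "f \<in> L2 \<Longrightarrow> f \<in> Cauchy_class"
  using L2_mult_integrable[OF _ inverse_i_plus_L2, of f] by (simp add: Cauchy_class_def)

section \<open>The Poisson kernel\<close>

definition poisson_kernel :: "complex \<Rightarrow> real \<Rightarrow> real" where
  "poisson_kernel z t = Im z / (pi * ((Re z - t)\<^sup>2 + (Im z)\<^sup>2))"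

definition poisson_int :: "(real \<Rightarrow> complex) \<Rightarrow> complex \<Rightarrow> complex" where
  "poisson_int f z = (LINT t|lebesgue. of_real (poisson_kernel z t) * f t)"

lemma poisson_kernel_pos: "Im z > 0 \<Longrightarrow> poisson_kernel z t > 0"
  by (auto simp: poisson_kernel_def intro!: divide_pos_pos mult_pos_pos add_nonneg_pos)

lemma poisson_kernel_nonneg: "Im z > 0 \<Longrightarrow> poisson_kernel z t \<ge> 0"
  using poisson_kernel_pos less_imp_le by blast

lemma poisson_kernel_borel_measurable: "poisson_kernel z \<in> borel_measurable borel"
  unfolding poisson_kernel_def[abs_def] by measurable

lemma poisson_kernel_measurable [measurable]: "poisson_kernel z \<in> borel_measurable lebesgue"
  by (rule measurable_completion) (simp add: poisson_kernel_borel_measurable)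

text \<open>The kernel depends on \<open>x - t\<close> only through its square. This exchange of variables is behind
  the self-adjointness of \<open>poisson_op\<close> and behind the uses of Fubini's theorem.\<close>

lemma poisson_kernel_sym: "poisson_kernel (Complex x y) t = poisson_kernel (Complex t y) x"
  by (simp add: poisson_kernel_def power2_commute)

lemma norm_real_minus_sq: "(norm (of_real t - z))\<^sup>2 = (Re z - t)\<^sup>2 + (Im z)\<^sup>2"
  by (simp add: cmod_power2 power2_commute)

lemma poisson_kernel_norm: "poisson_kernel z t = Im z / (pi * (norm (of_real t - z))\<^sup>2)"
  by (simp add: poisson_kernel_def norm_real_minus_sq)

text \<open>The Poisson kernel is the jump of the Cauchy kernel across the line.\<close>

lemma poisson_kernel_cauchy:
  assumes z: "Im z \<noteq> 0"
  shows "complex_of_real (poisson_kernel z t) = (1 / (of_real t - z) - 1 / (of_real t - cnj z)) / (2 * of_real pi * \<i>)"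
proof -
  have 1: "of_real t - z \<noteq> 0" "of_real t - cnj z \<noteq> 0" using z real_minus_neq_0[of z] real_minus_neq_0[of "cnj z"] by auto
  have "(of_real t - z) * (of_real t - cnj z) = of_real ((norm (of_real t - z))\<^sup>2)"
    by (subst complex_norm_square) simp
  moreover have "(of_real t - cnj z) - (of_real t - z) = 2 * \<i> * of_real (Im z)"
    by (simp add: complex_eq_iff)
  ultimately have "1 / (of_real t - z) - 1 / (of_real t - cnj z) = 2 * \<i> * of_real (Im z) / of_real ((norm (of_real t - z))\<^sup>2)"
    using 1 by (simp add: diff_frac_eq)
  then show ?thesis by (simp add: poisson_kernel_norm)
qed

lemma poisson_kernel_bound:
  assumes z: "Im z > 0"
  shows "\<exists>B\<ge>0. \<forall>t. poisson_kernel z t * (1 + t\<^sup>2) \<le> B"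
proof (intro exI conjI allI)
  let ?K = "1 + norm (z + \<i>) / \<bar>Im z\<bar>"
  show "0 \<le> Im z / pi * ?K\<^sup>2" using z by simp
  fix t
  have "(norm ((\<i> + of_real t) / (of_real t - z)))\<^sup>2 \<le> ?K\<^sup>2"
    using kernel_bound[of z t] z by (intro power_mono) auto
  then have "(1 + t\<^sup>2) / (norm (of_real t - z))\<^sup>2 \<le> ?K\<^sup>2"
    by (simp add: norm_divide power_divide norm_i_plus_real_sq)
  from mult_left_mono[OF this, of "Im z / pi"] z
  show "poisson_kernel z t * (1 + t\<^sup>2) \<le> Im z / pi * ?K\<^sup>2" by (simp add: poisson_kernel_norm)
qed

lemma poisson_kernel_has_integral:
  assumes "Im z > 0"
  shows "has_bochner_integral lebesgue (poisson_kernel z) 1"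
proof -
  have y: "Im z > 0" by fact
  have eq: "1 / (1 + ((- (Re z / Im z)) + (1 / Im z) * t)\<^sup>2) = pi * Im z * poisson_kernel z t" for t
  proof -
    have "(- (Re z / Im z)) + (1 / Im z) * t = (t - Re z) / Im z" using y by (simp add: field_simps)
    moreover have "1 + ((t - Re z) / Im z)\<^sup>2 = ((Re z - t)\<^sup>2 + (Im z)\<^sup>2) / (Im z)\<^sup>2"
      using y by (simp add: power_divide field_simps power2_commute)
    ultimately show ?thesis using y by (simp add: poisson_kernel_def power2_eq_square)
  qed
  have "has_bochner_integral lborel (\<lambda>t. 1 / (1 + ((- (Re z / Im z)) + (1 / Im z) * t)\<^sup>2)) (pi /\<^sub>R \<bar>1 / Im z\<bar>)"
    using lborel_has_bochner_integral_real_affine_iff[of "1 / Im z" "\<lambda>x. 1 / (1 + x\<^sup>2)" pi "- (Re z / Im z)"]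
      has_bochner_integral_inverse_1_plus_square y by simp
  then have "has_bochner_integral lborel (\<lambda>t. pi * Im z * poisson_kernel z t) (pi * Im z)"
    unfolding eq using y by (simp add: mult.commute)
  then have "has_bochner_integral lborel (\<lambda>t. pi * Im z * poisson_kernel z t / (pi * Im z)) (pi * Im z / (pi * Im z))"
    by (rule has_bochner_integral_divide_zero)
  then have 1: "has_bochner_integral lborel (poisson_kernel z) 1" using y by simp
  have "poisson_kernel z \<in> borel_measurable lborel" by (simp add: poisson_kernel_borel_measurable)
  with 1 show ?thesis by (simp add: has_bochner_integral_iff integrable_completion integral_completion)
qed

lemma nn_integral_poisson_kernel:
  assumes "Im z > 0" shows "(\<integral>\<^sup>+t. ennreal (poisson_kernel z t) \<partial>lebesgue) = 1"
  using nn_integral_eq_integral[of lebesgue "poisson_kernel z"] poisson_kernel_has_integral[OF assms]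
    poisson_kernel_nonneg[OF assms] by (simp add: has_bochner_integral_iff)

lemma poisson_int_cauchy:
  assumes "f \<in> Cauchy_class" "Im z > 0"
  shows "poisson_int f z = (cauchy_tr f z - cauchy_tr f (cnj z)) / (2 * of_real pi * \<i>)"
proof -
  have "of_real (poisson_kernel z t) * f t = (f t / (of_real t - z) - f t / (of_real t - cnj z)) / (2 * of_real pi * \<i>)" for t
    using poisson_kernel_cauchy[of z t] assms(2) by (simp add: diff_divide_distrib left_diff_distrib)
  then show ?thesis
    unfolding poisson_int_def cauchy_tr_def
    using Cauchy_class_cauchy_integrable[OF assms(1), of z] Cauchy_class_cauchy_integrable[OF assms(1), of "cnj z"] assms(2)
    by simp
qed

lemma poisson_int_integrable:
  assumes v: "integrable lebesgue (\<lambda>t. v t / of_real (1 + t\<^sup>2))" and z: "Im z > 0"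
  shows "integrable lebesgue (\<lambda>t. of_real (poisson_kernel z t) * (v t :: 'a::{real_normed_field,second_countable_topology,banach}))"
proof -
  obtain B where B: "\<And>t. poisson_kernel z t * (1 + t\<^sup>2) \<le> B" using poisson_kernel_bound[OF z] by blast
  have "integrable lebesgue (\<lambda>t. v t / of_real (1 + t\<^sup>2) * of_real (poisson_kernel z t * (1 + t\<^sup>2)))"
  proof (rule integrable_bounded_mult[OF v])
    show "AE t in lebesgue. norm (of_real (poisson_kernel z t * (1 + t\<^sup>2)) :: 'a) \<le> B"
      using B poisson_kernel_nonneg[OF z] by (auto simp: abs_mult simp del: of_real_mult of_real_add)
    have "(\<lambda>t. poisson_kernel z t * (1 + t\<^sup>2)) \<in> borel_measurable lebesgue"
      using poisson_kernel_borel_measurable[of z] by (intro measurable_completion) simp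
    then show "(\<lambda>t. of_real (poisson_kernel z t * (1 + t\<^sup>2)) :: 'a) \<in> borel_measurable lebesgue"
      by (rule measurable_compose) (simp add: borel_measurable_continuous_onI continuous_intros)
  qed
  moreover have "of_real (1 + t\<^sup>2) \<noteq> (0::'a)" for t :: real
    using add_pos_nonneg[of 1 "t\<^sup>2"] by (simp del: of_real_add)
  ultimately show ?thesis by (simp del: of_real_add add: mult.commute)
qed


section \<open>Fubini arguments for the Poisson kernel\<close>

lemma sigma_finite_lebesgue: "sigma_finite_measure (lebesgue :: real measure)"
proof
  obtain A :: "real set set" where A: "countable A" "A \<subseteq> sets lborel" "\<Union>A = space lborel" "\<forall>a\<in>A. emeasure lborel a \<noteq> \<infinity>"
    using lborel.sigma_finite_countable by blast
  show "\<exists>A::real set set. countable A \<and> A \<subseteq> sets lebesgue \<and> \<Union> A = space lebesgue \<and> (\<forall>a\<in>A. emeasure lebesgue a \<noteq> \<infinity>)"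
  proof (intro exI[of _ A] conjI ballI)
    show "emeasure lebesgue a \<noteq> \<infinity>" if "a \<in> A" for a
      using A(2,4) that by (subst emeasure_completion) (auto simp del: sets_lborel)
  qed (use A in auto)
qed

interpretation leb2: pair_sigma_finite "lebesgue :: real measure" "lebesgue :: real measure"
  using sigma_finite_lebesgue by (simp add: pair_sigma_finite_def)

lemma fst_lebesgue_measurable [measurable]: "(\<lambda>p. fst p) \<in> borel_measurable ((lebesgue :: real measure) \<Otimes>\<^sub>M (lebesgue :: real measure))"
  and snd_lebesgue_measurable [measurable]: "(\<lambda>p. snd p) \<in> borel_measurable ((lebesgue :: real measure) \<Otimes>\<^sub>M (lebesgue :: real measure))"
  by (rule measurable_compose[OF measurable_fst ident_measurable_lebesgue] measurable_compose[OF measurable_snd ident_measurable_lebesgue])+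

lemma poisson_kernel_product_measurable:
  "(\<lambda>p. poisson_kernel (Complex (fst p) y) (snd p)) \<in> borel_measurable (lebesgue \<Otimes>\<^sub>M lebesgue)"
  unfolding poisson_kernel_def
  by (intro borel_measurable_divide borel_measurable_times borel_measurable_add borel_measurable_power
      borel_measurable_diff borel_measurable_const) (auto simp: fst_lebesgue_measurable)

lemma nn_integral_poisson_swap:
  assumes F: "F \<in> borel_measurable lebesgue" and G: "G \<in> borel_measurable lebesgue"
  shows "(\<integral>\<^sup>+x. \<integral>\<^sup>+t. ennreal (poisson_kernel (Complex x y) t) * F t * G x \<partial>lebesgue \<partial>lebesgue)
       = (\<integral>\<^sup>+t. \<integral>\<^sup>+x. ennreal (poisson_kernel (Complex x y) t) * F t * G x \<partial>lebesgue \<partial>lebesgue)"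
proof -
  have "(\<lambda>p. ennreal (poisson_kernel (Complex (fst p) y) (snd p)) * F (snd p) * G (fst p)) \<in> borel_measurable (lebesgue \<Otimes>\<^sub>M lebesgue)"
    using measurable_compose[OF measurable_fst G] measurable_compose[OF measurable_snd F]
      measurable_compose[OF poisson_kernel_product_measurable measurable_ennreal]
    by (intro borel_measurable_times_ennreal) auto
  then show ?thesis
    by (intro leb2.Fubini'[symmetric]) (simp add: case_prod_beta')
qed

lemma nn_integral_poisson_kernel_fst:
  assumes "y > 0" shows "(\<integral>\<^sup>+x. ennreal (poisson_kernel (Complex x y) t) \<partial>lebesgue) = 1"
  unfolding poisson_kernel_sym[of _ y t] using assms by (intro nn_integral_poisson_kernel) simp

text \<open>Averaging with the Poisson kernel preserves the total mass, as the kernel has integral 1 in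
  either variable.\<close>

lemma nn_integral_poisson_avg:
  assumes F: "F \<in> borel_measurable lebesgue" and y: "y > 0"
  shows "(\<integral>\<^sup>+x. \<integral>\<^sup>+t. ennreal (poisson_kernel (Complex x y) t) * F t \<partial>lebesgue \<partial>lebesgue) = (\<integral>\<^sup>+t. F t \<partial>lebesgue)"
proof -
  have "(\<integral>\<^sup>+x. \<integral>\<^sup>+t. ennreal (poisson_kernel (Complex x y) t) * F t \<partial>lebesgue \<partial>lebesgue)
      = (\<integral>\<^sup>+t. \<integral>\<^sup>+x. ennreal (poisson_kernel (Complex x y) t) * F t \<partial>lebesgue \<partial>lebesgue)"
    using nn_integral_poisson_swap[OF F, of "\<lambda>_. 1" y] by simp
  also have "\<dots> = (\<integral>\<^sup>+t. (\<integral>\<^sup>+x. ennreal (poisson_kernel (Complex x y) t) \<partial>lebesgue) * F t \<partial>lebesgue)"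
  proof (intro nn_integral_cong nn_integral_multc)
    fix t show "(\<lambda>x. ennreal (poisson_kernel (Complex x y) t)) \<in> borel_measurable lebesgue"
      unfolding poisson_kernel_sym[of _ y t] by measurable
  qed
  finally show ?thesis by (simp add: nn_integral_poisson_kernel_fst[OF y])
qed

text \<open>The variance of \<open>\<bar>f\<bar>\<close> with respect to the Poisson kernel, which is a probability density, is
  not negative.\<close>

lemma poisson_int_sq_le:
  assumes f: "f \<in> borel_measurable lebesgue" and v: "integrable lebesgue (\<lambda>t. (norm (f t))\<^sup>2 / (1 + t\<^sup>2))" and z: "Im z > 0"
  shows "(norm (poisson_int f z))\<^sup>2 \<le> (LINT t|lebesgue. poisson_kernel z t * (norm (f t))\<^sup>2)"
proof -
  have i2: "integrable lebesgue (\<lambda>t. poisson_kernel z t * (norm (f t))\<^sup>2)"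
    using poisson_int_integrable[of "\<lambda>t. (norm (f t))\<^sup>2" z] v z by simp
  have ik: "integrable lebesgue (poisson_kernel z)" and k1: "(LINT t|lebesgue. poisson_kernel z t) = 1"
    using poisson_kernel_has_integral[OF z] by (auto simp: has_bochner_integral_iff)
  have i1: "integrable lebesgue (\<lambda>t. poisson_kernel z t * norm (f t))"
  proof (rule Bochner_Integration.integrable_bound)
    show "integrable lebesgue (\<lambda>t. poisson_kernel z t + poisson_kernel z t * (norm (f t))\<^sup>2)"
      by (intro Bochner_Integration.integrable_add i2 ik)
    have "a \<le> 1 + a\<^sup>2" for a :: real
      using zero_le_power2[of "a - 1/2"] by (simp add: power2_diff power_divide) 
    then have "poisson_kernel z t * norm (f t) \<le> poisson_kernel z t * (1 + (norm (f t))\<^sup>2)" for t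
      by (intro mult_left_mono poisson_kernel_nonneg z)
    then show "AE t in lebesgue. norm (poisson_kernel z t * norm (f t)) \<le> norm (poisson_kernel z t + poisson_kernel z t * (norm (f t))\<^sup>2)"
      using poisson_kernel_nonneg[OF z] by (simp add: distrib_left abs_mult)
  qed (use f in measurable)
  define m where "m = (LINT t|lebesgue. poisson_kernel z t * norm (f t))"
  have "norm (poisson_int f z) \<le> (LINT t|lebesgue. norm (of_real (poisson_kernel z t) * f t))"
    unfolding poisson_int_def by (rule integral_norm_bound)
  also have "\<dots> = m" using poisson_kernel_nonneg[OF z] by (simp add: m_def norm_mult)
  finally have 1: "norm (poisson_int f z) \<le> m" .
  have "0 \<le> (LINT t|lebesgue. poisson_kernel z t * (norm (f t) - m)\<^sup>2)"
    using poisson_kernel_nonneg[OF z] by (intro integral_nonneg_AE) auto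
  also have "\<dots> = (LINT t|lebesgue. poisson_kernel z t * (norm (f t))\<^sup>2 - 2 * m * (poisson_kernel z t * norm (f t)) + m\<^sup>2 * poisson_kernel z t)"
    by (intro Bochner_Integration.integral_cong refl) (simp add: power2_diff algebra_simps)
  also have "\<dots> = (LINT t|lebesgue. poisson_kernel z t * (norm (f t))\<^sup>2) - 2 * m * m + m\<^sup>2 * 1"
    using i1 i2 ik by (simp add: k1 m_def)
  finally have "m\<^sup>2 \<le> (LINT t|lebesgue. poisson_kernel z t * (norm (f t))\<^sup>2)" by (simp add: power2_eq_square)
  moreover have "(norm (poisson_int f z))\<^sup>2 \<le> m\<^sup>2" using 1 by (intro power_mono) auto
  ultimately show ?thesis by simp
qed

definition poisson_op :: "real \<Rightarrow> (real \<Rightarrow> complex) \<Rightarrow> real \<Rightarrow> complex" where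
  "poisson_op y f x = poisson_int f (Complex x y)"

lemma continuous_vertical_line: "continuous_on UNIV (\<lambda>x. Complex x y)"
  unfolding Complex_eq by (intro continuous_intros)

lemma poisson_op_continuous:
  assumes f: "f \<in> Cauchy_class" and y: "y > 0"
  shows "continuous_on UNIV (poisson_op y f)"
proof -
  have 1: "continuous_on UNIV (\<lambda>x. cauchy_tr f (Complex x y))"
    by (rule continuous_on_compose2[OF holomorphic_on_imp_continuous_on[OF cauchy_tr_holomorphic_upper[OF f]] continuous_vertical_line])
       (auto simp: upper_half_plane_def y)
  have 2: "continuous_on UNIV (\<lambda>x. cauchy_tr f (Complex x (-y)))"
    by (rule continuous_on_compose2[OF holomorphic_on_imp_continuous_on[OF cauchy_tr_holomorphic_lower[OF f]] continuous_vertical_line])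
       (auto simp: y)
  have "poisson_op y f = (\<lambda>x. (cauchy_tr f (Complex x y) - cauchy_tr f (Complex x (-y))) / (2 * of_real pi * \<i>))"
    using poisson_int_cauchy[OF f] y by (auto simp: poisson_op_def complex_cnj)
  then show ?thesis using 1 2 by (auto intro!: continuous_intros)
qed

lemma continuous_measurable_lebesgue:
  fixes f :: "real \<Rightarrow> 'b::topological_space"
  shows "continuous_on UNIV f \<Longrightarrow> f \<in> borel_measurable lebesgue"
  by (rule measurable_completion) (simp add: borel_measurable_continuous_onI)

lemma L2_weighted_integrable:
  assumes "f \<in> L2" shows "integrable lebesgue (\<lambda>t. (norm (f t))\<^sup>2 / (1 + t\<^sup>2))"
proof -
  have "(\<lambda>t::real. 1 / (1 + t\<^sup>2)) \<in> borel_measurable lebesgue"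
    using integrable_inverse_1_plus_square by (rule borel_measurable_integrable)
  then have "integrable lebesgue (\<lambda>t. (norm (f t))\<^sup>2 * (1 / (1 + t\<^sup>2)))"
    by (intro integrable_bounded_mult[OF L2_integrable[OF assms], of _ 1]) (auto simp: add_pos_nonneg divide_le_eq)
  then show ?thesis by simp
qed

text \<open>The pointwise bound on squares, integrated over the line, gives the contraction property,
  because averaging with the kernel preserves integrals.\<close>

lemma poisson_op_L2:
  assumes f: "f \<in> L2" and y: "y > 0"
  shows "poisson_op y f \<in> L2" "norm (cls (poisson_op y f)) \<le> norm (cls f)"
proof -
  have fm: "f \<in> borel_measurable lebesgue" using f by (rule L2_measurable)
  have m: "poisson_op y f \<in> borel_measurable lebesgue"
    by (intro continuous_measurable_lebesgue poisson_op_continuous L2_Cauchy_class f y)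
  have i: "integrable lebesgue (\<lambda>t. poisson_kernel (Complex x y) t * (norm (f t))\<^sup>2)" for x
    using poisson_int_integrable[of "\<lambda>t. (norm (f t))\<^sup>2" "Complex x y"] L2_weighted_integrable[OF f] y by simp
  have le: "(\<integral>\<^sup>+x. ennreal ((norm (poisson_op y f x))\<^sup>2) \<partial>lebesgue) \<le> ennreal ((norm (cls f))\<^sup>2)"
  proof -
    have "(\<integral>\<^sup>+x. ennreal ((norm (poisson_op y f x))\<^sup>2) \<partial>lebesgue)
        \<le> (\<integral>\<^sup>+x. \<integral>\<^sup>+t. ennreal (poisson_kernel (Complex x y) t) * ennreal ((norm (f t))\<^sup>2) \<partial>lebesgue \<partial>lebesgue)"
    proof (rule nn_integral_mono)
      fix x
      have nn: "AE t in lebesgue. 0 \<le> poisson_kernel (Complex x y) t * (norm (f t))\<^sup>2"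
        using poisson_kernel_nonneg[of "Complex x y"] y by simp
      have "ennreal ((norm (poisson_op y f x))\<^sup>2) \<le> ennreal (LINT t|lebesgue. poisson_kernel (Complex x y) t * (norm (f t))\<^sup>2)"
        unfolding poisson_op_def using y by (intro ennreal_leI poisson_int_sq_le fm L2_weighted_integrable f) simp
      also have "\<dots> = (\<integral>\<^sup>+t. ennreal (poisson_kernel (Complex x y) t * (norm (f t))\<^sup>2) \<partial>lebesgue)"
        by (rule nn_integral_eq_integral[OF i nn, symmetric])
      finally show "ennreal ((norm (poisson_op y f x))\<^sup>2) \<le> (\<integral>\<^sup>+t. ennreal (poisson_kernel (Complex x y) t) * ennreal ((norm (f t))\<^sup>2) \<partial>lebesgue)"
        using poisson_kernel_nonneg[of "Complex x y"] y by (simp add: ennreal_mult)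
    qed
    also have "\<dots> = (\<integral>\<^sup>+t. ennreal ((norm (f t))\<^sup>2) \<partial>lebesgue)"
      using fm y by (intro nn_integral_poisson_avg) auto
    also have "\<dots> = ennreal ((norm (cls f))\<^sup>2)" by (rule nn_integral_norm_sq_cls[OF f])
    finally show ?thesis .
  qed
  have "integrable lebesgue (\<lambda>x. (norm (poisson_op y f x))\<^sup>2)"
  proof (rule integrableI_bounded)
    show "(\<lambda>x. (norm (poisson_op y f x))\<^sup>2) \<in> borel_measurable lebesgue" using m by simp
    show "(\<integral>\<^sup>+ x. ennreal (norm ((cmod (poisson_op y f x))\<^sup>2)) \<partial>lebesgue) < \<infinity>"
      using order_le_less_trans[OF le ennreal_less_top] by simp
  qed
  with m show L: "poisson_op y f \<in> L2" by (simp add: L2_def)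
  have "(norm (cls (poisson_op y f)))\<^sup>2 \<le> (norm (cls f))\<^sup>2"
    using le by (simp add: nn_integral_norm_sq_cls[OF L] ennreal_le_iff)
  then show "norm (cls (poisson_op y f)) \<le> norm (cls f)" by (rule power2_le_imp_le) simp
qed

lemma poisson_op_selfadjoint:
  assumes f: "f \<in> L2" and g: "g \<in> L2" and y: "y > 0"
  shows "l2_inner (poisson_op y f) g = l2_inner f (poisson_op y g)"
proof -
  let ?k = "\<lambda>x t. poisson_kernel (Complex x y) t"
  have fm: "f \<in> borel_measurable lebesgue" and gm: "g \<in> borel_measurable lebesgue" using f g L2_measurable by auto
  have kn: "?k x t \<ge> 0" for x t using poisson_kernel_nonneg[of "Complex x y"] y by simp
  define \<Phi> where "\<Phi> = (\<lambda>x t. of_real (?k x t) * f t * cnj (g x))"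
  have int: "integrable (lebesgue \<Otimes>\<^sub>M lebesgue) (case_prod \<Phi>)"
  proof (rule integrableI_bounded)
    have "(\<lambda>x. cnj (g x)) \<in> borel_measurable lebesgue" using L2_measurable[OF L2_cnj[OF g]] .
    then show m: "case_prod \<Phi> \<in> borel_measurable (lebesgue \<Otimes>\<^sub>M lebesgue)"
      unfolding \<Phi>_def case_prod_beta'
      using poisson_kernel_product_measurable[of y] fm by measurable
    have "(\<integral>\<^sup>+p. ennreal (norm (case_prod \<Phi> p)) \<partial>(lebesgue \<Otimes>\<^sub>M lebesgue)) = (\<integral>\<^sup>+x. \<integral>\<^sup>+t. ennreal (norm (\<Phi> x t)) \<partial>lebesgue \<partial>lebesgue)"
      using m by (subst sigma_finite_measure.nn_integral_fst[OF sigma_finite_lebesgue, symmetric]) auto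
    also have "\<dots> \<le> (\<integral>\<^sup>+x. \<integral>\<^sup>+t. ennreal (?k x t) * ennreal ((norm (f t))\<^sup>2) + ennreal (?k x t) * ennreal ((norm (g x))\<^sup>2) \<partial>lebesgue \<partial>lebesgue)"
    proof (intro nn_integral_mono)
      fix x t
      have "norm (f t) * norm (g x) \<le> (norm (f t))\<^sup>2 + (norm (g x))\<^sup>2"
      proof -
        have "0 \<le> norm (f t) * norm (g x)" by simp
        then show ?thesis using zero_le_power2[of "norm (f t) - norm (g x)"] unfolding power2_diff by linarith
      qed
      from mult_left_mono[OF this kn[of x t]]
      have "norm (\<Phi> x t) \<le> ?k x t * (norm (f t))\<^sup>2 + ?k x t * (norm (g x))\<^sup>2"
        using kn[of x t] by (simp add: \<Phi>_def norm_mult algebra_simps)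
      then show "ennreal (norm (\<Phi> x t)) \<le> ennreal (?k x t) * ennreal ((norm (f t))\<^sup>2) + ennreal (?k x t) * ennreal ((norm (g x))\<^sup>2)"
        using kn[of x t] by (simp add: ennreal_mult[symmetric] ennreal_plus[symmetric] ennreal_leI del: ennreal_plus)
    qed
    also have "\<dots> = (\<integral>\<^sup>+x. (\<integral>\<^sup>+t. ennreal (?k x t) * ennreal ((norm (f t))\<^sup>2) \<partial>lebesgue) + ennreal ((norm (g x))\<^sup>2) \<partial>lebesgue)"
      using fm y by (intro nn_integral_cong, subst nn_integral_add) (auto simp: nn_integral_multc nn_integral_poisson_kernel)
    also have "\<dots> = (\<integral>\<^sup>+x. (\<integral>\<^sup>+t. ennreal (?k x t) * ennreal ((norm (f t))\<^sup>2) \<partial>lebesgue) \<partial>lebesgue) + (\<integral>\<^sup>+x. ennreal ((norm (g x))\<^sup>2) \<partial>lebesgue)"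
    proof (rule nn_integral_add)
      have "(\<lambda>p. ennreal (?k (fst p) (snd p)) * ennreal ((norm (f (snd p)))\<^sup>2)) \<in> borel_measurable (lebesgue \<Otimes>\<^sub>M lebesgue)"
        using poisson_kernel_product_measurable[of y] fm by measurable
      then show "(\<lambda>x. \<integral>\<^sup>+t. ennreal (?k x t) * ennreal ((norm (f t))\<^sup>2) \<partial>lebesgue) \<in> borel_measurable lebesgue"
        by (intro sigma_finite_measure.borel_measurable_nn_integral[OF sigma_finite_lebesgue]) (simp add: case_prod_beta')
    qed (use gm in auto)
    also have "\<dots> = ennreal ((norm (cls f))\<^sup>2) + ennreal ((norm (cls g))\<^sup>2)"
      using fm y by (subst nn_integral_poisson_avg) (auto simp: nn_integral_norm_sq_cls f g)
    also have "\<dots> < \<infinity>" by simp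
    finally show "(\<integral>\<^sup>+p. ennreal (norm (case_prod \<Phi> p)) \<partial>(lebesgue \<Otimes>\<^sub>M lebesgue)) < \<infinity>" .
  qed
  have "l2_inner (poisson_op y f) g = (LINT x|lebesgue. LINT t|lebesgue. \<Phi> x t)"
    unfolding l2_inner_def poisson_op_def poisson_int_def \<Phi>_def by simp
  also have "\<dots> = (LINT t|lebesgue. LINT x|lebesgue. \<Phi> x t)"
    by (rule leb2.Fubini_integral[OF int, symmetric])
  also have "\<dots> = (LINT t|lebesgue. f t * cnj (LINT x|lebesgue. of_real (?k t x) * g x))"
  proof (rule Bochner_Integration.integral_cong[OF refl])
    fix t
    have "(LINT x|lebesgue. \<Phi> x t) = (LINT x|lebesgue. f t * cnj (of_real (?k t x) * g x))"
      unfolding \<Phi>_def by (intro Bochner_Integration.integral_cong refl) (simp add: poisson_kernel_sym[of t y] mult_ac)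
    then show "(LINT x|lebesgue. \<Phi> x t) = f t * cnj (LINT x|lebesgue. of_real (?k t x) * g x)"
      by (simp only: integral_mult_right_zero Bochner_Integration.integral_cnj)
  qed
  finally show ?thesis by (simp add: l2_inner_def poisson_op_def poisson_int_def)
qed


section \<open>A function is determined by its Cauchy integrals off the real line\<close>

text \<open>The sets over which the integral vanishes are closed under countable disjoint unions and,
  since the total integral is a limit of integrals over intervals, under complements; so
  they include all Borel sets. A Lebesgue set differs from a Borel set by a null set.\<close>

lemma AE_zero_of_interval_integrals:
  fixes g :: "real \<Rightarrow> complex"
  assumes g: "integrable lebesgue g" and 0: "\<And>a b. a \<le> b \<Longrightarrow> (LINT t:{a..b}|lebesgue. g t) = 0"
  shows "AE t in lebesgue. g t = 0"
proof -
  have si: "set_integrable lebesgue A g" if "A \<in> sets lebesgue" for A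
    using g that by (auto simp: set_integrable_def intro: integrable_mult_indicator)
  have tot: "(LINT t|lebesgue. g t) = 0"
  proof -
    have "(\<lambda>n. LINT t:{- real n..real n}|lebesgue. g t) \<longlonglongrightarrow> (LINT t|lebesgue. g t)"
      unfolding set_lebesgue_integral_def
    proof (rule integral_dominated_convergence[where w = "\<lambda>t. norm (g t)"])
      show "AE t in lebesgue. (\<lambda>n. indicat_real {- real n..real n} t *\<^sub>R g t) \<longlonglongrightarrow> g t"
      proof (rule AE_I2, rule tendsto_eventually, rule eventually_sequentiallyI)
        fix t :: real and n assume "n \<ge> nat \<lceil>\<bar>t\<bar>\<rceil>"
        then have "\<bar>t\<bar> \<le> real n" by linarith
        then show "indicat_real {- real n..real n} t *\<^sub>R g t = g t" by (auto simp: abs_le_iff)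
      qed
      show "(\<lambda>t. indicat_real {- real n..real n} t *\<^sub>R g t) \<in> borel_measurable lebesgue" for n
        using si[of "{- real n..real n}"] by (auto simp: set_integrable_def)
    qed (use g in \<open>auto simp: indicator_def\<close>)
    then show ?thesis using 0 by (simp add: LIMSEQ_const_iff)
  qed
  have borel: "(LINT t:A|lebesgue. g t) = 0" if "A \<in> sets borel" for A
    using that
  proof (induction A rule: borel_set_induct)
    case empty then show ?case by (simp add: set_lebesgue_integral_def)
  next
    case (interval a b) then show ?case by (rule 0)
  next
    case (compl A)
    have "(LINT t:-A|lebesgue. g t) = (LINT t|lebesgue. g t - indicator A t *\<^sub>R g t)"
      unfolding set_lebesgue_integral_def
      by (intro Bochner_Integration.integral_cong refl) (auto split: split_indicator)
    also have "\<dots> = 0"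
      using si[of A] compl g tot by (simp add: set_integrable_def set_lebesgue_integral_def)
    finally show ?case .
  next
    case (union f)
    then have "(LINT t:(\<Union>i. f i)|lebesgue. g t) = (\<Sum>i. (LINT t:f i|lebesgue. g t))"
      by (intro lebesgue_integral_countable_add si) (auto simp: disjoint_family_on_def)
    then show ?case using union by simp
  qed
  show ?thesis
  proof (rule sigma_finite_measure.density_zero[OF sigma_finite_lebesgue g])
    fix A :: "real set" assume A: "A \<in> sets lebesgue"
    have ae: "AE x in lebesgue. x \<in> main_part lborel A \<longleftrightarrow> x \<in> A"
      using AE_completion[OF AE_in_main_part[OF A]] .
    have "(LINT t:A|lebesgue. g t) = (LINT t:main_part lborel A|lebesgue. g t)"
      unfolding set_lebesgue_integral_def
    proof (rule integral_cong_AE)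
      show "AE t in lebesgue. indicat_real A t *\<^sub>R g t = indicat_real (main_part lborel A) t *\<^sub>R g t"
        using ae by eventually_elim (auto simp: indicator_def)
    qed (use si[OF A] si[of "main_part lborel A"] A main_part_sets[OF A] in \<open>auto simp: set_integrable_def\<close>)
    then show "(LINT t:A|lebesgue. g t) = 0" using borel[of "main_part lborel A"] main_part_sets[OF A] by simp
  qed
qed

text \<open>The Poisson integral of the indicator function of \<open>[a, b]\<close>, in closed form.\<close>

definition interval_mass :: "real \<Rightarrow> real \<Rightarrow> real \<Rightarrow> real \<Rightarrow> real" where
  "interval_mass a b y t = (arctan ((b - t) / y) - arctan ((a - t) / y)) / pi"

lemma has_bochner_integral_interval_mass:
  assumes "a \<le> b" "y > 0"
  shows "has_bochner_integral lebesgue (\<lambda>x. indicator {a..b} x *\<^sub>R poisson_kernel (Complex x y) t) (interval_mass a b y t)"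
proof -
  have "has_bochner_integral lborel (\<lambda>x. indicator {a..b} x *\<^sub>R poisson_kernel (Complex x y) t)
      (arctan ((b - t) / y) / pi - arctan ((a - t) / y) / pi)"
  proof (rule has_bochner_integral_FTC_Icc[OF assms(1)])
    fix x
    have "((\<lambda>x. arctan ((x - t) / y) / pi) has_real_derivative (inverse (1 + ((x - t) / y)\<^sup>2) * (1 / y)) / pi) (at x within {a..b})"
      using assms(2) by (auto intro!: derivative_eq_intros)
    moreover have "(inverse (1 + ((x - t) / y)\<^sup>2) * (1 / y)) / pi = poisson_kernel (Complex x y) t"
    proof -
      have "1 + ((x - t) / y)\<^sup>2 = ((x - t)\<^sup>2 + y\<^sup>2) / y\<^sup>2" using assms by (simp add: power_divide add_divide_distrib)
      then show ?thesis using assms by (simp add: poisson_kernel_def power2_eq_square)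
    qed
    ultimately show "((\<lambda>x. arctan ((x - t) / y) / pi) has_vector_derivative poisson_kernel (Complex x y) t) (at x within {a..b})"
      by (simp add: has_real_derivative_iff_has_vector_derivative)
  next
    have y0: "y \<noteq> 0" using assms(2) by simp
    show "continuous_on {a..b} (\<lambda>x. poisson_kernel (Complex x y) t)"
      unfolding poisson_kernel_def by (auto intro!: continuous_intros simp: y0 sum_power2_eq_zero_iff)
  qed
  moreover have "(\<lambda>x. poisson_kernel (Complex x y) t) \<in> borel_measurable borel"
    unfolding poisson_kernel_sym[of _ y t] by (rule poisson_kernel_borel_measurable)
  then have "(\<lambda>x. indicator {a..b} x *\<^sub>R poisson_kernel (Complex x y) t) \<in> borel_measurable lborel" by simp
  ultimately show ?thesis
    by (simp add: has_bochner_integral_iff integrable_completion integral_completion interval_mass_def diff_divide_distrib)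
qed

text \<open>The second bound is uniform in \<open>y\<close> and is the domination needed for the limit \<open>y \<rightarrow> 0\<close> under
  integrals of functions in \<open>Cauchy_class\<close>. Near the interval the mass is at most 1, and far
  away the kernel decays like \<open>1 / t\<^sup>2\<close>.\<close>

lemma interval_mass_bounds:
  assumes ab: "a \<le> b" and y: "0 < y" "y \<le> 1"
  shows "0 \<le> interval_mass a b y t"
    and "interval_mass a b y t * norm (\<i> + of_real t) \<le> 8 * (b - a) + 3 + 2 * (\<bar>a\<bar> + \<bar>b\<bar>)"
proof -
  note hb = has_bochner_integral_interval_mass[OF ab y(1), of t]
  have eq: "interval_mass a b y t = (LINT x|lebesgue. indicator {a..b} x *\<^sub>R poisson_kernel (Complex x y) t)"
    using hb by (simp add: has_bochner_integral_iff)
  have int: "integrable lebesgue (\<lambda>x. indicator {a..b} x *\<^sub>R poisson_kernel (Complex x y) t)"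
    using hb by (simp add: has_bochner_integral_iff)
  have kn: "poisson_kernel (Complex x y) t \<ge> 0" for x using y by (intro poisson_kernel_nonneg) simp
  show nn: "0 \<le> interval_mass a b y t" unfolding eq by (rule integral_nonneg_AE) (use kn in auto)
  have le1: "interval_mass a b y t \<le> 1"
  proof -
    have "arctan ((b - t) / y) < pi / 2" "- (pi / 2) < arctan ((a - t) / y)" by (rule arctan_ubound arctan_lbound)+
    then show ?thesis by (simp add: interval_mass_def divide_le_eq)
  qed
  have n1: "norm (\<i> + complex_of_real t) \<le> 1 + \<bar>t\<bar>" using norm_triangle_ineq[of \<i> "of_real t"] by simp
  \<comment> \<open>For \<open>\<bar>t\<bar> > R\<close> the distance of \<open>t\<close> to the interval is at least \<open>\<bar>t\<bar> / 2\<close>.\<close>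
  define R where "R = 2 * (\<bar>a\<bar> + \<bar>b\<bar> + 1)"
  show "interval_mass a b y t * norm (\<i> + of_real t) \<le> 8 * (b - a) + 3 + 2 * (\<bar>a\<bar> + \<bar>b\<bar>)"
  proof (cases "\<bar>t\<bar> \<le> R")
    case True
    have "interval_mass a b y t * norm (\<i> + of_real t) \<le> 1 * (1 + R)"
      using le1 nn n1 True by (intro mult_mono) auto
    then show ?thesis using ab by (simp add: R_def)
  next
    case False
    then have t: "\<bar>t\<bar> \<ge> 1" by (simp add: R_def)
    have "interval_mass a b y t \<le> (LINT x|lebesgue. indicator {a..b} x *\<^sub>R (4 / t\<^sup>2))"
      unfolding eq
    proof (rule integral_mono[OF int])
      show "integrable lebesgue (\<lambda>x. indicator {a..b} x *\<^sub>R (4 / t\<^sup>2))"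
        using ab by (intro integrable_scaleR_left integrable_real_indicator) auto
      fix x
      show "indicator {a..b} x *\<^sub>R poisson_kernel (Complex x y) t \<le> indicator {a..b} x *\<^sub>R (4 / t\<^sup>2)"
      proof (cases "x \<in> {a..b}")
        case True
        have "\<bar>x\<bar> \<le> \<bar>a\<bar> + \<bar>b\<bar>" using True by (simp add: abs_le_iff) linarith
        then have "\<bar>x\<bar> \<le> R / 2" by (simp add: R_def)
        moreover have "R < \<bar>t\<bar>" "\<bar>t\<bar> - \<bar>x\<bar> \<le> \<bar>x - t\<bar>"
          using False abs_triangle_ineq2[of t x] by (simp_all add: abs_minus_commute)
        ultimately have "\<bar>x - t\<bar> \<ge> \<bar>t\<bar> / 2" by argo
        then have "(\<bar>t\<bar> / 2)\<^sup>2 \<le> \<bar>x - t\<bar>\<^sup>2" by (intro power_mono) auto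
        then have "t\<^sup>2 / 4 \<le> (x - t)\<^sup>2" by (simp add: power_divide)
        then have "t\<^sup>2 / 4 \<le> (x - t)\<^sup>2 + y\<^sup>2" using zero_le_power2[of y] by linarith
        also have "\<dots> \<le> pi * ((x - t)\<^sup>2 + y\<^sup>2)" using mult_right_mono[of 1 pi "(x - t)\<^sup>2 + y\<^sup>2"] pi_ge_two by simp
        finally have "y / (pi * ((x - t)\<^sup>2 + y\<^sup>2)) \<le> 1 / (t\<^sup>2 / 4)"
          using t y by (intro frac_le) auto
        then show ?thesis using True by (simp add: poisson_kernel_def)
      qed simp
    qed
    also have "\<dots> = 4 * (b - a) / t\<^sup>2" using ab by simp
    finally have "interval_mass a b y t * norm (\<i> + of_real t) \<le> 4 * (b - a) / t\<^sup>2 * (2 * t\<^sup>2)"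
    proof (rule mult_mono)
      have "1 \<le> \<bar>t\<bar> * \<bar>t\<bar>" "\<bar>t\<bar> \<le> \<bar>t\<bar> * \<bar>t\<bar>" using t mult_mono[of 1 "\<bar>t\<bar>" 1 "\<bar>t\<bar>"] mult_right_mono[of 1 "\<bar>t\<bar>" "\<bar>t\<bar>"] by auto
      then show "norm (\<i> + complex_of_real t) \<le> 2 * t\<^sup>2" using n1 by (simp add: power2_eq_square)
    qed (use ab in auto)
    also have "\<dots> = 8 * (b - a)" using t by auto
    finally show ?thesis by simp
  qed
qed

lemma interval_mass_limit:
  assumes "a \<le> b" "t \<noteq> a" "t \<noteq> b"
  shows "(\<lambda>n. interval_mass a b (1 / real (Suc n)) t) \<longlonglongrightarrow> indicator {a..b} t"
proof -
  have lim: "(\<lambda>n. arctan (c / (1 / real (Suc n)))) \<longlonglongrightarrow> sgn c * (pi / 2)" if "c \<noteq> 0" for c :: real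
  proof -
    have top: "filterlim (\<lambda>n. real (Suc n)) at_top sequentially"
      using filterlim_real_sequentially filterlim_sequentially_Suc by blast
    show ?thesis
    proof (cases "c > 0")
      case True
      have "filterlim (\<lambda>n. c * real (Suc n)) at_top sequentially"
        by (rule filterlim_tendsto_pos_mult_at_top[OF tendsto_const True top])
      from filterlim_compose[OF tendsto_arctan_at_top this] show ?thesis using True by simp
    next
      case False
      then have c: "c < 0" using that by simp
      have "filterlim (\<lambda>n. c * real (Suc n)) at_bot sequentially"
        by (rule filterlim_tendsto_neg_mult_at_bot[OF tendsto_const c top])
      from filterlim_compose[OF tendsto_arctan_at_bot this] show ?thesis using c by simp
    qed
  qed
  have "(\<lambda>n. interval_mass a b (1 / real (Suc n)) t) \<longlonglongrightarrow> (sgn (b - t) * (pi / 2) - sgn (a - t) * (pi / 2)) / pi"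
    unfolding interval_mass_def using assms by (intro tendsto_intros lim) auto
  also have "(sgn (b - t) * (pi / 2) - sgn (a - t) * (pi / 2)) / pi = indicator {a..b} t"
    using assms by (auto simp: sgn_if indicator_def)
  finally show ?thesis .
qed

text \<open>If the Cauchy integrals vanish on both sides, so do the Poisson integrals. Integrated over
  \<open>[a, b]\<close> on a horizontal line they become, by Fubini's theorem, the integral of \<open>k\<close>
  against \<open>interval_mass\<close>, and as the line approaches the boundary the latter tends to the
  indicator function. So all integrals of \<open>k\<close> over intervals are zero.\<close>

theorem Cauchy_class_AE_zero:
  assumes k: "k \<in> Cauchy_class" and 0: "\<And>z. Im z \<noteq> 0 \<Longrightarrow> cauchy_tr k z = 0"
  shows "AE t in lebesgue. k t = 0"
proof -
  have km: "k \<in> borel_measurable lebesgue" by (rule Cauchy_class_measurable[OF k])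
  have bd: "integrable lebesgue (\<lambda>t. k t * of_real (m t))"
    if "m \<in> borel_measurable lebesgue" "\<And>t. \<bar>m t\<bar> * norm (\<i> + complex_of_real t) \<le> B" for m B
  proof -
    have "integrable lebesgue (\<lambda>t. k t / (\<i> + of_real t) * ((\<i> + of_real t) * of_real (m t)))"
    proof (rule integrable_bounded_mult[OF Cauchy_class_integrable[OF k]])
      show "(\<lambda>t. (\<i> + of_real t) * complex_of_real (m t)) \<in> borel_measurable lebesgue" using that by measurable
      show "AE t in lebesgue. norm ((\<i> + complex_of_real t) * complex_of_real (m t)) \<le> B"
        using that(2) by (simp add: norm_mult mult.commute)
    qed
    then show ?thesis by (simp add: mult.assoc[symmetric])
  qed
  have massm: "(\<lambda>t. interval_mass a b y t) \<in> borel_measurable lebesgue" if "y > 0" for a b y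
    by (rule measurable_completion) (use that in \<open>simp add: interval_mass_def borel_measurable_continuous_onI continuous_intros\<close>)
  have mass0: "(LINT t|lebesgue. k t * of_real (interval_mass a b y t)) = 0"
    if ab: "a \<le> b" and y: "0 < y" "y \<le> 1" for a b y
  proof -
    define \<Phi> where "\<Phi> = (\<lambda>x t. of_real (indicator {a..b} x *\<^sub>R poisson_kernel (Complex x y) t) * k t)"
    have kn: "poisson_kernel (Complex x y) t \<ge> 0" for x t using y by (intro poisson_kernel_nonneg) simp
    have ind: "indicat_real {a..b} \<in> borel_measurable lebesgue" by (rule borel_measurable_indicator) auto
    have m: "(\<lambda>(t, x). \<Phi> x t) \<in> borel_measurable (lebesgue \<Otimes>\<^sub>M lebesgue)"
    proof -
      have pm: "(\<lambda>p. poisson_kernel (Complex (snd p) y) (fst p)) \<in> borel_measurable (lebesgue \<Otimes>\<^sub>M lebesgue)"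
        using poisson_kernel_product_measurable[of y] unfolding poisson_kernel_sym[of "snd _"] .
      show ?thesis unfolding \<Phi>_def case_prod_beta'
        using measurable_compose[OF measurable_snd ind, of lebesgue] measurable_compose[OF measurable_fst km, of lebesgue] pm
        by measurable
    qed
    have inner: "integrable lebesgue (\<lambda>x. \<Phi> x t)" "(LINT x|lebesgue. \<Phi> x t) = of_real (interval_mass a b y t) * k t"
      "(LINT x|lebesgue. norm (\<Phi> x t)) = interval_mass a b y t * norm (k t)" for t
    proof -
      note hb = has_bochner_integral_interval_mass[OF ab y(1), of t, unfolded has_bochner_integral_iff]
      show "integrable lebesgue (\<lambda>x. \<Phi> x t)" unfolding \<Phi>_def
        using hb by (intro integrable_mult_left integrable_of_real) simp
      show "(LINT x|lebesgue. \<Phi> x t) = of_real (interval_mass a b y t) * k t" unfolding \<Phi>_def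
        using hb by (simp only: integral_mult_left_zero integral_complex_of_real) 
      have "norm (\<Phi> x t) = indicator {a..b} x *\<^sub>R poisson_kernel (Complex x y) t * norm (k t)" for x
        using kn[of x t] by (simp add: \<Phi>_def norm_mult abs_mult)
      then show "(LINT x|lebesgue. norm (\<Phi> x t)) = interval_mass a b y t * norm (k t)"
        using hb by (simp only: integral_mult_left_zero)
    qed
    have int: "integrable (lebesgue \<Otimes>\<^sub>M lebesgue) (\<lambda>(t, x). \<Phi> x t)"
    proof (rule leb2.Fubini_integrable[OF m])
      have "integrable lebesgue (\<lambda>t. norm (k t * of_real (interval_mass a b y t)))"
        using interval_mass_bounds[OF ab y] massm[OF y(1), of a b] by (intro integrable_norm bd) auto
      then show "integrable lebesgue (\<lambda>t. LINT x|lebesgue. norm (case (t, x) of (t, x) \<Rightarrow> \<Phi> x t))"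
        using interval_mass_bounds(1)[OF ab y] by (simp add: inner norm_mult mult.commute)
    qed (use inner in simp)
    have z0: "(LINT t|lebesgue. \<Phi> x t) = 0" for x
    proof -
      have "(LINT t|lebesgue. \<Phi> x t) = (LINT t|lebesgue. of_real (indicator {a..b} x) * (of_real (poisson_kernel (Complex x y) t) * k t))"
        by (simp add: \<Phi>_def mult_ac)
      also have "\<dots> = of_real (indicator {a..b} x) * poisson_int k (Complex x y)"
        by (simp add: poisson_int_def)
      also have "poisson_int k (Complex x y) = 0"
        using poisson_int_cauchy[OF k, of "Complex x y"] y 0[of "Complex x y"] 0[of "cnj (Complex x y)"] by simp
      finally show ?thesis by simp
    qed
    have "0 = (LINT x|lebesgue. LINT t|lebesgue. \<Phi> x t)" by (simp add: z0)
    also have "(LINT x|lebesgue. LINT t|lebesgue. \<Phi> x t) = (LINT t|lebesgue. LINT x|lebesgue. \<Phi> x t)"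
      by (rule leb2.Fubini_integral) (use int in simp)
    also have "\<dots> = (LINT t|lebesgue. k t * of_real (interval_mass a b y t))"
      by (simp add: inner mult.commute)
    finally show ?thesis by simp
  qed
  have int0: "(LINT t:{a..b}|lebesgue. k t) = 0" if ab: "a \<le> b" for a b
  proof -
    let ?B = "8 * (b - a) + 3 + 2 * (\<bar>a\<bar> + \<bar>b\<bar>)"
    have "(\<lambda>n. LINT t|lebesgue. k t * of_real (interval_mass a b (1 / real (Suc n)) t)) \<longlonglongrightarrow> (LINT t|lebesgue. indicator {a..b} t *\<^sub>R k t)"
    proof (rule integral_dominated_convergence[where w = "\<lambda>t. ?B * norm (k t / (\<i> + of_real t))"])
      show "AE t in lebesgue. (\<lambda>n. k t * of_real (interval_mass a b (1 / real (Suc n)) t)) \<longlonglongrightarrow> indicat_real {a..b} t *\<^sub>R k t"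
      proof -
        have "AE t in lebesgue. t \<noteq> a" "AE t in lebesgue. t \<noteq> b"
          using AE_completion[OF AE_lborel_singleton] by auto
        then show ?thesis
        proof eventually_elim
          case (elim t)
          have "(\<lambda>n. k t * of_real (interval_mass a b (1 / real (Suc n)) t)) \<longlonglongrightarrow> k t * of_real (indicat_real {a..b} t)"
            by (intro tendsto_intros interval_mass_limit ab elim)
          then show ?case by (simp add: scaleR_conv_of_real mult.commute)
        qed
      qed
      show "AE t in lebesgue. norm (k t * of_real (interval_mass a b (1 / real (Suc n)) t)) \<le> ?B * norm (k t / (\<i> + of_real t))" for n
      proof (rule AE_I2)
        fix t
        have y: "0 < 1 / real (Suc n)" "1 / real (Suc n) \<le> 1" by auto
        have "norm (k t / (\<i> + of_real t)) * (interval_mass a b (1 / real (Suc n)) t * norm (\<i> + complex_of_real t)) \<le> norm (k t / (\<i> + of_real t)) * ?B"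
          by (intro mult_left_mono interval_mass_bounds ab y) simp
        moreover have "norm (k t / (\<i> + of_real t)) * (interval_mass a b (1 / real (Suc n)) t * norm (\<i> + complex_of_real t)) = norm (k t * of_real (interval_mass a b (1 / real (Suc n)) t))"
          using interval_mass_bounds(1)[OF ab y, of t] by (simp add: norm_divide norm_mult del: of_nat_Suc)
        ultimately show "norm (k t * of_real (interval_mass a b (1 / real (Suc n)) t)) \<le> ?B * norm (k t / (\<i> + of_real t))"
          by (simp only: mult.commute)
      qed
      show "integrable lebesgue (\<lambda>t. ?B * norm (k t / (\<i> + of_real t)))"
        by (intro integrable_mult_right integrable_norm Cauchy_class_integrable k)
      show "(\<lambda>t. k t * of_real (interval_mass a b (1 / real (Suc n)) t)) \<in> borel_measurable lebesgue" for n
        using km massm[of "1 / real (Suc n)" a b] by (simp del: of_nat_Suc)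
    qed (auto intro!: borel_measurable_scaleR borel_measurable_indicator km)
    moreover have "(LINT t|lebesgue. k t * of_real (interval_mass a b (1 / real (Suc n)) t)) = 0" for n
      by (rule mass0[OF ab]) auto
    ultimately show ?thesis by (simp add: LIMSEQ_const_iff set_lebesgue_integral_def)
  qed
  have "AE t in lebesgue. indicat_real {- real n..real n} t *\<^sub>R k t = 0" for n :: nat
  proof (rule AE_zero_of_interval_integrals)
    have "integrable lebesgue (\<lambda>t. k t * of_real (indicat_real {- real n..real n} t))"
    proof (rule bd)
      show "\<bar>indicat_real {- real n..real n} t\<bar> * norm (\<i> + complex_of_real t) \<le> 1 + real n" for t
        using norm_triangle_ineq[of \<i> "of_real t"] by (auto simp: indicator_def)
    qed (rule borel_measurable_indicator, simp)
    then show "integrable lebesgue (\<lambda>t. indicat_real {- real n..real n} t *\<^sub>R k t)"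
      by (simp add: scaleR_conv_of_real mult.commute)
    fix a b :: real assume "a \<le> b"
    have "(LINT t:{a..b}|lebesgue. indicat_real {- real n..real n} t *\<^sub>R k t) = (LINT t:{max a (- real n)..min b (real n)}|lebesgue. k t)"
      unfolding set_lebesgue_integral_def
      by (intro Bochner_Integration.integral_cong refl) (auto simp: indicator_def)
    also have "\<dots> = 0"
      using int0[of "max a (- real n)" "min b (real n)"]
      by (cases "max a (- real n) \<le> min b (real n)") (auto simp: set_lebesgue_integral_def)
    finally show "(LINT t:{a..b}|lebesgue. indicat_real {- real n..real n} t *\<^sub>R k t) = 0" .
  qed
  then have "AE t in lebesgue. \<forall>n::nat. indicat_real {- real n..real n} t *\<^sub>R k t = 0"
    unfolding AE_all_countable by blast
  then show ?thesis
  proof eventually_elim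
    case (elim t)
    obtain n :: nat where "\<bar>t\<bar> \<le> real n" using real_arch_simple by blast
    then show ?case using elim[rule_format, of n] by (auto simp: indicator_def abs_le_iff split: if_splits)
  qed
qed

text \<open>The moments of \<open>k\<close> determine its Cauchy integral below the line, and those of the conjugate
  the one above.\<close>

corollary Cauchy_class_AE_zero_of_moments:
  assumes k: "k \<in> Cauchy_class" and "\<And>n. moment k n = 0" "\<And>n. moment (\<lambda>t. cnj (k t)) n = 0"
  shows "AE t in lebesgue. k t = 0"
proof (rule Cauchy_class_AE_zero[OF k])
  fix z assume "Im z \<noteq> 0"
  then consider "Im z < 0" | "Im (cnj z) < 0" by fastforce
  then show "cauchy_tr k z = 0"
  proof cases
    case 2
    have "cnj (cauchy_tr k z) = cauchy_tr (\<lambda>t. cnj (k t)) (cnj z)" by (simp add: cauchy_tr_cnj)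
    also have "\<dots> = 0" by (rule cauchy_tr_eq_0_of_moments[OF Cauchy_class_cnj[OF k] assms(3) 2])
    finally show ?thesis by simp
  qed (rule cauchy_tr_eq_0_of_moments[OF k assms(2)])
qed

section \<open>Vertical boundary values of Poisson integrals\<close>

text \<open>The mass that the kernel puts outside of a fixed interval around \<open>x\<close> tends to zero with the
  height.\<close>

lemma poisson_approximate_identity:
  assumes c: "continuous_on UNIV f" and b: "\<And>t. norm (f t) \<le> B"
  shows "((\<lambda>y. poisson_op y f x) \<longlongrightarrow> f x) (at_right 0)"
proof (rule tendstoI)
  fix e :: real assume e: "e > 0"
  have B: "B \<ge> 0" using b[of 0] norm_ge_zero order_trans by blast
  have fm: "f \<in> borel_measurable lebesgue" by (rule continuous_measurable_lebesgue[OF c])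
  obtain d where d: "d > 0" "\<And>t. \<bar>t - x\<bar> < d \<Longrightarrow> norm (f t - f x) < e / 2"
    using c e unfolding continuous_on_iff dist_norm
    by (metis UNIV_I half_gt_zero real_norm_def)
  define h where "h = d / 2"
  have h: "h > 0" "\<And>t. t \<in> {x - h..x + h} \<Longrightarrow> norm (f t - f x) \<le> e / 2"
  proof -
    fix t assume "t \<in> {x - h..x + h}"
    then have "\<bar>t - x\<bar> < d" using d(1) by (auto simp: h_def)
    then show "norm (f t - f x) \<le> e / 2" using d(2) less_imp_le by blast
  qed (use d(1) in \<open>simp add: h_def\<close>)
  have "((\<lambda>y. arctan (h * inverse y)) \<longlongrightarrow> pi / 2) (at_right 0)"
    by (rule filterlim_compose[OF tendsto_arctan_at_top])
       (rule filterlim_tendsto_pos_mult_at_top[OF tendsto_const h(1) filterlim_inverse_at_top_right])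
  then have "((\<lambda>y. 1 - 2 * arctan (h * inverse y) / pi) \<longlongrightarrow> 1 - 2 * (pi / 2) / pi) (at_right 0)"
    by (intro tendsto_intros) auto
  then have lim: "((\<lambda>y. 2 * B * (1 - 2 * arctan (h * inverse y) / pi)) \<longlongrightarrow> 2 * B * 0) (at_right 0)"
    by (intro tendsto_intros) simp
  then have "eventually (\<lambda>y. 2 * B * (1 - 2 * arctan (h * inverse y) / pi) < e / 2) (at_right 0)"
    by (rule order_tendstoD(2)) (use e in simp)
  then show "eventually (\<lambda>y. dist (poisson_op y f x) (f x) < e) (at_right 0)"
    using eventually_at_right_less[of 0]
  proof eventually_elim
    case (elim y)
    let ?k = "poisson_kernel (Complex x y)"
    let ?I = "indicat_real {x - h..x + h}"
    have y: "y > 0" by (rule elim(2))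
    have kn: "?k t \<ge> 0" for t using y by (intro poisson_kernel_nonneg) simp
    have ik: "integrable lebesgue ?k" and k1: "(LINT t|lebesgue. ?k t) = 1"
      using poisson_kernel_has_integral[of "Complex x y"] y by (auto simp: has_bochner_integral_iff)
    have hb: "has_bochner_integral lebesgue (\<lambda>t. ?I t *\<^sub>R ?k t) (2 * arctan (h * inverse y) / pi)"
    proof -
      have "has_bochner_integral lebesgue (\<lambda>t. ?I t *\<^sub>R poisson_kernel (Complex t y) x) (interval_mass (x - h) (x + h) y x)"
        using h y by (intro has_bochner_integral_interval_mass) auto
      moreover have "interval_mass (x - h) (x + h) y x = 2 * arctan (h * inverse y) / pi"
        by (simp add: interval_mass_def arctan_minus divide_inverse)
      ultimately show ?thesis by (simp add: poisson_kernel_sym[of x y])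
    qed
    then have iI: "integrable lebesgue (\<lambda>t. ?I t *\<^sub>R ?k t)" and vI: "(LINT t|lebesgue. ?I t *\<^sub>R ?k t) = 2 * arctan (h * inverse y) / pi"
      by (auto simp: has_bochner_integral_iff)
    have ikf: "integrable lebesgue (\<lambda>t. of_real (?k t) * f t)"
      by (rule integrable_bounded_mult[OF _ fm]) (use b ik in auto)
    have "poisson_op y f x - f x = (LINT t|lebesgue. of_real (?k t) * f t) - (LINT t|lebesgue. of_real (?k t) * f x)"
      using k1 by (simp add: poisson_op_def poisson_int_def)
    also have "\<dots> = (LINT t|lebesgue. of_real (?k t) * (f t - f x))"
      using ikf ik by (simp add: right_diff_distrib)
    finally have "norm (poisson_op y f x - f x) \<le> (LINT t|lebesgue. norm (of_real (?k t) * (f t - f x)))"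
      using integral_norm_bound[of lebesgue "\<lambda>t. of_real (?k t) * (f t - f x)"] by simp
    also have "\<dots> \<le> (LINT t|lebesgue. e / 2 * ?k t + 2 * B * (?k t - ?I t *\<^sub>R ?k t))"
    proof (rule integral_mono)
      show "integrable lebesgue (\<lambda>t. norm (of_real (?k t) * (f t - f x)))"
        using ikf ik by (simp add: right_diff_distrib)
      show "integrable lebesgue (\<lambda>t. e / 2 * ?k t + 2 * B * (?k t - ?I t *\<^sub>R ?k t))"
        by (intro Bochner_Integration.integrable_add integrable_mult_right Bochner_Integration.integrable_diff ik iI)
      fix t
      show "norm (of_real (?k t) * (f t - f x)) \<le> e / 2 * ?k t + 2 * B * (?k t - ?I t *\<^sub>R ?k t)"
      proof (cases "t \<in> {x - h..x + h}")
        case True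
        then show ?thesis using mult_left_mono[OF h(2)[OF True] kn[of t]] kn[of t] by (simp add: norm_mult mult.commute)
      next
        case False
        have "norm (f t - f x) \<le> 2 * B" using norm_triangle_ineq4[of "f t" "f x"] b[of t] b[of x] by simp
        then have "?k t * norm (f t - f x) \<le> ?k t * (2 * B)" by (intro mult_left_mono kn)
        moreover have "0 \<le> e / 2 * ?k t" using e kn[of t] by simp
        ultimately show ?thesis using False kn[of t] by (simp add: norm_mult mult_ac)
      qed
    qed
    also have "\<dots> = e / 2 * 1 + 2 * B * (1 - 2 * arctan (h * inverse y) / pi)"
      using ik iI by (simp add: k1 vI[simplified])
    also have "\<dots> < e" using elim(1) by simp
    finally show ?case by (simp add: dist_norm)
  qed
qed

text \<open>Up to the factor \<open>sqrt \<pi>\<close> this is \<open>r\<^sub>n\<^sub>+\<^sub>1\<close> on the line.\<close>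

definition cayley_fun :: "nat \<Rightarrow> real \<Rightarrow> complex" where "cayley_fun n t = cayley t ^ n / (\<i> + of_real t)"

lemma cayley_fun_continuous: "continuous_on UNIV (cayley_fun n)"
  unfolding cayley_fun_def cayley_def by (intro continuous_intros) auto

lemma norm_cayley_fun: "norm (cayley_fun n t) = 1 / norm (\<i> + complex_of_real t)"
  by (simp add: cayley_fun_def norm_divide norm_power)

lemma norm_i_plus_ge_1: "1 \<le> norm (\<i> + complex_of_real t)"
  by (rule power2_le_imp_le) (simp_all add: norm_i_plus_real_sq)

lemma cayley_fun_bounded: "norm (cayley_fun n t) \<le> 1"
  unfolding norm_cayley_fun using norm_i_plus_ge_1[of t] by (simp add: divide_le_eq)

lemma cayley_fun_L2: "cayley_fun n \<in> L2"
  by (rule L2_bound[OF continuous_measurable_lebesgue[OF cayley_fun_continuous] integrable_inverse_1_plus_square])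
     (simp add: norm_cayley_fun power_divide norm_i_plus_real_sq)

lemma moment_inner: "moment f n = l2_inner f (\<lambda>t. cnj (cayley_fun n t))"
  by (simp only: moment_def l2_inner_def cayley_fun_def complex_cnj_cnj)

lemma subspace_closure:
  fixes S :: "'a::real_normed_vector set"
  assumes "subspace S" shows "subspace (closure S)"
proof (rule subspaceI)
  show "0 \<in> closure S" using subspace_0[OF assms] closure_subset by blast
  fix x y assume "x \<in> closure S" "y \<in> closure S"
  then obtain f g where "\<And>n. f n \<in> S" "\<And>n. g n \<in> S" and l: "f \<longlonglongrightarrow> x" "g \<longlonglongrightarrow> y"
    unfolding closure_sequential by blast
  then have "\<forall>n. f n + g n \<in> S" using subspace_add[OF assms] by blast
  then show "x + y \<in> closure S" unfolding closure_sequential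
    by (intro exI[of _ "\<lambda>n. f n + g n"] conjI tendsto_add l)
next
  fix c x assume "x \<in> closure S"
  then obtain f where "\<And>n. f n \<in> S" and l: "f \<longlonglongrightarrow> x" unfolding closure_sequential by blast
  then have "\<forall>n. c *\<^sub>R f n \<in> S" using subspace_scale[OF assms] by blast
  then show "c *\<^sub>R x \<in> closure S" unfolding closure_sequential
    by (intro exI[of _ "\<lambda>n. c *\<^sub>R f n"] conjI tendsto_scaleR tendsto_const l)
qed

text \<open>A dense class for which vertical limits exist at every point. Density holds because the
  functions \<open>cayley_fun n\<close> and their conjugates belong to the class, so that a function
  orthogonal to it has vanishing moments.\<close>

definition cont_L2 :: "l2 set" where
  "cont_L2 = {cls f | f. f \<in> L2 \<and> continuous_on UNIV f \<and> bounded (range f)}"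

lemma cont_L2_dense: "closure cont_L2 = UNIV"
proof (rule closed_subspace_eqI)
  have sub: "subspace cont_L2"
  proof (rule subspaceI)
    show "0 \<in> cont_L2" unfolding cont_L2_def by (rule CollectI, rule exI[of _ "\<lambda>x. 0"]) (simp add: cls_zero)
    fix x y assume "x \<in> cont_L2" "y \<in> cont_L2"
    then obtain f g where fg: "x = cls f" "y = cls g" "f \<in> L2" "g \<in> L2" "continuous_on UNIV f" "continuous_on UNIV g"
      "bounded (range f)" "bounded (range g)" unfolding cont_L2_def by blast
    show "x + y \<in> cont_L2" unfolding cont_L2_def
      by (rule CollectI, rule exI[of _ "\<lambda>t. f t + g t"])
         (use fg in \<open>auto simp: cls_add L2_add intro!: continuous_intros bounded_plus_comp\<close>)
  next
    fix c :: real and x assume "x \<in> cont_L2"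
    then obtain f where f: "x = cls f" "f \<in> L2" "continuous_on UNIV f" "bounded (range f)" unfolding cont_L2_def by blast
    obtain B where "\<And>t. norm (f t) \<le> B" using f(4) unfolding bounded_iff by blast
    then have "norm (of_real c * f t) \<le> \<bar>c\<bar> * B" for t by (simp add: norm_mult mult_left_mono)
    then have "bounded (range (\<lambda>t. of_real c * f t))" unfolding bounded_iff by blast
    then show "c *\<^sub>R x \<in> cont_L2" unfolding cont_L2_def
      by (intro CollectI, intro exI[of _ "\<lambda>t. of_real c * f t"])
         (use f in \<open>auto simp: cls_scale L2_cmult intro!: continuous_intros\<close>)
  qed
  then show "subspace (closure cont_L2)" by (rule subspace_closure)
  show "x = 0" if "x \<in> UNIV" and orth: "\<And>v. v \<in> closure cont_L2 \<Longrightarrow> inner x v = 0" for x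
  proof -
    define f where "f = rep x"
    have f: "f \<in> L2" "x = cls f" by (simp_all add: f_def)
    have in0: "l2_inner f g = 0" if g: "g \<in> L2" "continuous_on UNIV g" "bounded (range g)" for g
    proof -
      have "cls g \<in> cont_L2" using g unfolding cont_L2_def by blast
      then have 1: "Re (l2_inner f g) = 0" using orth[of "cls g"] closure_subset f g by (auto simp: inner_cls)
      have "bounded (range (\<lambda>t. \<i> * g t))" using g(3) unfolding bounded_iff by (simp add: norm_mult)
      then have "cls (\<lambda>t. \<i> * g t) \<in> cont_L2" using g unfolding cont_L2_def
        by (intro CollectI exI[of _ "\<lambda>t. \<i> * g t"]) (auto intro!: L2_cmult continuous_intros)
      then have "Re (l2_inner f (\<lambda>t. \<i> * g t)) = 0"
        using orth[of "cls (\<lambda>t. \<i> * g t)"] closure_subset f g by (auto simp: inner_cls L2_cmult)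
      then have "Im (l2_inner f g) = 0" by (simp add: l2_inner_cmult_right)
      with 1 show ?thesis by (simp add: complex_eq_iff)
    qed
    have b: "bounded (range (cayley_fun n))" for n unfolding bounded_iff using cayley_fun_bounded by auto
    then have b': "bounded (range (\<lambda>t. cnj (cayley_fun n t)))" for n unfolding bounded_iff by auto
    have "moment f n = 0" for n unfolding moment_inner
      by (intro in0 b' L2_cnj cayley_fun_L2 continuous_intros cayley_fun_continuous)
    moreover have "moment (\<lambda>t. cnj (f t)) n = 0" for n
    proof -
      have "moment (\<lambda>t. cnj (f t)) n = cnj (l2_inner f (cayley_fun n))"
        by (simp add: moment_inner l2_inner_def Bochner_Integration.integral_cnj[symmetric] del: Bochner_Integration.integral_cnj)
      then show ?thesis using in0[OF cayley_fun_L2 cayley_fun_continuous b] by simp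
    qed
    ultimately have "AE t in lebesgue. f t = 0" by (intro Cauchy_class_AE_zero_of_moments L2_Cauchy_class f)
    then have "cls f = cls (\<lambda>x. 0)" using f by (subst cls_eq_iff) (auto simp: ae_eq_def)
    then show ?thesis by (simp add: f cls_zero)
  qed
qed auto

text \<open>The weak-type estimate for the maximal function of \<open>m\<close>. The radii of the intervals with
  large mass are bounded by \<open>A / l\<close>, so by Vitali's covering lemma disjoint ones can be
  selected such that their enlargements by the factor 5 cover all of them; the length \<open>10 r\<close>
  of an enlarged interval is at most \<open>10 / l\<close> times the mass of the selected one. The set
  itself is only covered, which avoids the question of its measurability.\<close>

lemma weak_type_cover:
  fixes m :: "real \<Rightarrow> real"
  assumes m: "m \<in> borel_measurable lebesgue" and tot: "(\<integral>\<^sup>+t. ennreal (m t) \<partial>lebesgue) \<le> ennreal A" and A: "A \<ge> 0" and l: "l > 0"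
  shows "\<exists>T\<in>lmeasurable. measure lebesgue T \<le> 10 * A / l \<and>
    {x. \<exists>r>0. ennreal (l * r) < (\<integral>\<^sup>+t. ennreal (m t) * indicator (cball x r) t \<partial>lebesgue)} \<subseteq> T"
proof -
  let ?\<nu> = "\<lambda>S. \<integral>\<^sup>+t. ennreal (m t) * indicator S t \<partial>lebesgue"
  define K where "K = {(x, r). r > 0 \<and> ennreal (l * r) < ?\<nu> (cball x r)}"
  have rb: "0 < snd p \<and> snd p \<le> A / l" if "p \<in> K" for p
  proof -
    obtain x r where p: "p = (x, r)" by force
    have r: "r > 0" using that p by (auto simp: K_def)
    have "ennreal (l * r) < ?\<nu> (cball x r)" using that p by (auto simp: K_def)
    also have "?\<nu> (cball x r) \<le> (\<integral>\<^sup>+t. ennreal (m t) \<partial>lebesgue)"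
      by (intro nn_integral_mono) (auto split: split_indicator)
    also have "\<dots> \<le> ennreal A" by (rule tot)
    finally have "l * r \<le> A" using A by (simp add: ennreal_less_iff l r less_imp_le)
    then show ?thesis using l r p by (simp add: le_divide_eq mult.commute)
  qed
  obtain C where C: "countable C" "C \<subseteq> K" "pairwise (\<lambda>i j. disjnt (cball (fst i) (snd i)) (cball (fst j) (snd j))) C"
    "(\<Union>p\<in>K. cball (fst p) (snd p)) \<subseteq> (\<Union>i\<in>C. cball (fst i) (5 * snd i))"
    by (rule Vitali_covering_lemma_cballs[where S = "\<Union>p\<in>K. cball (fst p) (snd p)" and K = K and a = fst and r = snd and B = "A / l"]) (use rb in auto)
  define T where "T = (\<Union>i\<in>C. cball (fst i) (5 * snd i))"
  \<comment> \<open>The selected intervals are enumerated by natural numbers, with empty sets outside of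
    \<open>J\<close>.\<close>
  define J where "J = to_nat_on C ` C"
  define b where "b = (\<lambda>n. from_nat_into C n)"
  have bi: "b (to_nat_on C i) = i" if "i \<in> C" for i
    unfolding b_def by (rule from_nat_into_to_nat_on[OF C(1) that])
  have bC: "b n \<in> C" if "n \<in> J" for n using that bi by (auto simp: J_def)
  have bJ: "\<exists>n\<in>J. i = b n" if "i \<in> C" for i using that bi by (auto simp: J_def)
  have binj: "n = k" if "n \<in> J" "k \<in> J" "b n = b k" for n k
  proof -
    obtain i j where "i \<in> C" "j \<in> C" "n = to_nat_on C i" "k = to_nat_on C j" using \<open>n \<in> J\<close> \<open>k \<in> J\<close> unfolding J_def by blast
    then show ?thesis using that(3) bi by simp
  qed
  define X where "X = (\<lambda>n. if n \<in> J then cball (fst (b n)) (5 * snd (b n)) else {})"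
  define Y where "Y = (\<lambda>n. if n \<in> J then cball (fst (b n)) (snd (b n)) else {})"
  have TX: "T = (\<Union>n. X n)"
  proof (intro equalityI subsetI)
    fix x assume "x \<in> T"
    then obtain i where i: "i \<in> C" "x \<in> cball (fst i) (5 * snd i)" unfolding T_def by blast
    obtain n where "n \<in> J" "i = b n" using bJ[OF i(1)] by blast
    then have "x \<in> X n" using i(2) by (simp add: X_def)
    then show "x \<in> (\<Union>n. X n)" by blast
  next
    fix x assume "x \<in> (\<Union>n. X n)"
    then obtain n where "x \<in> X n" by blast
    then have "n \<in> J" "x \<in> cball (fst (b n)) (5 * snd (b n))" by (auto simp: X_def split: if_splits)
    then show "x \<in> T" unfolding T_def using bC by blast
  qed
  have Xm: "X n \<in> sets lebesgue" and Ym: "Y n \<in> sets lebesgue" for n by (auto simp: X_def Y_def)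
  have disj: "disjoint_family Y"
  proof (unfold disjoint_family_on_def, intro ballI impI)
    fix n k :: nat assume "n \<noteq> k"
    show "Y n \<inter> Y k = {}"
    proof (cases "n \<in> J \<and> k \<in> J")
      case True
      then have "b n \<noteq> b k" using binj \<open>n \<noteq> k\<close> by blast
      then have "disjnt (cball (fst (b n)) (snd (b n))) (cball (fst (b k)) (snd (b k)))"
        using C(3) bC True unfolding pairwise_def by blast
      then show ?thesis using True by (simp add: Y_def disjnt_def)
    qed (auto simp: Y_def)
  qed
  have XY: "emeasure lebesgue (X n) \<le> ennreal (10 / l) * ?\<nu> (Y n)" for n
  proof (cases "n \<in> J")
    case True
    then have k: "b n \<in> K" using bC C(2) by blast
    have r: "snd (b n) > 0" using rb[OF k] by simp
    have "emeasure lebesgue (X n) = ennreal (10 * snd (b n))"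
      using True r by (simp add: X_def cball_eq_atLeastAtMost)
    also have "\<dots> = ennreal (10 / l) * ennreal (l * snd (b n))"
      using l r by (simp add: ennreal_mult[symmetric])
    also have "\<dots> \<le> ennreal (10 / l) * ?\<nu> (Y n)"
      using k True by (intro mult_left_mono) (auto simp: K_def Y_def case_prod_beta intro: less_imp_le)
    finally show ?thesis .
  qed (simp add: X_def)
  have "emeasure lebesgue T \<le> (\<Sum>n. emeasure lebesgue (X n))"
    unfolding TX using Xm by (intro emeasure_subadditive_countably) auto
  also have "\<dots> \<le> (\<Sum>n. ennreal (10 / l) * ?\<nu> (Y n))" using XY by (intro suminf_le) auto
  also have "\<dots> = ennreal (10 / l) * (\<Sum>n. ?\<nu> (Y n))" by (rule ennreal_suminf_cmult)
  also have "(\<Sum>n. ?\<nu> (Y n)) = (\<integral>\<^sup>+t. (\<Sum>n. ennreal (m t) * indicator (Y n) t) \<partial>lebesgue)"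
    using m Ym by (intro nn_integral_suminf[symmetric] borel_measurable_times_ennreal borel_measurable_indicator) auto
  also have "\<dots> = ?\<nu> (\<Union>n. Y n)"
    by (intro nn_integral_cong) (simp add: suminf_indicator[OF disj] ennreal_suminf_cmult)
  also have "\<dots> \<le> (\<integral>\<^sup>+t. ennreal (m t) \<partial>lebesgue)" by (intro nn_integral_mono) (auto split: split_indicator)
  also have "\<dots> \<le> ennreal A" by (rule tot)
  also have "ennreal (10 / l) * ennreal A = ennreal (10 * A / l)" using l A by (simp add: ennreal_mult[symmetric])
  finally have eT: "emeasure lebesgue T \<le> ennreal (10 * A / l)" by (simp add: mult_left_mono)
  have Tm: "T \<in> lmeasurable"
  proof (rule fmeasurableI)
    show "T \<in> sets lebesgue" unfolding TX using Xm by blast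
    show "emeasure lebesgue T < \<infinity>"
      using order_le_less_trans[OF eT ennreal_less_top] by (simp only: infinity_ennreal_def)
  qed
  moreover have "measure lebesgue T \<le> 10 * A / l"
    using eT A l by (simp add: emeasure_eq_measure2[OF Tm] ennreal_le_iff)
  moreover have "{x. \<exists>r>0. ennreal (l * r) < ?\<nu> (cball x r)} \<subseteq> T"
  proof
    fix x assume "x \<in> {x. \<exists>r>0. ennreal (l * r) < ?\<nu> (cball x r)}"
    then obtain r where "(x, r) \<in> K" "r > 0" by (auto simp: K_def)
    then have "x \<in> (\<Union>p\<in>K. cball (fst p) (snd p))" by (intro UN_I[of "(x, r)"]) auto
    then show "x \<in> T" unfolding T_def by (rule subsetD[OF C(4)])
  qed
  ultimately show ?thesis by blast
qed

text \<open>On the \<open>k\<close>-th dyadic annulus around \<open>x\<close>, at the scale \<open>y\<close>, the kernel is at most a constant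
  times \<open>1 / (y 4\<^sup>k)\<close>.\<close>

lemma poisson_kernel_dyadic:
  assumes y: "y > 0"
  shows "\<exists>k. \<bar>t - x\<bar> \<le> 2 ^ k * y \<and> poisson_kernel (Complex x y) t \<le> 4 / (pi * y * 4 ^ k)"
proof -
  define k where "k = (LEAST k. \<bar>t - x\<bar> \<le> 2 ^ k * y)"
  obtain n where "\<bar>t - x\<bar> / y < 2 ^ n" using real_arch_pow[of 2 "\<bar>t - x\<bar> / y"] by auto
  then have "\<bar>t - x\<bar> \<le> 2 ^ n * y" using y by (simp add: divide_less_eq less_imp_le)
  then have k: "\<bar>t - x\<bar> \<le> 2 ^ k * y" unfolding k_def by (rule LeastI)
  show ?thesis
  proof (intro exI conjI)
    show "\<bar>t - x\<bar> \<le> 2 ^ k * y" by (rule k)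
    show "poisson_kernel (Complex x y) t \<le> 4 / (pi * y * 4 ^ k)"
    proof (cases k)
      case 0
      have "pi * (y * y) \<le> pi * ((x - t)\<^sup>2 + y\<^sup>2)" by (intro mult_left_mono) (auto simp: power2_eq_square)
      then have "y / (pi * ((x - t)\<^sup>2 + y\<^sup>2)) \<le> y / (pi * (y * y))" using y by (intro divide_left_mono) (auto intro!: mult_pos_pos add_nonneg_pos)
      also have "\<dots> = 1 / (pi * y)" using y by simp
      also have "\<dots> \<le> 4 / (pi * y)" using y by (intro divide_right_mono) auto
      finally show ?thesis using 0 by (simp add: poisson_kernel_def)
    next
      case (Suc j)
      have "\<not> \<bar>t - x\<bar> \<le> 2 ^ j * y" unfolding k_def by (rule not_less_Least) (use Suc k_def in simp)
      then have "(2 ^ j * y)\<^sup>2 \<le> \<bar>t - x\<bar>\<^sup>2" using y by (intro power_mono) auto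
      then have "(2 ^ j)\<^sup>2 * (y * y) \<le> (x - t)\<^sup>2"
        by (simp add: power_mult_distrib power2_commute[of x]) (simp add: power2_eq_square)
      moreover have "(2 ^ j)\<^sup>2 = (4::real) ^ j" by (simp add: power2_eq_square flip: power_mult_distrib)
      ultimately have "4 ^ j * (y * y) \<le> (x - t)\<^sup>2" by simp
      then have "4 ^ j * (y * y) \<le> (x - t)\<^sup>2 + y\<^sup>2" using zero_le_power2[of y] by linarith
      then have "pi * (4 ^ j * (y * y)) \<le> pi * ((x - t)\<^sup>2 + y\<^sup>2)" by (intro mult_left_mono) auto
      then have "y / (pi * ((x - t)\<^sup>2 + y\<^sup>2)) \<le> y / (pi * (4 ^ j * (y * y)))" using y by (intro divide_left_mono) (auto intro!: mult_pos_pos add_nonneg_pos)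
      also have "\<dots> = 4 / (pi * y * 4 ^ k)" using y Suc by simp
      finally show ?thesis by (simp add: poisson_kernel_def)
    qed
  qed
qed

text \<open>Poisson integrals are dominated by the maximal function: summing over dyadic intervals, the
  interval of radius \<open>2\<^sup>k y\<close> contributes a multiple of \<open>l 2\<^sup>k / 4\<^sup>k\<close>.\<close>

lemma poisson_maximal_bound:
  assumes m: "m \<in> borel_measurable lebesgue" and l: "l > 0" and y: "y > 0"
    and small: "\<And>r. r > 0 \<Longrightarrow> (\<integral>\<^sup>+t. ennreal (m t) * indicator (cball x r) t \<partial>lebesgue) \<le> ennreal (l * r)"
  shows "(\<integral>\<^sup>+t. ennreal (poisson_kernel (Complex x y) t) * ennreal (m t) \<partial>lebesgue) \<le> ennreal (4 * l)"
proof -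
  let ?c = "\<lambda>k::nat. 4 / (pi * y * 4 ^ k)"
  let ?J = "\<lambda>k t. ennreal (?c k) * (ennreal (m t) * indicator (cball x (2 ^ k * y)) t)"
  have cn: "?c k \<ge> 0" for k using y by simp
  have "(\<integral>\<^sup>+t. ennreal (poisson_kernel (Complex x y) t) * ennreal (m t) \<partial>lebesgue) \<le> (\<integral>\<^sup>+t. (\<Sum>k. ?J k t) \<partial>lebesgue)"
  proof (rule nn_integral_mono)
    fix t
    obtain k where k: "\<bar>t - x\<bar> \<le> 2 ^ k * y" "poisson_kernel (Complex x y) t \<le> ?c k" using poisson_kernel_dyadic[OF y] by blast
    have "ennreal (poisson_kernel (Complex x y) t) * ennreal (m t) \<le> ?J k t"
      using k by (auto simp: dist_real_def abs_minus_commute intro!: mult_right_mono ennreal_leI)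
    also have "\<dots> \<le> (\<Sum>k. ?J k t)" using sum_le_suminf[of "\<lambda>k. ?J k t" "{k}"] by simp
    finally show "ennreal (poisson_kernel (Complex x y) t) * ennreal (m t) \<le> (\<Sum>k. ?J k t)" .
  qed
  also have "\<dots> = (\<Sum>k. \<integral>\<^sup>+t. ?J k t \<partial>lebesgue)"
    using m by (intro nn_integral_suminf borel_measurable_times_ennreal borel_measurable_indicator) auto
  also have "\<dots> \<le> (\<Sum>k. ennreal (2 * l * (1/2) ^ k))"
  proof (intro suminf_le allI)
    fix k
    have "(\<integral>\<^sup>+t. ?J k t \<partial>lebesgue) = ennreal (?c k) * (\<integral>\<^sup>+t. ennreal (m t) * indicator (cball x (2 ^ k * y)) t \<partial>lebesgue)"
      using m by (intro nn_integral_cmult borel_measurable_times_ennreal borel_measurable_indicator) auto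
    also have "\<dots> \<le> ennreal (?c k) * ennreal (l * (2 ^ k * y))" using y by (intro mult_left_mono small) auto
    also have "\<dots> = ennreal (4 * l / pi * (1/2) ^ k)"
    proof -
      have "(4::real) ^ k = 2 ^ k * 2 ^ k" by (simp flip: power_mult_distrib)
      then have "?c k * (l * (2 ^ k * y)) = 4 * l / pi * (1/2) ^ k" using y by (simp add: power_divide)
      then show ?thesis using cn[of k] l y by (simp add: ennreal_mult[symmetric])
    qed
    also have "\<dots> \<le> ennreal (2 * l * (1/2) ^ k)"
      using l pi_ge_two by (intro ennreal_leI mult_right_mono) (auto simp: divide_le_eq)
    finally show "(\<integral>\<^sup>+t. ?J k t \<partial>lebesgue) \<le> ennreal (2 * l * (1/2) ^ k)" .
  qed auto
  also have "\<dots> = ennreal (4 * l)"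
  proof -
    have "(\<lambda>k. 2 * l * (1/2) ^ k) sums (2 * l * (1 / (1 - 1/2)))" by (intro sums_mult geometric_sums) simp
    then have "(\<lambda>k. ennreal (2 * l * (1/2) ^ k)) sums ennreal (4 * l)" using l by (subst sums_ennreal) auto
    then show ?thesis by (simp add: sums_iff)
  qed
  finally show ?thesis .
qed

text \<open>Write \<open>f = g + d\<close> with \<open>g\<close> continuous and bounded and \<open>d\<close> small in norm. For \<open>g\<close> the limit
  exists everywhere; the Poisson integrals of \<open>d\<close> at all heights are small outside of a set
  of small measure, by the maximal estimate applied to \<open>\<bar>d\<bar>\<^sup>2\<close>.\<close>

theorem poisson_vertical_limit:
  assumes f: "f \<in> L2"
  shows "AE x in lebesgue. ((\<lambda>y. poisson_op y f x) \<longlongrightarrow> f x) (at_right 0)"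
proof -
  define bad where "bad = (\<lambda>e. {x. \<not> eventually (\<lambda>y. norm (poisson_op y f x - f x) < e) (at_right 0)})"
  have neg: "negligible (bad e)" if e: "e > 0" for e
    unfolding negligible_outer_le
  proof (intro allI impI)
    fix \<epsilon> :: real assume \<epsilon>: "\<epsilon> > 0"
    \<comment> \<open>The three parts of the error are then at most \<open>2 e / 5\<close> (Poisson integral of \<open>d\<close>),
      \<open>e / 5\<close> (the function \<open>g\<close>) and \<open>e / 5\<close> (the value of \<open>d\<close>).\<close>
    define l where "l = (e / 5)\<^sup>2"
    have l: "l > 0" using e by (simp add: l_def)
    \<comment> \<open>The exceptional set has measure at most \<open>10 \<eta>\<^sup>2 / l\<close> from the maximal function plus
      \<open>\<eta>\<^sup>2 / l\<close> from the set where \<open>\<bar>d\<bar>\<^sup>2 \<ge> l\<close>.\<close>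
    define \<eta> where "\<eta> = sqrt (\<epsilon> * l / 11)"
    have \<eta>: "\<eta> > 0" "11 * \<eta>\<^sup>2 / l = \<epsilon>" using \<epsilon> l by (simp_all add: \<eta>_def)
    have "cls f \<in> closure cont_L2" by (simp add: cont_L2_dense)
    then obtain x0 where "x0 \<in> cont_L2" "dist x0 (cls f) < \<eta>" using \<eta>(1) closure_approachable by metis
    then obtain g where g: "g \<in> L2" "continuous_on UNIV g" "bounded (range g)" and gd: "norm (cls f - cls g) < \<eta>"
      unfolding cont_L2_def by (auto simp: dist_norm norm_minus_commute)
    obtain B where B: "\<And>t. norm (g t) \<le> B" using g(3) unfolding bounded_iff by blast
    define d where "d = (\<lambda>t. f t - g t)"
    have d: "d \<in> L2" using L2_diff[OF f g(1)] by (simp add: d_def)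
    have dn: "(\<integral>\<^sup>+t. ennreal ((norm (d t))\<^sup>2) \<partial>lebesgue) \<le> ennreal (\<eta>\<^sup>2)"
    proof -
      have "(norm (cls f - cls g))\<^sup>2 \<le> \<eta>\<^sup>2" using gd by (intro power_mono) auto
      then show ?thesis using nn_integral_norm_sq_cls[OF d] cls_diff[OF f g(1)] by (simp add: d_def ennreal_leI)
    qed
    have dm: "d \<in> borel_measurable lebesgue" by (rule L2_measurable[OF d])
    obtain T where T: "T \<in> lmeasurable" "measure lebesgue T \<le> 10 * \<eta>\<^sup>2 / l"
      "{x. \<exists>r>0. ennreal (l * r) < (\<integral>\<^sup>+t. ennreal ((norm (d t))\<^sup>2) * indicator (cball x r) t \<partial>lebesgue)} \<subseteq> T"
      using weak_type_cover[of "\<lambda>t. (norm (d t))\<^sup>2" "\<eta>\<^sup>2" l] dm dn l by auto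
    define S where "S = {t \<in> space lebesgue. (norm (d t))\<^sup>2 \<ge> l}"
    have Sm: "S \<in> sets lebesgue" unfolding S_def using dm by measurable
    have eS: "emeasure lebesgue S \<le> ennreal (\<eta>\<^sup>2 / l)"
    proof -
      have "ennreal l * emeasure lebesgue S = (\<integral>\<^sup>+t. ennreal l * indicator S t \<partial>lebesgue)"
        by (rule nn_integral_cmult_indicator[OF Sm, symmetric])
      also have "\<dots> \<le> (\<integral>\<^sup>+t. ennreal ((norm (d t))\<^sup>2) \<partial>lebesgue)"
        by (intro nn_integral_mono) (auto simp: S_def ennreal_leI split: split_indicator)
      also have "\<dots> \<le> ennreal (\<eta>\<^sup>2)" by (rule dn)
      finally have "ennreal (1 / l) * (ennreal l * emeasure lebesgue S) \<le> ennreal (1 / l) * ennreal (\<eta>\<^sup>2)"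
        by (intro mult_left_mono) auto
      then show ?thesis using l by (simp add: mult.assoc[symmetric] ennreal_mult[symmetric])
    qed
    have Sl: "S \<in> lmeasurable"
      by (rule fmeasurableI[OF Sm]) (rule order_le_less_trans[OF eS], simp)
    have mS: "measure lebesgue S \<le> \<eta>\<^sup>2 / l"
      using eS l by (simp add: emeasure_eq_measure2[OF Sl] ennreal_le_iff)
    show "\<exists>T'. bad e \<subseteq> T' \<and> T' \<in> lmeasurable \<and> measure lebesgue T' \<le> \<epsilon>"
    proof (intro exI[of _ "T \<union> S"] conjI)
      show "T \<union> S \<in> lmeasurable" using T(1) Sl by (rule fmeasurable.Un)
      have "measure lebesgue (T \<union> S) \<le> measure lebesgue T + measure lebesgue S"
        using T(1) Sl by (intro measure_Un_le) auto
      also have "\<dots> \<le> 11 * \<eta>\<^sup>2 / l" using T(2) mS by (simp add: add_divide_distrib)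
      finally show "measure lebesgue (T \<union> S) \<le> \<epsilon>" using \<eta> by simp
      show "bad e \<subseteq> T \<union> S"
      proof (rule ccontr)
        assume "\<not> bad e \<subseteq> T \<union> S"
        then obtain x where x: "x \<in> bad e" "x \<notin> T" "x \<notin> S" by blast
        have small: "(\<integral>\<^sup>+t. ennreal ((norm (d t))\<^sup>2) * indicator (cball x r) t \<partial>lebesgue) \<le> ennreal (l * r)" if "r > 0" for r
        proof (rule ccontr)
          assume "\<not> ?thesis"
          then have "x \<in> T" using T(3) that by (auto simp: not_le)
          then show False using x(2) by blast
        qed
        have dx: "norm (d x) < e / 5"
        proof -
          have "(norm (d x))\<^sup>2 < (e / 5)\<^sup>2" using x(3) by (simp add: S_def l_def)
          then show ?thesis by (rule power2_less_imp_less) (use e in simp)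
        qed
        have "((\<lambda>y. poisson_op y g x) \<longlongrightarrow> g x) (at_right 0)" by (rule poisson_approximate_identity[OF g(2) B])
        then have "eventually (\<lambda>y. dist (poisson_op y g x) (g x) < e / 5) (at_right 0)" by (rule tendstoD) (use e in simp)
        then have "eventually (\<lambda>y. norm (poisson_op y f x - f x) < e) (at_right 0)"
          using eventually_at_right_less[of 0]
        proof eventually_elim
          case (elim y)
          have y: "y > 0" by (rule elim(2))
          have z: "Im (Complex x y) > 0" using y by simp
          have "ennreal (LINT t|lebesgue. poisson_kernel (Complex x y) t * (norm (d t))\<^sup>2) \<le> ennreal (4 * l)"
          proof -
            have "integrable lebesgue (\<lambda>t. poisson_kernel (Complex x y) t * (norm (d t))\<^sup>2)"
              using poisson_int_integrable[of "\<lambda>t. (norm (d t))\<^sup>2" "Complex x y"] L2_weighted_integrable[OF d] y by simp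
            then have "ennreal (LINT t|lebesgue. poisson_kernel (Complex x y) t * (norm (d t))\<^sup>2)
                = (\<integral>\<^sup>+t. ennreal (poisson_kernel (Complex x y) t * (norm (d t))\<^sup>2) \<partial>lebesgue)"
              using poisson_kernel_nonneg[OF z] by (intro nn_integral_eq_integral[symmetric]) auto
            also have "\<dots> = (\<integral>\<^sup>+t. ennreal (poisson_kernel (Complex x y) t) * ennreal ((norm (d t))\<^sup>2) \<partial>lebesgue)"
              using poisson_kernel_nonneg[OF z] by (simp add: ennreal_mult)
            also have "\<dots> \<le> ennreal (4 * l)"
              using dm by (intro poisson_maximal_bound[OF _ l y small]) auto
            finally show ?thesis .
          qed
          then have "(LINT t|lebesgue. poisson_kernel (Complex x y) t * (norm (d t))\<^sup>2) \<le> 4 * l" using l by (simp add: ennreal_le_iff)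
          then have "(norm (poisson_op y d x))\<^sup>2 \<le> 4 * l"
            unfolding poisson_op_def using poisson_int_sq_le[OF dm L2_weighted_integrable[OF d] z] by linarith
          also have "4 * l = (2 * e / 5)\<^sup>2" by (simp add: l_def power_mult_distrib power_divide)
          finally have Pd: "norm (poisson_op y d x) \<le> 2 * e / 5" by (rule power2_le_imp_le) (use e in simp)
          have pint: "integrable lebesgue (\<lambda>t. of_real (poisson_kernel (Complex x y) t) * u t)" if "u \<in> L2" for u :: "real \<Rightarrow> complex"
          proof -
            have "of_real (poisson_kernel (Complex x y) t) * u t = (u t / (of_real t - Complex x y) - u t / (of_real t - cnj (Complex x y))) / (2 * of_real pi * \<i>)" for t
              using poisson_kernel_cauchy[of "Complex x y" t] y by (simp add: diff_divide_distrib left_diff_distrib)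
            then show ?thesis
              using Cauchy_class_cauchy_integrable[OF L2_Cauchy_class[OF that], of "Complex x y"]
                Cauchy_class_cauchy_integrable[OF L2_Cauchy_class[OF that], of "cnj (Complex x y)"] y by simp
          qed
          have "poisson_op y d x = poisson_op y f x - poisson_op y g x"
            unfolding poisson_op_def poisson_int_def d_def right_diff_distrib
            by (rule Bochner_Integration.integral_diff) (intro pint f g)+
          then have "poisson_op y f x - f x = poisson_op y d x + (poisson_op y g x - g x) + - d x" by (simp add: d_def)
          then have "norm (poisson_op y f x - f x) \<le> norm (poisson_op y d x) + norm (poisson_op y g x - g x) + norm (d x)"
            using norm_triangle_ineq[of "poisson_op y d x + (poisson_op y g x - g x)" "- d x"]
              norm_triangle_ineq[of "poisson_op y d x" "poisson_op y g x - g x"] by simp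
          also have "\<dots> < e" using Pd dx elim(1) e by (simp add: dist_norm)
          finally show ?case .
        qed
        then show False using x(1) by (simp add: bad_def)
      qed
    qed
  qed
  have "negligible (\<Union>n::nat. bad (1 / real (Suc n)))"
    by (intro negligible_countable_Union) (auto intro!: neg)
  then have "AE x in lebesgue. x \<notin> (\<Union>n::nat. bad (1 / real (Suc n)))"
    unfolding negligible_iff_null_sets by (rule AE_not_in)
  then show ?thesis
  proof eventually_elim
    case (elim x)
    show ?case
    proof (rule tendstoI)
      fix e :: real assume "e > 0"
      then obtain n where n: "1 / real (Suc n) < e" using nat_approx_posE by blast
      have "eventually (\<lambda>y. norm (poisson_op y f x - f x) < 1 / real (Suc n)) (at_right 0)"
        using elim by (auto simp: bad_def)
      then show "eventually (\<lambda>y. dist (poisson_op y f x) (f x) < e) (at_right 0)"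
        by eventually_elim (use n in \<open>simp add: dist_norm\<close>)
    qed
  qed
qed

section \<open>The Hardy space\<close>

lemma half_plane_convex: "convex {z. a < Im z}" and half_plane_open: "open {z. a < Im z}"
  by (simp_all add: convex_halfspace_Im_gt open_halfspace_Im_gt)

text \<open>Close the segment \<open>[- R, R]\<close> by a half circle, on which the integral is at most \<open>\<pi> K / R\<close>.\<close>

lemma integral_real_line_zero:
  assumes hol: "g holomorphic_on {z. a < Im z}" and a: "a < 0"
    and bd: "\<And>w. 0 \<le> Im w \<Longrightarrow> r \<le> norm w \<Longrightarrow> norm (g w) \<le> K / (norm w)\<^sup>2" and r: "1 \<le> r"
  shows "integrable lebesgue (\<lambda>t. g (of_real t))" "(LINT t|lebesgue. g (of_real t)) = 0"
proof -
  have K: "K \<ge> 0"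
  proof -
    have "0 \<le> norm (g (of_real r))" by simp
    also have "\<dots> \<le> K / (norm (complex_of_real r))\<^sup>2" using r by (intro bd) auto
    finally show ?thesis using r by (simp add: zero_le_divide_iff)
  qed
  have cont: "continuous_on UNIV (\<lambda>t. g (complex_of_real t))"
    by (rule continuous_on_compose2[OF holomorphic_on_imp_continuous_on[OF hol]]) (use a in \<open>auto intro!: continuous_intros\<close>)
  have "bounded ((\<lambda>t. g (complex_of_real t)) ` {-r..r})"
    by (intro compact_imp_bounded compact_continuous_image continuous_on_subset[OF cont]) auto
  then obtain M where M: "\<And>t. t \<in> {-r..r} \<Longrightarrow> norm (g (complex_of_real t)) \<le> M" unfolding bounded_iff by blast
  have M0: "M \<ge> 0" by (rule order_trans[OF norm_ge_zero M[of 0]]) (use r in simp)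
  have le: "norm (g (complex_of_real t)) \<le> (M * (1 + r\<^sup>2) + 2 * K) * (1 / (1 + t\<^sup>2))" for t
  proof (cases "\<bar>t\<bar> \<le> r")
    case True
    have "t\<^sup>2 \<le> r\<^sup>2" using True by (intro abs_le_square_iff[THEN iffD1]) simp
    then have "norm (g (complex_of_real t)) * (1 + t\<^sup>2) \<le> M * (1 + r\<^sup>2)"
      using M[of t] M0 True by (intro mult_mono) (auto simp: abs_le_iff)
    also have "\<dots> \<le> M * (1 + r\<^sup>2) + 2 * K" using K by simp
    finally show ?thesis by (simp add: le_divide_eq add_pos_nonneg)
  next
    case False
    then have t: "\<bar>t\<bar> \<ge> 1" using r by simp
    have t2: "t\<^sup>2 \<ge> 1" using t by (metis abs_le_square_iff abs_one one_power2)
    have "norm (g (complex_of_real t)) \<le> K / t\<^sup>2" using bd[of "of_real t"] False by simp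
    then have "norm (g (complex_of_real t)) * (1 + t\<^sup>2) \<le> K / t\<^sup>2 * (2 * t\<^sup>2)"
      using t2 K by (intro mult_mono) auto
    also have "\<dots> = 2 * K" using t2 by auto
    also have "\<dots> \<le> M * (1 + r\<^sup>2) + 2 * K" using M0 by simp
    finally show ?thesis by (simp add: le_divide_eq add_pos_nonneg)
  qed
  show int: "integrable lebesgue (\<lambda>t. g (of_real t))"
  proof (rule Bochner_Integration.integrable_bound)
    show "integrable lebesgue (\<lambda>t. (M * (1 + r\<^sup>2) + 2 * K) * (1 / (1 + t\<^sup>2)))"
      by (intro integrable_mult_right integrable_inverse_1_plus_square)
    show "AE t in lebesgue. norm (g (of_real t)) \<le> norm ((M * (1 + r\<^sup>2) + 2 * K) * (1 / (1 + t\<^sup>2)))"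
      by (rule AE_I2) (unfold real_norm_def, rule order_trans[OF le abs_ge_self])
  qed (rule continuous_measurable_lebesgue[OF cont])
  have seg: "norm (LINT t:{-R..R}|lebesgue. g (of_real t)) \<le> K * pi / R" if R: "R \<ge> r" for R
  proof -
    have Rp: "R > 0" using R r by simp
    let ?l = "linepath (of_real (-R)) (complex_of_real R)" and ?c = "part_circlepath 0 R 0 pi"
    have arc: "Im w \<ge> 0 \<and> norm w = R" if w: "w \<in> path_image ?c" for w
    proof -
      obtain t where t: "0 \<le> t" "t \<le> pi" "w = R * cis t"
        using w Rp by (auto simp: path_image_part_circlepath cis_conv_exp)
      then show ?thesis using Rp sin_ge_zero[of t] by (simp add: norm_mult)
    qed
    have arcS: "path_image ?c \<subseteq> {z. a < Im z}" using arc a by fastforce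
    have segS: "path_image ?l \<subseteq> {z. a < Im z}"
      unfolding path_image_linepath by (rule closed_segment_subset) (use a half_plane_convex in auto)
    have gc: "continuous_on (path_image ?c) g" "continuous_on (path_image ?l) g"
      using holomorphic_on_imp_continuous_on[OF hol] arcS segS continuous_on_subset by blast+
    have i1: "g contour_integrable_on ?c" by (rule contour_integrable_continuous_part_circlepath[OF gc(1)])
    have i2: "g contour_integrable_on ?l" using gc(2) by (simp add: contour_integrable_continuous_linepath)
    have "(g has_contour_integral 0) (?l +++ ?c)"
    proof (rule Cauchy_theorem_convex_simple[OF hol half_plane_convex])
      show "path_image (?l +++ ?c) \<subseteq> {z. a < Im z}"
        using path_image_join_subset[of ?l ?c] arcS segS by blast
    qed (auto simp: valid_path_join)
    moreover have "contour_integral (?l +++ ?c) g = contour_integral ?l g + contour_integral ?c g"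
      by (rule contour_integral_join[OF i2 i1]) auto
    ultimately have h1: "contour_integral ?l g = - contour_integral ?c g"
      by (simp add: contour_integral_unique add_eq_0_iff)
    have h2: "norm (contour_integral ?c g) \<le> K / R\<^sup>2 * R * (pi - 0)"
      using has_contour_integral_bound_part_circlepath[OF has_contour_integral_integral[OF i1], of "K / R\<^sup>2"] arc bd K Rp R by auto
    have h3: "contour_integral ?l g = integral {-R..R} (\<lambda>x. g (of_real x))"
      using contour_integral_linepath_Reals_eq[of "of_real (-R)" "of_real R" g] Rp by simp
    have "set_integrable lebesgue {-R..R} (\<lambda>t. g (of_real t))"
      using int by (auto simp: set_integrable_def intro: integrable_mult_indicator)
    then have "(LINT t:{-R..R}|lebesgue. g (of_real t)) = integral {-R..R} (\<lambda>x. g (of_real x))"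
      by (rule set_lebesgue_integral_eq_integral(2))
    also have "\<dots> = - contour_integral ?c g" by (simp only: h1 h3[symmetric])
    finally show ?thesis using Rp h2 by (simp add: power2_eq_square)
  qed
  have "(\<lambda>n. LINT t:{- real n..real n}|lebesgue. g (of_real t)) \<longlonglongrightarrow> (LINT t|lebesgue. g (of_real t))"
    unfolding set_lebesgue_integral_def
  proof (rule integral_dominated_convergence[where w = "\<lambda>t. norm (g (of_real t))"])
    show "AE t in lebesgue. (\<lambda>n. indicat_real {- real n..real n} t *\<^sub>R g (of_real t)) \<longlonglongrightarrow> g (of_real t)"
    proof (rule AE_I2, rule tendsto_eventually, rule eventually_sequentiallyI)
      fix t :: real and n assume "n \<ge> nat \<lceil>\<bar>t\<bar>\<rceil>"
      then have "\<bar>t\<bar> \<le> real n" by linarith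
      then show "indicat_real {- real n..real n} t *\<^sub>R g (of_real t) = g (of_real t)" by (auto simp: abs_le_iff)
    qed
    show "(\<lambda>t. indicat_real {- real n..real n} t *\<^sub>R g (of_real t)) \<in> borel_measurable lebesgue" for n
      using continuous_measurable_lebesgue[OF cont] by (intro borel_measurable_scaleR borel_measurable_indicator) auto
  qed (use int in \<open>auto simp: indicator_def\<close>)
  moreover have "(\<lambda>n. LINT t:{- real n..real n}|lebesgue. g (of_real t)) \<longlonglongrightarrow> 0"
  proof (rule Lim_null_comparison)
    show "eventually (\<lambda>n. norm (LINT t:{- real n..real n}|lebesgue. g (of_real t)) \<le> K * pi / real n) sequentially"
      by (rule eventually_sequentiallyI[of "nat \<lceil>r\<rceil>"]) (rule seg, linarith)
    show "(\<lambda>n. K * pi / real n) \<longlonglongrightarrow> 0" by (rule lim_const_over_n)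
  qed
  ultimately show "(LINT t|lebesgue. g (of_real t)) = 0" using LIMSEQ_unique by blast
qed

text \<open>The function \<open>(G w - G z) / ((w - z) (w - cnj z))\<close> is holomorphic in the half-plane and
  decays quadratically, so its integral over the line is zero; on the line the denominator
  is a multiple of the reciprocal of the Poisson kernel.\<close>

lemma poisson_formula_bounded:
  assumes hol: "G holomorphic_on {z. a < Im z}" and a: "a < 0"
    and bd: "\<And>w. 0 \<le> Im w \<Longrightarrow> norm (G w) \<le> B" and z: "Im z > 0"
  shows "poisson_int (\<lambda>t. G (of_real t)) z = G z"
proof -
  \<comment> \<open>This choice keeps the pole \<open>cnj z\<close> outside of the half-plane \<open>Im w > b\<close>, which still
    contains the real line.\<close>
  define b where "b = max a (- Im z)"
  have b: "b < 0" using a z by (simp add: b_def)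
  define q where "q = (\<lambda>w. if w = z then deriv G z else (G w - G z) / (w - z))"
  have B: "B \<ge> 0" by (rule order_trans[OF norm_ge_zero bd[of 0]]) simp
  have qhol: "q holomorphic_on {w. b < Im w}"
    unfolding q_def by (rule pole_lemma_open[OF holomorphic_on_subset[OF hol] half_plane_open]) (auto simp: b_def)
  have qchol: "(\<lambda>w. q w / (w - cnj z)) holomorphic_on {w. b < Im w}"
    by (intro holomorphic_intros qhol) (auto simp: b_def)
  have bound: "norm (q w / (w - cnj z)) \<le> (8 * B) / (norm w)\<^sup>2" if "0 \<le> Im w" "2 * norm z + 1 \<le> norm w" for w
  proof -
    have 1: "norm w / 2 \<le> norm (w - z)" using norm_triangle_ineq2[of w z] that by linarith
    have 2: "norm w / 2 \<le> norm (w - cnj z)" using norm_triangle_ineq2[of w "cnj z"] that by simp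
    have "norm z < norm w" "norm w > 0" using that norm_ge_zero[of z] by linarith+
    then have wz: "w \<noteq> z" "norm w > 0" by auto
    have 3: "norm (G w - G z) \<le> 2 * B" using norm_triangle_ineq4[of "G w" "G z"] bd[of w] bd[of z] that z by simp
    have "norm (q w / (w - cnj z)) = norm (G w - G z) / (norm (w - z) * norm (w - cnj z))"
      using wz by (simp add: q_def norm_divide norm_mult)
    also have "\<dots> \<le> (2 * B) / ((norm w / 2) * (norm w / 2))"
      using 1 2 3 wz B by (intro frac_le mult_mono mult_pos_pos) auto
    also have "\<dots> = (8 * B) / (norm w)\<^sup>2" by (simp add: power2_eq_square)
    finally show ?thesis .
  qed
  have R0: "1 \<le> 2 * norm z + 1" by simp
  have int: "integrable lebesgue (\<lambda>t. q (of_real t) / (of_real t - cnj z))"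
    and 0: "(LINT t|lebesgue. q (of_real t) / (of_real t - cnj z)) = 0"
    using integral_real_line_zero[OF qchol b bound R0] by auto
  have eq: "of_real (Im z / pi) * (q (of_real t) / (of_real t - cnj z)) = of_real (poisson_kernel z t) * G (of_real t) - of_real (poisson_kernel z t) * G z" for t
  proof -
    have tz: "of_real t - z \<noteq> 0" using z by (intro real_minus_neq_0) simp
    have "(of_real t - z) * (of_real t - cnj z) = of_real ((norm (of_real t - z))\<^sup>2)"
      by (subst complex_norm_square) simp
    then have "q (of_real t) / (of_real t - cnj z) = (G (of_real t) - G z) / of_real ((norm (of_real t - z))\<^sup>2)"
      using tz by (auto simp: q_def)
    then show ?thesis by (simp add: poisson_kernel_norm right_diff_distrib diff_divide_distrib)
  qed
  have ik: "integrable lebesgue (\<lambda>t. complex_of_real (poisson_kernel z t) * G z)"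
    "(LINT t|lebesgue. complex_of_real (poisson_kernel z t) * G z) = G z"
    using poisson_kernel_has_integral[OF z] by (auto simp: has_bochner_integral_iff)
  have d: "integrable lebesgue (\<lambda>t. of_real (poisson_kernel z t) * G (of_real t) - of_real (poisson_kernel z t) * G z)"
    unfolding eq[symmetric] by (intro integrable_mult_right int)
  have "poisson_int (\<lambda>t. G (of_real t)) z = (LINT t|lebesgue. (of_real (poisson_kernel z t) * G (of_real t) - of_real (poisson_kernel z t) * G z) + of_real (poisson_kernel z t) * G z)"
    by (simp add: poisson_int_def)
  also have "\<dots> = (LINT t|lebesgue. of_real (poisson_kernel z t) * G (of_real t) - of_real (poisson_kernel z t) * G z) + G z"
    by (subst Bochner_Integration.integral_add[OF d ik(1)]) (simp only: ik(2))
  also have "\<dots> = G z" unfolding eq[symmetric] by (simp only: integral_mult_right_zero 0) simp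
  finally show ?thesis .
qed

text \<open>The definition of \<open>H2\<close> without the boundary values, whose existence is a consequence
  (\<open>hardy_function_limit\<close> together with \<open>has_boundary_values_poisson\<close>).\<close>

definition hardy_function :: "(complex \<Rightarrow> complex) \<Rightarrow> bool" where
  "hardy_function F \<longleftrightarrow> F holomorphic_on upper_half_plane \<and>
     (\<exists>C. \<forall>y>0. integrable lebesgue (\<lambda>x. (norm (F (Complex x y)))\<^sup>2) \<and>
                (LINT x|lebesgue. (norm (F (Complex x y)))\<^sup>2) \<le> C)"

abbreviation on_line :: "(complex \<Rightarrow> complex) \<Rightarrow> real \<Rightarrow> real \<Rightarrow> complex" where
  "on_line F y \<equiv> (\<lambda>x. F (Complex x y))"

lemma hardy_line_continuous:
  assumes "F holomorphic_on upper_half_plane" "y > 0" shows "continuous_on UNIV (on_line F y)"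
  by (rule continuous_on_compose2[OF holomorphic_on_imp_continuous_on[OF assms(1)] continuous_vertical_line])
     (auto simp: upper_half_plane_def assms(2))

lemma hardy_line_L2:
  assumes "hardy_function F" "y > 0" shows "on_line F y \<in> L2"
  using assms hardy_line_continuous[of F y] continuous_measurable_lebesgue[of "on_line F y"]
  by (auto simp: hardy_function_def L2_def)

lemma segment_integral_bound:
  assumes F: "hardy_function F" and C: "\<And>y. y > 0 \<Longrightarrow> (LINT x|lebesgue. (norm (F (Complex x y)))\<^sup>2) \<le> C"
    and prim: "\<And>z. Im z > 0 \<Longrightarrow> (\<Phi> has_field_derivative F z) (at z)"
    and y: "y > 0" and s: "0 \<le> s" "s \<le> 1"
  shows "norm (\<Phi> (Complex (x + s) y) - \<Phi> (Complex x y)) \<le> 1 + C"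
proof -
  have vd: "((\<lambda>u. \<Phi> (Complex u y)) has_vector_derivative F (Complex u y)) (at u within {x..x + s})" for u
  proof -
    have "((\<lambda>u. Complex u y) has_vector_derivative 1) (at u within {x..x + s})"
      unfolding Complex_eq by (auto intro!: derivative_eq_intros)
    moreover have "(\<Phi> has_field_derivative F (Complex u y)) (at (Complex u y))" using y by (intro prim) simp
    ultimately show ?thesis
      using field_vector_diff_chain_within[of "\<lambda>u. Complex u y" 1 u "{x..x + s}" \<Phi> "F (Complex u y)"]
      by (simp add: o_def has_field_derivative_at_within)
  qed
  have c: "continuous_on UNIV (on_line F y)" using F y by (intro hardy_line_continuous) (auto simp: hardy_function_def)
  have hb: "has_bochner_integral lborel (\<lambda>u. indicator {x..x + s} u *\<^sub>R F (Complex u y)) (\<Phi> (Complex (x + s) y) - \<Phi> (Complex x y))"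
    using s vd by (intro has_bochner_integral_FTC_Icc continuous_on_subset[OF c]) auto
  let ?f = "\<lambda>u. indicator {x..x + s} u *\<^sub>R F (Complex u y)"
  have fm: "?f \<in> borel_measurable lborel" using hb by (auto simp: has_bochner_integral_iff)
  have int: "integrable lebesgue ?f" and val: "(LINT u|lebesgue. ?f u) = \<Phi> (Complex (x + s) y) - \<Phi> (Complex x y)"
    using hb fm by (auto simp: has_bochner_integral_iff integrable_completion integral_completion)
  have ii: "integrable lebesgue (indicat_real {x..x + s})" "(LINT u|lebesgue. indicat_real {x..x + s} u) = s"
    using s by (auto intro!: integrable_real_indicator)
  have i2: "integrable lebesgue (\<lambda>u. (norm (F (Complex u y)))\<^sup>2)" using F y by (auto simp: hardy_function_def)
  have "norm (\<Phi> (Complex (x + s) y) - \<Phi> (Complex x y)) \<le> (LINT u|lebesgue. norm (?f u))"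
    unfolding val[symmetric] by (rule integral_norm_bound)
  also have "\<dots> \<le> (LINT u|lebesgue. indicat_real {x..x + s} u + (norm (F (Complex u y)))\<^sup>2)"
  proof (rule integral_mono)
    fix u
    have "a \<le> 1 + a\<^sup>2" for a :: real using zero_le_power2[of "a - 1/2"] by (simp add: power2_diff power_divide)
    from this[of "norm (F (Complex u y))"]
    show "norm (?f u) \<le> indicat_real {x..x + s} u + (norm (F (Complex u y)))\<^sup>2" by (auto simp: indicator_def)
    show "integrable lebesgue (\<lambda>u. norm (?f u))" by (rule integrable_norm[OF int])
    show "integrable lebesgue (\<lambda>u. indicat_real {x..x + s} u + (norm (F (Complex u y)))\<^sup>2)"
      by (intro Bochner_Integration.integrable_add ii i2)
  qed
  also have "\<dots> = s + (LINT u|lebesgue. (norm (F (Complex u y)))\<^sup>2)" using ii i2 by simp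
  also have "\<dots> \<le> 1 + C" using C[OF y] s by simp
  finally show ?thesis .
qed

text \<open>A primitive has bounded increments over horizontal segments of length at most 1, because
  \<open>\<bar>a\<bar> \<le> 1 + \<bar>a\<bar>\<^sup>2\<close>. By Cauchy's estimate the increments of \<open>F\<close> itself are bounded away from
  the boundary. So \<open>F z\<close> differs by a bounded amount from its mean over the segment from \<open>z\<close>
  to \<open>z + 1\<close>, which is an increment of the primitive.\<close>

lemma hardy_bounded:
  assumes F: "hardy_function F" and d: "d > 0"
  shows "\<exists>B. \<forall>z. d \<le> Im z \<longrightarrow> norm (F z) \<le> B"
proof -
  obtain C where C: "\<And>y. y > 0 \<Longrightarrow> (LINT x|lebesgue. (norm (F (Complex x y)))\<^sup>2) \<le> C"
    using F by (auto simp: hardy_function_def)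
  have hol: "F holomorphic_on upper_half_plane" using F by (simp add: hardy_function_def)
  have "convex upper_half_plane" by (simp add: upper_half_plane_def half_plane_convex)
  then obtain \<Phi> where \<Phi>: "\<And>z. z \<in> upper_half_plane \<Longrightarrow> (\<Phi> has_field_derivative F z) (at z within upper_half_plane)"
    using holomorphic_convex_primitive'[OF _ open_upper hol] by blast
  then have prim: "(\<Phi> has_field_derivative F z) (at z)" if "Im z > 0" for z
  proof -
    have "z \<in> upper_half_plane" using that by (simp add: upper_half_plane_def)
    then show ?thesis using \<Phi>[of z] at_within_open[OF _ open_upper, of z] by simp
  qed
  define M where "M = 1 + C"
  have inc: "norm (\<Phi> (z + of_real s) - \<Phi> z) \<le> M" if "Im z > 0" "0 \<le> s" "s \<le> 1" for z s
  proof -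
    have "z + of_real s = Complex (Re z + s) (Im z)" "z = Complex (Re z) (Im z)" by (simp_all add: complex_eq_iff)
    then show ?thesis using segment_integral_bound[OF F C prim that, of "Re z"] by (simp add: M_def)
  qed
  have M: "M \<ge> 0" using inc[of \<i> 0] by simp
  \<comment> \<open>Cauchy's estimate on the disc of radius \<open>d / 2\<close>.\<close>
  have Fi: "norm (F (z + of_real s) - F z) \<le> M / (d / 2)" if z: "d \<le> Im z" and s: "0 \<le> s" "s \<le> 1" for z s
  proof -
    let ?D = "\<lambda>w. \<Phi> (w + of_real s) - \<Phi> w"
    have Dd: "(?D has_field_derivative F (w + of_real s) - F w) (at w)" if "Im w > 0" for w
    proof -
      have "((\<lambda>w. \<Phi> (w + of_real s)) has_field_derivative F (w + of_real s)) (at w)"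
        using prim[of "w + of_real s"] that DERIV_shift[of \<Phi> "F (w + of_real s)" w "of_real s"] by simp
      then show ?thesis using prim[OF that] by (rule DERIV_diff)
    qed
    have im: "Im w > 0" if "norm (z - w) \<le> d / 2" for w
      using abs_Im_le_cmod[of "z - w"] that z d by simp
    have hD: "?D holomorphic_on cball z (d / 2)"
      unfolding holomorphic_on_def field_differentiable_def
    proof (intro ballI exI)
      fix w assume "w \<in> cball z (d / 2)"
      then have "norm (z - w) \<le> d / 2" by (simp add: dist_norm)
      then show "(?D has_field_derivative F (w + of_real s) - F w) (at w within cball z (d / 2))"
        by (rule has_field_derivative_at_within[OF Dd[OF im]])
    qed
    have "norm ((deriv ^^ 1) ?D z) \<le> fact 1 * M / (d / 2) ^ 1"
    proof (rule Cauchy_inequality)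
      show "?D holomorphic_on ball z (d / 2)" by (rule holomorphic_on_subset[OF hD ball_subset_cball])
      show "continuous_on (cball z (d / 2)) ?D" by (rule holomorphic_on_imp_continuous_on[OF hD])
      show "norm (?D w) \<le> M" if "norm (z - w) = d / 2" for w
        using that by (intro inc im s) simp
    qed (use d in simp)
    moreover have "deriv ?D z = F (z + of_real s) - F z" using Dd z d by (intro DERIV_imp_deriv) auto
    ultimately show ?thesis by simp
  qed
  have "norm (F z) \<le> M + M / (d / 2)" if z: "d \<le> Im z" for z
  proof -
    define \<Psi> where "\<Psi> = (\<lambda>s::real. \<Phi> (z + of_real s) - of_real s * F z)"
    have "norm (\<Psi> 1 - \<Psi> 0) \<le> M / (d / 2) * norm (1 - 0 :: real)"
    proof (rule differentiable_bound[of "{0..1}"])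
      fix s :: real assume s: "s \<in> {0..1}"
      have "((\<lambda>s::real. z + of_real s) has_vector_derivative 1) (at s within {0..1})"
        by (auto intro!: derivative_eq_intros)
      moreover have "(\<Phi> has_field_derivative F (z + of_real s)) (at (z + of_real s))" using z d by (intro prim) simp
      ultimately have "((\<lambda>s. \<Phi> (z + of_real s)) has_vector_derivative F (z + of_real s)) (at s within {0..1})"
        using field_vector_diff_chain_within[of "\<lambda>s. z + of_real s" 1 s "{0..1}" \<Phi> "F (z + of_real s)"]
        by (simp add: o_def has_field_derivative_at_within)
      then have "(\<Psi> has_vector_derivative F (z + of_real s) - F z) (at s within {0..1})"
        unfolding \<Psi>_def by (auto intro!: derivative_eq_intros)
      then show "(\<Psi> has_derivative (\<lambda>h. h *\<^sub>R (F (z + of_real s) - F z))) (at s within {0..1})"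
        by (simp add: has_vector_derivative_def)
      show "onorm (\<lambda>h. h *\<^sub>R (F (z + of_real s) - F z)) \<le> M / (d / 2)"
      proof (rule onorm_le)
        fix h :: real
        show "norm (h *\<^sub>R (F (z + of_real s) - F z)) \<le> M / (d / 2) * norm h"
          using mult_right_mono[OF Fi[OF z, of s] abs_ge_zero[of h]] s by (simp add: mult.commute)
      qed
    qed auto
    then have "norm ((\<Phi> (z + 1) - \<Phi> z) - F z) \<le> M / (d / 2)" by (simp add: \<Psi>_def algebra_simps)
    moreover have "norm (\<Phi> (z + 1) - \<Phi> z) \<le> M" using inc[of z 1] z d by simp
    ultimately show ?thesis
      using norm_triangle_ineq3[of "\<Phi> (z + 1) - \<Phi> z" "F z"] norm_triangle_ineq2[of "F z" "\<Phi> (z + 1) - \<Phi> z"]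
      by (simp add: norm_minus_commute)
  qed
  then show ?thesis by blast
qed

lemma shift_holomorphic:
  assumes "F holomorphic_on upper_half_plane"
  shows "(\<lambda>w. F (w + \<i> * of_real y)) holomorphic_on {z. - y < Im z}"
proof -
  have "(F \<circ> (\<lambda>w. w + \<i> * of_real y)) holomorphic_on {z. - y < Im z}"
    by (rule holomorphic_on_compose_gen[OF _ assms]) (auto intro!: holomorphic_intros simp: upper_half_plane_def)
  then show ?thesis by (simp add: o_def)
qed

lemma on_line_shift: "on_line F y t = F (of_real t + \<i> * of_real y)" by (simp add: Complex_eq)

text \<open>Above height \<open>y\<close> the function is bounded, so the Poisson formula applies to its translate.\<close>

lemma hardy_poisson:
  assumes F: "hardy_function F" and y: "y > 0" and s: "s > 0"
  shows "poisson_op s (on_line F y) = on_line F (y + s)"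
proof
  fix x
  have hol: "F holomorphic_on upper_half_plane" using F by (simp add: hardy_function_def)
  obtain B where B: "\<And>z. y \<le> Im z \<Longrightarrow> norm (F z) \<le> B" using hardy_bounded[OF F y] by blast
  have "poisson_int (\<lambda>t. F (of_real t + \<i> * of_real y)) (Complex x s) = F (Complex x s + \<i> * of_real y)"
    by (rule poisson_formula_bounded[OF shift_holomorphic[OF hol, of y], where B = B]) (use y s B in auto)
  moreover have "Complex x s + \<i> * of_real y = Complex x (y + s)" by (simp add: complex_eq_iff)
  ultimately show "poisson_op s (on_line F y) x = on_line F (y + s) x" by (simp add: poisson_op_def on_line_shift)
qed

text \<open>The integrand is holomorphic, but its bound for large \<open>w\<close> is only a multiple of \<open>1 / \<bar>w\<bar>\<close>;
  the factor \<open>1 / (1 - \<i> \<epsilon> w)\<close> provides quadratic decay and is removed afterwards by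
  dominated convergence.\<close>

lemma hardy_moment:
  assumes F: "hardy_function F" and y: "y > 0"
  shows "moment (on_line F y) n = 0"
proof -
  have hol: "F holomorphic_on upper_half_plane" using F by (simp add: hardy_function_def)
  obtain B where B: "\<And>z. y \<le> Im z \<Longrightarrow> norm (F z) \<le> B" using hardy_bounded[OF F y] by blast
  have B0: "B \<ge> 0" by (rule order_trans[OF norm_ge_zero B[of "Complex 0 y"]]) simp
  \<comment> \<open>The translate of \<open>F\<close> is holomorphic above \<open>- y\<close>, and \<open>1 / (\<i> + w)\<close> has its pole at
    \<open>- \<i>\<close>.\<close>
  define a where "a = - min y 1"
  have a: "a < 0" "- 1 \<le> a" "- y \<le> a" using y by (auto simp: a_def)
  have L: "on_line F y \<in> L2" by (rule hardy_line_L2[OF F y])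
  define g where "g = (\<lambda>e w. F (w + \<i> * of_real y) * (((\<i> - w) / (\<i> + w)) ^ n / (\<i> + w)) / (1 - \<i> * of_real e * w))"
  have z0: "(LINT t|lebesgue. g e (of_real t)) = 0" if e: "0 < e" "e \<le> 1" for e
  proof (rule integral_real_line_zero(2)[where a = a and r = 1 and K = "B / e"])
    have ne: "\<i> + w \<noteq> 0" if "a < Im w" for w using that a by (auto simp: complex_eq_iff)
    have ne2: "1 - \<i> * of_real e * w \<noteq> 0" if "a < Im w" for w
    proof
      assume "1 - \<i> * of_real e * w = 0"
      then have "1 + e * Im w = 0" by (simp add: complex_eq_iff)
      moreover have "e * Im w > e * (-1)" using that a e by (intro mult_strict_left_mono) auto
      ultimately show False using e by simp
    qed
    show "g e holomorphic_on {z. a < Im z}"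
      unfolding g_def
      by (intro holomorphic_intros holomorphic_on_subset[OF shift_holomorphic[OF hol, of y]]) (use a ne ne2 in auto)
    fix w :: complex assume w: "0 \<le> Im w" "1 \<le> norm w"
    have n1: "norm (\<i> - w) \<le> norm (\<i> + w)"
      by (rule power2_le_imp_le) (use w in \<open>simp_all add: cmod_power2 power2_diff power2_sum\<close>)
    have n2: "norm w \<le> norm (\<i> + w)"
      by (rule power2_le_imp_le) (use w in \<open>simp_all add: cmod_power2 power2_sum\<close>)
    have n3: "e * norm w \<le> norm (1 - \<i> * of_real e * w)"
    proof (rule power2_le_imp_le)
      have "(norm (1 - \<i> * of_real e * w))\<^sup>2 = (1 + e * Im w)\<^sup>2 + (e * Re w)\<^sup>2" by (simp add: cmod_power2)
      moreover have "(e * Im w)\<^sup>2 \<le> (1 + e * Im w)\<^sup>2" using w e by (intro power_mono) auto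
      ultimately show "(e * norm w)\<^sup>2 \<le> (norm (1 - \<i> * of_real e * w))\<^sup>2"
        by (simp add: power_mult_distrib cmod_power2 distrib_left)
    qed simp
    have wp: "norm w > 0" using w by linarith
    have ip: "norm (\<i> + w) > 0" using n2 wp by linarith
    have "norm (g e w) = norm (F (w + \<i> * of_real y)) * (norm (\<i> - w) / norm (\<i> + w)) ^ n / norm (\<i> + w) / norm (1 - \<i> * of_real e * w)"
      by (simp add: g_def norm_mult norm_divide norm_power)
    also have "\<dots> \<le> B * 1 / norm w / (e * norm w)"
      using B[of "w + \<i> * of_real y"] w n1 n2 n3 wp ip e B0
      by (intro frac_le mult_mono power_le_one divide_nonneg_nonneg mult_nonneg_nonneg) auto
    also have "\<dots> = B / e / (norm w)\<^sup>2" by (simp add: power2_eq_square)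
    finally show "norm (g e w) \<le> B / e / (norm w)\<^sup>2" .
  qed (use a in auto)
  have int: "integrable lebesgue (\<lambda>t. on_line F y t * cayley_fun n t)" by (rule L2_mult_integrable[OF L cayley_fun_L2])
  have "(\<lambda>k. LINT t|lebesgue. g (1 / real (Suc k)) (of_real t)) \<longlonglongrightarrow> (LINT t|lebesgue. on_line F y t * cayley_fun n t)"
  proof (rule integral_dominated_convergence[where w = "\<lambda>t. norm (on_line F y t * cayley_fun n t)"])
    have geq: "g e (of_real t) = on_line F y t * cayley_fun n t / (1 - \<i> * of_real e * of_real t)" for e t
      by (simp add: g_def cayley_fun_def cayley_def on_line_shift)
    have ge1: "1 \<le> norm (1 - \<i> * of_real e * complex_of_real t)" for e t
      using abs_Re_le_cmod[of "1 - \<i> * of_real e * complex_of_real t"] by simp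
    show "AE t in lebesgue. (\<lambda>k. g (1 / real (Suc k)) (of_real t)) \<longlonglongrightarrow> on_line F y t * cayley_fun n t"
    proof (rule AE_I2)
      fix t
      have "(\<lambda>k. 1 / real (Suc k)) \<longlonglongrightarrow> 0" using LIMSEQ_inverse_real_of_nat by (simp add: inverse_eq_divide)
      then have "(\<lambda>k. on_line F y t * cayley_fun n t / (1 - \<i> * of_real (1 / real (Suc k)) * of_real t)) \<longlonglongrightarrow> on_line F y t * cayley_fun n t / (1 - \<i> * of_real 0 * of_real t)"
        by (intro tendsto_intros) auto
      then show "(\<lambda>k. g (1 / real (Suc k)) (of_real t)) \<longlonglongrightarrow> on_line F y t * cayley_fun n t" unfolding geq by simp
    qed
    show "AE t in lebesgue. norm (g (1 / real (Suc k)) (of_real t)) \<le> norm (on_line F y t * cayley_fun n t)" for k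
    proof (rule AE_I2)
      fix t
      show "norm (g (1 / real (Suc k)) (of_real t)) \<le> norm (on_line F y t * cayley_fun n t)"
        unfolding geq norm_divide
        using divide_left_mono[OF ge1[of "1 / real (Suc k)" t] norm_ge_zero[of "on_line F y t * cayley_fun n t"]] ge1[of "1 / real (Suc k)" t]
        by (simp del: of_nat_Suc)
    qed
    show "(\<lambda>t. g (1 / real (Suc k)) (of_real t)) \<in> borel_measurable lebesgue" for k
      unfolding geq using borel_measurable_integrable[OF int] by measurable
  qed (use int in auto)
  moreover have "(LINT t|lebesgue. g (1 / real (Suc k)) (of_real t)) = 0" for k by (rule z0) auto
  ultimately show ?thesis by (simp add: moment_def cayley_fun_def LIMSEQ_const_iff)
qed

lemma poisson_kernel_L2:
  assumes "Im z > 0" shows "(\<lambda>t. complex_of_real (poisson_kernel z t)) \<in> L2"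
proof -
  obtain B where B: "B \<ge> 0" "\<And>t. poisson_kernel z t * (1 + t\<^sup>2) \<le> B" using poisson_kernel_bound[OF assms] by blast
  show ?thesis
  proof (rule L2_bound)
    show "integrable lebesgue (\<lambda>t. B * poisson_kernel z t)"
      using poisson_kernel_has_integral[OF assms] by (simp add: has_bochner_integral_iff)
    show "(\<lambda>t. complex_of_real (poisson_kernel z t)) \<in> borel_measurable lebesgue" by measurable
    show "AE t in lebesgue. (norm (complex_of_real (poisson_kernel z t)))\<^sup>2 \<le> B * poisson_kernel z t"
    proof (rule AE_I2)
      fix t
      have k: "poisson_kernel z t \<ge> 0" by (rule poisson_kernel_nonneg[OF assms])
      have "poisson_kernel z t * 1 \<le> poisson_kernel z t * (1 + t\<^sup>2)" using k by (intro mult_left_mono) auto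
      then have "poisson_kernel z t \<le> B" using B(2)[of t] by simp
      then show "(norm (complex_of_real (poisson_kernel z t)))\<^sup>2 \<le> B * poisson_kernel z t"
        using k by (simp add: power2_eq_square mult_right_mono)
    qed
  qed
qed

lemma poisson_int_inner: "poisson_int f z = l2_inner f (\<lambda>t. complex_of_real (poisson_kernel z t))"
  by (simp add: poisson_int_def l2_inner_def mult.commute)

text \<open>Let \<open>X y\<close> be the restriction of \<open>F\<close> to the line at height \<open>y\<close>, and \<open>P s\<close> the Poisson
  operator. Since \<open>P s X y = X (y + s)\<close> and \<open>P\<close> is self-adjoint,
  \<open>\<langle>X (y + s), X y\<rangle> = \<parallel>X (y + s/2)\<parallel>\<^sup>2 \<ge> \<parallel>X (y + s)\<parallel>\<^sup>2\<close>, so that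
  \<open>\<parallel>X y - X (y + s)\<parallel>\<^sup>2 \<le> \<parallel>X y\<parallel>\<^sup>2 - \<parallel>X (y + s)\<parallel>\<^sup>2\<close>. The norms increase to a finite limit as
  \<open>y\<close> decreases to 0, and so the functions \<open>X y\<close> have a limit in \<open>L2\<close>.\<close>

theorem hardy_function_limit:
  assumes F: "hardy_function F"
  shows "\<exists>f\<in>L2. (\<forall>n. moment f n = 0) \<and> (\<forall>z. Im z > 0 \<longrightarrow> F z = poisson_int f z) \<and>
    (\<forall>C. (\<forall>y>0. (LINT x|lebesgue. (norm (F (Complex x y)))\<^sup>2) \<le> C) \<longrightarrow> (norm (cls f))\<^sup>2 \<le> C)"
proof -
  have hol: "F holomorphic_on upper_half_plane" using F by (simp add: hardy_function_def)
  obtain C where C: "\<And>y. y > 0 \<Longrightarrow> (LINT x|lebesgue. (norm (F (Complex x y)))\<^sup>2) \<le> C"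
    using F by (auto simp: hardy_function_def)
  note L = hardy_line_L2[OF F]
  define X where "X = (\<lambda>y. cls (on_line F y))"
  define N where "N = (\<lambda>y. (norm (X y))\<^sup>2)"
  have Nanti: "N (y + s) \<le> N y" if "y > 0" "s > 0" for y s
    using poisson_op_L2(2)[OF L[OF that(1)] that(2)] unfolding hardy_poisson[OF F that] N_def X_def
    by (intro power_mono) auto
  have NC: "N y \<le> C" if "y > 0" for y using C[OF that] norm_cls_sq[OF L[OF that]] by (simp add: N_def X_def)
  have dist: "(norm (X y - X (y + s)))\<^sup>2 \<le> N y - N (y + s)" if y: "y > 0" and s: "s > 0" for y s
  proof -
    \<comment> \<open>Move half of the step \<open>s\<close> to the other side.\<close>
    have "l2_inner (on_line F (y + s)) (on_line F y) = l2_inner (poisson_op (s/2) (on_line F (y + s/2))) (on_line F y)"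
      using hardy_poisson[OF F, of "y + s/2" "s/2"] y s by (simp add: add.commute)
    also have "\<dots> = l2_inner (on_line F (y + s/2)) (poisson_op (s/2) (on_line F y))"
      using y s by (intro poisson_op_selfadjoint L) auto
    also have "poisson_op (s/2) (on_line F y) = on_line F (y + s/2)" using y s by (intro hardy_poisson[OF F]) auto
    finally have "inner (X (y + s)) (X y) = N (y + s/2)"
      using y s by (simp add: X_def N_def inner_cls L power2_norm_eq_inner)
    moreover have "N (y + s) \<le> N (y + s/2)" using Nanti[of "y + s/2" "s/2"] y s by (simp add: add.commute)
    moreover have "(norm (X y - X (y + s)))\<^sup>2 = N y + N (y + s) - 2 * inner (X (y + s)) (X y)"
      by (simp add: N_def power2_norm_eq_inner inner_diff_left inner_diff_right inner_commute)
    ultimately show ?thesis by simp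
  qed
  define e where "e = (\<lambda>k. 1 / real (Suc k))"
  have e0: "e k > 0" for k by (simp add: e_def)
  have edec: "e m < e k" if "k < m" for k m using that by (auto simp: e_def intro!: divide_strict_left_mono)
  have dist': "(norm (X (e m) - X (e k)))\<^sup>2 \<le> \<bar>N (e m) - N (e k)\<bar>" for m k
  proof (cases m k rule: linorder_cases)
    case less
    then show ?thesis using dist[of "e k" "e m - e k"] e0 edec[OF less] by (simp add: norm_minus_commute)
  next
    case greater
    then show ?thesis using dist[of "e m" "e k - e m"] e0 edec[OF greater] by simp
  qed simp
  have "incseq (\<lambda>k. N (e k))"
  proof (rule incseq_SucI)
    fix k show "N (e k) \<le> N (e (Suc k))"
      using Nanti[of "e (Suc k)" "e k - e (Suc k)"] e0 edec[of k "Suc k"] by simp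
  qed
  then have "convergent (\<lambda>k. N (e k))"
    using incseq_convergent[of "\<lambda>k. N (e k)" C] NC e0 convergentI by metis
  then have NCau: "Cauchy (\<lambda>k. N (e k))" by (rule convergent_Cauchy)
  have "Cauchy (\<lambda>k. X (e k))"
  proof (rule CauchyI)
    fix r :: real assume r: "r > 0"
    then obtain M where M: "\<And>m n. m \<ge> M \<Longrightarrow> n \<ge> M \<Longrightarrow> norm (N (e m) - N (e n)) < r\<^sup>2"
      using CauchyD[OF NCau, of "r\<^sup>2"] by auto
    have "norm (X (e m) - X (e n)) < r" if "m \<ge> M" "n \<ge> M" for m n
    proof -
      have "(norm (X (e m) - X (e n)))\<^sup>2 < r\<^sup>2" using dist'[of m n] M[OF that] by simp
      then show ?thesis by (rule power2_less_imp_less) (use r in simp)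
    qed
    then show "\<exists>M. \<forall>m\<ge>M. \<forall>n\<ge>M. norm (X (e m) - X (e n)) < r" by blast
  qed
  then obtain x where x: "(\<lambda>k. X (e k)) \<longlonglongrightarrow> x" using Cauchy_convergent_iff convergent_def by blast
  define f where "f = rep x"
  have f: "f \<in> L2" "cls f = x" by (simp_all add: f_def)
  have lim: "(\<lambda>k. l2_inner (on_line F (e k)) g) \<longlonglongrightarrow> l2_inner f g" if g: "g \<in> L2" for g
    using ip_tendsto[OF x, of "cls g"] by (simp add: X_def ip_cls L e0 g f(1) flip: f(2))
  show ?thesis
  proof (intro bexI[OF _ f(1)] conjI allI impI)
    show "moment f n = 0" for n
      using lim[OF L2_cnj[OF cayley_fun_L2], of n] hardy_moment[OF F e0, of _ n]
      by (simp add: moment_inner LIMSEQ_const_iff)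
    fix z assume z: "Im z > 0"
    have "(\<lambda>k. F (Complex (Re z) (e k + Im z))) \<longlonglongrightarrow> poisson_int f z"
    proof -
      have "poisson_int (on_line F (e k)) z = F (Complex (Re z) (e k + Im z))" for k
        using fun_cong[OF hardy_poisson[OF F e0 z], of k "Re z"] by (simp add: poisson_op_def)
      then show ?thesis using lim[OF poisson_kernel_L2[OF z]] by (simp add: poisson_int_inner)
    qed
    moreover have "(\<lambda>k. F (Complex (Re z) (e k + Im z))) \<longlonglongrightarrow> F z"
    proof -
      have "isCont F z" using hol z continuous_on_eq_continuous_at[OF open_upper] holomorphic_on_imp_continuous_on
        by (auto simp: upper_half_plane_def)
      moreover have "(\<lambda>k. Complex (Re z) (e k + Im z)) \<longlonglongrightarrow> z"
      proof -
        have "e \<longlonglongrightarrow> 0" unfolding e_def using LIMSEQ_inverse_real_of_nat by (simp add: inverse_eq_divide)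
        then have "(\<lambda>k. Complex (Re z) (e k + Im z)) \<longlonglongrightarrow> Complex (Re z) (0 + Im z)" by (intro tendsto_intros)
        then show ?thesis by simp
      qed
      ultimately show ?thesis by (rule isCont_tendsto_compose)
    qed
    ultimately show "F z = poisson_int f z" using LIMSEQ_unique by blast
  next
    fix C assume C: "\<forall>y>0. (LINT x|lebesgue. (norm (F (Complex x y)))\<^sup>2) \<le> C"
    have "(\<lambda>k. (norm (X (e k)))\<^sup>2) \<longlonglongrightarrow> (norm x)\<^sup>2" by (intro tendsto_intros x)
    moreover have "(norm (X (e k)))\<^sup>2 \<le> C" for k
      using C e0[of k] norm_cls_sq[OF L[OF e0], of k] by (simp add: X_def)
    ultimately show "(norm (cls f))\<^sup>2 \<le> C" unfolding f(2) by (intro LIMSEQ_le_const2) auto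
  qed
qed

text \<open>The Cauchy integral at the reflected point vanishes.\<close>

lemma poisson_int_analytic:
  assumes f: "f \<in> L2" and m: "\<And>n. moment f n = 0" and z: "Im z > 0"
  shows "poisson_int f z = cauchy_tr f z / (2 * of_real pi * \<i>)"
proof -
  have "cauchy_tr f (cnj z) = 0" using z by (intro cauchy_tr_eq_0_of_moments L2_Cauchy_class f m) simp
  then show ?thesis using poisson_int_cauchy[OF L2_Cauchy_class[OF f] z] by simp
qed

lemma poisson_int_hardy_function:
  assumes f: "f \<in> L2" and m: "\<And>n. moment f n = 0"
  shows "hardy_function (poisson_int f)"
  unfolding hardy_function_def
proof
  have "(\<lambda>z. cauchy_tr f z / (2 * of_real pi * \<i>)) holomorphic_on upper_half_plane"
    by (intro holomorphic_intros cauchy_tr_holomorphic_upper L2_Cauchy_class f) auto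
  then show "poisson_int f holomorphic_on upper_half_plane"
    by (rule holomorphic_transform) (simp add: poisson_int_analytic[OF f m] upper_half_plane_def)
  show "\<exists>C. \<forall>y>0. integrable lebesgue (\<lambda>x. (norm (poisson_int f (Complex x y)))\<^sup>2) \<and> (LINT x|lebesgue. (norm (poisson_int f (Complex x y)))\<^sup>2) \<le> C"
  proof (intro exI allI impI conjI)
    fix y :: real assume y: "y > 0"
    note P = poisson_op_L2[OF f y]
    show "integrable lebesgue (\<lambda>x. (norm (poisson_int f (Complex x y)))\<^sup>2)"
      using L2_integrable[OF P(1)] by (simp add: poisson_op_def)
    have "(norm (cls (poisson_op y f)))\<^sup>2 \<le> (norm (cls f))\<^sup>2" using P(2) by (intro power_mono) auto
    then show "(LINT x|lebesgue. (norm (poisson_int f (Complex x y)))\<^sup>2) \<le> (norm (cls f))\<^sup>2"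
      by (simp add: norm_cls_sq[OF P(1)] poisson_op_def)
  qed
qed

lemma has_boundary_values_poisson:
  assumes "f \<in> L2" shows "has_boundary_values (poisson_int f) f"
  using poisson_vertical_limit[OF assms] by (simp add: has_boundary_values_def poisson_op_def)

lemma has_boundary_values_unique:
  assumes "has_boundary_values F f" "has_boundary_values G g" "\<And>z. Im z > 0 \<Longrightarrow> F z = G z"
  shows "ae_eq f g"
  using assms(1,2) unfolding has_boundary_values_def ae_eq_def
proof eventually_elim
  case (elim x)
  have "((\<lambda>y. F (Complex x y)) \<longlongrightarrow> g x) (at_right 0)"
    by (rule Lim_transform_eventually[OF elim(2)])
       (use eventually_at_right_less[of 0] assms(3) in \<open>auto elim: eventually_mono\<close>)
  then show ?case using elim(1) tendsto_unique[OF trivial_limit_at_right_real] by blast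
qed

theorem hardy_boundary:
  assumes F: "hardy_function F" and b: "has_boundary_values F f"
  shows "f \<in> L2" "moment f n = 0" "Im z > 0 \<Longrightarrow> F z = poisson_int f z"
proof -
  obtain g where g: "g \<in> L2" "\<And>n. moment g n = 0" "\<And>z. Im z > 0 \<Longrightarrow> F z = poisson_int g z"
    using hardy_function_limit[OF F] by blast
  have ae: "ae_eq g f" by (rule has_boundary_values_unique[OF has_boundary_values_poisson[OF g(1)] b]) (simp add: g(3))
  show f: "f \<in> L2" by (rule L2_cong_ae[OF g(1) ae])
  show "moment f n = 0"
    using g(2)[of n] l2_inner_cong[OF ae ae_eq_refl g(1) L2_cnj[OF cayley_fun_L2]] by (simp add: moment_inner)
  show "F z = poisson_int f z" if "Im z > 0"
    using g(3)[OF that] l2_inner_cong[OF ae ae_eq_refl g(1) poisson_kernel_L2[OF that]] by (simp add: poisson_int_inner)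
qed

text \<open>Membership in \<open>H2\<close> becomes a countable system of linear equations that are continuous in the
  norm. A function satisfying them is recovered as the vertical limit of its Poisson
  integral, which is in the Hardy class.\<close>

theorem H2_eq: "H2 = {f \<in> L2. \<forall>n. moment f n = 0}"
proof (intro equalityI subsetI)
  fix f assume "f \<in> H2"
  then obtain F where "hardy_function F" "has_boundary_values F f" by (auto simp: H2_def hardy_function_def)
  then show "f \<in> {f \<in> L2. \<forall>n. moment f n = 0}" using hardy_boundary by blast
next
  fix f assume "f \<in> {f \<in> L2. \<forall>n. moment f n = 0}"
  then have f: "f \<in> L2" "\<And>n. moment f n = 0" by auto
  have "hardy_function (poisson_int f)" by (rule poisson_int_hardy_function[OF f])
  then show "f \<in> H2" using f has_boundary_values_poisson[OF f(1)] unfolding H2_def hardy_function_def by blast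
qed

section \<open>Duality and density in the Hardy space\<close>

lemma H2_D: "f \<in> H2 \<Longrightarrow> f \<in> L2" "f \<in> H2 \<Longrightarrow> moment f n = 0"
  by (simp_all add: H2_eq)
lemma H2_I: "f \<in> L2 \<Longrightarrow> (\<And>n. moment f n = 0) \<Longrightarrow> f \<in> H2"
  by (simp add: H2_eq)

lemma H2_cong_ae: "f \<in> H2 \<Longrightarrow> ae_eq f g \<Longrightarrow> g \<in> H2"
proof (rule H2_I)
  assume f: "f \<in> H2" and ae: "ae_eq f g"
  show "g \<in> L2" by (rule L2_cong_ae[OF H2_D(1)[OF f] ae])
  show "moment g n = 0" for n
    using H2_D(2)[OF f, of n] l2_inner_cong[OF ae ae_eq_refl H2_D(1)[OF f] L2_cnj[OF cayley_fun_L2], of n] by (simp add: moment_inner)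
qed

lemma moment_add: "f \<in> L2 \<Longrightarrow> g \<in> L2 \<Longrightarrow> moment (\<lambda>x. f x + g x) n = moment f n + moment g n"
  unfolding moment_inner by (intro l2_inner_add_left L2_cnj cayley_fun_L2)
lemma moment_cmult: "moment (\<lambda>x. c * f x) n = c * moment f n"
  unfolding moment_inner by (rule l2_inner_cmult_left)

lemma H2_add: "f \<in> H2 \<Longrightarrow> g \<in> H2 \<Longrightarrow> (\<lambda>x. f x + g x) \<in> H2"
  by (rule H2_I) (simp_all add: H2_D L2_add moment_add)
lemma H2_cmult: "f \<in> H2 \<Longrightarrow> (\<lambda>x. c * f x) \<in> H2"
  by (rule H2_I) (simp_all add: H2_D L2_cmult moment_cmult)
lemma H2_zero: "(\<lambda>x. 0) \<in> H2" by (rule H2_I) (auto simp: moment_def)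

definition H2_classes :: "l2 set" where "H2_classes = cls ` H2"

lemma H2_classes_iff: "f \<in> L2 \<Longrightarrow> cls f \<in> H2_classes \<longleftrightarrow> f \<in> H2"
proof -
  assume f: "f \<in> L2"
  have "f \<in> H2" if "cls f = cls g" "g \<in> H2" for g
  proof (rule H2_cong_ae[OF that(2)])
    show "ae_eq g f" using that(1) cls_eq_iff[OF f H2_D(1)[OF that(2)]] by (simp add: ae_eq_sym)
  qed
  then show ?thesis unfolding H2_classes_def by blast
qed

lemma rep_H2: "x \<in> H2_classes \<Longrightarrow> rep x \<in> H2"
  using H2_classes_iff[OF rep_L2, of x] by simp

lemma ip_zero_left: "ip_l2 0 z = 0"
  by transfer (simp add: l2_inner_def)
lemma ip_add_left: "ip_l2 (x + y) z = ip_l2 x z + ip_l2 y z"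
  by transfer (simp add: l2_inner_add_left)
lemma ip_scale_left: "ip_l2 (c *\<^sub>R x) z = of_real c * ip_l2 x z"
  by transfer (simp add: l2_inner_cmult_left)

lemma subspace_ip_zero: "subspace {x. ip_l2 x y = 0}"
  by (simp add: subspace_def ip_zero_left ip_add_left ip_scale_left)

lemma closed_ip_zero: "closed {x. ip_l2 x y = 0}"
  unfolding closed_sequential_limits
proof (intro allI impI, elim conjE)
  fix f l assume a: "\<forall>n. f n \<in> {x. ip_l2 x y = 0}" and l: "f \<longlonglongrightarrow> l"
  show "l \<in> {x. ip_l2 x y = 0}" using ip_tendsto[OF l, of y] a by (simp add: LIMSEQ_const_iff)
qed

lemma H2_classes_Inter: "H2_classes = (\<Inter>n. {x. ip_l2 x (cls (\<lambda>t. cnj (cayley_fun n t))) = 0})"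
proof -
  have "x \<in> H2_classes \<longleftrightarrow> (\<forall>n. ip_l2 x (cls (\<lambda>t. cnj (cayley_fun n t))) = 0)" for x
    using H2_classes_iff[OF rep_L2, of x] ip_cls[OF rep_L2[of x] L2_cnj[OF cayley_fun_L2]]
    by (simp add: H2_eq moment_inner)
  then show ?thesis by auto
qed

lemma H2_classes_subspace: "subspace H2_classes" and H2_classes_closed: "closed H2_classes"
  unfolding H2_classes_Inter by (auto intro!: subspace_Inter subspace_ip_zero closed_INT closed_ip_zero)

text \<open>The imaginary part of the inner product of \<open>f\<close> and \<open>g\<close> is the real part of that of \<open>f\<close> and
  \<open>\<i> g\<close>.\<close>

lemma l2_inner_zero_of_inner_zero:
  assumes "f \<in> L2" "g \<in> L2" "inner (cls f) (cls g) = 0" "inner (cls f) (cls (\<lambda>t. \<i> * g t)) = 0"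
  shows "l2_inner f g = 0"
  using assms by (simp add: inner_cls L2_cmult l2_inner_cmult_right complex_eq_iff)

text \<open>The space \<open>M\<close> spanned by the \<open>r\<^sub>n\<close>, in the normalization without the factor \<open>sqrt \<pi>\<close>; see
  \<open>M_space_eq\<close>.\<close>

definition analytic_span :: "(real \<Rightarrow> complex) set" where
  "analytic_span = {m. \<exists>K a. m = (\<lambda>x. \<Sum>k<K. a k * cayley_fun k x)}"

lemma analytic_spanI: "(\<lambda>x. \<Sum>k<K. a k * cayley_fun k x) \<in> analytic_span"
  unfolding analytic_span_def by (rule CollectI, rule exI[of _ K], rule exI[of _ a], rule refl)

lemma analytic_spanE: "m \<in> analytic_span \<Longrightarrow> (\<And>K a. m = (\<lambda>x. \<Sum>k<K. a k * cayley_fun k x) \<Longrightarrow> thesis) \<Longrightarrow> thesis"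
  unfolding analytic_span_def by blast

lemma analytic_span_cayley_fun: "cayley_fun n \<in> analytic_span"
proof -
  have "cayley_fun n = (\<lambda>x. \<Sum>k<Suc n. (if k = n then 1 else 0) * cayley_fun k x)"
    by (auto simp: fun_eq_iff if_distrib[of "\<lambda>c. c * _"] cong: if_cong)
  also have "\<dots> \<in> analytic_span" by (rule analytic_spanI)
  finally show ?thesis .
qed

lemma analytic_span_cmult: "m \<in> analytic_span \<Longrightarrow> (\<lambda>x. c * m x) \<in> analytic_span"
proof -
  assume "m \<in> analytic_span"
  then obtain K a where "m = (\<lambda>x. \<Sum>k<K. a k * cayley_fun k x)" unfolding analytic_span_def by blast
  then have "(\<lambda>x. c * m x) = (\<lambda>x. \<Sum>k<K. (c * a k) * cayley_fun k x)" by (simp add: sum_distrib_left mult.assoc)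
  also have "\<dots> \<in> analytic_span" by (rule analytic_spanI)
  finally show ?thesis .
qed

lemma analytic_span_add: "m \<in> analytic_span \<Longrightarrow> m' \<in> analytic_span \<Longrightarrow> (\<lambda>x. m x + m' x) \<in> analytic_span"
proof -
  assume "m \<in> analytic_span" "m' \<in> analytic_span"
  then obtain K a K' a' where m: "m = (\<lambda>x. \<Sum>k<K. a k * cayley_fun k x)" "m' = (\<lambda>x. \<Sum>k<K'. a' k * cayley_fun k x)"
    unfolding analytic_span_def by blast
  define L where "L = max K K'"
  have ext: "(\<Sum>k<K. a k * cayley_fun k x) = (\<Sum>k<L. (if k < K then a k else 0) * cayley_fun k x)" if "K \<le> L" for K a x
    using that by (intro sum.mono_neutral_cong_left) auto
  have "(\<lambda>x. m x + m' x) = (\<lambda>x. \<Sum>k<L. ((if k < K then a k else 0) + (if k < K' then a' k else 0)) * cayley_fun k x)"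
    unfolding m by (subst (1 2) ext) (auto simp: L_def distrib_right sum.distrib)
  also have "\<dots> \<in> analytic_span" by (rule analytic_spanI)
  finally show ?thesis .
qed

lemma cayley_fun_H2: "cayley_fun n \<in> H2"
proof -
  define F where "F = (\<lambda>z. ((\<i> - z) / (\<i> + z)) ^ n / (\<i> + z))"
  have ne: "\<i> + z \<noteq> 0" if "0 \<le> Im z" for z using that by (auto simp: complex_eq_iff)
  have "hardy_function F" unfolding hardy_function_def
  proof
    show "F holomorphic_on upper_half_plane" unfolding F_def
      using ne by (intro holomorphic_intros) (auto simp: upper_half_plane_def)
    have le: "(norm (F (Complex x y)))\<^sup>2 \<le> 1 / (1 + x\<^sup>2)" if y: "y > 0" for x y
    proof -
      have n1: "norm (\<i> - Complex x y) \<le> norm (\<i> + Complex x y)"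
        by (rule power2_le_imp_le) (use y in \<open>simp_all add: cmod_power2 power2_diff power2_sum\<close>)
      have "norm (\<i> + Complex x y) > 0" using ne[of "Complex x y"] y by simp
      then have "(norm (\<i> - Complex x y) / norm (\<i> + Complex x y)) ^ n \<le> 1" using n1 by (intro power_le_one) auto
      then have "norm (F (Complex x y)) \<le> 1 / norm (\<i> + Complex x y)"
        unfolding F_def norm_divide norm_power by (intro divide_right_mono) auto
      then have "(norm (F (Complex x y)))\<^sup>2 \<le> 1 / (norm (\<i> + Complex x y))\<^sup>2"
        using power_mono[of "norm (F (Complex x y))" "1 / norm (\<i> + Complex x y)" 2] by (simp add: power_divide)
      also have "\<dots> \<le> 1 / (1 + x\<^sup>2)"
      proof (rule divide_left_mono)
        have "1 \<le> (1 + y)\<^sup>2" using y by (simp add: power2_sum)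
        then show "1 + x\<^sup>2 \<le> (norm (\<i> + Complex x y))\<^sup>2" by (simp add: cmod_power2)
        have "(norm (\<i> + Complex x y))\<^sup>2 > 0" using \<open>norm (\<i> + Complex x y) > 0\<close> by simp
        then show "0 < (norm (\<i> + Complex x y))\<^sup>2 * (1 + x\<^sup>2)" by (intro mult_pos_pos) (simp_all add: add_pos_nonneg)
      qed simp
      finally show ?thesis .
    qed
    have c: "continuous_on UNIV (on_line F y)" if "y > 0" for y
      by (rule hardy_line_continuous[OF \<open>F holomorphic_on upper_half_plane\<close> that])
    have int: "integrable lebesgue (\<lambda>x. (norm (F (Complex x y)))\<^sup>2)" if "y > 0" for y
      by (rule Bochner_Integration.integrable_bound[OF integrable_inverse_1_plus_square])
         (use le[OF that] continuous_measurable_lebesgue[OF c[OF that]] in \<open>auto simp: add_nonneg_nonneg\<close>)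
    show "\<exists>C. \<forall>y>0. integrable lebesgue (\<lambda>x. (norm (F (Complex x y)))\<^sup>2) \<and> (LINT x|lebesgue. (norm (F (Complex x y)))\<^sup>2) \<le> C"
      using int le by (intro exI[of _ "LINT x|lebesgue. 1 / (1 + x\<^sup>2)"] allI impI conjI integral_mono integrable_inverse_1_plus_square) auto
  qed
  moreover have "has_boundary_values F (cayley_fun n)"
    unfolding has_boundary_values_def
  proof (rule AE_I2)
    fix x
    have "isCont F (of_real x)" unfolding F_def by (intro continuous_intros) auto
    moreover have "((\<lambda>y. Complex x y) \<longlongrightarrow> Complex x 0) (at_right 0)" by (intro tendsto_intros)
    ultimately have "((\<lambda>y. F (Complex x y)) \<longlongrightarrow> F (of_real x)) (at_right 0)"
      using isCont_tendsto_compose[of "of_real x" F "\<lambda>y. Complex x y"] by (simp add: complex_of_real_def)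
    then show "((\<lambda>y. F (Complex x y)) \<longlongrightarrow> cayley_fun n x) (at_right 0)" by (simp add: F_def cayley_fun_def cayley_def)
  qed
  ultimately show ?thesis using hardy_boundary by (intro H2_I) blast+
qed

lemma analytic_span_H2: "m \<in> analytic_span \<Longrightarrow> m \<in> H2"
proof -
  assume "m \<in> analytic_span"
  then obtain K a where m: "m = (\<lambda>x. \<Sum>k<K. a k * cayley_fun k x)" unfolding analytic_span_def by blast
  have "(\<lambda>x. \<Sum>k<K. a k * cayley_fun k x) \<in> H2"
    by (induction K) (auto intro!: H2_add H2_cmult cayley_fun_H2 H2_zero)
  then show ?thesis by (simp add: m)
qed

lemma analytic_span_subspace_image:
  assumes q: "\<And>m. m \<in> analytic_span \<Longrightarrow> (\<lambda>x. q x * m x) \<in> L2"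
  shows "subspace (cls ` (\<lambda>m x. q x * m x) ` analytic_span)"
proof (rule subspaceI)
  have "cls (\<lambda>x. q x * (0 * cayley_fun 0 x)) \<in> cls ` (\<lambda>m x. q x * m x) ` analytic_span"
    by (intro imageI analytic_span_cmult analytic_span_cayley_fun)
  then show "0 \<in> cls ` (\<lambda>m x. q x * m x) ` analytic_span" by (simp add: cls_zero)
  fix x y assume "x \<in> cls ` (\<lambda>m x. q x * m x) ` analytic_span" "y \<in> cls ` (\<lambda>m x. q x * m x) ` analytic_span"
  then obtain m m' where m: "m \<in> analytic_span" "m' \<in> analytic_span" "x = cls (\<lambda>x. q x * m x)" "y = cls (\<lambda>x. q x * m' x)"
    by (elim imageE) auto
  have eq: "x + y = cls (\<lambda>x. q x * (m x + m' x))" using cls_add[OF q[OF m(1)] q[OF m(2)]] by (simp add: m distrib_left)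
  show "x + y \<in> cls ` (\<lambda>m x. q x * m x) ` analytic_span" unfolding eq
    by (rule imageI, rule image_eqI[where x = "\<lambda>x. m x + m' x"], rule refl, rule analytic_span_add[OF m(1,2)])
next
  fix c :: real and x assume "x \<in> cls ` (\<lambda>m x. q x * m x) ` analytic_span"
  then obtain m where m: "m \<in> analytic_span" "x = cls (\<lambda>x. q x * m x)" by blast
  have eq: "c *\<^sub>R x = cls (\<lambda>x. q x * (of_real c * m x))"
    unfolding m(2) cls_scale[OF q[OF m(1)], of c, symmetric] by (simp only: mult.left_commute)
  show "c *\<^sub>R x \<in> cls ` (\<lambda>m x. q x * m x) ` analytic_span" unfolding eq
    by (rule imageI, rule image_eqI[where x = "\<lambda>x. of_real c * m x"], rule refl, rule analytic_span_cmult[OF m(1)])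
qed

text \<open>The moments of \<open>g\<close> vanish because it is in \<open>H2\<close>, those of its conjugate by the hypothesis.\<close>

lemma H2_zero_of_orth:
  assumes g: "g \<in> H2" and 0: "\<And>n. l2_inner (cayley_fun n) g = 0"
  shows "ae_eq g (\<lambda>x. 0)"
proof -
  have "moment (\<lambda>t. cnj (g t)) n = l2_inner (cayley_fun n) g" for n by (simp add: moment_def l2_inner_def cayley_fun_def mult.commute)
  then have "AE t in lebesgue. g t = 0"
    using 0 H2_D[OF g] by (intro Cauchy_class_AE_zero_of_moments L2_Cauchy_class) auto
  then show ?thesis by (simp add: ae_eq_def)
qed

lemma dense_in_H2_classes:
  assumes q: "\<And>m. m \<in> analytic_span \<Longrightarrow> (\<lambda>x. q x * m x) \<in> H2"
    and triv: "\<And>g. g \<in> H2 \<Longrightarrow> (\<And>n. l2_inner (\<lambda>x. q x * cayley_fun n x) g = 0) \<Longrightarrow> ae_eq g (\<lambda>x. 0)"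
  shows "closure (cls ` (\<lambda>m x. q x * m x) ` analytic_span) = H2_classes"
proof (rule closed_subspace_eqI)
  let ?S = "cls ` (\<lambda>m x. q x * m x) ` analytic_span"
  show "subspace (closure ?S)" by (intro subspace_closure analytic_span_subspace_image H2_D(1) q)
  have "?S \<subseteq> H2_classes" unfolding H2_classes_def using q by blast
  then show "closure ?S \<subseteq> H2_classes" using H2_classes_closed by (rule closure_minimal)
  fix x assume x: "x \<in> H2_classes" and orth: "\<And>v. v \<in> closure ?S \<Longrightarrow> inner x v = 0"
  define g where "g = rep x"
  have g: "g \<in> H2" "x = cls g" using rep_H2[OF x] by (simp_all add: g_def)
  have o: "inner (cls g) (cls (\<lambda>x. q x * m x)) = 0" if "m \<in> analytic_span" for m
    using orth[of "cls (\<lambda>x. q x * m x)"] that closure_subset[of ?S] g by blast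
  have "ae_eq g (\<lambda>x. 0)"
  proof (rule triv[OF g(1)])
    fix n
    have "l2_inner g (\<lambda>x. q x * cayley_fun n x) = 0"
    proof (rule l2_inner_zero_of_inner_zero)
      show "inner (cls g) (cls (\<lambda>t. \<i> * (q t * cayley_fun n t))) = 0"
        using o[OF analytic_span_cmult[OF analytic_span_cayley_fun, of \<i>]] by (simp add: mult_ac)
    qed (use g(1) H2_D(1) q o analytic_span_cayley_fun in blast)+
    then show "l2_inner (\<lambda>x. q x * cayley_fun n x) g = 0" by (subst l2_inner_commute) simp
  qed
  then have "cls g = cls (\<lambda>x. 0)" using g H2_D(1) by (subst cls_eq_iff) auto
  then show "x = 0" by (simp add: g cls_zero)
qed (auto simp: H2_classes_subspace)

lemma analytic_span_dense: "closure (cls ` analytic_span) = H2_classes"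
  using dense_in_H2_classes[of "\<lambda>x. 1"] analytic_span_H2 H2_zero_of_orth by simp

text \<open>For \<open>f\<close> in the span of the functions \<open>cayley_fun n\<close> the integral is a combination of moments
  of \<open>g\<close>; the span is dense.\<close>

lemma H2_prod_zero:
  assumes f: "f \<in> H2" and g: "g \<in> H2" shows "(LINT t|lebesgue. f t * g t) = 0"
proof -
  let ?V = "{x. ip_l2 x (cls (\<lambda>t. cnj (g t))) = 0}"
  have gL: "(\<lambda>t. cnj (g t)) \<in> L2" using g H2_D L2_cnj by blast
  have "cls m \<in> ?V" if mM: "m \<in> analytic_span" for m
  proof -
    obtain K a where m: "m = (\<lambda>x. \<Sum>k<K. a k * cayley_fun k x)" by (rule analytic_spanE[OF mM])
    have "(LINT t|lebesgue. (\<Sum>k<K. a k * cayley_fun k t) * g t) = (\<Sum>k<K. a k * (LINT t|lebesgue. cayley_fun k t * g t))"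
      using L2_mult_integrable[OF cayley_fun_L2 H2_D(1)[OF g]] by (simp add: sum_distrib_right mult.assoc)
    moreover have "(LINT t|lebesgue. cayley_fun k t * g t) = 0" for k
      using H2_D(2)[OF g, of k] by (simp add: moment_def cayley_fun_def mult.commute)
    ultimately show ?thesis using mM analytic_span_H2 H2_D(1) gL by (simp add: ip_cls l2_inner_def m)
  qed
  then have "cls ` analytic_span \<subseteq> ?V" by blast
  then have "closure (cls ` analytic_span) \<subseteq> ?V" by (rule closure_minimal[OF _ closed_ip_zero])
  then have "cls f \<in> ?V" using f by (auto simp: analytic_span_dense H2_classes_def)
  then show ?thesis using H2_D(1)[OF f] gL by (simp add: ip_cls l2_inner_def)
qed

text \<open>The inner product of \<open>p\<close> with \<open>cayley_fun n\<close> is the conjugate of a moment of \<open>cnj p\<close>.\<close>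

lemma orth_H2_iff:
  assumes p: "p \<in> L2"
  shows "(\<forall>f\<in>H2. l2_inner p f = 0) \<longleftrightarrow> (\<lambda>t. cnj (p t)) \<in> H2"
proof
  assume a: "\<forall>f\<in>H2. l2_inner p f = 0"
  show "(\<lambda>t. cnj (p t)) \<in> H2"
  proof (rule H2_I)
    have "moment (\<lambda>t. cnj (p t)) n = cnj (l2_inner p (cayley_fun n))" for n
      unfolding moment_def l2_inner_def cayley_fun_def
      by (subst Bochner_Integration.integral_cnj[symmetric]) (simp only: complex_cnj_mult complex_cnj_cnj)
    then show "moment (\<lambda>t. cnj (p t)) n = 0" for n using a cayley_fun_H2 by simp
  qed (rule L2_cnj[OF p])
next
  assume c: "(\<lambda>t. cnj (p t)) \<in> H2"
  show "\<forall>f\<in>H2. l2_inner p f = 0"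
  proof
    fix f assume "f \<in> H2"
    from H2_prod_zero[OF this c] have "cnj (l2_inner p f) = 0"
      unfolding l2_inner_def by (subst Bochner_Integration.integral_cnj[symmetric]) (simp add: mult.commute)
    then show "l2_inner p f = 0" by simp
  qed
qed

text \<open>For a bounded sequence the vectors against which it converges weakly form a closed subspace.
  This subspace includes the Poisson kernels, by the pointwise convergence, and a function
  orthogonal to them is zero, since it is the vertical limit of its Poisson integral.\<close>

lemma H2_weak_convergence:
  assumes f: "\<And>k. f k \<in> H2" and f0: "f0 \<in> H2" and bd: "\<And>k. norm (cls (f k)) \<le> B"
    and pw: "\<And>z. Im z > 0 \<Longrightarrow> (\<lambda>k. poisson_int (f k) z) \<longlonglongrightarrow> poisson_int f0 z" and g: "g \<in> L2"
  shows "(\<lambda>k. l2_inner (f k) g) \<longlonglongrightarrow> l2_inner f0 g"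
proof -
  define d where "d = (\<lambda>k x. f k x - f0 x)"
  note fL = H2_D(1)[OF f] and f0L = H2_D(1)[OF f0]
  have dL: "d k \<in> L2" for k unfolding d_def by (rule L2_diff[OF fL f0L])
  define B' where "B' = B + norm (cls f0) + 1"
  have B': "norm (cls (d k)) \<le> B'" for k
    using bd[of k] norm_triangle_ineq4[of "cls (f k)" "cls f0"] by (simp add: d_def cls_diff fL f0L B'_def)
  have B'0: "B' > 0" using bd[of 0] norm_ge_zero[of "cls (f 0)"] norm_ge_zero[of "cls f0"] unfolding B'_def by linarith
  define V where "V = {x. (\<lambda>k. ip_l2 (cls (d k)) x) \<longlonglongrightarrow> 0}"
  have ipc: "ip_l2 y x = cnj (ip_l2 x y)" for x y by (rule ip_commute)
  have Vsub: "subspace V"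
  proof (rule subspaceI)
    have "ip_l2 (cls (d k)) 0 = 0" for k by (subst ipc) (simp add: ip_zero_left)
    then show "0 \<in> V" by (simp add: V_def)
    fix x y assume xy: "x \<in> V" "y \<in> V"
    have "ip_l2 (cls (d k)) (x + y) = ip_l2 (cls (d k)) x + ip_l2 (cls (d k)) y" for k
      unfolding ipc[of "cls (d k)"] by (simp add: ip_add_left)
    then show "x + y \<in> V" using tendsto_add[of "\<lambda>k. ip_l2 (cls (d k)) x" 0 sequentially "\<lambda>k. ip_l2 (cls (d k)) y" 0] xy by (simp add: V_def)
  next
    fix c :: real and x assume x: "x \<in> V"
    have "ip_l2 (cls (d k)) (c *\<^sub>R x) = of_real c * ip_l2 (cls (d k)) x" for k
      unfolding ipc[of "cls (d k)"] by (simp add: ip_scale_left)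
    then show "c *\<^sub>R x \<in> V" using tendsto_mult_right_zero x by (simp add: V_def)
  qed
  have Vclosed: "closed V" unfolding closed_sequential_limits
  proof (intro allI impI, elim conjE)
    fix s l assume s: "\<forall>n. s n \<in> V" and l: "s \<longlonglongrightarrow> l"
    show "l \<in> V" unfolding V_def
    proof (rule CollectI, rule LIMSEQ_I)
      fix e :: real assume e: "e > 0"
      obtain n where n: "norm (s n - l) < e / (2 * B')" using LIMSEQ_D[OF l, of "e / (2 * B')"] e B'0 by auto
      have "(\<lambda>k. ip_l2 (cls (d k)) (s n)) \<longlonglongrightarrow> 0" using s by (simp add: V_def)
      then obtain K where K: "\<And>k. k \<ge> K \<Longrightarrow> norm (ip_l2 (cls (d k)) (s n)) < e / 2"
        using LIMSEQ_D[of _ 0 "e/2"] e by (metis diff_zero half_gt_zero)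
      have "norm (ip_l2 (cls (d k)) l) < e" if "k \<ge> K" for k
      proof -
        have "ip_l2 (cls (d k)) l = ip_l2 (cls (d k)) (s n) - ip_l2 (cls (d k)) (s n - l)"
          unfolding ipc[of "cls (d k)"] by (simp add: ip_diff_left)
        then have "norm (ip_l2 (cls (d k)) l) \<le> norm (ip_l2 (cls (d k)) (s n)) + norm (ip_l2 (cls (d k)) (s n - l))"
          using norm_triangle_ineq4 by simp
        also have "norm (ip_l2 (cls (d k)) (s n - l)) \<le> norm (cls (d k)) * norm (s n - l)" by (rule norm_ip_le)
        also have "\<dots> \<le> B' * norm (s n - l)" by (intro mult_right_mono B') simp
        also have "\<dots> \<le> B' * (e / (2 * B'))" using n B'0 by (intro mult_left_mono) auto
        also have "\<dots> = e / 2" using B'0 by simp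
        finally show ?thesis using K[OF that] by simp
      qed
      then show "\<exists>no. \<forall>k\<ge>no. norm (ip_l2 (cls (d k)) l - 0) < e" by auto
    qed
  qed
  have VI: "cls \<phi> \<in> V" if "\<phi> \<in> L2" "(\<lambda>k. l2_inner (d k) \<phi>) \<longlonglongrightarrow> 0" for \<phi>
    using that by (simp add: V_def ip_cls dL)
  have VIi: "cls (\<lambda>t. \<i> * \<phi> t) \<in> V" if "\<phi> \<in> L2" "(\<lambda>k. l2_inner (d k) \<phi>) \<longlonglongrightarrow> 0" for \<phi>
    by (rule VI) (use that tendsto_mult_right_zero[OF that(2), of "- \<i>"] in \<open>auto intro: L2_cmult simp: l2_inner_cmult_right\<close>)
  have "V = UNIV"
  proof (rule closed_subspace_eqI[OF Vsub Vclosed])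
    fix x :: l2 assume orth: "\<And>v. v \<in> V \<Longrightarrow> inner x v = 0"
    define u where "u = rep x"
    have u: "u \<in> L2" "x = cls u" by (simp_all add: u_def)
    have o: "l2_inner u \<phi> = 0" if "\<phi> \<in> L2" "(\<lambda>k. l2_inner (d k) \<phi>) \<longlonglongrightarrow> 0" for \<phi>
      using orth[OF VI[OF that]] orth[OF VIi[OF that]] u that by (intro l2_inner_zero_of_inner_zero) auto
    have P0: "poisson_int u z = 0" if z: "Im z > 0" for z unfolding poisson_int_inner
    proof (rule o[OF poisson_kernel_L2[OF z]])
      have "(\<lambda>k. poisson_int (f k) z - poisson_int f0 z) \<longlonglongrightarrow> 0" using pw[OF z] by (rule LIM_zero)
      then show "(\<lambda>k. l2_inner (d k) (\<lambda>t. of_real (poisson_kernel z t))) \<longlonglongrightarrow> 0"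
        by (simp add: d_def l2_inner_diff_left fL f0L poisson_kernel_L2[OF z] poisson_int_inner)
    qed
    have "ae_eq u (\<lambda>x. 0)"
      by (rule has_boundary_values_unique[OF has_boundary_values_poisson[OF u(1)] has_boundary_values_poisson[OF L2_zero]])
         (simp add: P0, simp add: poisson_int_def)
    then show "x = 0" using u cls_eq_iff[OF u(1) L2_zero] by (simp add: cls_zero)
  qed auto
  then have "cls g \<in> V" by simp
  then have "(\<lambda>k. l2_inner (f k) g - l2_inner f0 g) \<longlonglongrightarrow> 0"
    by (simp add: V_def ip_cls dL g) (simp add: d_def l2_inner_diff_left fL f0L g)
  then show ?thesis by (rule LIM_zero_cancel)
qed

section \<open>Schwarz integrals\<close>

text \<open>An outer function is a unimodular constant times the exponential of this integral with
  \<open>v = log \<bar>h\<bar>\<close>.\<close>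

definition schwarz :: "(real \<Rightarrow> real) \<Rightarrow> complex \<Rightarrow> complex" where
  "schwarz v z = 1 / (of_real pi * \<i>) *
     (LINT t|lebesgue. (1 / (of_real t - z) - of_real (t / (1 + t\<^sup>2))) * of_real (v t))"

definition poisson_weight :: "(real \<Rightarrow> real) \<Rightarrow> bool" where
  "poisson_weight v \<longleftrightarrow> integrable lebesgue (\<lambda>t. v t / (1 + t\<^sup>2))"

definition poisson_real :: "(real \<Rightarrow> real) \<Rightarrow> complex \<Rightarrow> real" where
  "poisson_real v z = (LINT t|lebesgue. poisson_kernel z t * v t)"

lemma one_plus_sq_pos: "1 + (t::real)\<^sup>2 > 0" by (simp add: add_pos_nonneg)

lemma poisson_real_integrable:
  "poisson_weight v \<Longrightarrow> Im z > 0 \<Longrightarrow> integrable lebesgue (\<lambda>t. poisson_kernel z t * v t)"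
  using poisson_int_integrable[of v z] by (simp add: poisson_weight_def)

lemma poisson_weight_measurable:
  assumes "poisson_weight v" shows "v \<in> borel_measurable lebesgue"
proof -
  have "(\<lambda>t. 1 + t\<^sup>2 :: real) \<in> borel_measurable lebesgue"
    by (intro continuous_measurable_lebesgue continuous_intros)
  then have "(\<lambda>t. v t / (1 + t\<^sup>2) * (1 + t\<^sup>2)) \<in> borel_measurable lebesgue"
    by (rule borel_measurable_times[OF borel_measurable_integrable[OF assms[unfolded poisson_weight_def]]])
  then show ?thesis using one_plus_sq_pos by (simp add: less_imp_neq[symmetric])
qed

lemma poisson_weight_bound:
  assumes w: "poisson_weight w" and v: "v \<in> borel_measurable lebesgue" and le: "AE t in lebesgue. \<bar>v t\<bar> \<le> w t"
  shows "poisson_weight v"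
  unfolding poisson_weight_def
proof (rule Bochner_Integration.integrable_bound)
  show "integrable lebesgue (\<lambda>t. w t / (1 + t\<^sup>2))" using w by (simp add: poisson_weight_def)
  have "(\<lambda>t. 1 + t\<^sup>2 :: real) \<in> borel_measurable lebesgue"
    by (intro continuous_measurable_lebesgue continuous_intros)
  then show "(\<lambda>t. v t / (1 + t\<^sup>2)) \<in> borel_measurable lebesgue" using v by measurable
  show "AE t in lebesgue. norm (v t / (1 + t\<^sup>2)) \<le> norm (w t / (1 + t\<^sup>2))"
    using le
  proof eventually_elim
    case (elim t)
    then have "\<bar>v t\<bar> / (1 + t\<^sup>2) \<le> \<bar>w t\<bar> / (1 + t\<^sup>2)" by (intro divide_right_mono) (auto simp: add_nonneg_nonneg)
    then show ?case by (simp add: abs_divide add_nonneg_nonneg)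
  qed
qed

lemma poisson_weight_add: "poisson_weight v \<Longrightarrow> poisson_weight w \<Longrightarrow> poisson_weight (\<lambda>t. v t + w t)"
  unfolding poisson_weight_def by (simp add: add_divide_distrib)

lemma poisson_weight_cmult: "poisson_weight v \<Longrightarrow> poisson_weight (\<lambda>t. c * v t)"
  unfolding poisson_weight_def using integrable_mult_right[of c lebesgue "\<lambda>t. v t / (1 + t\<^sup>2)"] by simp

lemma poisson_weight_const: "poisson_weight (\<lambda>t. c)"
  unfolding poisson_weight_def using integrable_mult_right[of c, OF integrable_inverse_1_plus_square] by simp

lemma poisson_real_mono:
  assumes u: "poisson_weight u" and w: "poisson_weight w" and le: "AE t in lebesgue. u t \<le> w t" and z: "Im z > 0"
  shows "poisson_real u z \<le> poisson_real w z"
  unfolding poisson_real_def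
  by (rule integral_mono_AE[OF poisson_real_integrable[OF u z] poisson_real_integrable[OF w z]])
     (use le poisson_kernel_nonneg[OF z] in \<open>auto elim!: eventually_mono intro: mult_left_mono\<close>)

lemma poisson_weight_Cauchy_class:
  assumes v: "poisson_weight v" shows "(\<lambda>t. of_real (v t / (1 + t\<^sup>2))) \<in> Cauchy_class"
proof -
  have "integrable lebesgue (\<lambda>t. complex_of_real (v t / (1 + t\<^sup>2)))" using v by (simp only: poisson_weight_def complex_of_real_integrable_eq)
  then have "integrable lebesgue (\<lambda>t. complex_of_real (v t / (1 + t\<^sup>2)) * (1 / (\<i> + of_real t)))"
  proof (rule integrable_bounded_mult)
    show "AE t in lebesgue. norm (1 / (\<i> + complex_of_real t)) \<le> 1"
      using norm_i_plus_ge_1 by (auto simp: norm_divide divide_le_eq)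
  qed measurable
  then show ?thesis by (simp add: Cauchy_class_def)
qed

text \<open>The kernel splits into a Cauchy kernel and a constant in \<open>t\<close>, both against the density
  \<open>v t / (1 + t\<^sup>2)\<close>; this gives convergence and holomorphy.\<close>

lemma schwarz_kernel:
  assumes z: "Im z \<noteq> 0"
  shows "(1 / (of_real t - z) - of_real (t / (1 + t\<^sup>2))) * of_real (v t)
    = z * of_real (v t / (1 + t\<^sup>2)) + (1 + z\<^sup>2) * (of_real (v t / (1 + t\<^sup>2)) / (of_real t - z))"
proof -
  have tz: "of_real t - z \<noteq> 0" using z by (rule real_minus_neq_0)
  have t1: "complex_of_real (1 + t\<^sup>2) \<noteq> 0" using one_plus_sq_pos[of t] by (simp del: of_real_add)
  define D where "D = complex_of_real (1 + t\<^sup>2)"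
  have D: "D = 1 + (of_real t)\<^sup>2" "D \<noteq> 0" using t1 by (simp_all add: D_def)
  have "1 / (of_real t - z) - of_real t / D = (1 + of_real t * z) / ((of_real t - z) * D)"
    using tz D(2) by (simp add: diff_frac_eq) (simp add: D(1) power2_eq_square algebra_simps)
  also have "1 + of_real t * z = z * (of_real t - z) + (1 + z\<^sup>2)" by (simp add: power2_eq_square algebra_simps)
  also have "(z * (of_real t - z) + (1 + z\<^sup>2)) / ((of_real t - z) * D) = z / D + (1 + z\<^sup>2) * (1 / D / (of_real t - z))"
    using tz D(2) by (simp add: add_divide_distrib mult.commute)
  finally have "(1 / (of_real t - z) - of_real t / D) * of_real (v t) = (z / D + (1 + z\<^sup>2) * (1 / D / (of_real t - z))) * of_real (v t)"
    by (rule arg_cong)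
  also have "\<dots> = z * (of_real (v t) / D) + (1 + z\<^sup>2) * (of_real (v t) / D / (of_real t - z))"
    by (simp only: distrib_right times_divide_eq_left times_divide_eq_right mult_1_left mult.assoc)
  finally show ?thesis unfolding of_real_divide D_def[symmetric] .
qed

lemma schwarz_integrable:
  assumes v: "poisson_weight v" and z: "Im z \<noteq> 0"
  shows "integrable lebesgue (\<lambda>t. (1 / (of_real t - z) - of_real (t / (1 + t\<^sup>2))) * complex_of_real (v t))"
    and "schwarz v z = 1 / (of_real pi * \<i>) * (z * of_real (LINT t|lebesgue. v t / (1 + t\<^sup>2)) + (1 + z\<^sup>2) * cauchy_tr (\<lambda>t. of_real (v t / (1 + t\<^sup>2))) z)"
proof -
  have 1: "integrable lebesgue (\<lambda>t. complex_of_real (v t / (1 + t\<^sup>2)))" using v by (simp only: poisson_weight_def complex_of_real_integrable_eq)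
  have 2: "integrable lebesgue (\<lambda>t. complex_of_real (v t / (1 + t\<^sup>2)) / (of_real t - z))"
    by (rule Cauchy_class_cauchy_integrable[OF poisson_weight_Cauchy_class[OF v] z])
  show "integrable lebesgue (\<lambda>t. (1 / (of_real t - z) - of_real (t / (1 + t\<^sup>2))) * complex_of_real (v t))"
    unfolding schwarz_kernel[OF z] by (intro Bochner_Integration.integrable_add integrable_mult_right 1 2)
  show "schwarz v z = 1 / (of_real pi * \<i>) * (z * of_real (LINT t|lebesgue. v t / (1 + t\<^sup>2)) + (1 + z\<^sup>2) * cauchy_tr (\<lambda>t. of_real (v t / (1 + t\<^sup>2))) z)"
    unfolding schwarz_def schwarz_kernel[OF z]
    by (subst Bochner_Integration.integral_add[OF integrable_mult_right[OF 1] integrable_mult_right[OF 2]])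
       (simp only: integral_mult_right_zero cauchy_tr_def integral_complex_of_real)
qed

lemma schwarz_holomorphic:
  assumes v: "poisson_weight v" shows "schwarz v holomorphic_on upper_half_plane"
proof -
  let ?c = "cauchy_tr (\<lambda>t. of_real (v t / (1 + t\<^sup>2)))"
  have "(\<lambda>z. 1 / (of_real pi * \<i>) * (z * of_real (LINT t|lebesgue. v t / (1 + t\<^sup>2)) + (1 + z\<^sup>2) * ?c z)) holomorphic_on upper_half_plane"
    by (intro holomorphic_intros cauchy_tr_holomorphic_upper[OF poisson_weight_Cauchy_class[OF v]]) auto
  then show ?thesis
    by (rule holomorphic_transform) (simp add: schwarz_integrable(2)[OF v] upper_half_plane_def)
qed

lemma Re_schwarz:
  assumes v: "poisson_weight v" and z: "Im z > 0"
  shows "Re (schwarz v z) = poisson_real v z"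
proof -
  let ?f = "\<lambda>t. (1 / (of_real t - z) - of_real (t / (1 + t\<^sup>2))) * complex_of_real (v t)"
  have int: "integrable lebesgue ?f" using z by (intro schwarz_integrable v) simp
  have "Re (1 / (of_real pi * \<i>) * J) = Im J / pi" for J :: complex
    by (simp add: Re_divide power2_eq_square)
  then have "Re (schwarz v z) = Im (LINT t|lebesgue. ?f t) / pi" by (simp only: schwarz_def)
  also have "Im (LINT t|lebesgue. ?f t) = (LINT t|lebesgue. Im (?f t))" by (rule integral_Im[OF int, symmetric])
  also have "(\<lambda>t. Im (?f t)) = (\<lambda>t. pi * (poisson_kernel z t * v t))"
  proof
    fix t
    have "Im (1 / (of_real t - z)) = Im z / (norm (of_real t - z))\<^sup>2"
      by (simp add: Im_divide cmod_power2)
    then show "Im (?f t) = pi * (poisson_kernel z t * v t)" by (simp add: poisson_kernel_norm)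
  qed
  finally show ?thesis by (simp add: poisson_real_def)
qed

text \<open>Jensen's inequality: integrate the tangent line bound \<open>e\<^sup>u \<ge> e\<^sup>m (1 + u - m)\<close> at the mean
  \<open>m\<close> of \<open>u\<close>.\<close>

lemma poisson_exp_jensen:
  assumes u: "poisson_weight u" and eu: "poisson_weight (\<lambda>t. exp (u t))" and z: "Im z > 0"
  shows "exp (poisson_real u z) \<le> poisson_real (\<lambda>t. exp (u t)) z"
proof -
  let ?m = "poisson_real u z"
  have k: "integrable lebesgue (poisson_kernel z)" "(LINT t|lebesgue. poisson_kernel z t) = 1"
    using poisson_kernel_has_integral[OF z] by (auto simp: has_bochner_integral_iff)
  note iu = poisson_real_integrable[OF u z] and ie = poisson_real_integrable[OF eu z]
  have "(LINT t|lebesgue. a * poisson_kernel z t + b * (poisson_kernel z t * u t)) = a * 1 + b * ?m" for a b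
    using k iu by (simp add: poisson_real_def)
  from this[of "exp ?m * (1 - ?m)" "exp ?m"]
  have "exp ?m = (LINT t|lebesgue. exp ?m * (1 - ?m) * poisson_kernel z t + exp ?m * (poisson_kernel z t * u t))"
    by (simp add: algebra_simps)
  also have "\<dots> \<le> (LINT t|lebesgue. poisson_kernel z t * exp (u t))"
  proof (rule integral_mono[OF _ ie])
    show "integrable lebesgue (\<lambda>t. exp ?m * (1 - ?m) * poisson_kernel z t + exp ?m * (poisson_kernel z t * u t))"
      using k iu by (intro Bochner_Integration.integrable_add integrable_mult_right) auto
    fix t
    have "exp ?m * (1 + (u t - ?m)) \<le> exp ?m * exp (u t - ?m)" by (intro mult_left_mono exp_ge_add_one_self) simp
    then have "exp ?m * (1 + (u t - ?m)) \<le> exp (u t)" by (simp flip: exp_add)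
    from mult_left_mono[OF this poisson_kernel_nonneg[OF z, of t]]
    show "exp ?m * (1 - ?m) * poisson_kernel z t + exp ?m * (poisson_kernel z t * u t) \<le> poisson_kernel z t * exp (u t)"
      by (simp add: algebra_simps)
  qed
  finally show ?thesis by (simp add: poisson_real_def)
qed

lemma poisson_kernel_at_0: "poisson_kernel (Complex t y) 0 = - Im (1 / Complex t y) / pi"
  by (simp add: poisson_kernel_def Im_divide power2_eq_square)

text \<open>Apply the Poisson formula to \<open>w \<mapsto> 1 / (w + \<i> s)\<close>, whose imaginary part on the line is a
  multiple of the kernel at height \<open>s\<close>.\<close>

lemma poisson_kernel_convolution:
  assumes y: "y > 0" and s: "s > 0"
  shows "(LINT x|lebesgue. poisson_kernel (Complex t y) x * poisson_kernel (Complex x s) 0) = poisson_kernel (Complex t (y + s)) 0"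
proof -
  define G where "G = (\<lambda>w. 1 / (w + \<i> * of_real s))"
  have ne: "w + \<i> * of_real s \<noteq> 0" if "- s < Im w" for w using that by (auto simp: complex_eq_iff)
  have sg: "s \<le> norm (w + \<i> * of_real s)" if "0 \<le> Im w" for w
    using abs_Im_le_cmod[of "w + \<i> * of_real s"] that s by simp
  have "poisson_int (\<lambda>t. G (of_real t)) (Complex t y) = G (Complex t y)"
  proof (rule poisson_formula_bounded[where a = "- s" and B = "1 / s"])
    show "G holomorphic_on {z. - s < Im z}" unfolding G_def using ne by (intro holomorphic_intros) auto
    show "norm (G w) \<le> 1 / s" if "0 \<le> Im w" for w
      using sg[OF that] s by (simp add: G_def norm_divide frac_le)
  qed (use y s in auto)
  then have eq: "(LINT x|lebesgue. of_real (poisson_kernel (Complex t y) x) * G (of_real x)) = G (Complex t y)"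
    by (simp add: poisson_int_def)
  have int: "integrable lebesgue (\<lambda>x. of_real (poisson_kernel (Complex t y) x) * G (of_real x))"
  proof (rule integrable_bounded_mult)
    show "integrable lebesgue (\<lambda>x. complex_of_real (poisson_kernel (Complex t y) x))"
      using poisson_kernel_has_integral[of "Complex t y"] y by (auto simp: has_bochner_integral_iff)
    show "(\<lambda>x. G (complex_of_real x)) \<in> borel_measurable lebesgue" unfolding G_def by measurable
    show "AE x in lebesgue. norm (G (complex_of_real x)) \<le> 1 / s"
      using sg s by (auto simp: G_def norm_divide frac_le)
  qed
  have "G (of_real x) = 1 / Complex x s" "G (Complex t y) = 1 / Complex t (y + s)" for x
    by (simp_all add: G_def complex_eq_iff Re_divide Im_divide)
  note G = this
  have "- Im (G (Complex t y)) / pi = - (LINT x|lebesgue. Im (of_real (poisson_kernel (Complex t y) x) * G (of_real x))) / pi"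
    by (simp only: eq[symmetric] integral_Im[OF int])
  also have "\<dots> = (LINT x|lebesgue. - Im (of_real (poisson_kernel (Complex t y) x) * G (of_real x)) / pi)"
    by simp
  also have "\<dots> = (LINT x|lebesgue. poisson_kernel (Complex t y) x * poisson_kernel (Complex x s) 0)"
  proof (intro Bochner_Integration.integral_cong refl)
    fix x
    have im: "Im (complex_of_real r * w) = r * Im w" for r w by simp
    show "- Im (of_real (poisson_kernel (Complex t y) x) * G (of_real x)) / pi = poisson_kernel (Complex t y) x * poisson_kernel (Complex x s) 0"
      unfolding poisson_kernel_at_0[of x s] G(1) im by simp
  qed
  finally show ?thesis by (simp add: poisson_kernel_at_0 G)
qed

text \<open>On the line at height \<open>y\<close> the weight \<open>1 / \<bar>\<i> + z\<bar>\<^sup>2\<close> is \<open>\<pi> / (1 + y)\<close> times a Poisson kernel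
  at height \<open>1 + y\<close>. Integrating the Poisson integral of \<open>m\<close> against it gives, by the
  semigroup property, the integral of \<open>m\<close> against the kernel at height \<open>1 + 2 y\<close>, and
  \<open>(1 + 2 y) / ((1 + y) (t\<^sup>2 + (1 + 2 y)\<^sup>2)) \<le> 2 / (1 + t\<^sup>2)\<close>.\<close>

lemma poisson_line_mass:
  assumes m: "poisson_weight m" and m0: "\<And>t. m t \<ge> 0" and y: "y > 0"
  shows "(\<integral>\<^sup>+x. ennreal (poisson_real m (Complex x y) / (norm (\<i> + Complex x y))\<^sup>2) \<partial>lebesgue) \<le> ennreal (2 * (LINT t|lebesgue. m t / (1 + t\<^sup>2)))"
proof -
  define s where "s = 1 + y"
  have s: "s > 0" "s > 1" using y by (simp_all add: s_def)
  let ?k = "\<lambda>x t. poisson_kernel (Complex x y) t"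
  let ?G = "\<lambda>x. poisson_kernel (Complex x s) 0"
  have kn: "?k x t \<ge> 0" for x t using y by (intro poisson_kernel_nonneg) simp
  have Gn: "?G x \<ge> 0" for x using s by (intro poisson_kernel_nonneg) simp
  have mm: "m \<in> borel_measurable lebesgue" by (rule poisson_weight_measurable[OF m])
  have Gm: "?G \<in> borel_measurable lebesgue" unfolding poisson_kernel_sym[of _ s 0] by measurable
  have Geq: "1 / (norm (\<i> + Complex x y))\<^sup>2 = pi / s * ?G x" for x
    using s by (simp add: s_def poisson_kernel_def cmod_power2 add.commute)
  have "(\<integral>\<^sup>+x. ennreal (poisson_real m (Complex x y) / (norm (\<i> + Complex x y))\<^sup>2) \<partial>lebesgue)
      = (\<integral>\<^sup>+x. ennreal (pi / s) * (\<integral>\<^sup>+t. ennreal (?k x t) * ennreal (m t) * ennreal (?G x) \<partial>lebesgue) \<partial>lebesgue)"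
  proof (rule nn_integral_cong)
    fix x
    have z: "Im (Complex x y) > 0" using y by simp
    have "ennreal (poisson_real m (Complex x y)) = (\<integral>\<^sup>+t. ennreal (?k x t * m t) \<partial>lebesgue)"
      unfolding poisson_real_def using kn m0 by (intro nn_integral_eq_integral[symmetric] poisson_real_integrable m z) auto
    also have "\<dots> = (\<integral>\<^sup>+t. ennreal (?k x t) * ennreal (m t) \<partial>lebesgue)" using kn m0 by (simp add: ennreal_mult)
    finally have P: "ennreal (poisson_real m (Complex x y)) = (\<integral>\<^sup>+t. ennreal (?k x t) * ennreal (m t) \<partial>lebesgue)" .
    have Pn: "poisson_real m (Complex x y) \<ge> 0" unfolding poisson_real_def using kn m0 by (intro integral_nonneg_AE) auto
    have "ennreal (poisson_real m (Complex x y) / (norm (\<i> + Complex x y))\<^sup>2) = ennreal (poisson_real m (Complex x y) * (pi / s * ?G x))"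
      by (simp only: Geq[symmetric]) simp
    also have "\<dots> = ennreal (pi / s) * (ennreal (poisson_real m (Complex x y)) * ennreal (?G x))"
    proof -
      have a: "0 \<le> pi / s" "0 \<le> poisson_real m (Complex x y) * ?G x" using s Pn Gn[of x] by auto
      show ?thesis unfolding ennreal_mult[OF Pn Gn, symmetric] ennreal_mult[OF a, symmetric] by (simp only: mult.left_commute)
    qed
    also have "ennreal (poisson_real m (Complex x y)) * ennreal (?G x) = (\<integral>\<^sup>+t. ennreal (?k x t) * ennreal (m t) * ennreal (?G x) \<partial>lebesgue)"
      unfolding P by (rule nn_integral_multc[symmetric]) (use mm in measurable)
    finally show "ennreal (poisson_real m (Complex x y) / (norm (\<i> + Complex x y))\<^sup>2) = ennreal (pi / s) * (\<integral>\<^sup>+t. ennreal (?k x t) * ennreal (m t) * ennreal (?G x) \<partial>lebesgue)" .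
  qed
  also have "\<dots> = ennreal (pi / s) * (\<integral>\<^sup>+x. \<integral>\<^sup>+t. ennreal (?k x t) * ennreal (m t) * ennreal (?G x) \<partial>lebesgue \<partial>lebesgue)"
  proof (rule nn_integral_cmult)
    have "(\<lambda>p. ennreal (?k (fst p) (snd p)) * ennreal (m (snd p)) * ennreal (?G (fst p))) \<in> borel_measurable (lebesgue \<Otimes>\<^sub>M lebesgue)"
      using poisson_kernel_product_measurable[of y] mm Gm by measurable
    then show "(\<lambda>x. \<integral>\<^sup>+t. ennreal (?k x t) * ennreal (m t) * ennreal (?G x) \<partial>lebesgue) \<in> borel_measurable lebesgue"
      by (intro sigma_finite_measure.borel_measurable_nn_integral[OF sigma_finite_lebesgue]) (simp add: case_prod_beta')
  qed
  also have "(\<integral>\<^sup>+x. \<integral>\<^sup>+t. ennreal (?k x t) * ennreal (m t) * ennreal (?G x) \<partial>lebesgue \<partial>lebesgue)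
      = (\<integral>\<^sup>+t. \<integral>\<^sup>+x. ennreal (?k x t) * ennreal (m t) * ennreal (?G x) \<partial>lebesgue \<partial>lebesgue)"
    using mm Gm by (intro nn_integral_poisson_swap) auto
  also have "ennreal (pi / s) * \<dots> = (\<integral>\<^sup>+t. ennreal (pi / s) * (\<integral>\<^sup>+x. ennreal (?k x t) * ennreal (m t) * ennreal (?G x) \<partial>lebesgue) \<partial>lebesgue)"
  proof (rule nn_integral_cmult[symmetric])
    have "(\<lambda>p. ennreal (?k (snd p) (fst p)) * ennreal (m (fst p)) * ennreal (?G (snd p))) \<in> borel_measurable (lebesgue \<Otimes>\<^sub>M lebesgue)"
      unfolding poisson_kernel_sym[of "snd _" y] using poisson_kernel_product_measurable[of y] mm Gm by measurable
    then show "(\<lambda>t. \<integral>\<^sup>+x. ennreal (?k x t) * ennreal (m t) * ennreal (?G x) \<partial>lebesgue) \<in> borel_measurable lebesgue"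
      by (intro sigma_finite_measure.borel_measurable_nn_integral[OF sigma_finite_lebesgue]) (simp add: case_prod_beta')
  qed
  also have "\<dots> \<le> (\<integral>\<^sup>+t. ennreal (2 * (m t / (1 + t\<^sup>2))) \<partial>lebesgue)"
  proof (rule nn_integral_mono)
    fix t
    have ik: "integrable lebesgue (\<lambda>x. poisson_kernel (Complex t y) x * ?G x)"
    proof (rule integrable_bounded_mult[OF _ Gm])
      show "integrable lebesgue (poisson_kernel (Complex t y))"
        using poisson_kernel_has_integral[of "Complex t y"] y by (simp add: has_bochner_integral_iff)
      have "?G x \<le> 1 / (pi * s)" for x
      proof -
        have "s / (pi * (x\<^sup>2 + s\<^sup>2)) \<le> s / (pi * s\<^sup>2)" using s by (intro divide_left_mono mult_left_mono) (auto intro!: mult_pos_pos add_nonneg_pos)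
        also have "\<dots> = 1 / (pi * s)" using s by (simp add: power2_eq_square)
        finally show ?thesis by (simp add: poisson_kernel_def)
      qed
      then show "AE x in lebesgue. norm (?G x) \<le> 1 / (pi * s)" using Gn by simp
    qed
    have "(\<integral>\<^sup>+x. ennreal (?k x t) * ennreal (m t) * ennreal (?G x) \<partial>lebesgue)
        = (\<integral>\<^sup>+x. ennreal (m t) * ennreal (poisson_kernel (Complex t y) x * ?G x) \<partial>lebesgue)"
    proof (rule nn_integral_cong)
      fix x show "ennreal (?k x t) * ennreal (m t) * ennreal (?G x) = ennreal (m t) * ennreal (poisson_kernel (Complex t y) x * ?G x)"
        using kn[of x t] Gn[of x] m0[of t] by (simp add: poisson_kernel_sym[of t y] ennreal_mult mult_ac)
    qed
    also have "\<dots> = ennreal (m t) * (\<integral>\<^sup>+x. ennreal (poisson_kernel (Complex t y) x * ?G x) \<partial>lebesgue)"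
      by (rule nn_integral_cmult) (use ik in auto)
    also have "(\<integral>\<^sup>+x. ennreal (poisson_kernel (Complex t y) x * ?G x) \<partial>lebesgue) = ennreal (poisson_kernel (Complex t (y + s)) 0)"
      unfolding poisson_kernel_convolution[OF y s(1), of t, symmetric]
    proof (rule nn_integral_eq_integral[OF ik])
      show "AE x in lebesgue. 0 \<le> poisson_kernel (Complex t y) x * ?G x"
        using y s by (intro AE_I2 mult_nonneg_nonneg poisson_kernel_nonneg) auto
    qed
    finally have I: "(\<integral>\<^sup>+x. ennreal (?k x t) * ennreal (m t) * ennreal (?G x) \<partial>lebesgue) = ennreal (m t) * ennreal (poisson_kernel (Complex t (y + s)) 0)" .
    have n: "0 \<le> pi / s" "0 \<le> poisson_kernel (Complex t (y + s)) 0" using s y poisson_kernel_nonneg[of "Complex t (y + s)" 0] by auto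
    have "ennreal (pi / s) * (\<integral>\<^sup>+x. ennreal (?k x t) * ennreal (m t) * ennreal (?G x) \<partial>lebesgue) = ennreal (pi / s * (m t * poisson_kernel (Complex t (y + s)) 0))"
      unfolding I ennreal_mult[OF m0 n(2), symmetric] ennreal_mult[OF n(1) mult_nonneg_nonneg[OF m0 n(2)], symmetric] ..
    also have "\<dots> \<le> ennreal (2 * (m t / (1 + t\<^sup>2)))"
    proof (rule ennreal_leI)
      have "pi / s * poisson_kernel (Complex t (y + s)) 0 = (y + s) / (s * (t\<^sup>2 + (y + s)\<^sup>2))"
        by (simp add: poisson_kernel_def)
      also have "\<dots> \<le> (2 * s) / (s * (1 + t\<^sup>2))"
      proof (rule frac_le)
        have "1 \<le> (y + s)\<^sup>2" using y s by (intro one_le_power) simp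
        then show "s * (1 + t\<^sup>2) \<le> s * (t\<^sup>2 + (y + s)\<^sup>2)" using s by (intro mult_left_mono) auto
      qed (use y s one_plus_sq_pos[of t] in \<open>auto simp: s_def intro!: mult_pos_pos\<close>)
      also have "\<dots> = 2 / (1 + t\<^sup>2)" using s by simp
      finally show "pi / s * (m t * poisson_kernel (Complex t (y + s)) 0) \<le> 2 * (m t / (1 + t\<^sup>2))"
        using mult_left_mono[of _ _ "m t"] m0[of t] by (fastforce simp: mult_ac)
    qed
    finally show "ennreal (pi / s) * (\<integral>\<^sup>+x. ennreal (?k x t) * ennreal (m t) * ennreal (?G x) \<partial>lebesgue) \<le> ennreal (2 * (m t / (1 + t\<^sup>2)))" .
  qed
  also have "\<dots> = ennreal (LINT t|lebesgue. 2 * (m t / (1 + t\<^sup>2)))"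
  proof (rule nn_integral_eq_integral)
    show "integrable lebesgue (\<lambda>t. 2 * (m t / (1 + t\<^sup>2)))" using m unfolding poisson_weight_def by (rule integrable_mult_right)
    show "AE t in lebesgue. 0 \<le> 2 * (m t / (1 + t\<^sup>2))" using m0 one_plus_sq_pos by (auto simp: less_imp_le)
  qed
  also have "\<dots> = ennreal (2 * (LINT t|lebesgue. m t / (1 + t\<^sup>2)))" by (simp only: integral_mult_right_zero)
  finally show ?thesis .
qed

lemma hardy_function_criterion:
  assumes hol: "F holomorphic_on upper_half_plane" and m: "poisson_weight m" "\<And>t. m t \<ge> 0"
    and le: "\<And>z. Im z > 0 \<Longrightarrow> (norm (F z))\<^sup>2 \<le> poisson_real m z / (norm (\<i> + z))\<^sup>2"
  shows "hardy_function F"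
    and "y > 0 \<Longrightarrow> (LINT x|lebesgue. (norm (F (Complex x y)))\<^sup>2) \<le> 2 * (LINT t|lebesgue. m t / (1 + t\<^sup>2))"
proof -
  let ?C = "2 * (LINT t|lebesgue. m t / (1 + t\<^sup>2))"
  have C0: "?C \<ge> 0" using m(2) one_plus_sq_pos by (auto intro!: integral_nonneg_AE divide_nonneg_nonneg less_imp_le)
  have nn: "(\<integral>\<^sup>+x. ennreal ((norm (F (Complex x y)))\<^sup>2) \<partial>lebesgue) \<le> ennreal ?C" if y: "y > 0" for y
    by (rule order_trans[OF nn_integral_mono poisson_line_mass[OF m y]]) (use le y in \<open>auto intro!: ennreal_leI\<close>)
  have int: "integrable lebesgue (\<lambda>x. (norm (F (Complex x y)))\<^sup>2)" if y: "y > 0" for y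
  proof (rule integrableI_bounded)
    show "(\<lambda>x. (norm (F (Complex x y)))\<^sup>2) \<in> borel_measurable lebesgue"
      using continuous_measurable_lebesgue[OF hardy_line_continuous[OF hol y]] by measurable
    show "(\<integral>\<^sup>+ x. ennreal (norm ((cmod (F (Complex x y)))\<^sup>2)) \<partial>lebesgue) < \<infinity>"
      using order_le_less_trans[OF nn[OF y] ennreal_less_top] by simp
  qed
  have val: "(LINT x|lebesgue. (norm (F (Complex x y)))\<^sup>2) \<le> ?C" if y: "y > 0" for y
    using nn[OF y] C0 by (subst (asm) nn_integral_eq_integral[OF int[OF y]]) (auto simp: ennreal_le_iff)
  show "hardy_function F" unfolding hardy_function_def using hol int val by blast
  show "y > 0 \<Longrightarrow> (LINT x|lebesgue. (norm (F (Complex x y)))\<^sup>2) \<le> ?C" by (rule val)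
qed


section \<open>Outer functions\<close>

text \<open>The extensions of \<open>cayley\<close> and \<open>cayley_fun\<close> to the half-plane.\<close>

definition disc_map :: "complex \<Rightarrow> complex" where "disc_map z = (\<i> - z) / (\<i> + z)"
definition cayley_ext :: "nat \<Rightarrow> complex \<Rightarrow> complex" where "cayley_ext n z = disc_map z ^ n / (\<i> + z)"

lemma i_plus_neq_0: "0 \<le> Im z \<Longrightarrow> \<i> + z \<noteq> 0" by (auto simp: complex_eq_iff)

lemma disc_map_holomorphic: "disc_map holomorphic_on upper_half_plane"
  unfolding disc_map_def using i_plus_neq_0 by (intro holomorphic_intros) (auto simp: upper_half_plane_def)
lemma cayley_ext_holomorphic: "cayley_ext n holomorphic_on upper_half_plane"
  unfolding cayley_ext_def using i_plus_neq_0 disc_map_holomorphic by (intro holomorphic_intros) (auto simp: upper_half_plane_def)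

lemma norm_disc_map: "Im z > 0 \<Longrightarrow> norm (disc_map z) < 1"
  using cayley_disc[of "- z"] by (simp add: disc_map_def)

lemma norm_cayley_ext_le: "Im z > 0 \<Longrightarrow> norm (cayley_ext n z) \<le> 1 / norm (\<i> + z)"
  unfolding cayley_ext_def norm_divide norm_power
  using norm_disc_map[of z] by (intro divide_right_mono power_le_one) auto

lemma disc_map_vertical: "((\<lambda>y. disc_map (Complex x y)) \<longlongrightarrow> cayley x) (at_right 0)"
  and cayley_ext_vertical: "((\<lambda>y. cayley_ext n (Complex x y)) \<longlongrightarrow> cayley_fun n x) (at_right 0)"
proof -
  have v: "((\<lambda>y. Complex x y) \<longlongrightarrow> of_real x) (at_right 0)"
  proof -
    have "((\<lambda>y. Complex x y) \<longlongrightarrow> Complex x 0) (at_right 0)" by (intro tendsto_intros)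
    then show ?thesis by (simp add: complex_of_real_def)
  qed
  show 1: "((\<lambda>y. disc_map (Complex x y)) \<longlongrightarrow> cayley x) (at_right 0)"
    unfolding disc_map_def cayley_def by (intro tendsto_intros v) simp
  show "((\<lambda>y. cayley_ext n (Complex x y)) \<longlongrightarrow> cayley_fun n x) (at_right 0)"
    unfolding cayley_ext_def cayley_fun_def by (intro tendsto_intros v 1) simp
qed

lemma boundary_measurable:
  assumes hol: "F holomorphic_on upper_half_plane" and bv: "has_boundary_values F f"
  shows "f \<in> borel_measurable lebesgue"
proof (rule borel_measurable_lebesgue_ae)
  define e where "e = (\<lambda>k. 1 / real (Suc k))"
  have e: "e k > 0" for k by (simp add: e_def)
  show "(\<lambda>x. lim (\<lambda>k. F (Complex x (e k)))) \<in> borel_measurable lebesgue"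
    by (intro borel_measurable_lim_metric continuous_measurable_lebesgue hardy_line_continuous hol e)
  have "e \<longlonglongrightarrow> 0" unfolding e_def using LIMSEQ_inverse_real_of_nat by (simp add: inverse_eq_divide)
  then have er: "filterlim e (at_right 0) sequentially"
    using less_imp_neq[OF e] e by (auto simp: filterlim_at intro!: always_eventually)
  show "AE x in lebesgue. lim (\<lambda>k. F (Complex x (e k))) = f x"
    using bv unfolding has_boundary_values_def
  proof eventually_elim
    case (elim x)
    have "(\<lambda>k. F (Complex x (e k))) \<longlonglongrightarrow> f x" by (rule filterlim_compose[OF elim er])
    then show ?case by (rule limI)
  qed
qed

definition log_mod :: "(complex \<Rightarrow> complex) \<Rightarrow> real \<Rightarrow> real" where
  "log_mod h t = ln (norm (bdry h t))"

context
  fixes h :: "complex \<Rightarrow> complex"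
  assumes outer: "outer_function h"
    and h_weight: "integrable lebesgue (\<lambda>x. (norm (bdry h x))\<^sup>2 / (1 + x\<^sup>2))"
begin

lemma outer_bv: "has_boundary_values h (bdry h)" and outer_nz: "AE t in lebesgue. bdry h t \<noteq> 0"
  and outer_log: "poisson_weight (log_mod h)"
  using outer unfolding outer_function_def poisson_weight_def log_mod_def by auto

lemma outer_formula: "\<exists>c. norm c = 1 \<and> (\<forall>z\<in>upper_half_plane. h z = c * exp (schwarz (log_mod h) z))"
  using outer unfolding outer_function_def schwarz_def log_mod_def by auto

lemma outer_holomorphic: "h holomorphic_on upper_half_plane"
proof -
  obtain c where c: "\<And>z. z \<in> upper_half_plane \<Longrightarrow> h z = c * exp (schwarz (log_mod h) z)" using outer_formula by blast
  have "(\<lambda>z. c * exp (schwarz (log_mod h) z)) holomorphic_on upper_half_plane"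
    by (intro holomorphic_intros schwarz_holomorphic outer_log)
  then show ?thesis by (rule holomorphic_transform) (simp add: c)
qed

lemma outer_measurable: "bdry h \<in> borel_measurable lebesgue"
  by (rule boundary_measurable[OF outer_holomorphic outer_bv])

lemma outer_weight: "poisson_weight (\<lambda>t. (norm (bdry h t))\<^sup>2)"
  using h_weight by (simp add: poisson_weight_def)

lemma log_mod_measurable: "log_mod h \<in> borel_measurable lebesgue"
  by (rule poisson_weight_measurable[OF outer_log])

lemma exp_log_mod: "AE t in lebesgue. exp (2 * log_mod h t) = (norm (bdry h t))\<^sup>2"
  using outer_nz
proof eventually_elim
  case (elim t)
  have "exp (2 * log_mod h t) = (exp (log_mod h t))\<^sup>2" by (simp add: power2_eq_square flip: exp_add)
  then show ?case using elim by (simp add: log_mod_def)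
qed

text \<open>The product is, up to a constant, the Schwarz exponential of \<open>log \<bar>h\<bar> + u\<close>; its squared
  modulus is the exponential of a Poisson integral, to which Jensen's inequality applies.\<close>

lemma outer_mult_bound:
  assumes u: "poisson_weight u" and w: "poisson_weight w"
    and le: "AE t in lebesgue. exp (2 * (log_mod h t + u t)) \<le> w t" and z: "Im z > 0"
  shows "(norm (h z * exp (schwarz u z)))\<^sup>2 \<le> poisson_real w z"
proof -
  obtain c where c: "norm c = 1" "\<And>z. z \<in> upper_half_plane \<Longrightarrow> h z = c * exp (schwarz (log_mod h) z)" using outer_formula by blast
  let ?s = "\<lambda>t. 2 * (log_mod h t + u t)"
  have s: "poisson_weight ?s" by (intro poisson_weight_cmult poisson_weight_add outer_log u)
  have es: "poisson_weight (\<lambda>t. exp (?s t))"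
    by (rule poisson_weight_bound[OF w]) (use poisson_weight_measurable[OF s] le in auto)
  have "norm (h z * exp (schwarz u z)) = exp (poisson_real (log_mod h) z) * exp (poisson_real u z)"
    using z c by (simp add: norm_mult Re_schwarz outer_log u upper_half_plane_def)
  then have "(norm (h z * exp (schwarz u z)))\<^sup>2 = exp (2 * (poisson_real (log_mod h) z + poisson_real u z))"
    by (simp add: power2_eq_square flip: exp_add)
  also have "2 * (poisson_real (log_mod h) z + poisson_real u z) = poisson_real ?s z"
    using poisson_real_integrable[OF outer_log z] poisson_real_integrable[OF u z]
    by (simp add: poisson_real_def distrib_left mult.left_commute[of _ 2])
  also have "exp (poisson_real ?s z) \<le> poisson_real (\<lambda>t. exp (?s t)) z" by (rule poisson_exp_jensen[OF s es z])
  also have "\<dots> \<le> poisson_real w z" by (rule poisson_real_mono[OF es w le z])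
  finally show ?thesis .
qed

lemma outer_bound: "Im z > 0 \<Longrightarrow> (norm (h z))\<^sup>2 \<le> poisson_real (\<lambda>t. (norm (bdry h t))\<^sup>2) z"
proof -
  assume z: "Im z > 0"
  have "(norm (h z * exp (schwarz (\<lambda>t. 0) z)))\<^sup>2 \<le> poisson_real (\<lambda>t. (norm (bdry h t))\<^sup>2) z"
    by (rule outer_mult_bound[OF poisson_weight_const outer_weight _ z])
       (use exp_log_mod in \<open>auto elim: eventually_mono\<close>)
  then show ?thesis by (simp add: schwarz_def)
qed

lemma outer_cayley_ext_hardy:
  assumes b: "b holomorphic_on upper_half_plane" and B: "\<And>z. Im z > 0 \<Longrightarrow> norm (b z) \<le> B"
  shows "hardy_function (\<lambda>z. h z * b z * cayley_ext n z)"
proof (rule hardy_function_criterion(1))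
  show "(\<lambda>z. h z * b z * cayley_ext n z) holomorphic_on upper_half_plane"
    by (intro holomorphic_intros outer_holomorphic b cayley_ext_holomorphic)
  show "poisson_weight (\<lambda>t. B\<^sup>2 * (norm (bdry h t))\<^sup>2)" by (intro poisson_weight_cmult outer_weight)
  fix z assume z: "Im z > 0"
  have "(norm (h z * b z * cayley_ext n z))\<^sup>2 = (norm (h z))\<^sup>2 * (norm (b z))\<^sup>2 * (norm (cayley_ext n z))\<^sup>2"
    by (simp add: norm_mult power_mult_distrib)
  also have "\<dots> \<le> poisson_real (\<lambda>t. (norm (bdry h t))\<^sup>2) z * B\<^sup>2 * (1 / norm (\<i> + z))\<^sup>2"
    using outer_bound[OF z] B[OF z] norm_cayley_ext_le[OF z, of n]
    by (intro mult_mono power_mono mult_nonneg_nonneg) (auto intro: order_trans[OF zero_le_power2])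
  also have "\<dots> = poisson_real (\<lambda>t. B\<^sup>2 * (norm (bdry h t))\<^sup>2) z / (norm (\<i> + z))\<^sup>2"
    by (simp add: poisson_real_def power_divide mult.left_commute[of _ "B\<^sup>2"])
  finally show "(norm (h z * b z * cayley_ext n z))\<^sup>2 \<le> poisson_real (\<lambda>t. B\<^sup>2 * (norm (bdry h t))\<^sup>2) z / (norm (\<i> + z))\<^sup>2" .
qed simp

lemma outer_cayley_fun_H2: "(\<lambda>x. bdry h x * cayley_fun n x) \<in> H2"
proof -
  have "hardy_function (\<lambda>z. h z * 1 * cayley_ext n z)" by (rule outer_cayley_ext_hardy[where B = 1]) auto
  moreover have "has_boundary_values (\<lambda>z. h z * 1 * cayley_ext n z) (\<lambda>x. bdry h x * 1 * cayley_fun n x)"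
    using outer_bv unfolding has_boundary_values_def
    by eventually_elim (intro tendsto_intros cayley_ext_vertical)
  ultimately have "(\<lambda>x. bdry h x * 1 * cayley_fun n x) \<in> H2" using hardy_boundary by (intro H2_I) blast+
  then show ?thesis by simp
qed

lemma outer_span_H2: assumes "m \<in> analytic_span" shows "(\<lambda>x. bdry h x * m x) \<in> H2"
proof -
  obtain K a where m: "m = (\<lambda>x. \<Sum>k<K. a k * cayley_fun k x)" by (rule analytic_spanE[OF assms])
  have "(\<lambda>x. \<Sum>k<K. a k * (bdry h x * cayley_fun k x)) \<in> H2"
    by (induction K) (auto intro!: H2_add H2_cmult outer_cayley_fun_H2 H2_zero)
  then show ?thesis by (simp add: m sum_distrib_left mult.left_commute)
qed

text \<open>Transport \<open>b\<close> to the disc and dilate it by a radius \<open>r < 1\<close>. The Taylor series of the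
  dilated function converges absolutely up to the boundary, so that \<open>g\<close> is orthogonal to the
  product of \<open>h\<close>, the dilated function and \<open>cayley_fun j\<close>. As \<open>r\<close> tends to 1 these products
  converge weakly to \<open>f0\<close>. The function \<open>f0\<close> stands for the boundary values of
  \<open>h b cayley_ext j\<close>; it is specified by its Poisson integral because \<open>b\<close> comes without
  boundary values.\<close>

lemma outer_orth_bounded:
  assumes g: "g \<in> H2" and orth: "\<And>n. l2_inner (\<lambda>x. bdry h x * cayley_fun n x) g = 0"
    and b: "b holomorphic_on upper_half_plane" and B: "\<And>z. Im z > 0 \<Longrightarrow> norm (b z) \<le> B"
    and f0: "f0 \<in> H2" and F0: "\<And>z. Im z > 0 \<Longrightarrow> poisson_int f0 z = h z * b z * cayley_ext j z"
  shows "l2_inner f0 g = 0"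
proof -
  \<comment> \<open>The function \<open>b\<close> in the variable \<open>w = disc_map z\<close>.\<close>
  define \<beta> where "\<beta> = (\<lambda>w. b (\<i> * (1 - w) / (1 + w)))"
  have pos: "Im (\<i> * (1 - w) / (1 + w)) > 0" if w: "norm w < 1" for w
  proof -
    have "(norm w)\<^sup>2 < 1" using w by (simp add: abs_square_less_1)
    then have 1: "(Re w)\<^sup>2 + (Im w)\<^sup>2 < 1" by (simp add: cmod_power2)
    have ne: "1 + w \<noteq> 0" using w by (metis add_eq_0_iff less_irrefl norm_minus_cancel norm_one)
    have "Im (\<i> * (1 - w) / (1 + w)) = (1 - ((Re w)\<^sup>2 + (Im w)\<^sup>2)) / ((1 + Re w)\<^sup>2 + (Im w)\<^sup>2)"
      by (simp add: Im_divide power2_eq_square algebra_simps)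
    moreover have "(1 + Re w)\<^sup>2 + (Im w)\<^sup>2 > 0" using ne by (auto simp: complex_eq_iff sum_power2_gt_zero_iff)
    ultimately show ?thesis using 1 by simp
  qed
  have \<beta>hol: "\<beta> holomorphic_on ball 0 1"
  proof -
    have ne: "1 + w \<noteq> 0" if "norm w < 1" for w :: complex using that by (metis add_eq_0_iff less_irrefl norm_minus_cancel norm_one)
    have "(b \<circ> (\<lambda>w. \<i> * (1 - w) / (1 + w))) holomorphic_on ball 0 1"
      by (rule holomorphic_on_compose_gen[OF _ b])
         (use pos ne in \<open>auto intro!: holomorphic_intros simp: upper_half_plane_def\<close>)
    then show ?thesis by (simp add: \<beta>_def o_def)
  qed
  have \<beta>b: "norm (\<beta> w) \<le> B" if "norm w < 1" for w using B[OF pos[OF that]] by (simp add: \<beta>_def)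
  have \<beta>d: "\<beta> (disc_map z) = b z" if z: "Im z > 0" for z
  proof -
    have iz: "\<i> + z \<noteq> 0" using z by (intro i_plus_neq_0) simp
    have "1 - disc_map z = 2 * z / (\<i> + z)" "1 + disc_map z = 2 * \<i> / (\<i> + z)"
      using iz by (simp_all add: disc_map_def diff_divide_eq_iff add_divide_eq_iff)
    then have "\<i> * (1 - disc_map z) / (1 + disc_map z) = z" using iz by simp
    then show ?thesis by (simp add: \<beta>_def)
  qed
  have B0: "B \<ge> 0" by (rule order_trans[OF norm_ge_zero \<beta>b[of 0]]) simp
  have \<beta>c: "isCont \<beta> w" if "norm w < 1" for w
    using holomorphic_on_imp_continuous_on[OF \<beta>hol] that by (simp add: continuous_on_eq_continuous_at)
  define a where "a = (\<lambda>k. (deriv ^^ k) \<beta> 0 / fact k)"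
  have taylor: "(\<lambda>k. a k * w ^ k) sums \<beta> w" if "norm w < 1" for w
    using holomorphic_power_series[OF \<beta>hol, of w] that by (simp add: a_def)
  have asum: "summable (\<lambda>k. norm (a k) * r ^ k)" if r: "0 \<le> r" "r < 1" for r :: real
  proof -
    obtain s where s: "r < s" "s < 1" using dense[OF r(2)] by blast
    have "summable (\<lambda>k. norm (a k * of_real r ^ k))"
      by (rule powser_insidea[OF sums_summable[OF taylor[of "of_real s"]]]) (use r s in auto)
    then show ?thesis using r by (simp add: norm_mult norm_power)
  qed
  note gL = H2_D(1)[OF g] and hL = H2_D(1)[OF outer_cayley_fun_H2]
  define f where "f = (\<lambda>r x. bdry h x * \<beta> (of_real r * cayley x) * cayley_fun j x)"
  define F where "F = (\<lambda>r z. h z * \<beta> (of_real r * disc_map z) * cayley_ext j z)"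
  have small: "norm (of_real r * disc_map z) < 1" if "0 \<le> r" "r < 1" "Im z > 0" for r z
    using norm_disc_map[OF that(3)] that mult_strict_mono'[of r 1 "norm (disc_map z)" 1] by (simp add: norm_mult)
  have smallr: "norm (of_real r * cayley x) < 1" if "0 \<le> r" "r < 1" for r x using that by (simp add: norm_mult)
  have Fh: "hardy_function (F r)" if r: "0 \<le> r" "r < 1" for r unfolding F_def
  proof (rule outer_cayley_ext_hardy)
    have "(\<beta> \<circ> (\<lambda>z. of_real r * disc_map z)) holomorphic_on upper_half_plane"
      by (rule holomorphic_on_compose_gen[OF _ \<beta>hol])
         (use small[OF r] in \<open>auto intro!: holomorphic_intros disc_map_holomorphic[unfolded upper_half_plane_def] simp: upper_half_plane_def\<close>)
    then show "(\<lambda>z. \<beta> (of_real r * disc_map z)) holomorphic_on upper_half_plane" by (simp add: o_def)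
    show "norm (\<beta> (of_real r * disc_map z)) \<le> B" if "Im z > 0" for z by (rule \<beta>b[OF small[OF r that]])
  qed
  have Fbv: "has_boundary_values (F r) (f r)" if r: "0 \<le> r" "r < 1" for r
    using outer_bv unfolding has_boundary_values_def F_def f_def
  proof eventually_elim
    case (elim x)
    have "isCont \<beta> (of_real r * cayley x)"
      by (rule \<beta>c[OF smallr[OF r]])
    then have "((\<lambda>y. \<beta> (of_real r * disc_map (Complex x y))) \<longlongrightarrow> \<beta> (of_real r * cayley x)) (at_right 0)"
      by (rule isCont_tendsto_compose) (intro tendsto_intros disc_map_vertical)
    then show ?case using elim by (intro tendsto_mult cayley_ext_vertical)
  qed
  have fH: "f r \<in> H2" and fP: "Im z > 0 \<Longrightarrow> poisson_int (f r) z = F r z" if r: "0 \<le> r" "r < 1" for r z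
    using hardy_boundary[OF Fh[OF r] Fbv[OF r]] by (auto intro: H2_I)
  have f0: "l2_inner (f r) g = 0" if r: "0 \<le> r" "r < 1" for r
  proof -
    let ?c = "\<lambda>k. a k * of_real r ^ k"
    let ?p = "\<lambda>k t. ?c k * (bdry h t * cayley_fun (k + j) t * cnj (g t))"
    have pi: "integrable lebesgue (\<lambda>t. bdry h t * cayley_fun (k + j) t * cnj (g t))" for k
      by (rule L2_inner_integrable[OF hL gL])
    have pn: "norm (?p k t) = norm (bdry h t * cayley_fun j t * cnj (g t)) * (norm (a k) * r ^ k)" for k t
      using r by (simp add: norm_mult norm_power norm_cayley_fun)
    have "(\<lambda>k. LINT t|lebesgue. ?p k t) sums (LINT t|lebesgue. (\<Sum>k. ?p k t))"
    proof (rule sums_integral)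
      show "integrable lebesgue (?p k)" for k by (intro integrable_mult_right pi)
      show "AE t in lebesgue. summable (\<lambda>k. norm (?p k t))" unfolding pn by (intro AE_I2 summable_mult asum r)
      show "summable (\<lambda>k. LINT t|lebesgue. norm (?p k t))"
        unfolding pn Bochner_Integration.integral_mult_left_zero by (intro summable_mult asum r)
    qed
    moreover have "(LINT t|lebesgue. ?p k t) = 0" for k
      using orth[of "k + j"] unfolding l2_inner_def by (simp only: integral_mult_right_zero mult_zero_right)
    ultimately have "(\<lambda>k. 0) sums (LINT t|lebesgue. (\<Sum>k. ?p k t))" by (simp only:)
    then have "(LINT t|lebesgue. (\<Sum>k. ?p k t)) = 0" using sums_unique2[OF _ sums_zero] by blast
    moreover have "(\<Sum>k. ?p k t) = f r t * cnj (g t)" for t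
    proof -
      have "(\<lambda>k. a k * (of_real r * cayley t) ^ k * (bdry h t * cayley_fun j t * cnj (g t))) sums (\<beta> (of_real r * cayley t) * (bdry h t * cayley_fun j t * cnj (g t)))"
        by (intro sums_mult2 taylor smallr r)
      moreover have "a k * (of_real r * cayley t) ^ k * (bdry h t * cayley_fun j t * cnj (g t)) = ?p k t" for k
        by (simp add: cayley_fun_def power_mult_distrib power_add mult_ac)
      ultimately have "(\<lambda>k. ?p k t) sums (\<beta> (of_real r * cayley t) * (bdry h t * cayley_fun j t * cnj (g t)))"
        by (simp only:)
      then show ?thesis by (simp add: sums_iff f_def mult_ac)
    qed
    ultimately show ?thesis by (simp add: l2_inner_def)
  qed
  define r where "r = (\<lambda>k. 1 - 1 / real (Suc k))"
  have r: "0 \<le> r k" "r k < 1" for k by (simp_all add: r_def)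
  have r1: "r \<longlonglongrightarrow> 1"
  proof -
    have "(\<lambda>k. 1 / real (Suc k)) \<longlonglongrightarrow> 0" using LIMSEQ_inverse_real_of_nat by (simp add: inverse_eq_divide)
    then have "r \<longlonglongrightarrow> 1 - 0" unfolding r_def by (intro tendsto_intros)
    then show ?thesis by simp
  qed
  have "(\<lambda>k. l2_inner (f (r k)) g) \<longlonglongrightarrow> l2_inner f0 g"
  proof (rule H2_weak_convergence[OF _ \<open>f0 \<in> H2\<close> _ _ gL])
    show "f (r k) \<in> H2" for k by (rule fH[OF r])
    show "norm (cls (f (r k))) \<le> B * norm (cls (\<lambda>x. bdry h x * cayley_fun j x))" for k
    proof (rule power2_le_imp_le)
      have "(norm (cls (f (r k))))\<^sup>2 \<le> (LINT x|lebesgue. B\<^sup>2 * (norm (bdry h x * cayley_fun j x))\<^sup>2)"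
        unfolding norm_cls_sq[OF H2_D(1)[OF fH[OF r]]]
      proof (rule integral_mono)
        fix x
        have "norm (f (r k) x) \<le> B * norm (bdry h x * cayley_fun j x)"
          using mult_right_mono[OF \<beta>b[OF smallr[OF r, of k x]], of "norm (bdry h x * cayley_fun j x)"]
          by (simp add: f_def norm_mult mult_ac)
        then have "(norm (f (r k) x))\<^sup>2 \<le> (B * norm (bdry h x * cayley_fun j x))\<^sup>2" by (intro power_mono) auto
        then show "(norm (f (r k) x))\<^sup>2 \<le> B\<^sup>2 * (norm (bdry h x * cayley_fun j x))\<^sup>2" by (simp add: power_mult_distrib)
      qed (use L2_integrable[OF H2_D(1)[OF fH[OF r]]] L2_integrable[OF hL] in auto)
      then show "(norm (cls (f (r k))))\<^sup>2 \<le> (B * norm (cls (\<lambda>x. bdry h x * cayley_fun j x)))\<^sup>2"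
        by (simp add: power_mult_distrib norm_cls_sq[OF hL])
    qed (use B0 in simp)
    fix z assume z: "Im z > 0"
    have "(\<lambda>k. of_real (r k) * disc_map z) \<longlonglongrightarrow> of_real 1 * disc_map z" by (intro tendsto_intros r1)
    then have "(\<lambda>k. of_real (r k) * disc_map z) \<longlonglongrightarrow> disc_map z" by simp
    then have "(\<lambda>k. \<beta> (of_real (r k) * disc_map z)) \<longlonglongrightarrow> \<beta> (disc_map z)"
      by (rule isCont_tendsto_compose[OF \<beta>c[OF norm_disc_map[OF z]]])
    then have "(\<lambda>k. F (r k) z) \<longlonglongrightarrow> h z * \<beta> (disc_map z) * cayley_ext j z" unfolding F_def by (intro tendsto_intros)
    then show "(\<lambda>k. poisson_int (f (r k)) z) \<longlonglongrightarrow> poisson_int f0 z"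
      using fP[OF r z] F0[OF z] \<beta>d[OF z] by simp
  qed
  then show ?thesis using f0[OF r] by (simp add: LIMSEQ_const_iff)
qed

text \<open>Bounded outer functions \<open>b n\<close> approximate \<open>1 / h\<close>: truncate \<open>- log \<bar>h\<bar>\<close> at \<open>\<plusminus> n\<close> and take
  the exponential of the Schwarz integral. Then \<open>\<bar>h b n\<bar>\<^sup>2 \<le> 1 + \<bar>h\<bar>\<^sup>2\<close> on the line, so the
  functions \<open>h (b n) cayley_fun j\<close> are bounded in \<open>H2\<close>, and in the half-plane they converge
  to a constant multiple of \<open>cayley_ext j\<close>. By \<open>outer_orth_bounded\<close> the function \<open>g\<close> is
  orthogonal to all of them, and hence to \<open>cayley_fun j\<close>.\<close>

lemma outer_orth_zero:
  assumes g: "g \<in> H2" and orth: "\<And>n. l2_inner (\<lambda>x. bdry h x * cayley_fun n x) g = 0"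
  shows "ae_eq g (\<lambda>x. 0)"
proof (rule H2_zero_of_orth[OF g])
  fix j
  obtain c where c: "norm c = 1" "\<And>z. z \<in> upper_half_plane \<Longrightarrow> h z = c * exp (schwarz (log_mod h) z)" using outer_formula by blast
  \<comment> \<open>\<open>- log \<bar>h\<bar>\<close> truncated to \<open>[- n, n]\<close>; at each point \<open>log \<bar>h\<bar> + u n\<close> is at most \<open>0\<close> or at
    most \<open>log \<bar>h\<bar>\<close>.\<close>
  define u where "u = (\<lambda>n::nat. \<lambda>t. max (- real n) (min (real n) (- log_mod h t)))"
  define m where "m = (\<lambda>t. 1 + (norm (bdry h t))\<^sup>2)"
  have m: "poisson_weight m" "\<And>t. m t \<ge> 0"
    unfolding m_def by (intro poisson_weight_add poisson_weight_const outer_weight) (simp add: add_nonneg_nonneg)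
  have um: "u n \<in> borel_measurable lebesgue" for n unfolding u_def using log_mod_measurable by measurable
  have u: "poisson_weight (u n)" for n
    by (rule poisson_weight_bound[OF poisson_weight_const[of "real n"] um]) (auto simp: u_def)
  define b where "b = (\<lambda>n z. exp (schwarz (u n) z))"
  have bhol: "b n holomorphic_on upper_half_plane" for n
    unfolding b_def by (intro holomorphic_intros schwarz_holomorphic u)
  have bB: "norm (b n z) \<le> exp (real n)" if z: "Im z > 0" for n z
  proof -
    have "poisson_real (u n) z \<le> poisson_real (\<lambda>t. real n) z"
      by (rule poisson_real_mono[OF u poisson_weight_const _ z]) (auto simp: u_def)
    also have "\<dots> = real n" using poisson_kernel_has_integral[OF z] by (simp add: poisson_real_def has_bochner_integral_iff)
    finally show ?thesis using z by (simp add: b_def Re_schwarz u)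
  qed
  have le: "AE t in lebesgue. exp (2 * (log_mod h t + u n t)) \<le> m t" for n
    using exp_log_mod
  proof eventually_elim
    case (elim t)
    show ?case
    proof (cases "log_mod h t \<le> real n")
      case True
      then have "log_mod h t + u n t \<le> 0" by (auto simp: u_def max_def min_def)
      then have "exp (2 * (log_mod h t + u n t)) \<le> 1" by simp
      also have "1 \<le> m t" by (simp add: m_def)
      finally show ?thesis .
    next
      case False
      then have "exp (2 * (log_mod h t + u n t)) \<le> exp (2 * log_mod h t)" by (auto simp: u_def)
      also have "\<dots> \<le> m t" using elim by (simp add: m_def)
      finally show ?thesis .
    qed
  qed
  let ?F = "\<lambda>n z. h z * b n z * cayley_ext j z"
  let ?C = "2 * (LINT t|lebesgue. m t / (1 + t\<^sup>2))"
  have Fb: "(norm (?F n z))\<^sup>2 \<le> poisson_real m z / (norm (\<i> + z))\<^sup>2" if z: "Im z > 0" for n z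
  proof -
    have "(norm (?F n z))\<^sup>2 = (norm (h z * b n z))\<^sup>2 * (norm (cayley_ext j z))\<^sup>2" by (simp add: norm_mult power_mult_distrib)
    also have "\<dots> \<le> poisson_real m z * (1 / norm (\<i> + z))\<^sup>2"
    proof (rule mult_mono)
      show 1: "(norm (h z * b n z))\<^sup>2 \<le> poisson_real m z" unfolding b_def by (rule outer_mult_bound[OF u m(1) le z])
      show "(norm (cayley_ext j z))\<^sup>2 \<le> (1 / norm (\<i> + z))\<^sup>2" using norm_cayley_ext_le[OF z] by (intro power_mono) auto
      show "0 \<le> poisson_real m z" by (rule order_trans[OF zero_le_power2 1])
    qed simp
    finally show ?thesis by (simp add: power_divide)
  qed
  have Fhol: "?F n holomorphic_on upper_half_plane" for n
    by (intro holomorphic_intros outer_holomorphic bhol cayley_ext_holomorphic)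
  have "\<exists>f. f \<in> H2 \<and> (\<forall>z. Im z > 0 \<longrightarrow> poisson_int f z = ?F n z) \<and> (norm (cls f))\<^sup>2 \<le> ?C" for n
  proof -
    have "hardy_function (?F n)" by (rule hardy_function_criterion(1)[OF Fhol m Fb])
    from hardy_function_limit[OF this] obtain f where f: "f \<in> L2" "\<forall>n. moment f n = 0" "\<forall>z. Im z > 0 \<longrightarrow> ?F n z = poisson_int f z"
      "\<forall>C. (\<forall>y>0. (LINT x|lebesgue. (norm (?F n (Complex x y)))\<^sup>2) \<le> C) \<longrightarrow> (norm (cls f))\<^sup>2 \<le> C" by blast
    have "\<forall>y>0. (LINT x|lebesgue. (norm (?F n (Complex x y)))\<^sup>2) \<le> ?C"
      using hardy_function_criterion(2)[OF Fhol m Fb] by blast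
    then have "(norm (cls f))\<^sup>2 \<le> ?C" using f(4) by blast
    moreover have "f \<in> H2" using f by (intro H2_I) auto
    ultimately show ?thesis using f(3) by auto
  qed
  then obtain f where f: "\<And>n. f n \<in> H2" "\<And>n z. Im z > 0 \<Longrightarrow> poisson_int (f n) z = ?F n z" "\<And>n. (norm (cls (f n)))\<^sup>2 \<le> ?C"
    by metis
  have f0: "l2_inner (f n) g = 0" for n
    by (rule outer_orth_bounded[OF g orth bhol bB f(1,2)])
  have cH: "(\<lambda>x. c * cayley_fun j x) \<in> H2" by (intro H2_cmult cayley_fun_H2)
  have crho: "poisson_int (\<lambda>x. c * cayley_fun j x) z = c * cayley_ext j z" if z: "Im z > 0" for z
  proof -
    have "poisson_int (cayley_fun j) z = cayley_ext j z"
    proof -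
      have "poisson_int (\<lambda>t. cayley_ext j (of_real t)) z = cayley_ext j z"
      proof (rule poisson_formula_bounded[where a = "- 1" and B = 1])
        have ne: "\<i> + w \<noteq> 0" if "- 1 < Im w" for w using that by (auto simp: complex_eq_iff)
        show "cayley_ext j holomorphic_on {z. - 1 < Im z}" unfolding cayley_ext_def disc_map_def
          using ne by (intro holomorphic_intros) auto
        fix w :: complex assume w: "0 \<le> Im w"
        have 1: "norm (\<i> - w) \<le> norm (\<i> + w)"
          by (rule power2_le_imp_le) (use w in \<open>simp_all add: cmod_power2 power2_diff power2_sum\<close>)
        have 2: "1 \<le> norm (\<i> + w)" using abs_Im_le_cmod[of "\<i> + w"] w by simp
        have "norm (disc_map w) \<le> 1" using 1 2 by (simp add: disc_map_def norm_divide divide_le_eq)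
        then have "norm (disc_map w) ^ j / norm (\<i> + w) \<le> 1 / 1" using 2 by (intro frac_le power_le_one) auto
        then show "norm (cayley_ext j w) \<le> 1" by (simp add: cayley_ext_def norm_divide norm_power)
      qed (use z in auto)
      moreover have "cayley_ext j (of_real t) = cayley_fun j t" for t by (simp add: cayley_ext_def disc_map_def cayley_fun_def cayley_def)
      ultimately show ?thesis by simp
    qed
    then show ?thesis unfolding poisson_int_inner l2_inner_cmult_left by simp
  qed
  have "(\<lambda>n. l2_inner (f n) g) \<longlonglongrightarrow> l2_inner (\<lambda>x. c * cayley_fun j x) g"
  proof (rule H2_weak_convergence[OF f(1) cH _ _ H2_D(1)[OF g]])
    show "norm (cls (f n)) \<le> sqrt ?C" for n by (rule real_le_rsqrt[OF f(3)])
    fix z assume z: "Im z > 0"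
    have zU: "z \<in> upper_half_plane" using z by (simp add: upper_half_plane_def)
    let ?K = "\<lambda>t. 1 / (of_real t - z) - of_real (t / (1 + t\<^sup>2))"
    have "(\<lambda>n. LINT t|lebesgue. ?K t * of_real (log_mod h t + u n t)) \<longlonglongrightarrow> (LINT t::real|lebesgue. 0)"
    proof (rule integral_dominated_convergence[where w = "\<lambda>t. norm (?K t * of_real (log_mod h t))"])
      have zi: "Im z \<noteq> 0" using z by simp
      show "integrable lebesgue (\<lambda>t. norm (?K t * of_real (log_mod h t)))"
        by (intro integrable_norm schwarz_integrable outer_log zi)
      show "(\<lambda>t. ?K t * of_real (log_mod h t + u n t)) \<in> borel_measurable lebesgue" for n
        by (intro borel_measurable_integrable schwarz_integrable poisson_weight_add outer_log u zi)
      show "AE t in lebesgue. (\<lambda>n. ?K t * of_real (log_mod h t + u n t)) \<longlonglongrightarrow> 0"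
      proof (rule AE_I2, rule tendsto_eventually, rule eventually_sequentiallyI)
        fix t and n assume "n \<ge> nat \<lceil>\<bar>log_mod h t\<bar>\<rceil>"
        then have "\<bar>log_mod h t\<bar> \<le> real n" by linarith
        then have "log_mod h t + u n t = 0" by (auto simp: u_def abs_le_iff)
        then show "?K t * of_real (log_mod h t + u n t) = 0" by simp
      qed
      show "AE t in lebesgue. norm (?K t * of_real (log_mod h t + u n t)) \<le> norm (?K t * of_real (log_mod h t))" for n
      proof (rule AE_I2)
        fix t
        have "\<bar>log_mod h t + u n t\<bar> \<le> \<bar>log_mod h t\<bar>" by (auto simp: u_def max_def min_def)
        then show "norm (?K t * of_real (log_mod h t + u n t)) \<le> norm (?K t * of_real (log_mod h t))"
          unfolding norm_mult norm_of_real by (rule mult_left_mono) simp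
      qed
    qed simp
    then have "(\<lambda>n. schwarz (\<lambda>t. log_mod h t + u n t) z) \<longlonglongrightarrow> 1 / (of_real pi * \<i>) * 0"
      unfolding schwarz_def by (intro tendsto_mult tendsto_const) simp
    then have "(\<lambda>n. c * exp (schwarz (\<lambda>t. log_mod h t + u n t) z) * cayley_ext j z) \<longlonglongrightarrow> c * exp (1 / (of_real pi * \<i>) * 0) * cayley_ext j z"
      by (intro tendsto_intros)
    moreover have "c * exp (schwarz (\<lambda>t. log_mod h t + u n t) z) = h z * b n z" for n
    proof -
      have zi: "Im z \<noteq> 0" using z by simp
      have "schwarz (\<lambda>t. log_mod h t + u n t) z = schwarz (log_mod h) z + schwarz (u n) z"
        unfolding schwarz_def using schwarz_integrable(1)[OF outer_log zi] schwarz_integrable(1)[OF u zi, of n]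
        by (simp only: of_real_add distrib_left Bochner_Integration.integral_add)
      then show ?thesis using c(2)[OF zU] by (simp add: b_def exp_add mult.assoc)
    qed
    ultimately show "(\<lambda>n. poisson_int (f n) z) \<longlonglongrightarrow> poisson_int (\<lambda>x. c * cayley_fun j x) z"
      using f(2)[OF z] crho[OF z] by simp
  qed
  then have "l2_inner (\<lambda>x. c * cayley_fun j x) g = 0" using f0 by (simp add: LIMSEQ_const_iff)
  then show "l2_inner (cayley_fun j) g = 0" using c(1) by (auto simp: l2_inner_cmult_left)
qed

text \<open>A form of Beurling's theorem for the outer function \<open>h\<close>, with the span of the \<open>r\<^sub>n\<close> in place
  of bounded analytic functions.\<close>

theorem outer_span_dense: "closure (cls ` (\<lambda>m x. bdry h x * m x) ` analytic_span) = H2_classes"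
  by (rule dense_in_H2_classes[OF outer_span_H2 outer_orth_zero])

text \<open>The hypothesis says that \<open>f\<close> is in the kernel of the Toeplitz operator with symbol
  \<open>h / cnj h\<close>. The moments of \<open>h f\<close> and of \<open>h g\<close> vanish, as they are integrals of products
  of two functions in \<open>H2\<close>, namely \<open>h cayley_fun n\<close> and \<open>f\<close> or \<open>g\<close>. As \<open>h g\<close> is the
  conjugate of \<open>h f\<close>, the latter is zero by \<open>Cauchy_class_AE_zero_of_moments\<close>. The product
  \<open>h f\<close> need not be square-integrable, but it belongs to \<open>Cauchy_class\<close>.\<close>

theorem outer_toeplitz_injective:
  assumes f: "f \<in> H2" and g: "g \<in> H2"
    and eq: "AE x in lebesgue. bdry h x * f x = cnj (bdry h x * g x)"
  shows "ae_eq f (\<lambda>x. 0)"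
proof -
  define k where "k = (\<lambda>x. bdry h x * f x)"
  have prod: "moment (\<lambda>x. bdry h x * p x) n = 0" if p: "p \<in> H2" for p n
    using H2_prod_zero[OF outer_cayley_fun_H2[of n] p] by (simp add: moment_def cayley_fun_def mult_ac)
  have L0: "(\<lambda>x. bdry h x * (1 / (\<i> + of_real x))) \<in> L2"
    using H2_D(1)[OF outer_cayley_fun_H2[of 0]] by (simp add: cayley_fun_def)
  have kC: "k \<in> Cauchy_class" unfolding Cauchy_class_def k_def
    using L2_mult_integrable[OF L0 H2_D(1)[OF f]] by (simp add: mult_ac)
  have "AE x in lebesgue. k x = 0"
  proof (rule Cauchy_class_AE_zero_of_moments[OF kC])
    show "moment k n = 0" for n unfolding k_def by (rule prod[OF f])
    fix n
    have "moment (\<lambda>t. cnj (k t)) n = moment (\<lambda>x. bdry h x * g x) n"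
      unfolding moment_def
    proof (rule integral_cong_AE)
      show "(\<lambda>t. cnj (k t) * (cayley t ^ n / (\<i> + of_real t))) \<in> borel_measurable lebesgue"
        by (intro borel_measurable_integrable Cauchy_class_moment_integrable Cauchy_class_cnj kC)
      have "(\<lambda>x. bdry h x * g x) \<in> Cauchy_class" unfolding Cauchy_class_def
        using L2_mult_integrable[OF L0 H2_D(1)[OF g]] by (simp add: mult_ac)
      then show "(\<lambda>t. bdry h t * g t * (cayley t ^ n / (\<i> + of_real t))) \<in> borel_measurable lebesgue"
        by (intro borel_measurable_integrable Cauchy_class_moment_integrable)
      show "AE t in lebesgue. cnj (k t) * (cayley t ^ n / (\<i> + of_real t)) = bdry h t * g t * (cayley t ^ n / (\<i> + of_real t))"
        using eq by eventually_elim (simp add: k_def)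
    qed
    then show "moment (\<lambda>t. cnj (k t)) n = 0" using prod[OF g] by simp
  qed
  then show ?thesis using outer_nz unfolding ae_eq_def by eventually_elim (simp add: k_def)
qed

end

section \<open>Multiplication by unimodular functions\<close>

definition unimodular :: "(real \<Rightarrow> complex) \<Rightarrow> bool" where
  "unimodular \<phi> \<longleftrightarrow> \<phi> \<in> borel_measurable lebesgue \<and> (AE t in lebesgue. norm (\<phi> t) = 1)"

definition mult_op :: "(real \<Rightarrow> complex) \<Rightarrow> l2 \<Rightarrow> l2" where
  "mult_op \<phi> x = cls (\<lambda>t. \<phi> t * rep x t)"

lemma unimodular_L2: "unimodular \<phi> \<Longrightarrow> f \<in> L2 \<Longrightarrow> (\<lambda>t. \<phi> t * f t) \<in> L2"
  unfolding unimodular_def by (intro L2_bounded_mult[of _ _ 1]) (auto elim: eventually_mono)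

lemma measurable_cnj: "f \<in> borel_measurable lebesgue \<Longrightarrow> (\<lambda>t. cnj (f t)) \<in> borel_measurable lebesgue"
  by (rule measurable_compose[OF _ borel_measurable_continuous_onI]) (auto intro: continuous_intros)

lemma unimodular_cnj: "unimodular \<phi> \<Longrightarrow> unimodular (\<lambda>t. cnj (\<phi> t))"
  unfolding unimodular_def by (auto intro: measurable_cnj)

lemma mult_op_cls:
  assumes \<phi>: "unimodular \<phi>" and f: "f \<in> L2"
  shows "mult_op \<phi> (cls f) = cls (\<lambda>t. \<phi> t * f t)"
  unfolding mult_op_def
proof (subst cls_eq_iff)
  show "ae_eq (\<lambda>t. \<phi> t * rep (cls f) t) (\<lambda>t. \<phi> t * f t)"
    using rep_cls[OF f] unfolding ae_eq_def by eventually_elim simp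
qed (intro unimodular_L2 \<phi> rep_L2 f)+

context
  fixes \<phi> :: "real \<Rightarrow> complex"
  assumes \<phi>: "unimodular \<phi>"
begin

lemma mult_op_add: "mult_op \<phi> (x + y) = mult_op \<phi> x + mult_op \<phi> y"
proof -
  have "mult_op \<phi> (x + y) = mult_op \<phi> (cls (\<lambda>t. rep x t + rep y t))" by (simp add: cls_add)
  also have "\<dots> = cls (\<lambda>t. \<phi> t * rep x t + \<phi> t * rep y t)" by (simp add: mult_op_cls[OF \<phi>] L2_add distrib_left)
  finally show ?thesis by (simp add: cls_add unimodular_L2[OF \<phi>] mult_op_def)
qed

lemma mult_op_scale: "mult_op \<phi> (c *\<^sub>R x) = c *\<^sub>R mult_op \<phi> x"
proof -
  have "c *\<^sub>R x = cls (\<lambda>t. of_real c * rep x t)" by (simp add: cls_scale)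
  then have "mult_op \<phi> (c *\<^sub>R x) = cls (\<lambda>t. of_real c * (\<phi> t * rep x t))"
    by (simp add: mult_op_cls[OF \<phi>] L2_cmult mult.left_commute)
  then show ?thesis by (simp add: cls_scale unimodular_L2[OF \<phi>] mult_op_def)
qed

lemma linear_mult_op: "linear (mult_op \<phi>)"
  by (rule linearI) (auto simp: mult_op_add mult_op_scale)

lemma norm_mult_op: "norm (mult_op \<phi> x) = norm x"
proof -
  have "(norm (mult_op \<phi> x))\<^sup>2 = (LINT t|lebesgue. (norm (\<phi> t * rep x t))\<^sup>2)"
    by (simp add: mult_op_def norm_cls_sq unimodular_L2[OF \<phi>])
  also have "\<dots> = (LINT t|lebesgue. (norm (rep x t))\<^sup>2)"
  proof (rule integral_cong_AE)
    show "AE t in lebesgue. (norm (\<phi> t * rep x t))\<^sup>2 = (norm (rep x t))\<^sup>2"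
      using \<phi> unfolding unimodular_def by (auto simp: norm_mult elim: eventually_mono)
  qed (use L2_measurable[OF rep_L2[of x]] L2_measurable[OF unimodular_L2[OF \<phi> rep_L2[of x]]] in measurable)
  also have "\<dots> = (norm x)\<^sup>2" using norm_cls_sq[OF rep_L2, of x] by simp
  finally show ?thesis by simp
qed

lemma mult_op_diff: "mult_op \<phi> (x - y) = mult_op \<phi> x - mult_op \<phi> y"
  by (rule linear_diff[OF linear_mult_op])

lemma mult_op_tendsto: "f \<longlonglongrightarrow> x \<Longrightarrow> (\<lambda>n. mult_op \<phi> (f n)) \<longlonglongrightarrow> mult_op \<phi> x"
  unfolding tendsto_iff dist_norm mult_op_diff[symmetric] norm_mult_op .

lemma mult_op_inverse: "mult_op (\<lambda>t. cnj (\<phi> t)) (mult_op \<phi> x) = x" "mult_op \<phi> (mult_op (\<lambda>t. cnj (\<phi> t)) x) = x"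
proof -
  have *: "AE t in lebesgue. cnj (\<phi> t) * \<phi> t = 1"
    using \<phi> unfolding unimodular_def
    by (auto elim!: eventually_mono simp: mult.commute[of "cnj _"] complex_norm_square[symmetric])
  have L: "(\<lambda>t. \<phi> t * rep x t) \<in> L2" "(\<lambda>t. cnj (\<phi> t) * rep x t) \<in> L2"
    by (intro unimodular_L2 unimodular_cnj \<phi> rep_L2)+
  have "mult_op (\<lambda>t. cnj (\<phi> t)) (mult_op \<phi> x) = cls (\<lambda>t. cnj (\<phi> t) * (\<phi> t * rep x t))"
    unfolding mult_op_def[of \<phi>] by (rule mult_op_cls[OF unimodular_cnj[OF \<phi>] L(1)])
  also have "\<dots> = cls (rep x)"
  proof (subst cls_eq_iff)
    show "ae_eq (\<lambda>t. cnj (\<phi> t) * (\<phi> t * rep x t)) (rep x)"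
      using * unfolding ae_eq_def by eventually_elim (simp add: mult.assoc[symmetric])
  qed (intro unimodular_L2 unimodular_cnj \<phi> rep_L2)+
  finally show "mult_op (\<lambda>t. cnj (\<phi> t)) (mult_op \<phi> x) = x" by simp
  have "mult_op \<phi> (mult_op (\<lambda>t. cnj (\<phi> t)) x) = cls (\<lambda>t. \<phi> t * (cnj (\<phi> t) * rep x t))"
    unfolding mult_op_def[of "\<lambda>t. cnj (\<phi> t)"] by (rule mult_op_cls[OF \<phi> L(2)])
  also have "\<dots> = cls (rep x)"
  proof (subst cls_eq_iff)
    show "ae_eq (\<lambda>t. \<phi> t * (cnj (\<phi> t) * rep x t)) (rep x)"
      using * unfolding ae_eq_def by eventually_elim (simp add: mult.assoc[symmetric] mult.commute[of "\<phi> _"])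
  qed (intro unimodular_L2 unimodular_cnj \<phi> rep_L2)+
  finally show "mult_op \<phi> (mult_op (\<lambda>t. cnj (\<phi> t)) x) = x" by simp
qed

lemma inner_mult_op: "inner (mult_op \<phi> x) y = inner x (mult_op (\<lambda>t. cnj (\<phi> t)) y)"
proof -
  have "inner (mult_op \<phi> x) (cls (rep y)) = Re (l2_inner (\<lambda>t. \<phi> t * rep x t) (rep y))"
    unfolding mult_op_def by (intro inner_cls unimodular_L2 \<phi> rep_L2)
  also have "\<dots> = Re (l2_inner (rep x) (\<lambda>t. cnj (\<phi> t) * rep y t))"
    by (simp add: l2_inner_def mult_ac)
  also have "\<dots> = inner (cls (rep x)) (mult_op (\<lambda>t. cnj (\<phi> t)) y)"
    unfolding mult_op_def by (intro inner_cls[symmetric] unimodular_L2 unimodular_cnj \<phi> rep_L2)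
  finally show ?thesis by simp
qed

end

text \<open>Conjugation is real-linear and isometric. It exchanges \<open>H2\<close> with its orthogonal complement
  in \<open>L2\<close> (\<open>orth_H2_classes_conj\<close>, \<open>conj_op_orth\<close>).\<close>

definition conj_op :: "l2 \<Rightarrow> l2" where "conj_op x = cls (\<lambda>t. cnj (rep x t))"

lemma conj_op_cls: assumes "f \<in> L2" shows "conj_op (cls f) = cls (\<lambda>t. cnj (f t))"
  unfolding conj_op_def
proof (subst cls_eq_iff)
  show "ae_eq (\<lambda>t. cnj (rep (cls f) t)) (\<lambda>t. cnj (f t))"
    using rep_cls[OF assms] unfolding ae_eq_def by eventually_elim simp
qed (intro L2_cnj rep_L2 assms)+

lemma conj_op_diff: "conj_op (x - y) = conj_op x - conj_op y"
proof -
  have "conj_op (x - y) = conj_op (cls (\<lambda>t. rep x t - rep y t))" by (simp add: cls_diff)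
  also have "\<dots> = cls (\<lambda>t. cnj (rep x t) - cnj (rep y t))" by (simp add: conj_op_cls L2_diff)
  finally show ?thesis by (simp add: cls_diff L2_cnj conj_op_def)
qed

lemma norm_conj_op: "norm (conj_op x) = norm x"
proof -
  have "(norm (conj_op x))\<^sup>2 = (norm (cls (rep x)))\<^sup>2" unfolding conj_op_def by (simp only: norm_cls_sq L2_cnj rep_L2 complex_mod_cnj)
  then show ?thesis by simp
qed

lemma conj_op_tendsto: "f \<longlonglongrightarrow> x \<Longrightarrow> (\<lambda>n. conj_op (f n)) \<longlonglongrightarrow> conj_op x"
  unfolding tendsto_iff dist_norm conj_op_diff[symmetric] norm_conj_op .

lemma orth_H2_classes_conj:
  assumes "\<And>x. x \<in> H2_classes \<Longrightarrow> inner c x = 0"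
  shows "\<exists>y\<in>H2_classes. c = conj_op y"
proof -
  define p where "p = rep c"
  have p: "p \<in> L2" "c = cls p" by (simp_all add: p_def)
  have "\<forall>f\<in>H2. l2_inner p f = 0"
  proof
    fix f assume f: "f \<in> H2"
    then have "cls f \<in> H2_classes" "cls (\<lambda>t. \<i> * f t) \<in> H2_classes" unfolding H2_classes_def using H2_cmult by blast+
    then show "l2_inner p f = 0" using assms p H2_D(1)[OF f] by (intro l2_inner_zero_of_inner_zero) auto
  qed
  then have c: "(\<lambda>t. cnj (p t)) \<in> H2" by (simp add: orth_H2_iff[OF p(1)])
  moreover have "conj_op (cls (\<lambda>t. cnj (p t))) = c" by (simp add: conj_op_cls L2_cnj p)
  ultimately show ?thesis unfolding H2_classes_def by blast
qed

lemma conj_op_orth: assumes "x \<in> H2_classes" "y \<in> H2_classes" shows "inner (conj_op y) x = 0"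
proof -
  obtain f g where f: "f \<in> H2" "x = cls f" and g: "g \<in> H2" "y = cls g" using assms unfolding H2_classes_def by blast
  note L = H2_D(1)[OF f(1)] H2_D(1)[OF g(1)]
  have "l2_inner (\<lambda>t. cnj (g t)) f = 0" using orth_H2_iff[OF L2_cnj[OF L(2)]] g(1) f(1) by simp
  then show ?thesis by (simp add: f g conj_op_cls L inner_cls L2_cnj)
qed

section \<open>Inner functions and model spaces\<close>

context
  fixes J :: "complex \<Rightarrow> complex"
  assumes J: "inner_function J"
begin

lemma inner_bdry_unimodular: "unimodular (bdry J)"
  using J boundary_measurable[of J "bdry J"] unfolding inner_function_def unimodular_def by auto

text \<open>A bounded factor preserves the Hardy class, and boundary values are multiplicative.\<close>

lemma inner_mult_H2: assumes f: "f \<in> H2" shows "(\<lambda>t. bdry J t * f t) \<in> H2"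
proof -
  note fL = H2_D(1)[OF f] and fm = H2_D(2)[OF f]
  define F where "F = poisson_int f"
  have F: "hardy_function F" "has_boundary_values F f"
    unfolding F_def by (rule poisson_int_hardy_function[OF fL fm], rule has_boundary_values_poisson[OF fL])
  have Jh: "J holomorphic_on upper_half_plane" "has_boundary_values J (bdry J)" using J by (auto simp: inner_function_def)
  obtain B where B: "\<And>z. Im z > 0 \<Longrightarrow> norm (J z) \<le> B"
    using J unfolding inner_function_def bounded_iff upper_half_plane_def by auto
  obtain C where C: "\<And>y. y > 0 \<Longrightarrow> (LINT x|lebesgue. (norm (F (Complex x y)))\<^sup>2) \<le> C"
    and Fi: "\<And>y. y > 0 \<Longrightarrow> integrable lebesgue (\<lambda>x. (norm (F (Complex x y)))\<^sup>2)"
    and Fh: "F holomorphic_on upper_half_plane" using F(1) by (auto simp: hardy_function_def)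
  have hol: "(\<lambda>z. J z * F z) holomorphic_on upper_half_plane" by (intro holomorphic_intros Jh Fh)
  have le: "(norm (J (Complex x y) * F (Complex x y)))\<^sup>2 \<le> B\<^sup>2 * (norm (F (Complex x y)))\<^sup>2" if "y > 0" for x y
    using B[of "Complex x y"] that unfolding norm_mult power_mult_distrib by (intro mult_right_mono power_mono) auto
  have int: "integrable lebesgue (\<lambda>x. (norm (J (Complex x y) * F (Complex x y)))\<^sup>2)" if y: "y > 0" for y
  proof (rule Bochner_Integration.integrable_bound)
    show "integrable lebesgue (\<lambda>x. B\<^sup>2 * (norm (F (Complex x y)))\<^sup>2)" by (intro integrable_mult_right Fi y)
    show "(\<lambda>x. (norm (J (Complex x y) * F (Complex x y)))\<^sup>2) \<in> borel_measurable lebesgue"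
      using continuous_measurable_lebesgue[OF hardy_line_continuous[OF hol y]] by measurable
    show "AE x in lebesgue. norm ((norm (J (Complex x y) * F (Complex x y)))\<^sup>2) \<le> norm (B\<^sup>2 * (norm (F (Complex x y)))\<^sup>2)"
      using le[OF y] by (intro AE_I2) (simp del: power_mult_distrib add: abs_mult)
  qed
  have "(LINT x|lebesgue. (norm (J (Complex x y) * F (Complex x y)))\<^sup>2) \<le> B\<^sup>2 * C" if y: "y > 0" for y
  proof -
    have "(LINT x|lebesgue. (norm (J (Complex x y) * F (Complex x y)))\<^sup>2) \<le> (LINT x|lebesgue. B\<^sup>2 * (norm (F (Complex x y)))\<^sup>2)"
      by (rule integral_mono[OF int[OF y] integrable_mult_right[OF Fi[OF y]] le[OF y]])
    also have "\<dots> = B\<^sup>2 * (LINT x|lebesgue. (norm (F (Complex x y)))\<^sup>2)" by (rule integral_mult_right_zero)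
    also have "\<dots> \<le> B\<^sup>2 * C" by (intro mult_left_mono C y) simp
    finally show ?thesis .
  qed
  then have "hardy_function (\<lambda>z. J z * F z)" unfolding hardy_function_def using hol int by blast
  moreover have "has_boundary_values (\<lambda>z. J z * F z) (\<lambda>t. bdry J t * f t)"
    using Jh(2) F(2) unfolding has_boundary_values_def by eventually_elim (rule tendsto_mult)
  ultimately show ?thesis using hardy_boundary by (intro H2_I) blast+
qed

definition inner_range :: "l2 set" where "inner_range = mult_op (bdry J) ` H2_classes"

lemma inner_range_sub: "inner_range \<subseteq> H2_classes"
proof
  fix x assume "x \<in> inner_range"
  then obtain f where "f \<in> H2" "x = mult_op (bdry J) (cls f)" unfolding inner_range_def H2_classes_def by blast
  then show "x \<in> H2_classes" using inner_mult_H2 by (simp add: mult_op_cls[OF inner_bdry_unimodular] H2_D(1) H2_classes_def)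
qed

lemma inner_range_subspace: "subspace inner_range"
  unfolding inner_range_def by (rule linear_subspace_image[OF linear_mult_op[OF inner_bdry_unimodular] H2_classes_subspace])

lemma inner_range_closed: "closed inner_range"
  unfolding closed_sequential_limits
proof (intro allI impI, elim conjE)
  note U = inner_bdry_unimodular
  fix s l assume s: "\<forall>n. s n \<in> inner_range" and l: "s \<longlonglongrightarrow> l"
  have "mult_op (\<lambda>t. cnj (bdry J t)) (s n) \<in> H2_classes" for n
    using s mult_op_inverse(1)[OF U] unfolding inner_range_def by (metis imageE)
  then have "mult_op (\<lambda>t. cnj (bdry J t)) l \<in> H2_classes"
    by (intro closed_sequentially[OF H2_classes_closed _ mult_op_tendsto[OF unimodular_cnj[OF U] l]]) simp
  then have "mult_op (bdry J) (mult_op (\<lambda>t. cnj (bdry J t)) l) \<in> inner_range" unfolding inner_range_def by (rule imageI)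
  then show "l \<in> inner_range" by (simp add: mult_op_inverse(2)[OF U])
qed

lemma model_space_iff:
  assumes f: "f \<in> L2" shows "f \<in> model_space J \<longleftrightarrow> cls f \<in> rel_compl H2_classes inner_range"
proof
  assume m: "f \<in> model_space J"
  have "inner (cls f) a = 0" if a: "a \<in> inner_range" for a
  proof -
    obtain g where g: "g \<in> H2" "a = mult_op (bdry J) (cls g)" using a unfolding inner_range_def H2_classes_def by blast
    have "l2_inner f (\<lambda>x. bdry J x * g x) = 0" using m g(1) by (simp add: model_space_def)
    then show ?thesis using f H2_D(1)[OF g(1)] H2_D(1)[OF inner_mult_H2[OF g(1)]]
      by (simp add: g(2) mult_op_cls[OF inner_bdry_unimodular] inner_cls)
  qed
  then show "cls f \<in> rel_compl H2_classes inner_range"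
    using m by (auto simp: rel_compl_def H2_classes_iff[OF f] model_space_def)
next
  assume c: "cls f \<in> rel_compl H2_classes inner_range"
  have "l2_inner f (\<lambda>x. bdry J x * g x) = 0" if g: "g \<in> H2" for g
  proof (rule l2_inner_zero_of_inner_zero[OF f H2_D(1)[OF inner_mult_H2[OF g]]])
    have in1: "cls (\<lambda>x. bdry J x * k x) \<in> inner_range" if "k \<in> H2" for k
      using mult_op_cls[OF inner_bdry_unimodular H2_D(1)[OF that]] that unfolding inner_range_def H2_classes_def by (metis imageI)
    show "inner (cls f) (cls (\<lambda>x. bdry J x * g x)) = 0" using c in1[OF g] by (simp add: rel_compl_def)
    show "inner (cls f) (cls (\<lambda>x. \<i> * (bdry J x * g x))) = 0"
      using c in1[OF H2_cmult[OF g, of \<i>]] by (simp add: rel_compl_def mult.left_commute)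
  qed
  then show "f \<in> model_space J" using c by (simp add: model_space_def rel_compl_def H2_classes_iff[OF f])
qed

definition model_cls :: "l2 set" where "model_cls = rel_compl H2_classes inner_range"

lemma model_cls_subspace: "subspace model_cls" and model_cls_closed: "closed model_cls"
  unfolding model_cls_def by (rule subspace_rel_compl[OF H2_classes_subspace], rule closed_rel_compl[OF H2_classes_closed])

lemma model_space_L2: "f \<in> model_space J \<Longrightarrow> f \<in> L2"
  by (simp add: model_space_def H2_D(1))

lemma model_space_cls: "f \<in> model_space J \<Longrightarrow> cls f \<in> model_cls"
  using model_space_iff[OF model_space_L2] unfolding model_cls_def by blast

lemma rep_model_space: "x \<in> model_cls \<Longrightarrow> rep x \<in> model_space J"
  unfolding model_cls_def by (simp add: model_space_iff)

lemma model_space_add: "f \<in> model_space J \<Longrightarrow> g \<in> model_space J \<Longrightarrow> (\<lambda>x. f x + g x) \<in> model_space J"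
  using inner_mult_H2 by (auto simp: model_space_def H2_add l2_inner_add_left H2_D(1))
lemma model_space_cmult: "f \<in> model_space J \<Longrightarrow> (\<lambda>x. c * f x) \<in> model_space J"
  by (auto simp: model_space_def H2_cmult l2_inner_cmult_left)

text \<open>The function chosen by \<open>orth_proj\<close> satisfies the equations that characterize the orthogonal
  projection; here complex and real orthogonality agree because model spaces are closed
  under multiplication by \<open>\<i>\<close>.\<close>

lemma model_proj_props:
  assumes f: "f \<in> L2"
  shows "model_proj J f \<in> model_space J" "cls (model_proj J f) = proj model_cls (cls f)"
proof -
  note S = model_cls_subspace model_cls_closed
  define g where "g = rep (proj model_cls (cls f))"
  have g: "g \<in> model_space J" "cls g = proj model_cls (cls f)"
    unfolding g_def by (simp_all add: rep_model_space proj_in[OF S])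
  have fg: "(\<lambda>x. f x - g x) \<in> L2" by (intro L2_diff f model_space_L2 g)
  have orth: "l2_inner (\<lambda>x. f x - g x) k = 0" if k: "k \<in> model_space J" for k
  proof (rule l2_inner_zero_of_inner_zero[OF fg model_space_L2[OF k]])
    have "inner (cls f - cls g) (cls k') = 0" if "k' \<in> model_space J" for k'
      unfolding g(2) by (rule proj_orth[OF S model_space_cls[OF that]])
    then show "inner (cls (\<lambda>x. f x - g x)) (cls k) = 0" "inner (cls (\<lambda>x. f x - g x)) (cls (\<lambda>t. \<i> * k t)) = 0"
      using k model_space_cmult[OF k] by (simp_all add: cls_diff f model_space_L2 g)
  qed
  have "\<exists>g. g \<in> model_space J \<and> (\<forall>k\<in>model_space J. l2_inner (\<lambda>x. f x - g x) k = 0)"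
    using g(1) orth by blast
  from someI_ex[OF this]
  have "model_proj J f \<in> model_space J \<and> (\<forall>k\<in>model_space J. l2_inner (\<lambda>x. f x - model_proj J f x) k = 0)"
    unfolding model_proj_def orth_proj_def .
  then have p: "model_proj J f \<in> model_space J" "\<And>k. k \<in> model_space J \<Longrightarrow> l2_inner (\<lambda>x. f x - model_proj J f x) k = 0" by auto
  show "model_proj J f \<in> model_space J" by (rule p)
  have pL: "model_proj J f \<in> L2" by (rule model_space_L2[OF p(1)])
  have "proj model_cls (cls f) = cls (model_proj J f)"
  proof (rule proj_unique[OF S])
    show "cls (model_proj J f) \<in> model_cls" by (rule model_space_cls[OF p(1)])
    fix k assume "k \<in> model_cls"
    then have k: "rep k \<in> model_space J" by (rule rep_model_space)
    have "inner (cls (\<lambda>x. f x - model_proj J f x)) (cls (rep k)) = 0"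
      using p(2)[OF k] by (simp add: inner_cls L2_diff f pL del: cls_rep)
    then show "inner (cls f - cls (model_proj J f)) k = 0" by (simp add: cls_diff f pL)
  qed
  then show "cls (model_proj J f) = proj model_cls (cls f)" ..
qed

end

section \<open>Isomorphisms between model spaces\<close>

context
  fixes I \<Theta> :: "complex \<Rightarrow> complex"
  assumes I: "inner_function I" and \<Theta>: "inner_function \<Theta>"
begin

lemma domain_L2: "f \<in> model_space \<Theta> \<Longrightarrow> f \<in> L2" by (rule model_space_L2[OF \<Theta>])
lemma codomain_L2: "f \<in> model_space I \<Longrightarrow> f \<in> L2" by (rule model_space_L2[OF I])
lemma model_proj_cls: "f \<in> L2 \<Longrightarrow> cls (model_proj I f) = proj (model_cls I) (cls f)" by (rule model_proj_props(2)[OF I])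
lemma model_proj_in: "f \<in> L2 \<Longrightarrow> model_proj I f \<in> model_space I" by (rule model_proj_props(1)[OF I])

lemma model_proj_ae_iff: "f \<in> L2 \<Longrightarrow> g \<in> L2 \<Longrightarrow> ae_eq (model_proj I f) g \<longleftrightarrow> proj (model_cls I) (cls f) = cls g"
  using cls_eq_iff[OF codomain_L2[OF model_proj_in], of f g] model_proj_cls by simp

lemmas proj_linear = proj_add[OF model_cls_subspace[OF I] model_cls_closed[OF I]] proj_diff[OF model_cls_subspace[OF I] model_cls_closed[OF I]]

text \<open>Together, the two conditions \<open>lower_bound\<close> and \<open>proj_surjective\<close> say on the level of classes
  that the restricted projection is an isomorphism. The constants admissible in
  \<open>lower_bound\<close> are the bounds for the inverse (\<open>inverse_bound_iff\<close>).\<close>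

definition lower_bound :: "real \<Rightarrow> bool" where
  "lower_bound C \<longleftrightarrow> (\<forall>a\<in>model_cls \<Theta>. norm a \<le> C * norm (proj (model_cls I) a))"

definition proj_surjective :: bool where
  "proj_surjective \<longleftrightarrow> proj (model_cls I) ` model_cls \<Theta> = model_cls I"

lemma lower_bound_inj:
  assumes "lower_bound C" "f \<in> model_space \<Theta>" "g \<in> model_space \<Theta>" "proj (model_cls I) (cls f) = proj (model_cls I) (cls g)"
  shows "ae_eq f g"
proof -
  have "cls f - cls g \<in> model_cls \<Theta>"
    using assms by (intro subspace_diff model_cls_subspace \<Theta> model_space_cls)
  then have "norm (cls f - cls g) \<le> C * norm (proj (model_cls I) (cls f - cls g))" using assms(1) by (simp add: lower_bound_def)
  then have "cls f = cls g" using assms(4) by (simp add: proj_linear)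
  then show ?thesis using assms by (simp add: cls_eq_iff domain_L2)
qed

lemma inverse_props:
  assumes "proj_surjective" "g \<in> model_space I"
  shows "l2_inverse (model_proj I) (model_space \<Theta>) g \<in> model_space \<Theta>"
    and "proj (model_cls I) (cls (l2_inverse (model_proj I) (model_space \<Theta>) g)) = cls g"
proof -
  have "cls g \<in> proj (model_cls I) ` model_cls \<Theta>" using assms model_space_cls[OF I] by (simp add: proj_surjective_def)
  then obtain a where a: "a \<in> model_cls \<Theta>" "proj (model_cls I) a = cls g" by auto
  have "rep a \<in> model_space \<Theta>" by (rule rep_model_space[OF \<Theta> a(1)])
  moreover have "ae_eq (model_proj I (rep a)) g" using a by (subst model_proj_ae_iff) (auto simp: codomain_L2 assms)
  ultimately have "\<exists>f. f \<in> model_space \<Theta> \<and> ae_eq (model_proj I f) g" by blast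
  from someI_ex[OF this]
  have *: "l2_inverse (model_proj I) (model_space \<Theta>) g \<in> model_space \<Theta> \<and> ae_eq (model_proj I (l2_inverse (model_proj I) (model_space \<Theta>) g)) g"
    unfolding l2_inverse_def .
  then show "l2_inverse (model_proj I) (model_space \<Theta>) g \<in> model_space \<Theta>" by simp
  then show "proj (model_cls I) (cls (l2_inverse (model_proj I) (model_space \<Theta>) g)) = cls g"
    using * model_proj_ae_iff domain_L2 codomain_L2 assms(2) by blast
qed

lemma inverse_bound_iff:
  assumes s: "proj_surjective"
    and inj: "\<And>f g. f \<in> model_space \<Theta> \<Longrightarrow> g \<in> model_space \<Theta> \<Longrightarrow> proj (model_cls I) (cls f) = proj (model_cls I) (cls g) \<Longrightarrow> ae_eq f g"
  shows "(\<forall>g\<in>model_space I. l2_norm (l2_inverse (model_proj I) (model_space \<Theta>) g) \<le> C * l2_norm g) \<longleftrightarrow> lower_bound C"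
proof
  assume b: "\<forall>g\<in>model_space I. l2_norm (l2_inverse (model_proj I) (model_space \<Theta>) g) \<le> C * l2_norm g"
  show "lower_bound C" unfolding lower_bound_def
  proof
    fix a assume a: "a \<in> model_cls \<Theta>"
    define f where "f = rep a"
    have f: "f \<in> model_space \<Theta>" "a = cls f" using rep_model_space[OF \<Theta> a] by (simp_all add: f_def)
    define g where "g = model_proj I f"
    have g: "g \<in> model_space I" "cls g = proj (model_cls I) a" unfolding g_def using f domain_L2 model_proj_in model_proj_cls by auto
    let ?S = "l2_inverse (model_proj I) (model_space \<Theta>) g"
    have S: "?S \<in> model_space \<Theta>" "proj (model_cls I) (cls ?S) = cls g" by (rule inverse_props[OF s g(1)])+
    have "ae_eq ?S f" by (rule inj[OF S(1) f(1)]) (simp add: S(2) g(2) f(2))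
    then have "cls ?S = a" using cls_eq_iff[OF domain_L2[OF S(1)] domain_L2[OF f(1)]] by (simp add: f(2))
    then show "norm a \<le> C * norm (proj (model_cls I) a)"
      using b g S by (metis norm_cls domain_L2 codomain_L2)
  qed
next
  assume l: "lower_bound C"
  show "\<forall>g\<in>model_space I. l2_norm (l2_inverse (model_proj I) (model_space \<Theta>) g) \<le> C * l2_norm g"
  proof
    fix g assume g: "g \<in> model_space I"
    let ?S = "l2_inverse (model_proj I) (model_space \<Theta>) g"
    have S: "?S \<in> model_space \<Theta>" "proj (model_cls I) (cls ?S) = cls g" by (rule inverse_props[OF s g])+
    have "norm (cls ?S) \<le> C * norm (proj (model_cls I) (cls ?S))"
      using l model_space_cls[OF \<Theta> S(1)] by (simp add: lower_bound_def)
    then show "l2_norm ?S \<le> C * l2_norm g" using S g by (simp add: norm_cls domain_L2 codomain_L2)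
  qed
qed

lemma isomorphism_imp:
  assumes iso: "l2_isomorphism (model_proj I) (model_space \<Theta>) (model_space I)"
  shows "proj_surjective"
    and "f \<in> model_space \<Theta> \<Longrightarrow> g \<in> model_space \<Theta> \<Longrightarrow> proj (model_cls I) (cls f) = proj (model_cls I) (cls g) \<Longrightarrow> ae_eq f g"
    and "\<exists>C\<ge>1. lower_bound C"
proof -
  show s: "proj_surjective" unfolding proj_surjective_def
  proof (intro equalityI subsetI)
    fix y assume "y \<in> proj (model_cls I) ` model_cls \<Theta>"
    then show "y \<in> model_cls I" using proj_in[OF model_cls_subspace[OF I] model_cls_closed[OF I]] by auto
  next
    fix y assume y: "y \<in> model_cls I"
    then obtain f where f: "f \<in> model_space \<Theta>" "ae_eq (model_proj I f) (rep y)"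
      using iso rep_model_space[OF I y] unfolding l2_isomorphism_def by blast
    then have "proj (model_cls I) (cls f) = y" using model_proj_ae_iff[OF domain_L2[OF f(1)] rep_L2] by simp
    then show "y \<in> proj (model_cls I) ` model_cls \<Theta>" using model_space_cls[OF \<Theta> f(1)] by blast
  qed
  show inj: "ae_eq f g" if fg: "f \<in> model_space \<Theta>" "g \<in> model_space \<Theta>" "proj (model_cls I) (cls f) = proj (model_cls I) (cls g)" for f g
  proof -
    have "ae_eq (model_proj I f) (model_proj I g)"
      using fg by (simp add: model_proj_ae_iff domain_L2 codomain_L2 model_proj_in model_proj_cls)
    then show ?thesis using iso fg unfolding l2_isomorphism_def by blast
  qed
  obtain C where "\<forall>g\<in>model_space I. l2_norm (l2_inverse (model_proj I) (model_space \<Theta>) g) \<le> C * l2_norm g"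
    using iso unfolding l2_isomorphism_def l2_bounded_linear_def op_bounded_def by blast
  then have l: "lower_bound C" using inverse_bound_iff[OF s inj] by blast
  have "lower_bound (max C 1)" unfolding lower_bound_def
  proof
    fix a assume "a \<in> model_cls \<Theta>"
    then have "norm a \<le> C * norm (proj (model_cls I) a)" using l by (simp add: lower_bound_def)
    also have "\<dots> \<le> max C 1 * norm (proj (model_cls I) a)" by (intro mult_right_mono) auto
    finally show "norm a \<le> max C 1 * norm (proj (model_cls I) a)" .
  qed
  then show "\<exists>C\<ge>1. lower_bound C" by (intro exI[of _ "max C 1"]) auto
qed

lemma isomorphism_if:
  assumes s: "proj_surjective" and l: "lower_bound C"
  shows "l2_isomorphism (model_proj I) (model_space \<Theta>) (model_space I)"
proof -
  let ?S = "l2_inverse (model_proj I) (model_space \<Theta>)"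
  note inj = lower_bound_inj[OF l]
  note S = inverse_props[OF s]
  note P = model_cls_subspace[OF I] model_cls_closed[OF I]
  have T: "l2_bounded_linear (model_proj I) (model_space \<Theta>) (model_space I)"
    unfolding l2_bounded_linear_def
  proof (intro conjI ballI allI)
    fix f assume f: "f \<in> model_space \<Theta>"
    note fL = domain_L2[OF f]
    show "model_proj I f \<in> model_space I" by (rule model_proj_in[OF fL])
    show "ae_eq (model_proj I (\<lambda>x. f x + g x)) (\<lambda>x. model_proj I f x + model_proj I g x)" if g: "g \<in> model_space \<Theta>" for g
      using domain_L2[OF g] fL by (subst model_proj_ae_iff) (simp_all add: L2_add codomain_L2 model_proj_in cls_add proj_linear model_proj_cls)
    fix c
    have Tc: "(\<lambda>x. c * model_proj I f x) \<in> model_space I" by (intro model_space_cmult model_proj_in fL I)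
    show "ae_eq (model_proj I (\<lambda>x. c * f x)) (\<lambda>x. c * model_proj I f x)"
    proof (subst model_proj_ae_iff)
      show "proj (model_cls I) (cls (\<lambda>x. c * f x)) = cls (\<lambda>x. c * model_proj I f x)"
      proof (rule proj_unique[OF P])
        show "cls (\<lambda>x. c * model_proj I f x) \<in> model_cls I" by (rule model_space_cls[OF I Tc])
        fix k assume "k \<in> model_cls I"
        then have k: "rep k \<in> model_space I" by (rule rep_model_space[OF I])
        define d where "d = (\<lambda>x. f x - model_proj I f x)"
        have dL: "d \<in> L2" unfolding d_def by (intro L2_diff fL codomain_L2 model_proj_in)
        have dk: "inner (cls d) (cls k') = 0" if "k' \<in> model_space I" for k'
          unfolding d_def using proj_orth[OF P model_space_cls[OF I that], of "cls f"] by (simp add: cls_diff fL codomain_L2 model_proj_in model_proj_cls)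
        have "l2_inner d (rep k) = 0"
          by (rule l2_inner_zero_of_inner_zero[OF dL rep_L2 dk[OF k] dk[OF model_space_cmult[OF I k]]])
        then have "inner (cls (\<lambda>x. c * d x)) (cls (rep k)) = 0"
          by (simp add: inner_cls L2_cmult dL l2_inner_cmult_left del: cls_rep)
        moreover have "cls (\<lambda>x. c * d x) = cls (\<lambda>x. c * f x) - cls (\<lambda>x. c * model_proj I f x)"
          unfolding d_def right_diff_distrib by (intro cls_diff L2_cmult fL codomain_L2 model_proj_in)
        ultimately show "inner (cls (\<lambda>x. c * f x) - cls (\<lambda>x. c * model_proj I f x)) k = 0" by simp
      qed
    qed (intro L2_cmult fL codomain_L2 model_proj_in)+
  next
    show "op_bounded l2_norm (model_proj I) (model_space \<Theta>)" unfolding op_bounded_def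
    proof (intro exI[of _ 1] ballI)
      fix f assume f: "f \<in> model_space \<Theta>"
      show "l2_norm (model_proj I f) \<le> 1 * l2_norm f"
        using norm_proj_le[OF P, of "cls f"] domain_L2[OF f] by (simp add: model_proj_cls[symmetric] norm_cls codomain_L2 model_proj_in)
    qed
  qed
  have S': "l2_bounded_linear ?S (model_space I) (model_space \<Theta>)"
    unfolding l2_bounded_linear_def
  proof (intro conjI ballI allI)
    fix g assume g: "g \<in> model_space I"
    show "?S g \<in> model_space \<Theta>" by (rule S(1)[OF g])
    show "ae_eq (?S (\<lambda>x. g x + g' x)) (\<lambda>x. ?S g x + ?S g' x)" if g': "g' \<in> model_space I" for g'
    proof (rule inj)
      have gg: "(\<lambda>x. g x + g' x) \<in> model_space I" by (intro model_space_add I g g')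
      show "?S (\<lambda>x. g x + g' x) \<in> model_space \<Theta>" by (rule S(1)[OF gg])
      show "(\<lambda>x. ?S g x + ?S g' x) \<in> model_space \<Theta>" by (intro model_space_add \<Theta> S(1) g g')
      show "proj (model_cls I) (cls (?S (\<lambda>x. g x + g' x))) = proj (model_cls I) (cls (\<lambda>x. ?S g x + ?S g' x))"
        by (simp add: S(2)[OF gg] cls_add domain_L2 codomain_L2 S g g' proj_linear)
    qed
    fix c
    show "ae_eq (?S (\<lambda>x. c * g x)) (\<lambda>x. c * ?S g x)"
    proof (rule inj)
      have cg: "(\<lambda>x. c * g x) \<in> model_space I" by (intro model_space_cmult I g)
      show "?S (\<lambda>x. c * g x) \<in> model_space \<Theta>" by (rule S(1)[OF cg])
      show cS: "(\<lambda>x. c * ?S g x) \<in> model_space \<Theta>" by (intro model_space_cmult \<Theta> S(1) g)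
      have "ae_eq (model_proj I (\<lambda>x. c * ?S g x)) (\<lambda>x. c * model_proj I (?S g) x)"
        using T S(1)[OF g] unfolding l2_bounded_linear_def by blast
      moreover have "ae_eq (model_proj I (?S g)) g" using S[OF g] by (subst model_proj_ae_iff) (auto simp: domain_L2 codomain_L2 g)
      then have "ae_eq (\<lambda>x. c * model_proj I (?S g) x) (\<lambda>x. c * g x)" by (auto simp: ae_eq_def elim: eventually_mono)
      ultimately have "ae_eq (model_proj I (\<lambda>x. c * ?S g x)) (\<lambda>x. c * g x)" by (rule ae_eq_trans)
      then have "proj (model_cls I) (cls (\<lambda>x. c * ?S g x)) = cls (\<lambda>x. c * g x)"
        using model_proj_ae_iff[OF domain_L2[OF cS] codomain_L2[OF cg]] by blast
      then show "proj (model_cls I) (cls (?S (\<lambda>x. c * g x))) = proj (model_cls I) (cls (\<lambda>x. c * ?S g x))"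
        by (simp add: S(2)[OF cg])
    qed
  next
    show "op_bounded l2_norm ?S (model_space I)" unfolding op_bounded_def
      using inverse_bound_iff[OF s inj, of C] l by blast
  qed
  show ?thesis unfolding l2_isomorphism_def
  proof (intro conjI T S' ballI impI)
    fix f g assume fg: "f \<in> model_space \<Theta>" "g \<in> model_space \<Theta>" "ae_eq (model_proj I f) (model_proj I g)"
    then have "proj (model_cls I) (cls f) = proj (model_cls I) (cls g)"
      using model_proj_ae_iff[OF domain_L2[OF fg(1)] codomain_L2[OF model_proj_in[OF domain_L2[OF fg(2)]]]] by (simp add: model_proj_cls domain_L2)
    then show "ae_eq f g" by (rule inj[OF fg(1,2)])
  next
    fix g assume g: "g \<in> model_space I"
    show "\<exists>f\<in>model_space \<Theta>. ae_eq (model_proj I f) g"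
      using S[OF g] by (intro bexI[of _ "?S g"]) (auto simp: model_proj_ae_iff domain_L2 codomain_L2 g)
  qed
qed

end

section \<open>The Riesz projection\<close>

lemma r_pos_cayley_fun: "r_pos (Suc k) (of_real x) = cayley_fun k x / of_real (sqrt pi)"
  by (simp add: r_pos_def cayley_fun_def cayley_def power_divide)

lemma M_space_eq: "M_space = analytic_span"
proof (intro equalityI subsetI)
  fix f assume "f \<in> M_space"
  then obtain K a where f: "f = (\<lambda>x. \<Sum>n=1..K. a n * r_pos n (of_real x))" unfolding M_space_def by blast
  have "f = (\<lambda>x. \<Sum>k<K. (a (Suc k) / of_real (sqrt pi)) * cayley_fun k x)"
  proof
    fix x
    have "f x = (\<Sum>k<K. a (Suc k) * r_pos (Suc k) (of_real x))"
      unfolding f by (rule sum.reindex_bij_witness[of _ Suc "\<lambda>n. n - 1"]) auto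
    then show "f x = (\<Sum>k<K. (a (Suc k) / of_real (sqrt pi)) * cayley_fun k x)" by (simp add: r_pos_cayley_fun)
  qed
  also have "\<dots> \<in> analytic_span" by (rule analytic_spanI)
  finally show "f \<in> analytic_span" .
next
  fix f assume "f \<in> analytic_span"
  then obtain K a where f: "f = (\<lambda>x. \<Sum>k<K. a k * cayley_fun k x)" by (rule analytic_spanE)
  have "f = (\<lambda>x. \<Sum>n=1..K. (a (n - 1) * of_real (sqrt pi)) * r_pos n (of_real x))"
  proof
    fix x
    have "f x = (\<Sum>k<K. (a k * of_real (sqrt pi)) * r_pos (Suc k) (of_real x))" by (simp add: f r_pos_cayley_fun)
    also have "\<dots> = (\<Sum>n=1..K. (a (n - 1) * of_real (sqrt pi)) * r_pos n (of_real x))"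
      by (rule sum.reindex_bij_witness[of _ "\<lambda>n. n - 1" Suc]) auto
    finally show "f x = (\<Sum>n=1..K. (a (n - 1) * of_real (sqrt pi)) * r_pos n (of_real x))" .
  qed
  then show "f \<in> M_space" unfolding M_space_def by (intro CollectI) (rule exI[of _ K], rule exI[of _ "\<lambda>n. a (n - 1) * of_real (sqrt pi)"])
qed

lemma N_space_eq: "N_space = (\<lambda>m x. cnj (m x)) ` analytic_span"
proof -
  have eq: "(\<Sum>n=1..K. a n * r_neg n (of_real x)) = cnj (\<Sum>n=1..K. cnj (a n) * r_pos n (of_real x))" for K a and x :: real
    by (simp add: r_neg_def)
  show ?thesis
  proof (intro equalityI subsetI)
    fix f assume "f \<in> N_space"
    then obtain K a where f: "f = (\<lambda>x. \<Sum>n=1..K. a n * r_neg n (of_real x))" unfolding N_space_def by blast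
    have "(\<lambda>x. \<Sum>n=1..K. cnj (a n) * r_pos n (of_real x)) \<in> analytic_span"
      unfolding M_space_eq[symmetric] M_space_def by (rule CollectI, rule exI[of _ K], rule exI[of _ "\<lambda>n. cnj (a n)"], rule refl)
    then show "f \<in> (\<lambda>m x. cnj (m x)) ` analytic_span" unfolding f eq by (rule image_eqI[rotated]) (rule refl)
  next
    fix f assume "f \<in> (\<lambda>m x. cnj (m x)) ` analytic_span"
    then obtain m where m: "f = (\<lambda>x. cnj (m x))" "m \<in> M_space" unfolding M_space_eq by (rule imageE)
    then obtain K a where "m = (\<lambda>x. \<Sum>n=1..K. a n * r_pos n (of_real x))" unfolding M_space_def by blast
    then have "f = (\<lambda>x. \<Sum>n=1..K. cnj (a n) * r_neg n (of_real x))" unfolding m(1) eq by simp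
    then show "f \<in> N_space" unfolding N_space_def by (intro CollectI) (rule exI[of _ K], rule exI[of _ "\<lambda>n. cnj (a n)"])
  qed
qed

lemma analytic_span_continuous: "m \<in> analytic_span \<Longrightarrow> continuous_on UNIV m"
  by (erule analytic_spanE) (auto intro!: continuous_intros cayley_fun_continuous)

lemma continuous_ae_zero:
  fixes f :: "real \<Rightarrow> complex"
  assumes c: "continuous_on UNIV f" and ae: "AE x in lebesgue. f x = 0"
  shows "f x = 0"
proof (rule ccontr)
  assume nz: "f x \<noteq> 0"
  have "open (f -` (- {0}))" using c by (intro open_vimage) auto
  moreover have "f -` (- {0}) \<noteq> {}" using nz by auto
  ultimately have "\<not> negligible (f -` (- {0}))" by (rule open_not_negligible)
  moreover have "f -` (- {0}) \<in> null_sets lebesgue"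
    using ae completion.AE_iff_null_sets[of "\<lambda>x. f x = 0" lborel] by (simp add: vimage_def)
  ultimately show False by (simp add: negligible_iff_null_sets)
qed

text \<open>The function \<open>m\<close> and its conjugate are in \<open>H2\<close>, so \<open>m\<close> vanishes almost everywhere, and
  everywhere by continuity.\<close>

lemma M_N_trivial:
  assumes m: "m \<in> analytic_span" and m': "m' \<in> analytic_span" and eq: "m = (\<lambda>x. cnj (m' x))"
  shows "m x = 0"
proof (rule continuous_ae_zero[OF analytic_span_continuous[OF m]])
  have "(\<lambda>t. cnj (m t)) \<in> H2" using analytic_span_H2[OF m'] by (simp add: eq)
  then show "AE x in lebesgue. m x = 0"
    using analytic_span_H2[OF m] by (intro Cauchy_class_AE_zero_of_moments L2_Cauchy_class) (auto simp: H2_D)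
qed

lemma riesz_proj_eq:
  assumes m: "m \<in> analytic_span" and m': "m' \<in> analytic_span"
  shows "riesz_proj (\<lambda>x. m x + cnj (m' x)) = m"
  unfolding riesz_proj_def
proof (rule the_equality)
  show "m \<in> M_space \<and> (\<exists>n\<in>N_space. (\<lambda>x. m x + cnj (m' x)) = (\<lambda>x. m x + n x))"
    unfolding M_space_eq N_space_eq
    by (intro conjI m bexI[of _ "\<lambda>x. cnj (m' x)"] refl imageI m')
  fix p assume "p \<in> M_space \<and> (\<exists>n\<in>N_space. (\<lambda>x. m x + cnj (m' x)) = (\<lambda>x. p x + n x))"
  then obtain q where p: "p \<in> analytic_span" and q: "q \<in> analytic_span" and e: "(\<lambda>x. m x + cnj (m' x)) = (\<lambda>x. p x + cnj (q x))"
    unfolding M_space_eq N_space_eq by auto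
  have d: "(\<lambda>x. p x + (-1) * m x) \<in> analytic_span" and d': "(\<lambda>x. m' x + (-1) * q x) \<in> analytic_span"
    by (intro analytic_span_add analytic_span_cmult p m q m')+
  have "p x + (-1) * m x = 0" for x
  proof (rule M_N_trivial[OF d d'])
    show "(\<lambda>x. p x + (-1) * m x) = (\<lambda>x. cnj (m' x + (-1) * q x))"
    proof
      fix x show "p x + (-1) * m x = cnj (m' x + (-1) * q x)" using fun_cong[OF e, of x] by (simp add: algebra_simps)
    qed
  qed
  then show "p = m" by (auto simp: fun_eq_iff)
qed

lemma E_space_eq: "E_space = {\<lambda>x. m x + cnj (m' x) | m m'. m \<in> analytic_span \<and> m' \<in> analytic_span}"
  unfolding E_space_def M_space_eq N_space_eq by auto

section \<open>Invertibility of the restricted projection and the Riesz projection\<close>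

context
  fixes I \<Theta> h :: "complex \<Rightarrow> complex"
  assumes I: "inner_function I" and \<Theta>: "inner_function \<Theta>" and outer: "outer_function h"
    and quot: "AE x in lebesgue. cnj (bdry I x) * bdry \<Theta> x = cnj (bdry h x) / bdry h x"
    and hw: "integrable lebesgue (\<lambda>x. (norm (bdry h x))\<^sup>2 / (1 + x\<^sup>2))"
begin

text \<open>Almost everywhere this is \<open>cnj \<Theta> I\<close>.\<close>

definition symbol_quot :: "real \<Rightarrow> complex" where "symbol_quot t = bdry h t / cnj (bdry h t)"

lemma symbol_quot_unimodular: "unimodular symbol_quot"
  unfolding unimodular_def
proof
  show "symbol_quot \<in> borel_measurable lebesgue" unfolding symbol_quot_def[abs_def]
    using outer_measurable[OF outer hw] measurable_cnj by measurable
  show "AE t in lebesgue. norm (symbol_quot t) = 1"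
    using outer_nz[OF outer hw] by eventually_elim (simp add: symbol_quot_def norm_divide)
qed

lemma symbol_quot_inner: "AE t in lebesgue. cnj (bdry \<Theta> t) * bdry I t = symbol_quot t"
  using quot
proof eventually_elim
  case (elim t)
  have "cnj (bdry \<Theta> t) * bdry I t = cnj (cnj (bdry I t) * bdry \<Theta> t)" by simp
  then show ?case by (simp only: elim symbol_quot_def) simp
qed

lemma symbol_quot_mult_op: "mult_op (\<lambda>t. cnj (bdry \<Theta> t)) (mult_op (bdry I) x) = mult_op symbol_quot x"
proof -
  note uI = inner_bdry_unimodular[OF I] and uT = unimodular_cnj[OF inner_bdry_unimodular[OF \<Theta>]]
  have "mult_op (\<lambda>t. cnj (bdry \<Theta> t)) (mult_op (bdry I) x) = cls (\<lambda>t. cnj (bdry \<Theta> t) * (bdry I t * rep x t))"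
    unfolding mult_op_def[of "bdry I"] by (rule mult_op_cls[OF uT unimodular_L2[OF uI rep_L2]])
  also have "\<dots> = mult_op symbol_quot x" unfolding mult_op_def
  proof (subst cls_eq_iff)
    show "ae_eq (\<lambda>t. cnj (bdry \<Theta> t) * (bdry I t * rep x t)) (\<lambda>t. symbol_quot t * rep x t)"
      using symbol_quot_inner unfolding ae_eq_def by eventually_elim (simp add: mult.assoc[symmetric])
  qed (intro unimodular_L2 uI uT symbol_quot_unimodular rep_L2)+
  finally show ?thesis .
qed

text \<open>The map \<open>g \<mapsto> (h / cnj h) cnj g\<close>, which sends \<open>h m\<close> to \<open>h cnj m\<close>.\<close>

definition reflect_op :: "l2 \<Rightarrow> l2" where "reflect_op y = mult_op symbol_quot (conj_op y)"

lemma reflect_op_outer: assumes "m \<in> analytic_span" shows "reflect_op (cls (\<lambda>t. bdry h t * m t)) = cls (\<lambda>t. bdry h t * cnj (m t))"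
proof -
  have L: "(\<lambda>t. bdry h t * m t) \<in> L2" by (rule H2_D(1)[OF outer_span_H2[OF outer hw assms]])
  have "reflect_op (cls (\<lambda>t. bdry h t * m t)) = cls (\<lambda>t. symbol_quot t * cnj (bdry h t * m t))"
    unfolding reflect_op_def by (simp add: conj_op_cls L mult_op_cls[OF symbol_quot_unimodular] L2_cnj del: complex_cnj_mult)
  also have "\<dots> = cls (\<lambda>t. bdry h t * cnj (m t))"
  proof (subst cls_eq_iff)
    show ae: "ae_eq (\<lambda>t. symbol_quot t * cnj (bdry h t * m t)) (\<lambda>t. bdry h t * cnj (m t))"
      using outer_nz[OF outer hw] unfolding ae_eq_def by eventually_elim (simp add: symbol_quot_def)
    show 1: "(\<lambda>t. symbol_quot t * cnj (bdry h t * m t)) \<in> L2" by (intro unimodular_L2 symbol_quot_unimodular L2_cnj L)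
    show "(\<lambda>t. bdry h t * cnj (m t)) \<in> L2" by (rule L2_cong_ae[OF 1 ae])
  qed
  finally show ?thesis .
qed

lemma reflect_op_tendsto: "f \<longlonglongrightarrow> x \<Longrightarrow> (\<lambda>n. reflect_op (f n)) \<longlonglongrightarrow> reflect_op x"
  unfolding reflect_op_def by (intro mult_op_tendsto symbol_quot_unimodular conj_op_tendsto)

text \<open>The same inequality in three forms. The first is the boundedness of the Riesz projection,
  the last the lower bound for the projection onto \<open>I H2\<close> restricted to \<open>\<Theta> H2\<close>, and the
  second connects the two.\<close>

definition riesz_estimate :: "real \<Rightarrow> bool" where
  "riesz_estimate C \<longleftrightarrow> (\<forall>f\<in>E_space. weighted_norm (\<lambda>x. (norm (bdry h x))\<^sup>2) (riesz_proj f)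
      \<le> C * weighted_norm (\<lambda>x. (norm (bdry h x))\<^sup>2) f)"

definition pair_estimate :: "real \<Rightarrow> bool" where
  "pair_estimate C \<longleftrightarrow> (\<forall>x\<in>H2_classes. \<forall>y\<in>H2_classes. norm x \<le> C * norm (x + reflect_op y))"

definition proj_estimate :: "real \<Rightarrow> bool" where
  "proj_estimate C \<longleftrightarrow> (\<forall>a\<in>inner_range \<Theta>. norm a \<le> C * norm (proj (inner_range I) a))"

lemma weighted_norm_cls:
  assumes "(\<lambda>x. bdry h x * f x) \<in> L2"
  shows "weighted_norm (\<lambda>x. (norm (bdry h x))\<^sup>2) f = norm (cls (\<lambda>x. bdry h x * f x))"
  unfolding norm_cls[OF assms] l2_norm_def weighted_norm_def
  by (simp add: norm_mult power_mult_distrib mult.commute)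

lemma riesz_estimate_iff:
  "riesz_estimate C \<longleftrightarrow> (\<forall>m\<in>analytic_span. \<forall>m'\<in>analytic_span. norm (cls (\<lambda>x. bdry h x * m x))
     \<le> C * norm (cls (\<lambda>x. bdry h x * m x) + reflect_op (cls (\<lambda>x. bdry h x * m' x))))"
proof -
  have "weighted_norm (\<lambda>x. (norm (bdry h x))\<^sup>2) (riesz_proj (\<lambda>x. m x + cnj (m' x))) = norm (cls (\<lambda>x. bdry h x * m x))
      \<and> weighted_norm (\<lambda>x. (norm (bdry h x))\<^sup>2) (\<lambda>x. m x + cnj (m' x)) = norm (cls (\<lambda>x. bdry h x * m x) + reflect_op (cls (\<lambda>x. bdry h x * m' x)))"
    if m: "m \<in> analytic_span" "m' \<in> analytic_span" for m m'
  proof -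
    have L: "(\<lambda>x. bdry h x * m x) \<in> L2" by (rule H2_D(1)[OF outer_span_H2[OF outer hw m(1)]])
    have L': "(\<lambda>x. bdry h x * cnj (m' x)) \<in> L2"
    proof (rule L2_cong_ae)
      show "(\<lambda>t. symbol_quot t * cnj (bdry h t * m' t)) \<in> L2"
        by (intro unimodular_L2 symbol_quot_unimodular L2_cnj H2_D(1)[OF outer_span_H2[OF outer hw m(2)]])
      show "ae_eq (\<lambda>t. symbol_quot t * cnj (bdry h t * m' t)) (\<lambda>t. bdry h t * cnj (m' t))"
        using outer_nz[OF outer hw] unfolding ae_eq_def by eventually_elim (simp add: symbol_quot_def)
    qed
    have s: "(\<lambda>x. bdry h x * (m x + cnj (m' x))) = (\<lambda>x. bdry h x * m x + bdry h x * cnj (m' x))" by (simp add: distrib_left)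
    have "weighted_norm (\<lambda>x. (norm (bdry h x))\<^sup>2) (\<lambda>x. m x + cnj (m' x)) = norm (cls (\<lambda>x. bdry h x * m x + bdry h x * cnj (m' x)))"
      using weighted_norm_cls[of "\<lambda>x. m x + cnj (m' x)"] L2_add[OF L L'] unfolding s by blast
    then show ?thesis by (simp add: riesz_proj_eq m weighted_norm_cls L reflect_op_outer cls_add L')
  qed
  then show ?thesis unfolding riesz_estimate_def E_space_eq by fastforce
qed

text \<open>The Riesz estimate is the second form on the dense subspace of the products \<open>h m\<close>.\<close>

lemma riesz_pair: "riesz_estimate C \<longleftrightarrow> pair_estimate C"
proof
  assume r: "riesz_estimate C"
  show "pair_estimate C" unfolding pair_estimate_def
  proof (intro ballI)
    fix x y assume "x \<in> H2_classes" "y \<in> H2_classes"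
    let ?S = "cls ` (\<lambda>m x. bdry h x * m x) ` analytic_span"
    have "x \<in> closure ?S" "y \<in> closure ?S" using \<open>x \<in> H2_classes\<close> \<open>y \<in> H2_classes\<close> by (simp_all add: outer_span_dense[OF outer hw])
    then obtain s t where s: "\<And>n. s n \<in> ?S" "s \<longlonglongrightarrow> x" and t: "\<And>n. t n \<in> ?S" "t \<longlonglongrightarrow> y"
      unfolding closure_sequential by blast
    have le: "norm (s n) \<le> C * norm (s n + reflect_op (t n))" for n
    proof -
      obtain m m' where "m \<in> analytic_span" "m' \<in> analytic_span" "s n = cls (\<lambda>x. bdry h x * m x)" "t n = cls (\<lambda>x. bdry h x * m' x)"
        using s(1)[of n] t(1)[of n] by (elim imageE) auto
      then show ?thesis using r unfolding riesz_estimate_iff by simp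
    qed
    have "(\<lambda>n. norm (s n)) \<longlonglongrightarrow> norm x" "(\<lambda>n. C * norm (s n + reflect_op (t n))) \<longlonglongrightarrow> C * norm (x + reflect_op y)"
      by (intro tendsto_intros s t reflect_op_tendsto)+
    then show "norm x \<le> C * norm (x + reflect_op y)" by (rule LIMSEQ_le) (use le in blast)
  qed
next
  assume p: "pair_estimate C"
  have in1: "cls (\<lambda>x. bdry h x * m x) \<in> H2_classes" if "m \<in> analytic_span" for m
    unfolding H2_classes_def by (rule imageI, rule outer_span_H2[OF outer hw that])
  show "riesz_estimate C" unfolding riesz_estimate_iff using p in1 unfolding pair_estimate_def by blast
qed

text \<open>Multiply by the unimodular function \<open>cnj \<Theta>\<close>.\<close>

lemma pair_norm_eq: "norm (mult_op (bdry \<Theta>) x + mult_op (bdry I) (conj_op y)) = norm (x + reflect_op y)"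
proof -
  note uT = inner_bdry_unimodular[OF \<Theta>]
  have "norm (mult_op (bdry \<Theta>) x + mult_op (bdry I) (conj_op y))
      = norm (mult_op (\<lambda>t. cnj (bdry \<Theta> t)) (mult_op (bdry \<Theta>) x + mult_op (bdry I) (conj_op y)))"
    by (simp add: norm_mult_op[OF unimodular_cnj[OF uT]])
  then show ?thesis
    by (simp add: mult_op_add[OF unimodular_cnj[OF uT]] mult_op_inverse(1)[OF uT] symbol_quot_mult_op reflect_op_def)
qed

text \<open>The functions \<open>I cnj g\<close> with \<open>g\<close> in \<open>H2\<close> form the orthogonal complement of \<open>I H2\<close>. So, for
  fixed \<open>f\<close>, the norms on the right-hand side of the second form are, after multiplication
  by \<open>\<Theta>\<close>, the norms of the elements of \<open>\<Theta> f + (I H2)\<^sup>\<bottom>\<close>, and the smallest of them is the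
  norm of the projection.\<close>

lemma pair_proj:
  assumes C: "C \<ge> 0"
  shows "pair_estimate C \<longleftrightarrow> proj_estimate C"
proof
  note B = inner_range_subspace[OF I] inner_range_closed[OF I]
  note uI = inner_bdry_unimodular[OF I] and uT = inner_bdry_unimodular[OF \<Theta>]
  assume p: "pair_estimate C"
  show "proj_estimate C" unfolding proj_estimate_def
  proof
    fix a assume "a \<in> inner_range \<Theta>"
    then obtain x where x: "x \<in> H2_classes" "a = mult_op (bdry \<Theta>) x" unfolding inner_range_def[OF \<Theta>] by blast
    \<comment> \<open>This is orthogonal to \<open>I H2\<close>, hence of the form \<open>I cnj g\<close>.\<close>
    define c where "c = proj (inner_range I) a - a"
    have orth: "inner c b = 0" if "b \<in> inner_range I" for b
      using proj_orth[OF B that, of a] unfolding c_def by (simp add: inner_diff_left)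
    have "\<exists>y\<in>H2_classes. mult_op (\<lambda>t. cnj (bdry I t)) c = conj_op y"
    proof (rule orth_H2_classes_conj)
      fix z assume "z \<in> H2_classes"
      then have "inner c (mult_op (bdry I) z) = 0" by (intro orth) (simp add: inner_range_def[OF I])
      then show "inner (mult_op (\<lambda>t. cnj (bdry I t)) c) z = 0"
        using inner_mult_op[OF uI, of z c] by (simp add: inner_commute)
    qed
    then obtain y where y: "y \<in> H2_classes" "mult_op (\<lambda>t. cnj (bdry I t)) c = conj_op y" by blast
    have "c = mult_op (bdry I) (conj_op y)" using mult_op_inverse(2)[OF uI, of c] y(2) by simp
    then have "proj (inner_range I) a = mult_op (bdry \<Theta>) x + mult_op (bdry I) (conj_op y)"
      using x(2) by (simp add: c_def algebra_simps)
    then have "norm (proj (inner_range I) a) = norm (x + reflect_op y)" by (simp add: pair_norm_eq)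
    moreover have "norm a = norm x" by (simp add: x(2) norm_mult_op[OF uT])
    ultimately show "norm a \<le> C * norm (proj (inner_range I) a)" using p x(1) y(1) by (simp add: pair_estimate_def)
  qed
next
  note B = inner_range_subspace[OF I] inner_range_closed[OF I]
  note uI = inner_bdry_unimodular[OF I] and uT = inner_bdry_unimodular[OF \<Theta>]
  assume p: "proj_estimate C"
  show "pair_estimate C" unfolding pair_estimate_def
  proof (intro ballI)
    fix x y assume x: "x \<in> H2_classes" and y: "y \<in> H2_classes"
    let ?a = "mult_op (bdry \<Theta>) x" and ?c = "mult_op (bdry I) (conj_op y)"
    have "proj (inner_range I) ?c = 0"
    proof (rule proj_unique[OF B])
      show "0 \<in> inner_range I" by (rule subspace_0[OF B(1)])
      fix k assume "k \<in> inner_range I"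
      then obtain z where z: "z \<in> H2_classes" "k = mult_op (bdry I) z" unfolding inner_range_def[OF I] by blast
      have "inner ?c k = inner (conj_op y) z"
        by (simp add: inner_mult_op[OF uI] z(2) mult_op_inverse(1)[OF uI])
      then show "inner (?c - 0) k = 0" using conj_op_orth[OF z(1) y] by simp
    qed
    then have "proj (inner_range I) ?a = proj (inner_range I) (?a + ?c)" by (simp add: proj_add[OF B])
    then have "norm (proj (inner_range I) ?a) \<le> norm (?a + ?c)" using norm_proj_le[OF B] by simp
    then have le: "norm (proj (inner_range I) ?a) \<le> norm (x + reflect_op y)" by (simp add: pair_norm_eq)
    have "?a \<in> inner_range \<Theta>" using x by (simp add: inner_range_def[OF \<Theta>])
    then have "norm ?a \<le> C * norm (proj (inner_range I) ?a)" using p by (simp add: proj_estimate_def)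
    also have "\<dots> \<le> C * norm (x + reflect_op y)" using le C by (intro mult_left_mono)
    finally show "norm x \<le> C * norm (x + reflect_op y)" by (simp add: norm_mult_op[OF uT])
  qed
qed

text \<open>If \<open>I f\<close> is orthogonal to \<open>\<Theta> H2\<close>, then \<open>cnj \<Theta> I f\<close> is orthogonal to \<open>H2\<close>, hence the
  conjugate of some \<open>g\<close> in \<open>H2\<close>. As \<open>cnj \<Theta> I = h / cnj h\<close>, the function \<open>h f\<close> is the
  conjugate of \<open>h g\<close>.\<close>

lemma inner_range_orth_trivial:
  assumes b: "b \<in> inner_range I" and orth: "\<And>a. a \<in> inner_range \<Theta> \<Longrightarrow> inner b a = 0"
  shows "b = 0"
proof -
  note uI = inner_bdry_unimodular[OF I] and uT = inner_bdry_unimodular[OF \<Theta>]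
  obtain f where f: "f \<in> H2" "b = mult_op (bdry I) (cls f)" using b unfolding inner_range_def[OF I] H2_classes_def by blast
  have "\<exists>y\<in>H2_classes. mult_op symbol_quot (cls f) = conj_op y"
  proof (rule orth_H2_classes_conj)
    fix z assume "z \<in> H2_classes"
    then have "inner b (mult_op (bdry \<Theta>) z) = 0" by (intro orth) (simp add: inner_range_def[OF \<Theta>])
    then have "inner (mult_op (\<lambda>t. cnj (bdry \<Theta> t)) b) z = 0"
      using inner_mult_op[OF uT, of z b] by (simp add: inner_commute)
    then show "inner (mult_op symbol_quot (cls f)) z = 0" by (simp add: f(2) symbol_quot_mult_op)
  qed
  then obtain g where g: "g \<in> H2" "mult_op symbol_quot (cls f) = conj_op (cls g)" unfolding H2_classes_def by blast
  note fL = H2_D(1)[OF f(1)] and gL = H2_D(1)[OF g(1)]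
  have "cls (\<lambda>t. symbol_quot t * f t) = cls (\<lambda>t. cnj (g t))" using g(2) by (simp add: mult_op_cls[OF symbol_quot_unimodular fL] conj_op_cls[OF gL])
  then have ae: "ae_eq (\<lambda>t. symbol_quot t * f t) (\<lambda>t. cnj (g t))"
    by (subst (asm) cls_eq_iff[OF unimodular_L2[OF symbol_quot_unimodular fL] L2_cnj[OF gL]])
  have "AE x in lebesgue. bdry h x * f x = cnj (bdry h x * g x)"
    using ae[unfolded ae_eq_def] outer_nz[OF outer hw]
  proof eventually_elim
    case (elim x)
    then have "cnj (g x) = bdry h x / cnj (bdry h x) * f x" by (simp add: symbol_quot_def)
    then show ?case using elim(2) by simp
  qed
  then have "ae_eq f (\<lambda>x. 0)" by (rule outer_toeplitz_injective[OF outer hw f(1) g(1)])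
  then have "cls f = 0" using cls_eq_iff[OF fL L2_zero] by (simp add: cls_zero)
  then show "b = 0" using linear_0[OF linear_mult_op[OF uI]] by (simp add: f(2))
qed

lemma proj_estimate_imp:
  assumes "proj_estimate C" "C \<ge> 1"
  shows "lower_bound I \<Theta> C" "proj_surjective I \<Theta>"
proof -
  note * = complementary_restricted_proj[OF H2_classes_subspace H2_classes_closed
      inner_range_subspace[OF \<Theta>] inner_range_closed[OF \<Theta>] inner_range_sub[OF \<Theta>]
      inner_range_subspace[OF I] inner_range_closed[OF I] inner_range_sub[OF I] assms(2) _ inner_range_orth_trivial]
  show "lower_bound I \<Theta> C" unfolding lower_bound_def[OF I \<Theta>] model_cls_def[OF I] model_cls_def[OF \<Theta>]
    using *(1) assms(1) unfolding proj_estimate_def by blast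
  show "proj_surjective I \<Theta>" unfolding proj_surjective_def[OF I \<Theta>] model_cls_def[OF I] model_cls_def[OF \<Theta>]
    using *(2) assms(1) unfolding proj_estimate_def by blast
qed

text \<open>The converse direction applies \<open>complementary_restricted_proj\<close> to the model spaces, whose
  complements are \<open>\<Theta> H2\<close> and \<open>I H2\<close>. Surjectivity of the restricted projection shows that no
  nonzero element of the model space of \<open>I\<close> is orthogonal to that of \<open>\<Theta>\<close>.\<close>

lemma proj_estimate_if:
  assumes l: "lower_bound I \<Theta> C" and s: "proj_surjective I \<Theta>" and C: "C \<ge> 1"
  shows "proj_estimate C"
proof -
  let ?A = "model_cls \<Theta>" and ?B = "model_cls I"
  note A = model_cls_subspace[OF \<Theta>] model_cls_closed[OF \<Theta>] and B = model_cls_subspace[OF I] model_cls_closed[OF I]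
  have sub: "?A \<subseteq> H2_classes" "?B \<subseteq> H2_classes" by (auto simp: model_cls_def[OF I] model_cls_def[OF \<Theta>] rel_compl_def)
  have triv: "b = 0" if b: "b \<in> ?B" and orth: "\<And>a. a \<in> ?A \<Longrightarrow> inner b a = 0" for b
  proof -
    have "b \<in> proj ?B ` ?A" using s b by (simp add: proj_surjective_def[OF I \<Theta>])
    then obtain a where a: "a \<in> ?A" "b = proj ?B a" by blast
    have "inner b b = inner a b" using inner_proj[OF B b, of a] a(2) by simp
    also have "\<dots> = 0" using orth[OF a(1)] by (simp add: inner_commute)
    finally show ?thesis by simp
  qed
  have low: "\<And>a. a \<in> ?A \<Longrightarrow> norm a \<le> C * norm (proj ?B a)" using l by (simp add: lower_bound_def[OF I \<Theta>])
  have AA: "rel_compl H2_classes ?A = inner_range \<Theta>" and BB: "rel_compl H2_classes ?B = inner_range I"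
    unfolding model_cls_def[OF I] model_cls_def[OF \<Theta>]
    by (rule rel_compl_rel_compl[OF H2_classes_subspace H2_classes_closed inner_range_subspace inner_range_closed inner_range_sub], fact+)+
  show ?thesis unfolding proj_estimate_def
    using complementary_restricted_proj(1)[OF H2_classes_subspace H2_classes_closed A sub(1) B sub(2) C low triv] unfolding AA BB by blast
qed

lemma riesz_proj_estimate: "C \<ge> 0 \<Longrightarrow> riesz_estimate C \<longleftrightarrow> proj_estimate C"
  by (simp add: riesz_pair pair_proj)

text \<open>Projections do not increase norms and \<open>\<Theta> H2\<close> is not zero. The bound makes
  \<open>complementary_restricted_proj\<close> applicable to every admissible constant, which is what
  equality of the norms requires.\<close>

lemma proj_estimate_ge_1:
  assumes "proj_estimate C" shows "C \<ge> 1"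
proof -
  note B = inner_range_subspace[OF I] inner_range_closed[OF I]
  define a where "a = mult_op (bdry \<Theta>) (cls (cayley_fun 0))"
  have "a \<in> inner_range \<Theta>" unfolding a_def inner_range_def[OF \<Theta>] H2_classes_def by (intro imageI cayley_fun_H2)
  then have le: "norm a \<le> C * norm (proj (inner_range I) a)" using assms by (simp add: proj_estimate_def)
  have "cls (cayley_fun 0) \<noteq> 0"
  proof
    assume "cls (cayley_fun 0) = 0"
    then have "ae_eq (cayley_fun 0) (\<lambda>x. 0)" using cls_eq_iff[OF cayley_fun_L2 L2_zero] by (simp add: cls_zero)
    then have "cayley_fun 0 0 = 0" unfolding ae_eq_def by (rule continuous_ae_zero[OF cayley_fun_continuous])
    then show False by (simp add: cayley_fun_def)
  qed
  then have a: "norm a > 0" by (simp add: a_def norm_mult_op[OF inner_bdry_unimodular[OF \<Theta>]])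
  have "0 \<le> C"
  proof (rule ccontr)
    assume "\<not> 0 \<le> C"
    then have "C * norm (proj (inner_range I) a) \<le> 0" by (intro mult_nonpos_nonneg) auto
    then show False using le a by linarith
  qed
  then have "norm a \<le> C * norm a" using le norm_proj_le[OF B, of a] by (meson mult_left_mono order_trans)
  then show ?thesis using a by (simp add: mult_le_cancel_right1)
qed

lemma lower_bound_ge_1:
  assumes l: "lower_bound I \<Theta> C" and C: "0 \<le> C" and f: "f \<in> model_space \<Theta>" "\<not> ae_eq f (\<lambda>x. 0)"
  shows "C \<ge> 1"
proof -
  note B = model_cls_subspace[OF I] model_cls_closed[OF I]
  have a: "cls f \<in> model_cls \<Theta>" by (rule model_space_cls[OF \<Theta> f(1)])
  have "cls f \<noteq> 0" using f cls_eq_iff[OF model_space_L2[OF \<Theta> f(1)] L2_zero] by (simp add: cls_zero)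
  then have n: "norm (cls f) > 0" by simp
  have "norm (cls f) \<le> C * norm (proj (model_cls I) (cls f))" using l a by (simp add: lower_bound_def[OF I \<Theta>])
  also have "\<dots> \<le> C * norm (cls f)" by (intro mult_left_mono norm_proj_le[OF B] C)
  finally show ?thesis using n by (simp add: mult_le_cancel_right1)
qed

lemma riesz_bounded_iff:
  "riesz_bounded (\<lambda>x. (norm (bdry h x))\<^sup>2) \<longleftrightarrow> (\<exists>C\<ge>1. proj_estimate C)"
proof
  assume "riesz_bounded (\<lambda>x. (norm (bdry h x))\<^sup>2)"
  then obtain C where C: "riesz_estimate C" unfolding riesz_bounded_def op_bounded_def riesz_estimate_def by blast
  have "pair_estimate (max C 1)" unfolding pair_estimate_def
  proof (intro ballI)
    fix x y assume "x \<in> H2_classes" "y \<in> H2_classes"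
    then have "norm x \<le> C * norm (x + reflect_op y)" using C unfolding riesz_pair pair_estimate_def by blast
    also have "\<dots> \<le> max C 1 * norm (x + reflect_op y)" by (intro mult_right_mono) auto
    finally show "norm x \<le> max C 1 * norm (x + reflect_op y)" .
  qed
  then show "\<exists>C\<ge>1. proj_estimate C" using pair_proj[of "max C 1"] by (intro exI[of _ "max C 1"]) auto
next
  assume "\<exists>C\<ge>1. proj_estimate C"
  then obtain C where "C \<ge> 1" "proj_estimate C" by blast
  then have "riesz_estimate C" by (simp add: riesz_proj_estimate)
  then show "riesz_bounded (\<lambda>x. (norm (bdry h x))\<^sup>2)" unfolding riesz_bounded_def op_bounded_def riesz_estimate_def by blast
qed

theorem isomorphism_iff_riesz_bounded:
  "l2_isomorphism (model_proj I) (model_space \<Theta>) (model_space I) \<longleftrightarrow> riesz_bounded (\<lambda>x. (norm (bdry h x))\<^sup>2)"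
  unfolding riesz_bounded_iff
  using isomorphism_imp[OF I \<Theta>] isomorphism_if[OF I \<Theta>] proj_estimate_imp proj_estimate_if by blast

text \<open>Both norms are infima of sets of admissible constants. The nonzero function \<open>f\<close> forces the
  constants for the inverse to be at least 1, those for the Riesz projection always are, and
  above 1 the two sets coincide.\<close>

theorem inverse_norm_eq_riesz_norm:
  assumes iso: "l2_isomorphism (model_proj I) (model_space \<Theta>) (model_space I)"
    and f: "f \<in> model_space \<Theta>" "\<not> ae_eq f (\<lambda>x. 0)"
  shows "op_norm l2_norm (l2_inverse (model_proj I) (model_space \<Theta>)) (model_space I) = riesz_norm (\<lambda>x. (norm (bdry h x))\<^sup>2)"
proof -
  note s = isomorphism_imp(1)[OF I \<Theta> iso] and inj = isomorphism_imp(2)[OF I \<Theta> iso]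
  have "(0 \<le> C \<and> (\<forall>g\<in>model_space I. l2_norm (l2_inverse (model_proj I) (model_space \<Theta>) g) \<le> C * l2_norm g))
      \<longleftrightarrow> (0 \<le> C \<and> riesz_estimate C)" for C
  proof -
    have "0 \<le> C \<Longrightarrow> lower_bound I \<Theta> C \<longleftrightarrow> proj_estimate C"
      using lower_bound_ge_1[OF _ _ f] proj_estimate_ge_1 proj_estimate_if[OF _ s] proj_estimate_imp(1) by blast
    then show ?thesis using inverse_bound_iff[OF I \<Theta> s inj, of C] riesz_proj_estimate[of C] by blast
  qed
  then show ?thesis unfolding op_norm_def riesz_norm_def riesz_estimate_def by simp
qed

end

theorem theorem2p6:
  fixes I \<Theta> h :: "complex \<Rightarrow> complex" and w :: "real \<Rightarrow> real"
  assumes "inner_function I"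
    and "inner_function \<Theta>"
    and "outer_function h"
    and "AE x in lebesgue. cnj (bdry I x) * bdry \<Theta> x = cnj (bdry h x) / bdry h x"
    and "integrable lebesgue (\<lambda>x. (norm (bdry h x))\<^sup>2 / (1 + x\<^sup>2))"
    and "w = (\<lambda>x. (norm (bdry h x))\<^sup>2)"
  shows "(l2_isomorphism (model_proj I) (model_space \<Theta>) (model_space I) \<longleftrightarrow> riesz_bounded w) \<and>
    (l2_isomorphism (model_proj I) (model_space \<Theta>) (model_space I) \<and>
     (\<exists>f\<in>model_space \<Theta>. \<not> ae_eq f (\<lambda>x. 0)) \<longrightarrow>
       op_norm l2_norm (l2_inverse (model_proj I) (model_space \<Theta>)) (model_space I) = riesz_norm w)"
proof -
  note hyps = assms(1-5)
  show ?thesis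
    unfolding assms(6)
    using isomorphism_iff_riesz_bounded[OF hyps] inverse_norm_eq_riesz_norm[OF hyps] by blast
qed

end
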